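(* Let $\Omega\subset\mathbb{R}^n$ be a Lipschitz domain, $s<\frac12$, $s\ne\frac12-k$ for any integer $k>0$. Then for any $g\in H^s(\Omega)$ there exists $\tilde g\in\widetilde H^s(\Omega)$ such that $g=\tilde g|_\Omega$ and $\|\tilde g\|_{\widetilde H^s(\Omega)}\le C\|g\|_{H^s(\Omega)}$, where $C>0$ does not depend on $g$.
   Context: $\Omega$ is a bounded or unbounded open domain in $\mathbb{R}^n$ whose boundary $\partial\Omega$ is a simply connected, closed, Lipschitz $(n-1)$-dimensional set, represented by a finite number of Lipschitz charts. $H^s(\mathbb{R}^n)$ is the $L_2$-based Bessel potential space; $H^s(\Omega)$ is the space of restrictions to $\Omega$ of distributions from $H^s(\mathbb{R}^n)$ (with the quotient norm); $\widetilde H^s(\Omega)$ is the closure of $C^\infty_{comp}(\Omega)$ in $H^s(\mathbb{R}^n)$, equivalently $\{g\in H^s(\mathbb{R}^n):\operatorname{supp}g\subset\overline\Omega\}$, with the norm of $H^s(\mathbb{R}^n)$. *)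

theory Defs
  imports "HOL-Analysis.Analysis"
begin

section \<open>Smooth functions, test functions and the Schwartz space\<close>

primrec iter_deriv :: "'a list \<Rightarrow> ('a::euclidean_space \<Rightarrow> complex) \<Rightarrow> 'a \<Rightarrow> complex" where
  "iter_deriv [] f = f"
| "iter_deriv (b # bs) f = (\<lambda>x. frechet_derivative (iter_deriv bs f) (at x) b)"

definition smooth :: "('a::euclidean_space \<Rightarrow> complex) \<Rightarrow> bool" where
  "smooth f \<longleftrightarrow> (\<forall>bs\<in>lists Basis. \<forall>x. iter_deriv bs f differentiable (at x))"

text \<open>\<open>C\<^sup>\<infinity>\<close> functions with compact support in \<open>\<Omega>\<close>, regarded as functions on the
  whole space.\<close>

definition test_functions :: "'a::euclidean_space set \<Rightarrow> ('a \<Rightarrow> complex) set" where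
  "test_functions \<Omega> =
     {\<phi>. smooth \<phi> \<and> compact (closure {x. \<phi> x \<noteq> 0}) \<and> closure {x. \<phi> x \<noteq> 0} \<subseteq> \<Omega>}"

definition schwartz :: "('a::euclidean_space \<Rightarrow> complex) set" where
  "schwartz = {\<phi>. smooth \<phi> \<and>
     (\<forall>N. \<forall>bs\<in>lists Basis. bounded (range (\<lambda>x. (1 + norm x) ^ N *\<^sub>R iter_deriv bs \<phi> x)))}"

definition schwartz_seminorm :: "nat \<Rightarrow> ('a::euclidean_space \<Rightarrow> complex) \<Rightarrow> real" where
  "schwartz_seminorm N \<phi> =
     (SUP (bs, x) \<in> {bs \<in> lists Basis. length bs \<le> N} \<times> UNIV.
        (1 + norm x) ^ N * norm (iter_deriv bs \<phi> x))"

section \<open>Tempered distributions\<close>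

type_synonym 'a functional = "('a \<Rightarrow> complex) \<Rightarrow> complex"

text \<open>Functionals are kept extensional (\<open>undefined\<close> off the Schwartz space), so that HOL
  equality of two functionals is equality of distributions.\<close>

definition tempered :: "'a::euclidean_space functional set" where
  "tempered = {u \<in> extensional schwartz.
     (\<forall>\<phi>\<in>schwartz. \<forall>\<psi>\<in>schwartz. \<forall>a b.
        u (\<lambda>x. a * \<phi> x + b * \<psi> x) = a * u \<phi> + b * u \<psi>) \<and>
     (\<exists>C N. \<forall>\<phi>\<in>schwartz. norm (u \<phi>) \<le> C * schwartz_seminorm N \<phi>)}"

definition dist_of_fun :: "('a::euclidean_space \<Rightarrow> complex) \<Rightarrow> 'a functional" where
  "dist_of_fun w = (\<lambda>\<phi>\<in>schwartz. LINT x|lborel. w x * \<phi> x)"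

text \<open>The unitary normalisation of the Fourier transform; other normalisations lead to the same
  spaces with equivalent norms.\<close>

definition fourier :: "('a::euclidean_space \<Rightarrow> complex) \<Rightarrow> 'a \<Rightarrow> complex" where
  "fourier f \<xi> =
     (2 * pi) powr (- real DIM('a) / 2) *\<^sub>R (LINT x|lborel. cis (- (x \<bullet> \<xi>)) * f x)"

definition inv_fourier :: "('a::euclidean_space \<Rightarrow> complex) \<Rightarrow> 'a \<Rightarrow> complex" where
  "inv_fourier f x =
     (2 * pi) powr (- real DIM('a) / 2) *\<^sub>R (LINT \<xi>|lborel. cis (x \<bullet> \<xi>) * f \<xi>)"

definition fourier_dist :: "'a::euclidean_space functional \<Rightarrow> 'a functional" where
  "fourier_dist u = (\<lambda>\<phi>\<in>schwartz. u (fourier \<phi>))"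

definition inv_fourier_dist :: "'a::euclidean_space functional \<Rightarrow> 'a functional" where
  "inv_fourier_dist u = (\<lambda>\<phi>\<in>schwartz. u (inv_fourier \<phi>))"

definition mult_dist :: "('a::euclidean_space \<Rightarrow> real) \<Rightarrow> 'a functional \<Rightarrow> 'a functional" where
  "mult_dist m u = (\<lambda>\<phi>\<in>schwartz. u (\<lambda>x. m x *\<^sub>R \<phi> x))"

section \<open>Bessel potential spaces\<close>

definition bessel_potential :: "real \<Rightarrow> 'a::euclidean_space functional \<Rightarrow> 'a functional" where
  "bessel_potential s u =
     inv_fourier_dist (mult_dist (\<lambda>\<xi>. (1 + (norm \<xi>)\<^sup>2) powr (s / 2)) (fourier_dist u))"

definition L2 :: "('a::euclidean_space \<Rightarrow> complex) set" where
  "L2 = {w \<in> borel_measurable lborel. integrable lborel (\<lambda>x. (norm (w x))\<^sup>2)}"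

definition L2_norm :: "('a::euclidean_space \<Rightarrow> complex) \<Rightarrow> real" where
  "L2_norm w = sqrt (LINT x|lborel. (norm (w x))\<^sup>2)"

definition bessel_space :: "real \<Rightarrow> 'a::euclidean_space functional set" where
  "bessel_space s = {u \<in> tempered. \<exists>w\<in>L2. bessel_potential s u = dist_of_fun w}"

text \<open>The density \<open>w\<close> is unique up to null sets, so the choice does not affect the norm.\<close>

definition bessel_norm :: "real \<Rightarrow> 'a::euclidean_space functional \<Rightarrow> real" where
  "bessel_norm s u = L2_norm (SOME w. w \<in> L2 \<and> bessel_potential s u = dist_of_fun w)"

text \<open>Restriction of a distribution to \<open>\<Omega>\<close> is restriction of the functional to the test
  functions on \<open>\<Omega>\<close>.\<close>

definition dist_restrict :: "'a::euclidean_space functional \<Rightarrow> 'a set \<Rightarrow> 'a functional" where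
  "dist_restrict u \<Omega> = restrict u (test_functions \<Omega>)"

definition bessel_space_on :: "real \<Rightarrow> 'a::euclidean_space set \<Rightarrow> 'a functional set" where
  "bessel_space_on s \<Omega> = (\<lambda>u. dist_restrict u \<Omega>) ` bessel_space s"

definition bessel_norm_on :: "real \<Rightarrow> 'a::euclidean_space set \<Rightarrow> 'a functional \<Rightarrow> real" where
  "bessel_norm_on s \<Omega> g = Inf (bessel_norm s ` {u \<in> bessel_space s. dist_restrict u \<Omega> = g})"

text \<open>The closure of the test functions on \<open>\<Omega>\<close> in the Bessel potential space on the whole space;
  it carries the norm \<^const>\<open>bessel_norm\<close>.\<close>

definition bessel_space_tilde :: "real \<Rightarrow> 'a::euclidean_space set \<Rightarrow> 'a functional set" where
  "bessel_space_tilde s \<Omega> = {u \<in> bessel_space s.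
     \<forall>\<epsilon>>0. \<exists>\<phi>\<in>test_functions \<Omega>. bessel_norm s (\<lambda>\<psi>\<in>schwartz. u \<psi> - dist_of_fun \<phi> \<psi>) < \<epsilon>}"

section \<open>Lipschitz domains\<close>

text \<open>The region below the graph of a Lipschitz function in a rotated coordinate system: \<open>e\<close> is
  the rotated last coordinate direction and \<open>f\<close> a function of the component orthogonal to \<open>e\<close>.
  Translations are absorbed into \<open>f\<close>, and a rotation within the hyperplane preserves Lipschitz
  functions.\<close>

definition lipschitz_hypograph :: "'a::euclidean_space set \<Rightarrow> bool" where
  "lipschitz_hypograph H \<longleftrightarrow> (\<exists>e f L. norm e = 1 \<and> L-lipschitz_on {y. y \<bullet> e = 0} f \<and>
     H = {x. x \<bullet> e < f (x - (x \<bullet> e) *\<^sub>R e)})"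

text \<open>Neither \<open>\<Omega>\<close> nor its frontier is assumed bounded. The frontier is automatically closed.
  A pair \<open>(W, H)\<close> is a chart: inside \<open>W\<close>, \<open>\<Omega>\<close> coincides with the Lipschitz hypograph \<open>H\<close>.\<close>

definition lipschitz_domain :: "'a::euclidean_space set \<Rightarrow> bool" where
  "lipschitz_domain \<Omega> \<longleftrightarrow>
     open \<Omega> \<and> connected \<Omega> \<and> \<Omega> \<noteq> {} \<and> simply_connected (frontier \<Omega>) \<and>
     (\<exists>\<C>. finite \<C> \<and>
        (\<forall>(W, H)\<in>\<C>. open W \<and> lipschitz_hypograph H \<and> W \<inter> \<Omega> = W \<inter> H) \<and>
        frontier \<Omega> \<subseteq> (\<Union>(W, H)\<in>\<C>. W))"

end

theory Submission
  imports Defs "HOL-Probability.Probability"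
begin

text \<open>Every element \<open>u\<close> of the Bessel potential space of order \<open>s\<close> has the form
  \<open>u \<phi> = \<integral> w * bessel_op (- s) \<phi>\<close> with a square integrable density \<open>w\<close>, unique up to null sets, and the norm of \<open>u\<close>
  is the norm of \<open>w\<close>. So a distribution \<open>g\<close> on \<open>\<Omega>\<close> with an extension of order \<open>s\<close> is a linear functional on
  the test functions on \<open>\<Omega>\<close> with \<open>norm (g \<phi>) \<le> N * sob_norm (- s) \<phi>\<close>, where \<open>N\<close> is the quotient norm of \<open>g\<close>.
  The extension sought for is a density \<open>w\<close> that reproduces \<open>g\<close> and in addition lies in the
  closed span of the functions \<open>bessel_op s \<psi>\<close>, with \<open>\<psi>\<close> a test function on \<open>\<Omega>\<close>: this says that the
  extension is a limit of test functions on \<open>\<Omega>\<close>. By the Babuska--Brezzi principle (\<open>inf_sup_solution\<close>, two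
  applications of the Riesz representation theorem) such a \<open>w\<close> of norm at most \<open>C * N\<close> exists provided that the pairing
  of test functions satisfies an inf-sup condition of order \<open>- s\<close>. The condition \<open>inf_sup \<Omega> \<sigma>\<close> says that
  every test function \<open>\<phi>\<close> on \<open>\<Omega>\<close> has a partner \<open>\<psi>\<close>, again a test function on \<open>\<Omega>\<close>, with
  \<open>(sob_norm \<sigma> \<phi>)\<^sup>2 \<le> Re (\<integral> \<phi> * \<psi>)\<close> and \<open>sob_norm (- \<sigma>) \<psi> \<le> C * sob_norm \<sigma> \<phi>\<close>. This is where all the work is.

  Without the domain the best partner is \<open>bessel_op (2 * \<sigma>)\<close> of the complex conjugate of \<open>\<phi>\<close>. Multiplication by a cutoff function
  supported in \<open>\<Omega>\<close> that is 1 on the support of \<open>\<phi>\<close> leaves the pairing unchanged, and the question is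
  whether such cutoff functions, which may have to drop to 0 arbitrarily close to the frontier, are multipliers of
  order \<open>- \<sigma>\<close> with a common bound. For \<open>\<bar>\<sigma>\<bar> < 1 / 2\<close> they are (\<open>cutoff_multiplier\<close>). For a positive order \<open>r\<close> the norm is equivalent to one
  given by squared differences \<open>f (x + t *\<^sub>R b) - f x\<close> weighted with \<open>t powr (- 1 - 2 * r)\<close>, and the differences of the cutoff
  function contribute at most a multiple of the integral of \<open>(norm f)\<^sup>2\<close> against the distance to the frontier to the power \<open>- 2 * r\<close>. Hardy's inequality
  bounds this for \<open>r < 1 / 2\<close>, without any boundary condition on \<open>f\<close>. Here, and only here, the
  Lipschitz property enters: the frontier is covered by the zero sets of finitely many Lipschitz functions, each of which grows
  with unit speed in some direction, so that Hardy's inequality is needed only along lines (\<open>hardy_graph\<close>). Negative orders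
  follow by duality.

  Partial integration carries the condition from \<open>\<sigma>\<close> to \<open>\<sigma> + 1\<close> (\<open>inf_sup_succ\<close>). As \<open>s < 1 / 2\<close>, the order \<open>- s\<close> exceeds \<open>- 1 / 2\<close>,
  so it is reached by such steps from the open interval between \<open>- 1 / 2\<close> and \<open>1 / 2\<close>, unless it is itself of the form
  \<open>k - 1 / 2\<close>; this is why exactly these values are excluded.\<close>

section \<open>Smooth, slowly growing and rapidly decreasing functions\<close>

definition partial_deriv :: "'a::euclidean_space \<Rightarrow> ('a \<Rightarrow> complex) \<Rightarrow> 'a \<Rightarrow> complex" where
  "partial_deriv b f = (\<lambda>x. frechet_derivative f (at x) b)"

lemma partial_deriv_eqI:
  assumes "\<And>x. (f has_derivative f' x) (at x)"
  shows "partial_deriv b f = (\<lambda>x. f' x b)"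
  unfolding partial_deriv_def using frechet_derivative_at[OF assms] by (simp add: fun_eq_iff)

lemma iter_deriv_Cons: "iter_deriv (b # bs) f = partial_deriv b (iter_deriv bs f)"
  by (simp add: partial_deriv_def)

lemma iter_deriv_snoc: "iter_deriv (bs @ [b]) f = iter_deriv bs (partial_deriv b f)"
  by (induction bs) (auto simp: partial_deriv_def)

lemma iter_deriv_mem:
  assumes "f \<in> S" "\<And>g b. g \<in> S \<Longrightarrow> b \<in> Basis \<Longrightarrow> partial_deriv b g \<in> S" "bs \<in> lists Basis"
  shows "iter_deriv bs f \<in> S"
  using assms(3) by induction (auto simp: assms iter_deriv_Cons simp del: iter_deriv.simps(2))

text \<open>Smoothness and decay are statements about all iterated derivatives. They are proved throughout by exhibiting a
  family of functions that contains the given one and is closed under partial derivatives, so that only the family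
  itself has to be examined.\<close>

lemma smooth_coinduct:
  assumes "f \<in> S" "\<And>g x. g \<in> S \<Longrightarrow> g differentiable (at x)"
    "\<And>g b. g \<in> S \<Longrightarrow> b \<in> Basis \<Longrightarrow> partial_deriv b g \<in> S"
  shows "smooth f"
  unfolding smooth_def using iter_deriv_mem[OF assms(1,3)] assms(2) by blast

lemma smooth_differentiable: "smooth f \<Longrightarrow> f differentiable (at x)"
  unfolding smooth_def using iter_deriv.simps(1) lists.Nil by metis

lemma smooth_has_derivative: "smooth f \<Longrightarrow> (f has_derivative frechet_derivative f (at x)) (at x)"
  using smooth_differentiable frechet_derivative_works by blast

lemma smooth_partial_deriv:
  assumes "smooth f" "b \<in> Basis" shows "smooth (partial_deriv b f)"
proof -
  have "iter_deriv (bs @ [b]) f differentiable (at x)" if "bs \<in> lists Basis" for bs x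
    using assms that unfolding smooth_def by (meson append_in_lists_conv lists.Cons lists.Nil)
  thus ?thesis by (simp add: smooth_def iter_deriv_snoc)
qed

lemma smooth_continuous_on: "smooth f \<Longrightarrow> continuous_on A f"
  by (simp add: continuous_at_imp_continuous_on differentiable_imp_continuous_within
      smooth_differentiable)

lemma smooth_measurable: "smooth f \<Longrightarrow> f \<in> borel_measurable borel"
  by (simp add: borel_measurable_continuous_onI smooth_continuous_on)

definition decay :: "('a::euclidean_space \<Rightarrow> complex) \<Rightarrow> bool" where
  "decay f \<longleftrightarrow> (\<forall>N. \<exists>C. \<forall>x. (1 + norm x) ^ N * norm (f x) \<le> C)"

definition slow :: "('a::euclidean_space \<Rightarrow> complex) set" where
  "slow = {f. smooth f \<and> (\<forall>bs\<in>lists Basis. \<exists>N C. \<forall>x. norm (iter_deriv bs f x) \<le> C * (1 + norm x) ^ N)}"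

lemma schwartz_iff:
  "f \<in> schwartz \<longleftrightarrow> smooth f \<and> (\<forall>bs\<in>lists Basis. decay (iter_deriv bs f))"
proof -
  have "bounded (range (\<lambda>x. (1 + norm x) ^ N *\<^sub>R g x)) \<longleftrightarrow> (\<exists>C. \<forall>x. (1 + norm x) ^ N * norm (g x) \<le> C)"
    for N and g :: "'a \<Rightarrow> complex"
    by (auto simp: bounded_iff)
  thus ?thesis unfolding schwartz_def decay_def mem_Collect_eq by (simp only:) blast
qed

lemma schwartz_coinduct:
  assumes "f \<in> S" "\<And>g x. g \<in> S \<Longrightarrow> g differentiable (at x)"
    "\<And>g b. g \<in> S \<Longrightarrow> b \<in> Basis \<Longrightarrow> partial_deriv b g \<in> S"
    "\<And>g. g \<in> S \<Longrightarrow> decay g"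
  shows "f \<in> schwartz"
  unfolding schwartz_iff using smooth_coinduct[OF assms(1-3)] iter_deriv_mem[OF assms(1,3)] assms(4) by blast

lemma slow_coinduct:
  assumes "f \<in> S" "\<And>g x. g \<in> S \<Longrightarrow> g differentiable (at x)"
    "\<And>g b. g \<in> S \<Longrightarrow> b \<in> Basis \<Longrightarrow> partial_deriv b g \<in> S"
    "\<And>g. g \<in> S \<Longrightarrow> \<exists>N C. \<forall>x. norm (g x) \<le> C * (1 + norm x) ^ N"
  shows "f \<in> slow"
  unfolding slow_def using smooth_coinduct[OF assms(1-3)] iter_deriv_mem[OF assms(1,3)] assms(4) by blast

lemma schwartz_smooth: "f \<in> schwartz \<Longrightarrow> smooth f"
  by (simp add: schwartz_iff)

lemma schwartz_decay: "f \<in> schwartz \<Longrightarrow> decay f"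
  unfolding schwartz_iff using iter_deriv.simps(1) lists.Nil by metis

lemma slow_smooth: "f \<in> slow \<Longrightarrow> smooth f"
  by (simp add: slow_def)

lemma slow_bound: "f \<in> slow \<Longrightarrow> \<exists>N C. \<forall>x. norm (f x) \<le> C * (1 + norm x) ^ N"
  unfolding slow_def by (drule CollectD, erule conjE, drule bspec[of _ _ "[]"]) auto

lemma schwartz_partial_deriv:
  assumes "f \<in> schwartz" "b \<in> Basis" shows "partial_deriv b f \<in> schwartz"
proof -
  have "decay (iter_deriv (bs @ [b]) f)" if "bs \<in> lists Basis" for bs
    using assms that unfolding schwartz_iff by (meson append_in_lists_conv lists.Cons lists.Nil)
  thus ?thesis using assms by (simp add: schwartz_iff smooth_partial_deriv iter_deriv_snoc)
qed

lemma slow_partial_deriv: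
  assumes "f \<in> slow" "b \<in> Basis" shows "partial_deriv b f \<in> slow"
proof -
  have "\<exists>N C. \<forall>x. norm (iter_deriv (bs @ [b]) f x) \<le> C * (1 + norm x) ^ N" if "bs \<in> lists Basis" for bs
  proof -
    have "bs @ [b] \<in> lists Basis" using that assms by auto
    thus ?thesis using assms(1) unfolding slow_def mem_Collect_eq by blast
  qed
  thus ?thesis using assms by (simp add: slow_def smooth_partial_deriv iter_deriv_snoc)
qed

lemma decay_add:
  assumes "decay f" "decay g" shows "decay (\<lambda>x. f x + g x)"
  unfolding decay_def
proof
  fix N
  obtain C D where CD: "\<And>x. (1 + norm x) ^ N * norm (f x) \<le> C" "\<And>x. (1 + norm x) ^ N * norm (g x) \<le> D"
    using assms unfolding decay_def by metis
  have "(1 + norm x) ^ N * norm (f x + g x) \<le> C + D" for x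
  proof -
    have "(1 + norm x) ^ N * norm (f x + g x) \<le> (1 + norm x) ^ N * (norm (f x) + norm (g x))"
      by (intro mult_left_mono norm_triangle_ineq) auto
    thus ?thesis using CD[of x] by (simp add: distrib_left)
  qed
  thus "\<exists>C. \<forall>x. (1 + norm x) ^ N * norm (f x + g x) \<le> C" by blast
qed

lemma decay_slow_mult:
  assumes "\<And>x. norm (f x) \<le> C * (1 + norm x) ^ k" "decay g" shows "decay (\<lambda>x. f x * g x)"
  unfolding decay_def
proof
  fix N
  obtain D where D: "\<And>x. (1 + norm x) ^ (N + k) * norm (g x) \<le> D"
    using assms unfolding decay_def by metis
  have "0 \<le> C" using assms(1)[of 0] norm_ge_zero[of "f 0"] by (simp del: norm_ge_zero)
  have "(1 + norm x) ^ N * norm (f x * g x) \<le> C * D" for x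
  proof -
    have "(1 + norm x) ^ N * norm (f x * g x) \<le> (1 + norm x) ^ N * ((C * (1 + norm x) ^ k) * norm (g x))"
      unfolding norm_mult by (intro mult_left_mono mult_right_mono assms) auto
    also have "\<dots> = C * ((1 + norm x) ^ (N + k) * norm (g x))"
      by (simp add: power_add mult_ac)
    also have "\<dots> \<le> C * D" using D \<open>0 \<le> C\<close> by (intro mult_left_mono) auto
    finally show ?thesis .
  qed
  thus "\<exists>C. \<forall>x. (1 + norm x) ^ N * norm (f x * g x) \<le> C" by blast
qed

text \<open>The Leibniz rule turns a product into a sum of products, so the products alone are not stable
  under differentiation, but their sums are.\<close>

inductive_set product_span :: "('a::euclidean_space \<Rightarrow> complex) set \<Rightarrow> ('a \<Rightarrow> complex) set \<Rightarrow> ('a \<Rightarrow> complex) set"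
  for A B where
  mult: "f \<in> A \<Longrightarrow> g \<in> B \<Longrightarrow> (\<lambda>x. f x * g x) \<in> product_span A B"
| add: "f \<in> product_span A B \<Longrightarrow> g \<in> product_span A B \<Longrightarrow> (\<lambda>x. f x + g x) \<in> product_span A B"

lemma product_span_deriv:
  assumes "h \<in> product_span A B" and sm: "\<And>f. f \<in> A \<union> B \<Longrightarrow> smooth f"
    and A: "\<And>f b. f \<in> A \<Longrightarrow> b \<in> Basis \<Longrightarrow> partial_deriv b f \<in> A"
    and B: "\<And>f b. f \<in> B \<Longrightarrow> b \<in> Basis \<Longrightarrow> partial_deriv b f \<in> B"
  shows "(\<forall>x. h differentiable (at x)) \<and> (\<forall>b\<in>Basis. partial_deriv b h \<in> product_span A B)"
  using assms(1)
proof induction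
  case (mult f g)
  note df = smooth_has_derivative[OF sm, of f]
  note dg = smooth_has_derivative[OF sm, of g]
  have d: "((\<lambda>x. f x * g x) has_derivative
      (\<lambda>h. f x * frechet_derivative g (at x) h + frechet_derivative f (at x) h * g x)) (at x)" for x
    using mult df dg by (auto intro!: derivative_eq_intros)
  have "partial_deriv b (\<lambda>x. f x * g x) = (\<lambda>x. f x * partial_deriv b g x + partial_deriv b f x * g x)" for b
    using partial_deriv_eqI[OF d] by (simp add: partial_deriv_def)
  thus ?case using d mult A B
    by (auto simp: differentiable_def intro!: product_span.intros)
next
  case (add f g)
  have df: "(f has_derivative frechet_derivative f (at x)) (at x)"
    and dg: "(g has_derivative frechet_derivative g (at x)) (at x)" for x
    using add frechet_derivative_works by blast+
  have d: "((\<lambda>x. f x + g x) has_derivative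
      (\<lambda>h. frechet_derivative f (at x) h + frechet_derivative g (at x) h)) (at x)" for x
    using df dg by (auto intro!: derivative_eq_intros)
  have "partial_deriv b (\<lambda>x. f x + g x) = (\<lambda>x. partial_deriv b f x + partial_deriv b g x)" for b
    using partial_deriv_eqI[OF d] by (simp add: partial_deriv_def)
  thus ?case using d add
    by (auto simp: differentiable_def intro!: product_span.intros)
qed

lemma smooth_mult:
  assumes "smooth f" "smooth g" shows "smooth (\<lambda>x. f x * g x)"
proof (rule smooth_coinduct)
  let ?S = "product_span (Collect smooth) (Collect smooth)"
  show "(\<lambda>x. f x * g x) \<in> ?S" using assms by (intro product_span.mult) auto
  fix h :: "'a \<Rightarrow> complex" assume h: "h \<in> ?S"
  have *: "(\<forall>x. h differentiable (at x)) \<and> (\<forall>b\<in>Basis. partial_deriv b h \<in> ?S)"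
    by (rule product_span_deriv[OF h]) (auto intro: smooth_partial_deriv)
  show "h differentiable (at x)" for x using * by blast
  show "partial_deriv b h \<in> ?S" if "b \<in> Basis" for b using * that by blast
qed

lemma schwartz_slow_mult:
  assumes "f \<in> slow" "g \<in> schwartz" shows "(\<lambda>x. f x * g x) \<in> schwartz"
proof (rule schwartz_coinduct[where S="product_span slow schwartz"])
  fix h :: "'a \<Rightarrow> complex" assume h: "h \<in> product_span slow schwartz"
  show "decay h" using h
  proof induction
    case (mult f g)
    then obtain N C where "\<And>x. norm (f x) \<le> C * (1 + norm x) ^ N" using slow_bound by metis
    thus ?case using decay_slow_mult[of f C N g] schwartz_decay mult by blast
  qed (rule decay_add)
next
  show "(\<lambda>x. f x * g x) \<in> product_span slow schwartz" using assms by (rule product_span.mult)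
next
  fix h :: "'a \<Rightarrow> complex" assume h: "h \<in> product_span slow schwartz"
  have *: "(\<forall>x. h differentiable (at x)) \<and> (\<forall>b\<in>Basis. partial_deriv b h \<in> product_span slow schwartz)"
    by (rule product_span_deriv[OF h])
      (auto intro: slow_smooth schwartz_smooth slow_partial_deriv schwartz_partial_deriv)
  show "h differentiable (at x)" for x using * by blast
  show "partial_deriv b h \<in> product_span slow schwartz" if "b \<in> Basis" for b using * that by blast
qed

lemma schwartz_add:
  assumes "f \<in> schwartz" "g \<in> schwartz" shows "(\<lambda>x. f x + g x) \<in> schwartz"
proof (rule schwartz_coinduct[where S="{h. \<exists>f\<in>schwartz. \<exists>g\<in>schwartz. h = (\<lambda>x. f x + g x)}"])
  have d: "((\<lambda>x. f x + g x) has_derivative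
      (\<lambda>h. frechet_derivative f (at x) h + frechet_derivative g (at x) h)) (at x)"
    if "f \<in> schwartz" "g \<in> schwartz" for f g :: "'a \<Rightarrow> complex" and x
    using smooth_has_derivative[OF schwartz_smooth] that by (auto intro!: derivative_eq_intros)
  fix h assume "h \<in> {h::'a\<Rightarrow>complex. \<exists>f\<in>schwartz. \<exists>g\<in>schwartz. h = (\<lambda>x. f x + g x)}"
  then obtain f g where fg: "f \<in> schwartz" "g \<in> schwartz" "h = (\<lambda>x. f x + g x)" by blast
  show "h differentiable (at x)" for x using d fg unfolding differentiable_def by blast
  show "decay h" using fg decay_add schwartz_decay by blast
  show "partial_deriv b h \<in> {h. \<exists>f\<in>schwartz. \<exists>g\<in>schwartz. h = (\<lambda>x. f x + g x)}" if "b \<in> Basis" for b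
  proof -
    have "partial_deriv b h = (\<lambda>x. partial_deriv b f x + partial_deriv b g x)"
      using partial_deriv_eqI[OF d[OF fg(1,2)]] by (simp add: fg(3) partial_deriv_def)
    thus ?thesis using schwartz_partial_deriv[OF fg(1) that] schwartz_partial_deriv[OF fg(2) that] by blast
  qed
qed (use assms in auto)

lemma partial_deriv_const: "partial_deriv b (\<lambda>x. c) = (\<lambda>x. 0)"
  by (subst partial_deriv_eqI[where f'="\<lambda>x h. 0"]) auto

lemma slow_const: "(\<lambda>x. c) \<in> slow"
proof (rule slow_coinduct[where S="range (\<lambda>c x. c)"])
  fix g assume "g \<in> range (\<lambda>c (x::'a). c::complex)"
  then obtain c where c: "g = (\<lambda>x. c)" by blast
  show "\<exists>N C. \<forall>x. norm (g x) \<le> C * (1 + norm x) ^ N"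
    unfolding c by (rule exI[of _ 0], rule exI[of _ "norm c"]) simp
  show "g differentiable (at x)" for x unfolding c by simp
  show "partial_deriv b g \<in> range (\<lambda>c x. c)" for b unfolding c partial_deriv_const by blast
qed blast

lemma schwartz_cmult: "f \<in> schwartz \<Longrightarrow> (\<lambda>x. c * f x) \<in> schwartz"
  using schwartz_slow_mult[OF slow_const] .

lemma schwartz_diff: "f \<in> schwartz \<Longrightarrow> g \<in> schwartz \<Longrightarrow> (\<lambda>x. f x - g x) \<in> schwartz"
  using schwartz_add[OF _ schwartz_cmult[of g "-1"], of f] by simp

lemma schwartz_zero: "(\<lambda>x. 0) \<in> schwartz"
  by (rule schwartz_coinduct[where S="{\<lambda>x. 0}"]) (auto simp: partial_deriv_const decay_def)

lemma schwartz_sum: "(\<And>i. i \<in> A \<Longrightarrow> f i \<in> schwartz) \<Longrightarrow> (\<lambda>x. \<Sum>i\<in>A. f i x) \<in> schwartz"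
  by (induction A rule: infinite_finite_induct) (auto simp: schwartz_zero intro: schwartz_add)

text \<open>The radial functions that occur below are differentiated inside such a span: each derivative
  of a generator is a linear combination of generators multiplied by a coordinate function.\<close>

inductive_set polynomial_span :: "('a::euclidean_space \<Rightarrow> complex) set \<Rightarrow> ('a \<Rightarrow> complex) set" for A where
  base: "f \<in> A \<Longrightarrow> f \<in> polynomial_span A"
| coord: "f \<in> polynomial_span A \<Longrightarrow> (\<lambda>x. complex_of_real (x \<bullet> b) * f x) \<in> polynomial_span A"
| cmult: "f \<in> polynomial_span A \<Longrightarrow> (\<lambda>x. c * f x) \<in> polynomial_span A"
| add: "f \<in> polynomial_span A \<Longrightarrow> g \<in> polynomial_span A \<Longrightarrow> (\<lambda>x. f x + g x) \<in> polynomial_span A"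

lemma polynomial_span_deriv:
  fixes f :: "'a::euclidean_space \<Rightarrow> complex"
  assumes "f \<in> polynomial_span A"
    and A: "\<And>f x. f \<in> A \<Longrightarrow> f differentiable (at x)"
      "\<And>f b. f \<in> A \<Longrightarrow> b \<in> Basis \<Longrightarrow> partial_deriv b f \<in> polynomial_span A"
  shows "(\<forall>x. f differentiable (at x)) \<and> (\<forall>b\<in>Basis. partial_deriv b f \<in> polynomial_span A)"
  using assms(1)
proof induction
  case (base f)
  thus ?case using A by blast
next
  case (coord f b')
  have df: "(f has_derivative frechet_derivative f (at x)) (at x)" for x
    using coord frechet_derivative_works by blast
  have d: "((\<lambda>x. complex_of_real (x \<bullet> b') * f x) has_derivative
     (\<lambda>h. complex_of_real (x \<bullet> b') * frechet_derivative f (at x) h + complex_of_real (h \<bullet> b') * f x)) (at x)" for x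
    by (auto intro!: derivative_eq_intros df)
  have "partial_deriv b (\<lambda>x. complex_of_real (x \<bullet> b') * f x) =
    (\<lambda>x. complex_of_real (x \<bullet> b') * partial_deriv b f x + complex_of_real (b \<bullet> b') * f x)" for b
    unfolding partial_deriv_eqI[OF d] by (simp add: partial_deriv_def)
  thus ?case using d coord by (auto simp: differentiable_def intro!: polynomial_span.coord polynomial_span.cmult polynomial_span.add)
next
  case (cmult f c)
  have df: "(f has_derivative frechet_derivative f (at x)) (at x)" for x
    using cmult frechet_derivative_works by blast
  have d: "((\<lambda>x. c * f x) has_derivative (\<lambda>h. c * frechet_derivative f (at x) h)) (at x)" for x
    by (auto intro!: derivative_eq_intros df)
  have "partial_deriv b (\<lambda>x. c * f x) = (\<lambda>x. c * partial_deriv b f x)" for b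
    unfolding partial_deriv_eqI[OF d] by (simp add: partial_deriv_def)
  thus ?case using d cmult by (auto simp: differentiable_def intro!: polynomial_span.coord polynomial_span.cmult polynomial_span.add)
next
  case (add f g)
  have df: "(f has_derivative frechet_derivative f (at x)) (at x)"
    and dg: "(g has_derivative frechet_derivative g (at x)) (at x)" for x
    using add frechet_derivative_works by blast+
  have d: "((\<lambda>x. f x + g x) has_derivative
      (\<lambda>h. frechet_derivative f (at x) h + frechet_derivative g (at x) h)) (at x)" for x
    using df dg by (auto intro!: derivative_eq_intros)
  have "partial_deriv b (\<lambda>x. f x + g x) = (\<lambda>x. partial_deriv b f x + partial_deriv b g x)" for b
    using partial_deriv_eqI[OF d] by (simp add: partial_deriv_def)
  thus ?case using d add by (auto simp: differentiable_def intro!: polynomial_span.coord polynomial_span.cmult polynomial_span.add)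
qed

lemma polynomial_span_growth:
  fixes f :: "'a::euclidean_space \<Rightarrow> complex"
  assumes "f \<in> polynomial_span A" and A: "\<And>f. f \<in> A \<Longrightarrow> \<exists>N C. \<forall>x. norm (f x) \<le> C * (1 + norm x) ^ N"
  shows "\<exists>N C. \<forall>x. norm (f x) \<le> C * (1 + norm x) ^ N"
  using assms(1)
proof induction
  case (base f)
  thus ?case by (rule A)
next
  case (coord f b)
  then obtain N C where C: "\<And>x. norm (f x) \<le> C * (1 + norm x) ^ N" by blast
  have "norm (complex_of_real (x \<bullet> b) * f x) \<le> (norm b * C) * (1 + norm x) ^ Suc N" for x
  proof -
    have "\<bar>x \<bullet> b\<bar> \<le> norm b * (1 + norm x)"
      using Cauchy_Schwarz_ineq2[of x b] by (simp add: algebra_simps order_trans)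
    hence "norm (complex_of_real (x \<bullet> b) * f x) \<le> (norm b * (1 + norm x)) * (C * (1 + norm x) ^ N)"
      unfolding norm_mult by (intro mult_mono C) auto
    thus ?thesis by (simp add: mult_ac)
  qed
  thus ?case by blast
next
  case (cmult f c)
  then obtain N C where C: "\<And>x. norm (f x) \<le> C * (1 + norm x) ^ N" by blast
  have "norm (c * f x) \<le> (norm c * C) * (1 + norm x) ^ N" for x
    using C[of x] by (simp add: norm_mult mult.assoc mult_left_mono)
  thus ?case by blast
next
  case (add f g)
  then obtain N C M D where C: "\<And>x. norm (f x) \<le> C * (1 + norm x) ^ N"
    and D: "\<And>x. norm (g x) \<le> D * (1 + norm x) ^ M" by blast
  have "norm (f x + g x) \<le> (\<bar>C\<bar> + \<bar>D\<bar>) * (1 + norm x) ^ (N + M)" for x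
  proof -
    have "norm (f x) \<le> \<bar>C\<bar> * (1 + norm x) ^ (N + M)"
      by (rule order_trans[OF C], intro mult_mono power_increasing) auto
    moreover have "norm (g x) \<le> \<bar>D\<bar> * (1 + norm x) ^ (N + M)"
      by (rule order_trans[OF D], intro mult_mono power_increasing) auto
    ultimately show ?thesis using norm_triangle_ineq[of "f x" "g x"] by (simp add: distrib_right)
  qed
  thus ?case by blast
qed

text \<open>Closed under differentiation up to coordinate factors, because the exponent just drops by 1.\<close>

definition bracket_powers :: "('a::euclidean_space \<Rightarrow> complex) set" where
  "bracket_powers = range (\<lambda>r x. complex_of_real ((1 + (norm x)\<^sup>2) powr r))"

lemma bracket_powers_deriv:
  fixes f :: "'a::euclidean_space \<Rightarrow> complex"
  assumes "f \<in> bracket_powers"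
  shows "f differentiable (at x)" "partial_deriv b f \<in> polynomial_span bracket_powers"
proof -
  from assms obtain r where f: "f = (\<lambda>x. complex_of_real ((1 + (norm x)\<^sup>2) powr r))"
    unfolding bracket_powers_def by blast
  have d: "((\<lambda>x. complex_of_real ((1 + (norm x)\<^sup>2) powr r)) has_derivative
      (\<lambda>h. complex_of_real (2 * r * (h \<bullet> x) * (1 + (norm x)\<^sup>2) powr (r - 1)))) (at x)" for x :: 'a
  proof -
    have p: "0 < 1 + x \<bullet> x" by (simp add: add_pos_nonneg)
    have "((\<lambda>x. (1 + x \<bullet> x) powr r) has_derivative
      (\<lambda>h. (2 * r * (h \<bullet> x) * (1 + x \<bullet> x) powr (r - 1)))) (at x)"
      using p by (auto intro!: derivative_eq_intros simp: inner_commute powr_diff fun_eq_iff field_simps)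
    from has_derivative_of_real[OF this, where 'a=complex] show ?thesis
      by (simp add: power2_norm_eq_inner)
  qed
  have "partial_deriv b (\<lambda>x::'a. complex_of_real ((1 + (norm x)\<^sup>2) powr r)) =
    (\<lambda>x. complex_of_real (2 * r) * (complex_of_real (x \<bullet> b) * complex_of_real ((1 + (norm x)\<^sup>2) powr (r - 1))))" for b
    unfolding partial_deriv_eqI[OF d] by (simp add: inner_commute mult_ac)
  hence "partial_deriv b f = (\<lambda>x. complex_of_real (2 * r) * (complex_of_real (x \<bullet> b) * complex_of_real ((1 + (norm x)\<^sup>2) powr (r - 1))))"
    unfolding f .
  moreover have "(\<lambda>x::'a. complex_of_real ((1 + (norm x)\<^sup>2) powr (r - 1))) \<in> bracket_powers"
    unfolding bracket_powers_def by blast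
  ultimately show "partial_deriv b f \<in> polynomial_span bracket_powers"
    by (simp add: polynomial_span.coord polynomial_span.cmult polynomial_span.base)
  show "f differentiable (at x)" unfolding f using d differentiable_def by blast
qed

lemma bracket_powers_growth:
  fixes f :: "'a::euclidean_space \<Rightarrow> complex"
  assumes "f \<in> bracket_powers"
  shows "\<exists>N C. \<forall>x. norm (f x) \<le> C * (1 + norm x) ^ N"
proof -
  from assms obtain r where f: "f = (\<lambda>x. complex_of_real ((1 + (norm x)\<^sup>2) powr r))"
    unfolding bracket_powers_def by blast
  define k where "k = nat \<lceil>\<bar>r\<bar>\<rceil>"
  have "norm (complex_of_real ((1 + (norm x)\<^sup>2) powr r)) \<le> 1 * (1 + norm x) ^ (2 * k)" for x :: 'a
  proof -
    have "r \<le> real k" unfolding k_def by linarith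
    hence "(1 + (norm x)\<^sup>2) powr r \<le> (1 + (norm x)\<^sup>2) powr (real k)" by (intro powr_mono) auto
    also have "\<dots> = (1 + (norm x)\<^sup>2) ^ k" by (rule powr_realpow) (simp add: add_pos_nonneg)
    also have "\<dots> \<le> ((1 + norm x)\<^sup>2) ^ k"
      by (intro power_mono) (auto simp: power2_eq_square algebra_simps)
    finally show ?thesis by (simp add: power_mult)
  qed
  thus ?thesis unfolding f by blast
qed

lemma bracket_span_slow: "f \<in> polynomial_span bracket_powers \<Longrightarrow> f \<in> slow"
  by (rule slow_coinduct[of f "polynomial_span bracket_powers"])
    (blast dest: polynomial_span_deriv[OF _ bracket_powers_deriv] polynomial_span_growth[OF _ bracket_powers_growth])+

lemma bracket_power_mem: "(\<lambda>x. complex_of_real ((1 + (norm x)\<^sup>2) powr r)) \<in> polynomial_span bracket_powers"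
  by (rule polynomial_span.base) (auto simp: bracket_powers_def)

text \<open>The Fourier multiplier of the Bessel potential of order \<open>s\<close>.\<close>

definition bracket :: "real \<Rightarrow> 'a::euclidean_space \<Rightarrow> real" where
  "bracket s x = (1 + (norm x)\<^sup>2) powr (s / 2)"

lemma bracket_pos: "0 < bracket s x"
proof -
  have "0 < 1 + (norm x)\<^sup>2" by (simp add: add_pos_nonneg)
  thus ?thesis by (simp add: bracket_def)
qed

lemma bracket_mult: "bracket s x * bracket t x = bracket (s + t) x"
  by (simp add: bracket_def powr_add add_divide_distrib)

lemma bracket_0: "bracket 0 x = 1"
proof -
  have "0 < 1 + (norm x)\<^sup>2" by (simp add: add_pos_nonneg)
  thus ?thesis by (simp add: bracket_def)
qed

lemma schwartz_bracket: "f \<in> schwartz \<Longrightarrow> (\<lambda>x. bracket s x *\<^sub>R f x) \<in> schwartz"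
  using schwartz_slow_mult[OF bracket_span_slow[OF bracket_power_mem[of "s / 2"]]]
  by (simp add: bracket_def scaleR_conv_of_real)

lemma schwartz_coord: "f \<in> schwartz \<Longrightarrow> (\<lambda>x. complex_of_real (x \<bullet> b) * f x) \<in> schwartz"
proof -
  have "(\<lambda>x. complex_of_real (x \<bullet> b)) \<in> slow"
    using bracket_span_slow[OF polynomial_span.coord[OF bracket_power_mem[of 0]], of b]
    by (simp add: add_pos_nonneg add_nonneg_eq_0_iff)
  thus "f \<in> schwartz \<Longrightarrow> ?thesis" using schwartz_slow_mult by blast
qed

lemma decay_affine:
  assumes "decay f" "c \<noteq> 0" shows "decay (\<lambda>x. k * f (c *\<^sub>R x + t))"
  unfolding decay_def
proof
  fix N
  obtain C where C: "\<And>x. (1 + norm x) ^ N * norm (f x) \<le> C" using assms unfolding decay_def by metis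
  define L where "L = (1 + 1 / \<bar>c\<bar>) * (1 + norm t)"
  have L: "0 \<le> L" by (simp add: L_def)
  have "(1 + norm x) ^ N * norm (k * f (c *\<^sub>R x + t)) \<le> norm k * L ^ N * C" for x
  proof -
    have "norm (c *\<^sub>R x) \<le> norm (c *\<^sub>R x + t) + norm t"
      using norm_triangle_ineq4[of "c *\<^sub>R x + t" t] by simp
    hence "norm x \<le> (norm (c *\<^sub>R x + t) + norm t) / \<bar>c\<bar>" using assms(2) by (simp add: field_simps)
    moreover have "1 + (p + q) / r \<le> (1 + 1 / r) * (1 + q) * (1 + p)" if "0 \<le> p" "0 \<le> q" "0 < r" for p q r :: real
    proof -
      have "1 + (p + q) / r \<le> (1 + 1 / r) * (1 + (p + q))" using that by (simp add: field_simps)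
      also have "\<dots> \<le> (1 + 1 / r) * ((1 + q) * (1 + p))" using that by (intro mult_left_mono) (auto simp: algebra_simps)
      finally show ?thesis by simp
    qed
    ultimately have "1 + norm x \<le> L * (1 + norm (c *\<^sub>R x + t))" unfolding L_def
      using assms(2) by (smt (verit) norm_ge_zero zero_less_abs_iff)
    hence "(1 + norm x) ^ N \<le> L ^ N * (1 + norm (c *\<^sub>R x + t)) ^ N"
      by (metis power_mono power_mult_distrib add_nonneg_nonneg norm_ge_zero zero_le_one)
    hence "(1 + norm x) ^ N * norm (k * f (c *\<^sub>R x + t)) \<le>
      (L ^ N * (1 + norm (c *\<^sub>R x + t)) ^ N) * norm (k * f (c *\<^sub>R x + t))"
      by (intro mult_right_mono) auto
    also have "\<dots> = norm k * L ^ N * ((1 + norm (c *\<^sub>R x + t)) ^ N * norm (f (c *\<^sub>R x + t)))"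
      by (simp add: norm_mult mult_ac)
    also have "\<dots> \<le> norm k * L ^ N * C" using L by (intro mult_left_mono C) auto
    finally show ?thesis .
  qed
  thus "\<exists>C. \<forall>x. (1 + norm x) ^ N * norm (k * f (c *\<^sub>R x + t)) \<le> C" by blast
qed

lemma schwartz_affine:
  assumes "f \<in> schwartz" "c \<noteq> 0" shows "(\<lambda>x. f (c *\<^sub>R x + t)) \<in> schwartz"
proof (rule schwartz_coinduct[where S="{h. \<exists>f\<in>schwartz. \<exists>k. h = (\<lambda>x. k * f (c *\<^sub>R x + t))}"])
  have d: "((\<lambda>x. k * f (c *\<^sub>R x + t)) has_derivative
      (\<lambda>h. k * frechet_derivative f (at (c *\<^sub>R x + t)) (c *\<^sub>R h))) (at x)"
    if "f \<in> schwartz" for f :: "'a \<Rightarrow> complex" and x k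
  proof -
    have "((\<lambda>x. c *\<^sub>R x + t) has_derivative (\<lambda>h. c *\<^sub>R h)) (at x)"
      by (auto intro!: derivative_eq_intros)
    from has_derivative_compose[OF this smooth_has_derivative[OF schwartz_smooth[OF that]]]
    show ?thesis by (intro has_derivative_mult_right)
  qed
  have lin: "frechet_derivative f (at y) (c *\<^sub>R b) = c *\<^sub>R frechet_derivative f (at y) b"
    if "f \<in> schwartz" for f :: "'a \<Rightarrow> complex" and y b
    using smooth_has_derivative[OF schwartz_smooth[OF that]] has_derivative_linear linear_cmul by blast
  fix h assume "h \<in> {h. \<exists>f\<in>schwartz. \<exists>k. h = (\<lambda>x. k * f (c *\<^sub>R x + t))}"
  then obtain f k where fg: "f \<in> schwartz" "h = (\<lambda>x. k * f (c *\<^sub>R x + t))" by blast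
  show "h differentiable (at x)" for x using d[OF fg(1)] fg unfolding differentiable_def by blast
  show "decay h" using fg decay_affine schwartz_decay assms by blast
  fix b :: 'a assume "b \<in> Basis"
  have "partial_deriv b h = (\<lambda>x. (k * complex_of_real c) * partial_deriv b f (c *\<^sub>R x + t))"
    unfolding fg partial_deriv_eqI[OF d[OF fg(1)]] lin[OF fg(1)] by (simp add: partial_deriv_def scaleR_conv_of_real mult_ac)
  thus "partial_deriv b h \<in> {h. \<exists>f\<in>schwartz. \<exists>k. h = (\<lambda>x. k * f (c *\<^sub>R x + t))}"
    using schwartz_partial_deriv[OF fg(1) \<open>b \<in> Basis\<close>] by blast
qed (use assms in \<open>auto intro!: exI[of _ 1] bexI[of _ f]\<close>)

lemma schwartz_cnj:
  assumes "f \<in> schwartz" shows "(\<lambda>x. cnj (f x)) \<in> schwartz"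
proof (rule schwartz_coinduct[where S="{h. \<exists>f\<in>schwartz. h = (\<lambda>x. cnj (f x))}"])
  have d: "((\<lambda>x. cnj (f x)) has_derivative (\<lambda>h. cnj (frechet_derivative f (at x) h))) (at x)"
    if "f \<in> schwartz" for f :: "'a \<Rightarrow> complex" and x
    using smooth_has_derivative[OF schwartz_smooth[OF that]] by (intro has_derivative_cnj)
  fix h assume "h \<in> {h::'a\<Rightarrow>complex. \<exists>f\<in>schwartz. h = (\<lambda>x. cnj (f x))}"
  then obtain f where fg: "f \<in> schwartz" "h = (\<lambda>x. cnj (f x))" by blast
  show "h differentiable (at x)" for x using d[OF fg(1)] fg unfolding differentiable_def by blast
  show "decay h" using schwartz_decay[OF fg(1)] by (simp add: decay_def fg)
  fix b :: 'a assume "b \<in> Basis"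
  have "partial_deriv b h = (\<lambda>x. cnj (partial_deriv b f x))"
    unfolding fg partial_deriv_eqI[OF d[OF fg(1)]] by (simp add: partial_deriv_def)
  thus "partial_deriv b h \<in> {h. \<exists>f\<in>schwartz. h = (\<lambda>x. cnj (f x))}"
    using schwartz_partial_deriv[OF fg(1) \<open>b \<in> Basis\<close>] by blast
qed (use assms in auto)

section \<open>Integration over Euclidean space\<close>

lemma integral_translate:
  fixes f :: "'a::euclidean_space \<Rightarrow> 'b::{banach,second_countable_topology}"
  assumes [measurable]: "f \<in> borel_measurable borel"
  shows "(LINT x|lborel. f (x + t)) = (LINT x|lborel. f x)"
proof -
  have "(LINT x|lborel. f x) = (LINT x|distr lborel borel ((+) t). f x)" by (simp add: lborel_distr_plus)
  also have "\<dots> = (LINT x|lborel. f (t + x))" by (rule integral_distr) auto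
  finally show ?thesis by (simp add: add.commute)
qed

lemma nn_integral_translate:
  fixes f :: "'a::euclidean_space \<Rightarrow> ennreal"
  assumes [measurable]: "f \<in> borel_measurable borel"
  shows "(\<integral>\<^sup>+x. f (x + t) \<partial>lborel) = (\<integral>\<^sup>+x. f x \<partial>lborel)"
proof -
  have "(\<integral>\<^sup>+x. f x \<partial>lborel) = (\<integral>\<^sup>+x. f x \<partial>distr lborel borel ((+) t))" by (simp add: lborel_distr_plus)
  also have "\<dots> = (\<integral>\<^sup>+x. f (t + x) \<partial>lborel)" by (rule nn_integral_distr) auto
  finally show ?thesis by (simp add: add.commute)
qed

lemma integral_affine:
  fixes f :: "'a::euclidean_space \<Rightarrow> 'b::{banach,second_countable_topology}"
  assumes [measurable]: "f \<in> borel_measurable borel" and "c \<noteq> 0"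
  shows "(LINT x|lborel. f x) = \<bar>c\<bar> ^ DIM('a) *\<^sub>R (LINT x|lborel. f (t + c *\<^sub>R x))"
proof -
  have "(LINT x|lborel. f x) = (LINT x|density (distr lborel borel (\<lambda>x::'a. t + c *\<^sub>R x)) (\<lambda>_. \<bar>c\<bar>^DIM('a)). f x)"
    using lborel_affine[OF assms(2), of t] by simp
  also have "\<dots> = (LINT x|distr lborel borel (\<lambda>x::'a. t + c *\<^sub>R x). \<bar>c\<bar>^DIM('a) *\<^sub>R f x)"
    by (subst integral_density) auto
  also have "\<dots> = (LINT x|lborel. \<bar>c\<bar>^DIM('a) *\<^sub>R f (t + c *\<^sub>R x))"
    by (subst integral_distr) auto
  finally show ?thesis by simp
qed

lemma integral_reflect:
  fixes f :: "'a::euclidean_space \<Rightarrow> 'b::{banach,second_countable_topology}"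
  assumes "f \<in> borel_measurable borel"
  shows "(LINT x|lborel. f (- x)) = (LINT x|lborel. f x)"
  using integral_affine[OF assms, of "-1" 0] by simp

text \<open>Dominated by the product of the one-dimensional kernels \<open>inverse (1 + (x \<bullet> b)\<^sup>2)\<close>, since every coordinate is at most the norm.\<close>

lemma integrable_decay_kernel: "integrable lborel (\<lambda>x::'a::euclidean_space. inverse ((1 + norm x) ^ (2 * DIM('a))))"
proof (rule integrableI_bounded)
  have fin: "(\<integral>\<^sup>+x. ennreal (inverse (1 + x\<^sup>2)) \<partial>(lborel::real measure)) < \<infinity>"
    using integrable_inverse_1_plus_square
    by (auto simp: set_integrable_def integrable_iff_bounded)
  have "(\<integral>\<^sup>+ x. ennreal (norm (inverse ((1 + norm x) ^ (2 * DIM('a))))) \<partial>(lborel::'a measure)) \<le>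
    (\<integral>\<^sup>+ x. (\<Prod>b\<in>Basis. ennreal (inverse (1 + (x \<bullet> b)\<^sup>2))) \<partial>(lborel::'a measure))"
  proof (rule nn_integral_mono)
    fix x :: 'a
    have "(\<Prod>b\<in>(Basis::'a set). 1 + (x \<bullet> b)\<^sup>2) \<le> (\<Prod>b\<in>(Basis::'a set). (1 + norm x)\<^sup>2)"
    proof (intro prod_mono conjI)
      fix b :: 'a assume "b \<in> Basis"
      hence "\<bar>x \<bullet> b\<bar> \<le> norm x" by (rule Basis_le_norm)
      hence "(x \<bullet> b)\<^sup>2 \<le> (norm x)\<^sup>2" by (metis abs_le_square_iff abs_norm_cancel)
      thus "1 + (x \<bullet> b)\<^sup>2 \<le> (1 + norm x)\<^sup>2" by (simp add: power2_sum add_increasing2)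
    qed auto
    also have "\<dots> = (1 + norm x) ^ (2 * DIM('a))" by (simp add: power_mult)
    finally have "inverse ((1 + norm x) ^ (2 * DIM('a))) \<le> inverse (\<Prod>b\<in>(Basis::'a set). 1 + (x \<bullet> b)\<^sup>2)"
      by (intro le_imp_inverse_le prod_pos) (auto simp: add_pos_nonneg)
    also have "\<dots> = (\<Prod>b\<in>(Basis::'a set). inverse (1 + (x \<bullet> b)\<^sup>2))" by (simp add: prod_inversef[symmetric] o_def)
    finally show "ennreal (norm (inverse ((1 + norm x) ^ (2 * DIM('a))))) \<le> (\<Prod>b\<in>Basis. ennreal (inverse (1 + (x \<bullet> b)\<^sup>2)))"
      by (subst prod_ennreal) (auto simp: ennreal_leI)
  qed
  also have "\<dots> = (\<Prod>b\<in>(Basis::'a set). (\<integral>\<^sup>+x. ennreal (inverse (1 + x\<^sup>2)) \<partial>(lborel::real measure)))"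
    by (subst nn_integral_lborel_prod[symmetric]) auto
  also have "\<dots> < \<infinity>" using fin by (simp add: power_less_top_ennreal)
  finally show "(\<integral>\<^sup>+ x. ennreal (norm (inverse ((1 + norm x) ^ (2 * DIM('a))))) \<partial>(lborel::'a measure)) < \<infinity>" .
qed measurable

lemma integrable_decay:
  fixes f :: "'a::euclidean_space \<Rightarrow> 'b::{banach,second_countable_topology}"
  assumes [measurable]: "f \<in> borel_measurable borel"
    and le: "\<And>x. (1 + norm x) ^ (2 * DIM('a)) * norm (f x) \<le> C"
  shows "integrable lborel f"
proof (rule Bochner_Integration.integrable_bound)
  show "integrable lborel (\<lambda>x::'a. C * inverse ((1 + norm x) ^ (2 * DIM('a))))"
    using integrable_decay_kernel by (rule integrable_mult_right)
  show "AE x in lborel. norm (f x) \<le> norm (C * inverse ((1 + norm x) ^ (2 * DIM('a))))"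
  proof (rule AE_I2)
    fix x :: 'a
    have p: "0 < (1 + norm x) ^ (2 * DIM('a))" by (simp add: add_pos_nonneg)
    have "norm (f x) \<le> C * inverse ((1 + norm x) ^ (2 * DIM('a)))"
      using le[of x] p by (simp add: field_simps)
    thus "norm (f x) \<le> norm (C * inverse ((1 + norm x) ^ (2 * DIM('a))))" by (simp add: abs_if)
  qed
qed auto

lemma schwartz_measurable: "f \<in> schwartz \<Longrightarrow> f \<in> borel_measurable borel"
  using schwartz_smooth smooth_measurable by blast

lemma schwartz_integrable: "f \<in> schwartz \<Longrightarrow> integrable lborel f"
  using schwartz_decay[unfolded decay_def] integrable_decay[OF schwartz_measurable] by metis

lemma schwartz_bounded: "f \<in> schwartz \<Longrightarrow> \<exists>C. \<forall>x. norm (f x) \<le> C"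
  using schwartz_decay[unfolded decay_def, rule_format, of f 0] by auto

lemma slow_of_schwartz: "f \<in> schwartz \<Longrightarrow> f \<in> slow"
proof (rule slow_coinduct[of f schwartz])
  fix g :: "'a \<Rightarrow> complex" assume "g \<in> schwartz"
  then obtain C where "\<And>x. norm (g x) \<le> C" using schwartz_bounded by blast
  hence "\<forall>x. norm (g x) \<le> C * (1 + norm x) ^ 0" by simp
  thus "\<exists>N C. \<forall>x. norm (g x) \<le> C * (1 + norm x) ^ N" by blast
qed (auto intro: schwartz_partial_deriv smooth_differentiable schwartz_smooth)

lemma schwartz_mult: "f \<in> schwartz \<Longrightarrow> g \<in> schwartz \<Longrightarrow> (\<lambda>x. f x * g x) \<in> schwartz"
  using schwartz_slow_mult slow_of_schwartz by blast

lemma partial_deriv_mult: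
  assumes "smooth f" "smooth g"
  shows "partial_deriv b (\<lambda>x. f x * g x) = (\<lambda>x. f x * partial_deriv b g x + partial_deriv b f x * g x)"
proof -
  have "((\<lambda>x. f x * g x) has_derivative
      (\<lambda>h. f x * frechet_derivative g (at x) h + frechet_derivative f (at x) h * g x)) (at x)" for x
    using smooth_has_derivative[OF assms(1)] smooth_has_derivative[OF assms(2)]
    by (auto intro!: derivative_eq_intros)
  from partial_deriv_eqI[OF this] show ?thesis by (simp add: partial_deriv_def)
qed

lemma has_vector_derivative_line:
  assumes "smooth f"
  shows "((\<lambda>t. f (x + t *\<^sub>R b)) has_vector_derivative partial_deriv b f (x + t *\<^sub>R b)) (at t within S)"
proof -
  let ?D = "frechet_derivative f (at (x + t *\<^sub>R b))"
  have "((\<lambda>t. x + t *\<^sub>R b) has_derivative (\<lambda>h. h *\<^sub>R b)) (at t within S)"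
    by (auto intro!: derivative_eq_intros)
  from has_derivative_compose[OF this smooth_has_derivative[OF assms]]
  have "((\<lambda>t. f (x + t *\<^sub>R b)) has_derivative (\<lambda>h. ?D (h *\<^sub>R b))) (at t within S)" .
  moreover have "?D (h *\<^sub>R b) = h *\<^sub>R ?D b" for h
    using smooth_has_derivative[OF assms] has_derivative_linear linear_cmul by blast
  ultimately show ?thesis by (simp add: has_vector_derivative_def partial_deriv_def)
qed

lemma norm_diff_le_line:
  assumes "smooth f" "0 \<le> t" "\<And>u. 0 \<le> u \<Longrightarrow> u \<le> t \<Longrightarrow> norm (partial_deriv b f (x + u *\<^sub>R b)) \<le> B"
  shows "norm (f (x + t *\<^sub>R b) - f x) \<le> B * t"
proof -
  have "norm (f (x + t *\<^sub>R b) - f (x + 0 *\<^sub>R b)) \<le> B * norm (t - 0)"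
  proof (rule differentiable_bound[where f="\<lambda>t. f (x + t *\<^sub>R b)" and S="{0..t}"
        and f'="\<lambda>u h. h *\<^sub>R partial_deriv b f (x + u *\<^sub>R b)"])
    fix u assume u: "u \<in> {0..t}"
    show "((\<lambda>t. f (x + t *\<^sub>R b)) has_derivative (\<lambda>h. h *\<^sub>R partial_deriv b f (x + u *\<^sub>R b))) (at u within {0..t})"
      using has_vector_derivative_line[OF assms(1)] by (simp add: has_vector_derivative_def)
    show "onorm (\<lambda>h. h *\<^sub>R partial_deriv b f (x + u *\<^sub>R b)) \<le> B"
      using assms(3)[of u] u by (intro onorm_le) (simp add: mult.commute[of B] mult_left_mono)
  qed (use assms in auto)
  thus ?thesis using assms by simp
qed

text \<open>The integral of a translate does not depend on the translation, so its difference quotients in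
  direction \<open>b\<close> vanish; they converge to the integral below. The quotients are dominated because within distance 1 the
  factor \<open>1 + norm x\<close> changes at most by the factor 2.\<close>

lemma integral_partial_deriv_eq_0:
  fixes g :: "'a::euclidean_space \<Rightarrow> complex"
  assumes g: "g \<in> schwartz" and b: "b \<in> Basis"
  shows "(LINT x|lborel. partial_deriv b g x) = 0"
proof -
  let ?N = "2 * DIM('a)"
  let ?t = "\<lambda>n. 1 / real (Suc n)"
  let ?q = "\<lambda>n x. real (Suc n) *\<^sub>R (g (x + ?t n *\<^sub>R b) - g x)"
  note sm = schwartz_smooth[OF g]
  have gm[measurable]: "g \<in> borel_measurable borel" "partial_deriv b g \<in> borel_measurable borel"
    using schwartz_measurable schwartz_partial_deriv g b by blast+
  obtain C where C: "\<And>x. (1 + norm x) ^ ?N * norm (partial_deriv b g x) \<le> C"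
    using schwartz_decay[OF schwartz_partial_deriv[OF g b]] unfolding decay_def by metis
  have "(\<lambda>n. LINT x|lborel. ?q n x) \<longlonglongrightarrow> (LINT x|lborel. partial_deriv b g x)"
  proof (rule integral_dominated_convergence)
    show "integrable lborel (\<lambda>x::'a. (C * 2 ^ ?N) * inverse ((1 + norm x) ^ ?N))"
      using integrable_decay_kernel by (rule integrable_mult_right)
    show "AE x in lborel. (\<lambda>n. ?q n x) \<longlonglongrightarrow> partial_deriv b g x"
    proof (rule AE_I2)
      fix x
      have "((\<lambda>t. g (x + t *\<^sub>R b)) has_vector_derivative partial_deriv b g x) (at 0)"
        using has_vector_derivative_line[OF sm, of x b 0] by simp
      hence "((\<lambda>t. norm (g (x + t *\<^sub>R b) - g x - t *\<^sub>R partial_deriv b g x) / norm t) \<longlongrightarrow> 0) (at 0)"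
        unfolding has_vector_derivative_def has_derivative_at by simp
      moreover have "\<forall>\<^sub>F t in at 0. norm (g (x + t *\<^sub>R b) - g x - t *\<^sub>R partial_deriv b g x) / norm t =
        norm ((g (x + t *\<^sub>R b) - g x) /\<^sub>R t - partial_deriv b g x)"
      proof (rule eventually_at_filter[THEN iffD2], rule always_eventually, intro allI impI)
        fix t :: real assume "t \<noteq> 0"
        hence "(g (x + t *\<^sub>R b) - g x) /\<^sub>R t - partial_deriv b g x = inverse t *\<^sub>R (g (x + t *\<^sub>R b) - g x - t *\<^sub>R partial_deriv b g x)"
          by (simp add: scaleR_right_diff_distrib)
        thus "norm (g (x + t *\<^sub>R b) - g x - t *\<^sub>R partial_deriv b g x) / norm t =
          norm ((g (x + t *\<^sub>R b) - g x) /\<^sub>R t - partial_deriv b g x)" by (simp add: divide_inverse mult.commute)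
      qed
      ultimately have "((\<lambda>t. norm ((g (x + t *\<^sub>R b) - g x) /\<^sub>R t - partial_deriv b g x)) \<longlongrightarrow> 0) (at 0)"
        using tendsto_cong by fast
      hence *: "((\<lambda>t. (g (x + t *\<^sub>R b) - g x) /\<^sub>R t) \<longlongrightarrow> partial_deriv b g x) (at 0)"
        using tendsto_norm_zero_iff Lim_null by blast
      have "filterlim ?t (at 0) sequentially"
        unfolding filterlim_at using LIMSEQ_Suc[OF lim_1_over_n] by auto
      from filterlim_compose[OF * this] show "(\<lambda>n. ?q n x) \<longlonglongrightarrow> partial_deriv b g x" by simp
    qed
    show "AE x in lborel. norm (?q n x) \<le> (C * 2 ^ ?N) * inverse ((1 + norm x) ^ ?N)" for n
    proof (rule AE_I2)
      fix x :: 'a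
      have *: "norm (partial_deriv b g (x + u *\<^sub>R b)) \<le> (C * 2 ^ ?N) * inverse ((1 + norm x) ^ ?N)"
        if u: "0 \<le> u" "u \<le> ?t n" for u
      proof -
        have "u \<le> 1" by (rule order_trans[OF u(2)]) (simp add: divide_le_eq)
        hence "norm (u *\<^sub>R b) \<le> 1" using u b by simp
        moreover have "norm x \<le> norm (x + u *\<^sub>R b) + norm (u *\<^sub>R b)"
          using norm_triangle_ineq4[of "x + u *\<^sub>R b" "u *\<^sub>R b"] by simp
        ultimately have "norm x \<le> norm (x + u *\<^sub>R b) + 1" by (meson add_left_mono order_trans)
        moreover have "1 + p \<le> 2 * (1 + q)" if "p \<le> q + 1" "0 \<le> q" for p q :: real using that by simp
        ultimately have "1 + norm x \<le> 2 * (1 + norm (x + u *\<^sub>R b))" using norm_ge_zero by blast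
        hence "(1 + norm x) ^ ?N \<le> (2 * (1 + norm (x + u *\<^sub>R b))) ^ ?N"
          by (intro power_mono) auto
        hence "(1 + norm x) ^ ?N * norm (partial_deriv b g (x + u *\<^sub>R b)) \<le>
          (2 * (1 + norm (x + u *\<^sub>R b))) ^ ?N * norm (partial_deriv b g (x + u *\<^sub>R b))"
          by (rule mult_right_mono) simp
        also have "\<dots> \<le> 2 ^ ?N * C"
          unfolding power_mult_distrib mult.assoc by (intro mult_left_mono C) simp
        finally have "(1 + norm x) ^ ?N * norm (partial_deriv b g (x + u *\<^sub>R b)) \<le> 2 ^ ?N * C" .
        moreover have "0 < (1 + norm x) ^ ?N" by (simp add: add_pos_nonneg)
        ultimately show ?thesis by (simp add: field_simps)
      qed
      have "norm (g (x + ?t n *\<^sub>R b) - g x) \<le> (C * 2 ^ ?N) * inverse ((1 + norm x) ^ ?N) * ?t n"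
        by (rule norm_diff_le_line[OF sm _ *]) (simp, assumption+)
      hence "real (Suc n) * norm (g (x + ?t n *\<^sub>R b) - g x) \<le>
        real (Suc n) * ((C * 2 ^ ?N) * inverse ((1 + norm x) ^ ?N) * ?t n)" by (rule mult_left_mono) simp
      thus "norm (?q n x) \<le> (C * 2 ^ ?N) * inverse ((1 + norm x) ^ ?N)"
        by (simp del: of_nat_Suc)
    qed
  qed measurable
  moreover have "(LINT x|lborel. ?q n x) = 0" for n
  proof -
    have "integrable lborel (\<lambda>x. g (x + ?t n *\<^sub>R b))"
      using schwartz_integrable[OF schwartz_affine[OF g, of 1 "?t n *\<^sub>R b"]] by simp
    moreover have "integrable lborel g" by (rule schwartz_integrable[OF g])
    ultimately show ?thesis by (simp add: integral_translate del: of_nat_Suc)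
  qed
  ultimately have "(\<lambda>n::nat. 0 :: complex) \<longlonglongrightarrow> (LINT x|lborel. partial_deriv b g x)" by simp
  thus ?thesis using LIMSEQ_unique tendsto_const by blast
qed

lemma integral_by_parts:
  assumes f: "f \<in> slow" and g: "g \<in> schwartz" and b: "b \<in> Basis"
  shows "(LINT x|lborel. partial_deriv b f x * g x) = - (LINT x|lborel. f x * partial_deriv b g x)"
proof -
  have "integrable lborel (\<lambda>x. partial_deriv b f x * g x)" "integrable lborel (\<lambda>x. f x * partial_deriv b g x)"
    using schwartz_integrable schwartz_slow_mult slow_partial_deriv schwartz_partial_deriv f g b by blast+
  moreover have "(LINT x|lborel. partial_deriv b (\<lambda>x. f x * g x) x) = 0"
    using integral_partial_deriv_eq_0 schwartz_slow_mult f g b by blast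
  ultimately have "(LINT x|lborel. f x * partial_deriv b g x) + (LINT x|lborel. partial_deriv b f x * g x) = 0"
    unfolding partial_deriv_mult[OF slow_smooth[OF f] schwartz_smooth[OF g]] by simp
  thus ?thesis by (simp add: eq_neg_iff_add_eq_0 add.commute)
qed

section \<open>The Fourier transform on the Schwartz space\<close>

text \<open>The argument only carries the type, whose dimension determines the constant.\<close>

definition fourier_const :: "'a::euclidean_space itself \<Rightarrow> real" where
  "fourier_const _ = (2 * pi) powr (- real DIM('a) / 2)"

lemma fourier_const_pos: "0 < fourier_const TYPE('a::euclidean_space)"
  by (simp add: fourier_const_def)

lemma fourier_eq: "fourier f (\<xi>::'a::euclidean_space) = fourier_const TYPE('a) *\<^sub>R (LINT x|lborel. cis (- (x \<bullet> \<xi>)) * f x)"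
  by (simp add: fourier_def fourier_const_def)

lemma inv_fourier_eq: "inv_fourier f x = fourier f (- x)"
  by (simp add: inv_fourier_def fourier_def inner_commute)

lemma measurable_cis[measurable]: "cis \<in> borel_measurable borel"
  by (intro borel_measurable_continuous_onI continuous_intros)

lemma integrable_cis_mult:
  assumes "integrable lborel f" "h \<in> borel_measurable lborel"
  shows "integrable lborel (\<lambda>x. cis (h x) * f x)"
proof (rule Bochner_Integration.integrable_bound[OF assms(1)])
  show "(\<lambda>x. cis (h x) * f x) \<in> borel_measurable lborel"
    using assms(2) borel_measurable_integrable[OF assms(1)] by measurable
qed (simp add: norm_mult)

lemma norm_fourier_le:
  fixes f :: "'a::euclidean_space \<Rightarrow> complex"
  shows "norm (fourier f \<xi>) \<le> fourier_const TYPE('a) * (LINT x|lborel. norm (f x))"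
proof -
  have "norm (LINT x|lborel. cis (- (x \<bullet> \<xi>)) * f x) \<le> (LINT x|lborel. norm (cis (- (x \<bullet> \<xi>)) * f x))"
    by (rule integral_norm_bound)
  thus ?thesis unfolding fourier_eq using fourier_const_pos[where 'a='a]
    by (simp add: norm_mult mult_left_mono)
qed

lemma fourier_cmult: "fourier (\<lambda>x. c * f x) \<xi> = c * fourier f \<xi>"
proof -
  have "(\<lambda>x. cis (- (x \<bullet> \<xi>)) * (c * f x)) = (\<lambda>x. c * (cis (- (x \<bullet> \<xi>)) * f x))" by (simp add: mult_ac)
  thus ?thesis by (simp add: fourier_eq)
qed

lemma fourier_scaleR: "fourier (\<lambda>x. c *\<^sub>R f x) \<xi> = c *\<^sub>R fourier f \<xi>"
  by (simp add: scaleR_conv_of_real fourier_cmult)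

lemma fourier_add:
  assumes "integrable lborel f" "integrable lborel g"
  shows "fourier (\<lambda>x. f x + g x) \<xi> = fourier f \<xi> + fourier g \<xi>"
proof -
  have "integrable lborel (\<lambda>x. cis (- (x \<bullet> \<xi>)) * f x)" "integrable lborel (\<lambda>x. cis (- (x \<bullet> \<xi>)) * g x)"
    using assms by (intro integrable_cis_mult; simp)+
  thus ?thesis by (simp add: fourier_eq distrib_left scaleR_right_distrib)
qed

lemma fourier_diff:
  assumes "integrable lborel f" "integrable lborel g"
  shows "fourier (\<lambda>x. f x - g x) \<xi> = fourier f \<xi> - fourier g \<xi>"
  using fourier_add[OF assms(1), of "\<lambda>x. - 1 * g x"] assms(2) fourier_cmult[of "-1" g \<xi>] by simp

lemma fourier_translate:
  assumes [measurable]: "f \<in> borel_measurable borel"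
  shows "fourier (\<lambda>x. f (x + t)) \<xi> = cis (t \<bullet> \<xi>) * fourier f \<xi>"
proof -
  have "(LINT x|lborel. cis (- (x \<bullet> \<xi>)) * f (x + t)) = (LINT x|lborel. cis (t \<bullet> \<xi>) * (cis (- ((x + t) \<bullet> \<xi>)) * f (x + t)))"
    by (intro Bochner_Integration.integral_cong refl)
      (simp add: mult.assoc[symmetric] cis_mult inner_add_left)
  also have "\<dots> = cis (t \<bullet> \<xi>) * (LINT x|lborel. cis (- (x \<bullet> \<xi>)) * f x)"
    using integral_translate[of "\<lambda>x. cis (- (x \<bullet> \<xi>)) * f x" t] by simp
  finally show ?thesis by (simp add: fourier_eq)
qed

lemma fourier_reflect:
  assumes [measurable]: "f \<in> borel_measurable borel"
  shows "fourier (\<lambda>x. f (- x)) \<xi> = fourier f (- \<xi>)"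
  using integral_reflect[of "\<lambda>x. cis (x \<bullet> \<xi>) * f x"] by (simp add: fourier_eq)

lemma cnj_fourier: "cnj (fourier f \<xi>) = inv_fourier (\<lambda>x. cnj (f x)) \<xi>"
proof -
  have "cnj (LINT x|lborel. cis (- (x \<bullet> \<xi>)) * f x) = (LINT x|lborel. cnj (cis (- (x \<bullet> \<xi>)) * f x))"
    by (rule Bochner_Integration.integral_cnj[symmetric])
  also have "\<dots> = (LINT x|lborel. cis (x \<bullet> \<xi>) * cnj (f x))" by (simp add: cis_cnj)
  finally show ?thesis by (simp add: inv_fourier_eq fourier_eq)
qed

lemma fourier_multiplication_formula:
  fixes f g :: "'a::euclidean_space \<Rightarrow> complex"
  assumes f: "integrable lborel f" and g: "integrable lborel g"
  shows "(LINT \<xi>|lborel. fourier f \<xi> * g \<xi>) = (LINT x|lborel. f x * fourier g x)"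
proof -
  have [measurable]: "f \<in> borel_measurable borel" "g \<in> borel_measurable borel" using f g by auto
  have int: "integrable (lborel \<Otimes>\<^sub>M lborel) (\<lambda>(x, y). cis (- (x \<bullet> y)) * f x * g y)"
  proof (rule lborel_pair.Fubini_integrable)
    show "integrable lborel (\<lambda>x. LINT y|lborel. norm (case (x, y) of (x, y) \<Rightarrow> cis (- (x \<bullet> y)) * f x * g y))"
      using f by (simp add: norm_mult)
    show "AE x in lborel. integrable lborel (\<lambda>y. case (x, y) of (x, y) \<Rightarrow> cis (- (x \<bullet> y)) * f x * g y)"
    proof (rule AE_I2)
      fix x
      have "integrable lborel (\<lambda>y. f x * (cis (- (x \<bullet> y)) * g y))"
        by (intro integrable_mult_right integrable_cis_mult g) simp
      thus "integrable lborel (\<lambda>y. case (x, y) of (x, y) \<Rightarrow> cis (- (x \<bullet> y)) * f x * g y)"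
        by (simp add: mult_ac)
    qed
  qed measurable
  have "(LINT y|lborel. (LINT x|lborel. cis (- (x \<bullet> y)) * f x * g y)) = (LINT x|lborel. (LINT y|lborel. cis (- (x \<bullet> y)) * f x * g y))"
    by (rule lborel_pair.Fubini_integral[OF int])
  moreover have "(LINT x|lborel. cis (- (x \<bullet> y)) * f x * g y) = (LINT x|lborel. cis (- (x \<bullet> y)) * f x) * g y" for y by simp
  moreover have "(LINT y|lborel. cis (- (x \<bullet> y)) * f x * g y) = f x * (LINT y|lborel. cis (- (y \<bullet> x)) * g y)" for x
  proof -
    have "(LINT y|lborel. cis (- (x \<bullet> y)) * f x * g y) = (LINT y|lborel. f x * (cis (- (y \<bullet> x)) * g y))"
      by (simp add: mult_ac inner_commute)
    thus ?thesis by simp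
  qed
  ultimately show ?thesis by (simp add: fourier_eq)
qed

lemma norm_cis_taylor: "norm (cis (a + t) - cis a - \<i> * t * cis a) \<le> t\<^sup>2 / 2"
proof -
  have "cis (a + t) - cis a - \<i> * t * cis a = cis a * (iexp t - (\<Sum>k\<le>1. (\<i> * t) ^ k / fact k))"
    unfolding cis_mult[of a t, symmetric] cis_conv_exp[of t, symmetric] by (simp add: algebra_simps)
  hence "norm (cis (a + t) - cis a - \<i> * t * cis a) = norm (iexp t - (\<Sum>k\<le>1. (\<i> * t) ^ k / fact k))"
    by (simp only: norm_mult norm_cis mult_1)
  also have "\<dots> \<le> \<bar>t\<bar> ^ Suc 1 / fact (Suc 1)" by (rule iexp_approx1)
  finally show ?thesis by (simp add: power2_eq_square)
qed

lemma has_derivative_quadratic_bound: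
  fixes f :: "'a::euclidean_space \<Rightarrow> 'b::real_normed_vector"
  assumes "linear D" "\<And>h. norm (f (x + h) - f x - D h) \<le> C * (norm h)\<^sup>2"
  shows "(f has_derivative D) (at x)"
  unfolding has_derivative_at2
proof (intro conjI)
  show "bounded_linear D" using assms(1) linear_conv_bounded_linear by blast
  have "((\<lambda>y. C * norm (y - x)) \<longlongrightarrow> C * norm (x - x)) (at x)"
    by (intro tendsto_intros)
  hence l: "((\<lambda>y. C * norm (y - x)) \<longlongrightarrow> 0) (at x)" by simp
  have "norm ((1 / norm (y - x)) *\<^sub>R (f y - (f x + D (y - x)))) \<le> C * norm (y - x)" (is "?L y \<le> _") for y
  proof (cases "y = x")
    case False
    have "norm ((1 / norm (y - x)) *\<^sub>R (f y - (f x + D (y - x)))) = norm (f y - (f x + D (y - x))) / norm (y - x)"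
      by (simp add: divide_inverse mult.commute)
    also have "\<dots> \<le> (C * (norm (y - x))\<^sup>2) / norm (y - x)"
      using assms(2)[of "y - x"] by (intro divide_right_mono) (simp_all add: diff_diff_eq)
    finally show ?thesis using False by (simp add: power2_eq_square)
  qed simp
  hence "\<forall>\<^sub>F y in at x. norm ((1 / norm (y - x)) *\<^sub>R (f y - (f x + D (y - x)))) \<le> C * norm (y - x)"
    by (intro always_eventually allI)
  from Lim_null_comparison[OF this l]
  show "((\<lambda>y. (1 / norm (y - x)) *\<^sub>R (f y - (f x + D (y - x)))) \<longlongrightarrow> 0) (at x)" .
qed

text \<open>The Taylor formula for \<open>cis\<close> under the integral. The error is uniform in \<open>\<xi>\<close>, which is used later for convolutions.\<close>

lemma fourier_taylor:
  fixes f :: "'a::euclidean_space \<Rightarrow> complex"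
  assumes f: "f \<in> schwartz"
  shows "norm (fourier f (\<xi> + h) - fourier f \<xi> - fourier (\<lambda>x. - \<i> * (complex_of_real (x \<bullet> h) * f x)) \<xi>)
    \<le> (fourier_const TYPE('a) * (LINT x|lborel. (norm x)\<^sup>2 * norm (f x))) * (norm h)\<^sup>2"
proof -
  let ?D = "\<lambda>h. fourier (\<lambda>x. - \<i> * (complex_of_real (x \<bullet> h) * f x)) \<xi>"
  have sc: "(\<lambda>x. - \<i> * (complex_of_real (x \<bullet> h) * f x)) \<in> schwartz" for h
    by (intro schwartz_cmult schwartz_coord f)
  let ?I = "LINT x|lborel. (norm x)\<^sup>2 * norm (f x)"
  obtain C where C: "\<And>x. (1 + norm x) ^ (2 * DIM('a) + 2) * norm (f x) \<le> C"
    using schwartz_decay[OF f] unfolding decay_def by metis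
  have [measurable]: "f \<in> borel_measurable borel" using schwartz_measurable f by blast
  have int2: "integrable lborel (\<lambda>x. (norm x)\<^sup>2 * norm (f x))"
  proof (rule integrable_decay[where C=C])
    fix x :: 'a
    have "(norm x)\<^sup>2 \<le> (1 + norm x)\<^sup>2" by (intro power_mono) auto
    hence "(1 + norm x) ^ (2 * DIM('a)) * norm ((norm x)\<^sup>2 * norm (f x)) \<le>
       (1 + norm x) ^ (2 * DIM('a)) * ((1 + norm x)\<^sup>2 * norm (f x))"
      by (intro mult_left_mono) (auto simp: mult_right_mono)
    also have "\<dots> = (1 + norm x) ^ (2 * DIM('a) + 2) * norm (f x)"
      by (simp only: power_add mult.assoc)
    finally show "(1 + norm x) ^ (2 * DIM('a)) * norm ((norm x)\<^sup>2 * norm (f x)) \<le> C" using C[of x] by linarith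
  qed measurable
  let ?r = "\<lambda>x. cis (- (x \<bullet> (\<xi> + h))) * f x - cis (- (x \<bullet> \<xi>)) * f x - cis (- (x \<bullet> \<xi>)) * (- \<i> * (complex_of_real (x \<bullet> h) * f x))"
  have i: "integrable lborel (\<lambda>x. cis (- (x \<bullet> (\<xi> + h))) * f x)" "integrable lborel (\<lambda>x. cis (- (x \<bullet> \<xi>)) * f x)"
    "integrable lborel (\<lambda>x. cis (- (x \<bullet> \<xi>)) * (- \<i> * (complex_of_real (x \<bullet> h) * f x)))"
    using schwartz_integrable[OF f] schwartz_integrable[OF sc] by (intro integrable_cis_mult; simp)+
  have ri: "integrable lborel ?r" using i by (intro Bochner_Integration.integrable_diff)
  have "fourier f (\<xi> + h) - fourier f \<xi> - ?D h = fourier_const TYPE('a) *\<^sub>R (LINT x|lborel. ?r x)"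
    using i by (simp add: fourier_eq scaleR_right_diff_distrib scaleR_right_distrib)
  hence eq: "norm (fourier f (\<xi> + h) - fourier f \<xi> - ?D h) = fourier_const TYPE('a) * norm (LINT x|lborel. ?r x)"
    using fourier_const_pos[where 'a='a] by (simp only: norm_scaleR abs_of_pos)
  have "norm (LINT x|lborel. ?r x) \<le> (LINT x|lborel. norm (?r x))" by (rule integral_norm_bound)
  also have "\<dots> \<le> (LINT x|lborel. (norm h)\<^sup>2 * ((norm x)\<^sup>2 * norm (f x)))"
  proof (rule integral_mono)
    show "integrable lborel (\<lambda>x. norm (?r x))" using ri by (rule integrable_norm)
    show "integrable lborel (\<lambda>x. (norm h)\<^sup>2 * ((norm x)\<^sup>2 * norm (f x)))" using int2 by simp
    fix x
    have "?r x = (cis (- (x \<bullet> \<xi>) + - (x \<bullet> h)) - cis (- (x \<bullet> \<xi>)) - \<i> * (- (x \<bullet> h)) * cis (- (x \<bullet> \<xi>))) * f x"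
      by (simp add: inner_add_right algebra_simps)
    hence "norm (?r x) \<le> ((- (x \<bullet> h))\<^sup>2 / 2) * norm (f x)"
      using norm_cis_taylor[of "- (x \<bullet> \<xi>)" "- (x \<bullet> h)"] by (simp only: norm_mult) (intro mult_right_mono, auto)
    also have "\<dots> \<le> ((norm x * norm h)\<^sup>2) * norm (f x)"
    proof (rule mult_right_mono)
      have "\<bar>x \<bullet> h\<bar>\<^sup>2 \<le> (norm x * norm h)\<^sup>2"
        by (intro power_mono Cauchy_Schwarz_ineq2) simp
      hence "(x \<bullet> h)\<^sup>2 \<le> (norm x * norm h)\<^sup>2" by simp
      thus "(- (x \<bullet> h))\<^sup>2 / 2 \<le> (norm x * norm h)\<^sup>2" using zero_le_power2[of "x \<bullet> h"] by (simp only: power2_minus)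
    qed simp
    finally show "norm (?r x) \<le> (norm h)\<^sup>2 * ((norm x)\<^sup>2 * norm (f x))" by (simp add: power_mult_distrib mult_ac)
  qed
  also have "\<dots> = ?I * (norm h)\<^sup>2" by simp
  finally have "norm (LINT x|lborel. ?r x) \<le> ?I * (norm h)\<^sup>2" .
  hence "fourier_const TYPE('a) * norm (LINT x|lborel. ?r x) \<le> fourier_const TYPE('a) * (?I * (norm h)\<^sup>2)"
    using fourier_const_pos[where 'a='a] by (intro mult_left_mono) auto
  thus ?thesis unfolding eq mult.assoc .
qed

lemma fourier_has_derivative:
  fixes f :: "'a::euclidean_space \<Rightarrow> complex"
  assumes f: "f \<in> schwartz"
  shows "(fourier f has_derivative (\<lambda>h. fourier (\<lambda>x. - \<i> * (complex_of_real (x \<bullet> h) * f x)) \<xi>)) (at \<xi>)"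
proof (rule has_derivative_quadratic_bound[OF _ fourier_taylor[OF f]])
  let ?D = "\<lambda>h. fourier (\<lambda>x. - \<i> * (complex_of_real (x \<bullet> h) * f x)) \<xi>"
  have sc: "(\<lambda>x. - \<i> * (complex_of_real (x \<bullet> h) * f x)) \<in> schwartz" for h
    by (intro schwartz_cmult schwartz_coord f)
  show "linear ?D"
  proof (rule linearI)
    fix h k
    have "(\<lambda>x. - \<i> * (complex_of_real (x \<bullet> (h + k)) * f x)) =
      (\<lambda>x. - \<i> * (complex_of_real (x \<bullet> h) * f x) + - \<i> * (complex_of_real (x \<bullet> k) * f x))"
      by (simp add: inner_add_right algebra_simps fun_eq_iff)
    thus "?D (h + k) = ?D h + ?D k"
      using fourier_add[OF schwartz_integrable[OF sc[of h]] schwartz_integrable[OF sc[of k]]] by simp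
  next
    fix r :: real and h
    have "(\<lambda>x. - \<i> * (complex_of_real (x \<bullet> (r *\<^sub>R h)) * f x)) = (\<lambda>x. r *\<^sub>R (- \<i> * (complex_of_real (x \<bullet> h) * f x)))"
      by (simp add: scaleR_conv_of_real mult_ac fun_eq_iff)
    thus "?D (r *\<^sub>R h) = r *\<^sub>R ?D h" by (simp only: fourier_scaleR)
  qed
qed

lemma fourier_partial_deriv_coord:
  "f \<in> schwartz \<Longrightarrow> partial_deriv b (fourier f) = fourier (\<lambda>x. - \<i> * (complex_of_real (x \<bullet> b) * f x))"
  by (rule partial_deriv_eqI[OF fourier_has_derivative])

lemma cis_has_derivative:
  "((\<lambda>x. cis (- (x \<bullet> \<xi>))) has_derivative (\<lambda>h. - \<i> * complex_of_real (h \<bullet> \<xi>) * cis (- (x \<bullet> \<xi>)))) (at x)"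
proof -
  have "((\<lambda>x. - (\<i> * complex_of_real (x \<bullet> \<xi>))) has_derivative (\<lambda>h. - (\<i> * complex_of_real (h \<bullet> \<xi>)))) (at x)"
    by (auto intro!: derivative_eq_intros)
  from has_derivative_compose[OF this DERIV_exp[unfolded has_field_derivative_def]]
  show ?thesis by (simp add: cis_conv_exp mult_ac)
qed

lemma slow_cis: "(\<lambda>x. cis (- (x \<bullet> \<xi>))) \<in> slow"
proof (rule slow_coinduct[where S="range (\<lambda>k x. k * cis (- (x \<bullet> \<xi>)))"])
  show "(\<lambda>x. cis (- (x \<bullet> \<xi>))) \<in> range (\<lambda>k x. k * cis (- (x \<bullet> \<xi>)))"
    by (rule range_eqI[of _ _ 1]) simp
  have d: "((\<lambda>x. k * cis (- (x \<bullet> \<xi>))) has_derivative (\<lambda>h. k * (- \<i> * complex_of_real (h \<bullet> \<xi>)) * cis (- (x \<bullet> \<xi>)))) (at x)" for k x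
    using has_derivative_mult_right[OF cis_has_derivative[of \<xi> x], of k] by (simp add: mult_ac)
  fix g assume "g \<in> range (\<lambda>k x. k * cis (- (x \<bullet> \<xi>)))"
  then obtain k where k: "g = (\<lambda>x. k * cis (- (x \<bullet> \<xi>)))" by blast
  show "g differentiable (at x)" for x unfolding k using d differentiable_def by blast
  show "partial_deriv b g \<in> range (\<lambda>k x. k * cis (- (x \<bullet> \<xi>)))" for b
    unfolding k partial_deriv_eqI[OF d] by blast
  have "norm (g x) \<le> norm k * (1 + norm x) ^ 0" for x unfolding k by (simp add: norm_mult)
  thus "\<exists>N C. \<forall>x. norm (g x) \<le> C * (1 + norm x) ^ N" by blast
qed

lemma partial_deriv_cis: "partial_deriv b (\<lambda>x. cis (- (x \<bullet> \<xi>))) = (\<lambda>x. (- \<i> * complex_of_real (b \<bullet> \<xi>)) * cis (- (x \<bullet> \<xi>)))"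
  by (rule partial_deriv_eqI[OF cis_has_derivative])

lemma fourier_of_partial_deriv:
  assumes f: "f \<in> schwartz" and b: "b \<in> Basis"
  shows "fourier (partial_deriv b f) \<xi> = \<i> * complex_of_real (\<xi> \<bullet> b) * fourier f \<xi>"
proof -
  have "(LINT x|lborel. (- \<i> * complex_of_real (b \<bullet> \<xi>)) * cis (- (x \<bullet> \<xi>)) * f x) =
    - (LINT x|lborel. cis (- (x \<bullet> \<xi>)) * partial_deriv b f x)"
    using integral_by_parts[OF slow_cis[of \<xi>] f b] unfolding partial_deriv_cis .
  hence "(LINT x|lborel. cis (- (x \<bullet> \<xi>)) * partial_deriv b f x) =
    - (LINT x|lborel. (- \<i> * complex_of_real (b \<bullet> \<xi>)) * cis (- (x \<bullet> \<xi>)) * f x)" by simp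
  also have "\<dots> = \<i> * complex_of_real (b \<bullet> \<xi>) * (LINT x|lborel. cis (- (x \<bullet> \<xi>)) * f x)"
    by (simp add: mult.assoc)
  finally show ?thesis by (simp add: fourier_eq inner_commute)
qed

text \<open>Multiplication by a coordinate becomes differentiation before the transform. A transform of an integrable
  function is bounded, so this is the source of the decay of Fourier transforms.\<close>

lemma fourier_coord_power:
  assumes "f \<in> schwartz" "b \<in> Basis"
  shows "\<exists>g\<in>schwartz. \<forall>\<xi>. complex_of_real (\<xi> \<bullet> b) ^ k * fourier f \<xi> = fourier g \<xi>"
  using assms(1)
proof (induction k arbitrary: f)
  case (Suc k)
  have m: "(\<lambda>x. - \<i> * partial_deriv b f x) \<in> schwartz"
    using schwartz_cmult schwartz_partial_deriv Suc assms by blast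
  from Suc.IH[OF m] obtain g where g: "g \<in> schwartz"
    "\<And>\<xi>. complex_of_real (\<xi> \<bullet> b) ^ k * fourier (\<lambda>x. - \<i> * partial_deriv b f x) \<xi> = fourier g \<xi>" by blast
  have "complex_of_real (\<xi> \<bullet> b) ^ Suc k * fourier f \<xi> = fourier g \<xi>" for \<xi>
    unfolding g(2)[symmetric] fourier_cmult fourier_of_partial_deriv[OF Suc.prems assms(2)]
    by (simp add: algebra_simps)
  thus ?case using g by blast
qed auto

lemma power_sum_le:
  fixes a :: "'i \<Rightarrow> real"
  assumes "finite A" "\<And>i. i \<in> A \<Longrightarrow> 0 \<le> a i"
  shows "(1 + (\<Sum>i\<in>A. a i)) ^ N \<le> (1 + card A) ^ N * (1 + (\<Sum>i\<in>A. a i ^ N))"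
proof -
  define M where "M = Max (insert 1 (a ` A))"
  have M: "1 \<le> M" "\<And>i. i \<in> A \<Longrightarrow> a i \<le> M" using assms by (auto simp: M_def)
  have "(\<Sum>i\<in>A. a i) \<le> card A * M" using M sum_bounded_above[of A a M] by auto
  hence "1 + (\<Sum>i\<in>A. a i) \<le> (1 + card A) * M" using M by (simp add: algebra_simps)
  hence "(1 + (\<Sum>i\<in>A. a i)) ^ N \<le> ((1 + card A) * M) ^ N"
    by (intro power_mono) (auto simp: add_nonneg_nonneg sum_nonneg assms)
  also have "\<dots> = (1 + card A) ^ N * M ^ N" by (simp add: power_mult_distrib)
  also have "M ^ N \<le> 1 + (\<Sum>i\<in>A. a i ^ N)"
  proof -
    have "M \<in> insert 1 (a ` A)" unfolding M_def using assms by (intro Max_in) auto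
    moreover have "a i ^ N \<le> (\<Sum>i\<in>A. a i ^ N)" if "i \<in> A" for i
      using assms that by (intro member_le_sum) auto
    moreover have "0 \<le> (\<Sum>i\<in>A. a i ^ N)" using assms by (intro sum_nonneg) auto
    ultimately show ?thesis by fastforce
  qed
  finally show ?thesis by (simp add: mult_left_mono)
qed

lemma decay_coordI:
  fixes f :: "'a::euclidean_space \<Rightarrow> complex"
  assumes "\<And>b k. b \<in> Basis \<Longrightarrow> \<exists>C. \<forall>x. \<bar>x \<bullet> b\<bar> ^ k * norm (f x) \<le> C"
  shows "decay f"
  unfolding decay_def
proof
  fix N
  obtain C where C: "\<And>b x. b \<in> Basis \<Longrightarrow> \<bar>x \<bullet> b\<bar> ^ N * norm (f x) \<le> C b"
    using assms[of _ N] by metis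
  obtain b0 :: 'a where "b0 \<in> Basis" using nonempty_Basis by blast
  then obtain C0 where C0: "\<And>x. norm (f x) \<le> C0" using assms[of b0 0] by auto
  let ?K = "(1 + real DIM('a)) ^ N"
  have "(1 + norm x) ^ N * norm (f x) \<le> ?K * (C0 + (\<Sum>b\<in>Basis. C b))" for x :: 'a
  proof -
    have "(1 + norm x) ^ N \<le> (1 + (\<Sum>b\<in>Basis. \<bar>x \<bullet> b\<bar>)) ^ N"
      using norm_le_l1[of x] by (intro power_mono) auto
    also have "\<dots> \<le> ?K * (1 + (\<Sum>b\<in>Basis. \<bar>x \<bullet> b\<bar> ^ N))"
      using power_sum_le[of "Basis::'a set" "\<lambda>b. \<bar>x \<bullet> b\<bar>" N] by simp
    finally have "(1 + norm x) ^ N * norm (f x) \<le> ?K * (1 + (\<Sum>b\<in>Basis. \<bar>x \<bullet> b\<bar> ^ N)) * norm (f x)"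
      by (rule mult_right_mono) simp
    also have "\<dots> = ?K * (norm (f x) + (\<Sum>b\<in>Basis. \<bar>x \<bullet> b\<bar> ^ N * norm (f x)))"
      by (simp add: sum_distrib_right distrib_right mult.assoc)
    also have "\<dots> \<le> ?K * (C0 + (\<Sum>b\<in>Basis. C b))"
      by (intro mult_left_mono add_mono C0 sum_mono C) auto
    finally show ?thesis .
  qed
  thus "\<exists>C. \<forall>x. (1 + norm x) ^ N * norm (f x) \<le> C" by blast
qed

lemma schwartz_fourier:
  fixes f :: "'a::euclidean_space \<Rightarrow> complex"
  assumes "f \<in> schwartz" shows "fourier f \<in> schwartz"
proof (rule schwartz_coinduct[where S="fourier ` schwartz"])
  fix g assume "g \<in> fourier ` (schwartz :: ('a \<Rightarrow> complex) set)"
  then obtain f where f: "f \<in> schwartz" "g = fourier f" by blast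
  show "g differentiable (at x)" for x using fourier_has_derivative[OF f(1)] f(2) differentiable_def by blast
  have "(\<lambda>x. - \<i> * (complex_of_real (x \<bullet> b) * f x)) \<in> schwartz" for b
    by (intro schwartz_cmult schwartz_coord f)
  thus "partial_deriv b g \<in> fourier ` schwartz" for b
    unfolding f(2) fourier_partial_deriv_coord[OF f(1)] by blast
  show "decay g"
  proof (rule decay_coordI)
    fix b :: 'a and k assume "b \<in> Basis"
    from fourier_coord_power[OF f(1) this, of k] obtain h where h: "h \<in> schwartz"
      "\<And>\<xi>. complex_of_real (\<xi> \<bullet> b) ^ k * fourier f \<xi> = fourier h \<xi>" by blast
    have "\<bar>\<xi> \<bullet> b\<bar> ^ k * norm (g \<xi>) \<le> fourier_const TYPE('a) * (LINT x|lborel. norm (h x))" for \<xi>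
      using norm_fourier_le[of h \<xi>] unfolding f(2) h(2)[symmetric] by (simp add: norm_mult norm_power)
    thus "\<exists>C. \<forall>x. \<bar>x \<bullet> b\<bar> ^ k * norm (g x) \<le> C" by blast
  qed
qed (use assms in blast)

lemma schwartz_inv_fourier:
  assumes "f \<in> schwartz" shows "inv_fourier f \<in> schwartz"
proof -
  have "inv_fourier f = (\<lambda>x. fourier f ((-1) *\<^sub>R x + 0))" by (simp add: inv_fourier_eq fun_eq_iff)
  thus ?thesis using schwartz_affine[OF schwartz_fourier[OF assms], of "-1" 0] by simp
qed

subsection \<open>Inversion\<close>

definition gaussian :: "'a::euclidean_space \<Rightarrow> complex" where
  "gaussian x = complex_of_real (exp (- (norm x)\<^sup>2 / 2))"

lemma gaussian_integral_1D:
  "integrable lborel (\<lambda>t::real. cis (- (t * x)) * complex_of_real (exp (- t\<^sup>2 / 2)))"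
  "(LINT t|lborel. cis (- (t * x)) * complex_of_real (exp (- t\<^sup>2 / 2))) = sqrt (2 * pi) * exp (- x\<^sup>2 / 2)"
proof -
  have sd: "exp (- t\<^sup>2 / 2) = sqrt (2 * pi) * std_normal_density t" for t :: real
    unfolding std_normal_density_def by simp
  have "integrable lborel std_normal_density" by (rule integrable_normal_density) simp
  hence "integrable lborel (\<lambda>t::real. exp (- t\<^sup>2 / 2))"
    unfolding sd by (rule integrable_mult_right)
  hence "integrable lborel (\<lambda>t::real. complex_of_real (exp (- t\<^sup>2 / 2)))"
    by (rule integrable_of_real)
  thus "integrable lborel (\<lambda>t::real. cis (- (t * x)) * complex_of_real (exp (- t\<^sup>2 / 2)))"
    by (rule integrable_cis_mult) simp
  have "complex_of_real (exp (- x\<^sup>2 / 2)) = char std_normal_distribution (- x)"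
    by (simp add: char_std_normal_distribution)
  also have "\<dots> = (LINT t|lborel. std_normal_density t *\<^sub>R iexp (- x * t))"
    unfolding char_def by (subst integral_density) auto
  also have "\<dots> = (LINT t|lborel. (1 / sqrt (2 * pi)) *\<^sub>R (cis (- (t * x)) * complex_of_real (exp (- t\<^sup>2 / 2))))"
    by (intro Bochner_Integration.integral_cong refl)
      (simp add: std_normal_density_def cis_conv_exp scaleR_conv_of_real mult_ac)
  finally show "(LINT t|lborel. cis (- (t * x)) * complex_of_real (exp (- t\<^sup>2 / 2))) = sqrt (2 * pi) * exp (- x\<^sup>2 / 2)"
    by (simp add: scaleR_conv_of_real field_simps)
qed

text \<open>Both the Gaussian and the character factor over the coordinates, and in one dimension the
  claim is the formula for the characteristic function of the normal distribution.\<close>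

lemma gaussian_integrable_fourier:
  fixes \<xi> :: "'a::euclidean_space"
  shows "integrable lborel (gaussian :: 'a \<Rightarrow> complex)" "fourier gaussian \<xi> = gaussian \<xi>"
proof -
  interpret p: product_sigma_finite "\<lambda>_::'a. lborel :: real measure" ..
  let ?g = "\<lambda>\<xi> (b::'a) t. cis (- (t * (\<xi> \<bullet> b))) * complex_of_real (exp (- t\<^sup>2 / 2))"
  have pr: "cis (- (x \<bullet> \<xi>)) * gaussian x = (\<Prod>b\<in>Basis. ?g \<xi> b (x \<bullet> b))" for x \<xi> :: 'a
  proof -
    have "(\<Prod>b\<in>Basis. ?g \<xi> b (x \<bullet> b)) =
      (\<Prod>b\<in>Basis. exp (\<i> * complex_of_real (- ((x \<bullet> b) * (\<xi> \<bullet> b))) + complex_of_real (- (x \<bullet> b)\<^sup>2 / 2)))"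
      by (simp only: exp_add cis_conv_exp exp_of_real)
    also have "\<dots> = exp (\<i> * complex_of_real (\<Sum>b\<in>Basis. - ((x \<bullet> b) * (\<xi> \<bullet> b))) + complex_of_real (\<Sum>b\<in>Basis. - (x \<bullet> b)\<^sup>2 / 2))"
      by (simp only: exp_sum[symmetric] finite_Basis sum.distrib sum_distrib_left of_real_sum)
    also have "(\<Sum>b\<in>Basis. - ((x \<bullet> b) * (\<xi> \<bullet> b))) = - (x \<bullet> \<xi>)"
      by (simp only: sum_negf euclidean_inner[of x \<xi>])
    also have "(\<Sum>b\<in>Basis. - (x \<bullet> b)\<^sup>2 / 2) = - (norm x)\<^sup>2 / 2"
    proof -
      have "(norm x)\<^sup>2 = (\<Sum>b\<in>Basis. (x \<bullet> b)\<^sup>2)"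
        unfolding power2_norm_eq_inner by (subst euclidean_inner) (simp add: power2_eq_square)
      thus ?thesis by (simp add: sum_negf sum_divide_distrib)
    qed
    finally show ?thesis by (simp only: gaussian_def exp_add cis_conv_exp exp_of_real)
  qed
  have [measurable]: "(gaussian :: 'a \<Rightarrow> complex) \<in> borel_measurable borel" unfolding gaussian_def by measurable
  have rep: "(\<Sum>b'\<in>Basis. f b' *\<^sub>R b') \<bullet> b = f b" if "b \<in> Basis" for f and b :: 'a
    using that by simp
  have int: "integrable (Pi\<^sub>M Basis (\<lambda>_. lborel)) (\<lambda>f. \<Prod>b\<in>Basis. ?g \<xi> b (f b))" for \<xi>
    by (intro p.product_integrable_prod gaussian_integral_1D) simp
  have m: "(\<lambda>f. \<Sum>b\<in>Basis. f b *\<^sub>R b) \<in> Pi\<^sub>M Basis (\<lambda>_::'a. lborel) \<rightarrow>\<^sub>M borel" by measurable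
  have int2: "integrable lborel (\<lambda>x. cis (- (x \<bullet> \<xi>)) * gaussian x)" for \<xi> :: 'a
    unfolding pr by (subst lborel_eq, subst integrable_distr_eq[OF m]) (use int in \<open>simp_all add: rep cong: prod.cong\<close>)
  show "integrable lborel (gaussian :: 'a \<Rightarrow> complex)" using int2[of 0] by simp
  have "(LINT x|lborel. cis (- (x \<bullet> \<xi>)) * gaussian x) = integral\<^sup>L (Pi\<^sub>M Basis (\<lambda>_. lborel)) (\<lambda>f. \<Prod>b\<in>Basis. ?g \<xi> b (f b))"
    unfolding pr by (subst lborel_eq, subst integral_distr[OF m]) (simp_all add: rep cong: prod.cong)
  also have "\<dots> = (\<Prod>b\<in>Basis. LINT t|lborel. ?g \<xi> b t)"
    by (rule p.product_integral_prod[OF finite_Basis gaussian_integral_1D(1)])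
  also have "\<dots> = sqrt (2 * pi) ^ DIM('a) * (\<Prod>b\<in>Basis. complex_of_real (exp (- (\<xi> \<bullet> b)\<^sup>2 / 2)))"
    unfolding gaussian_integral_1D(2) by (simp add: prod.distrib)
  also have "(\<Prod>b\<in>Basis. complex_of_real (exp (- (\<xi> \<bullet> b)\<^sup>2 / 2))) = gaussian \<xi>"
    using pr[of \<xi> 0] by simp
  finally have *: "(LINT x|lborel. cis (- (x \<bullet> \<xi>)) * gaussian x) = complex_of_real (sqrt (2 * pi) ^ DIM('a)) * gaussian \<xi>" by simp
  have "sqrt (2 * pi) ^ DIM('a) = (2 * pi) powr (real DIM('a) / 2)"
    by (simp add: powr_half_sqrt[symmetric] powr_powr flip: powr_realpow)
  hence "fourier_const TYPE('a) * sqrt (2 * pi) ^ DIM('a) = 1"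
    by (simp add: fourier_const_def powr_minus field_simps)
  hence "complex_of_real (fourier_const TYPE('a)) * complex_of_real (sqrt (2 * pi) ^ DIM('a)) = 1"
    by (metis of_real_1 of_real_mult)
  thus "fourier gaussian \<xi> = gaussian \<xi>"
    unfolding fourier_eq * scaleR_conv_of_real mult.assoc[symmetric] by simp
qed

text \<open>Fubini is not applicable to the double integral, so the integrand is damped by the dilated Gaussian \<open>gaussian (\<epsilon> *\<^sub>R \<xi>)\<close>. For it
  the multiplication formula moves the transform over to the damping factor, whose transform is a Gaussian concentrated
  near \<open>x\<close>; both sides converge as \<open>\<epsilon>\<close> tends to 0.\<close>

lemma inv_fourier_fourier:
  fixes f :: "'a::euclidean_space \<Rightarrow> complex"
  assumes f: "f \<in> schwartz"
  shows "inv_fourier (fourier f) x = f x"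
proof -
  let ?c = "fourier_const TYPE('a)"
  let ?e = "\<lambda>n. 1 / real (Suc n)"
  let ?h = "\<lambda>n \<xi>. cis (x \<bullet> \<xi>) * gaussian (?e n *\<^sub>R \<xi>)"
  have fm[measurable]: "f \<in> borel_measurable borel" using schwartz_measurable f by blast
  have Fm[measurable]: "fourier f \<in> borel_measurable borel" using schwartz_measurable schwartz_fourier f by blast
  have gm[measurable]: "(gaussian :: 'a \<Rightarrow> complex) \<in> borel_measurable borel" unfolding gaussian_def by measurable
  have gb: "norm (gaussian y) \<le> 1" for y :: 'a unfolding gaussian_def by simp
  have gc: "(\<lambda>n. gaussian (?e n *\<^sub>R y)) \<longlonglongrightarrow> 1" for y :: 'a
  proof -
    have "?e \<longlonglongrightarrow> 0" using LIMSEQ_Suc[OF lim_1_over_n] by simp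
    hence "(\<lambda>n. complex_of_real (exp (- (norm (?e n *\<^sub>R y))\<^sup>2 / 2))) \<longlonglongrightarrow> complex_of_real (exp (- (norm (0 *\<^sub>R y))\<^sup>2 / 2))"
      by (intro tendsto_intros) auto
    thus ?thesis by (simp add: gaussian_def)
  qed
  have ig: "integrable lborel (\<lambda>\<xi>::'a. gaussian (c *\<^sub>R \<xi>))" if "c \<noteq> 0" for c
  proof -
    have "integrable (density (distr lborel borel (\<lambda>x::'a. 0 + c *\<^sub>R x)) (\<lambda>_. \<bar>c\<bar>^DIM('a))) (gaussian :: 'a \<Rightarrow> complex)"
      using gaussian_integrable_fourier(1)[where 'a='a] lborel_affine[OF that, of "0::'a"] by simp
    hence "integrable lborel (\<lambda>x::'a. \<bar>c\<bar>^DIM('a) *\<^sub>R gaussian (c *\<^sub>R x))"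
      by (subst (asm) integrable_density) (auto simp: integrable_distr_eq)
    from integrable_scaleR_right[OF this, of "inverse (\<bar>c\<bar>^DIM('a))"] show ?thesis using that by simp
  qed
  have "(\<lambda>n. LINT \<xi>|lborel. fourier f \<xi> * ?h n \<xi>) \<longlonglongrightarrow> (LINT \<xi>|lborel. fourier f \<xi> * (cis (x \<bullet> \<xi>) * 1))"
  proof (rule integral_dominated_convergence)
    show "integrable lborel (\<lambda>\<xi>. norm (fourier f \<xi>))"
      using schwartz_integrable schwartz_fourier f by (intro integrable_norm) blast
    show "AE \<xi> in lborel. (\<lambda>n. fourier f \<xi> * ?h n \<xi>) \<longlonglongrightarrow> fourier f \<xi> * (cis (x \<bullet> \<xi>) * 1)"
      by (intro AE_I2 tendsto_intros gc)
    show "AE \<xi> in lborel. norm (fourier f \<xi> * ?h n \<xi>) \<le> norm (fourier f \<xi>)" for n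
      using gb by (intro AE_I2) (simp add: norm_mult mult_left_le)
  qed measurable
  moreover have "(LINT \<xi>|lborel. fourier f \<xi> * ?h n \<xi>) = (LINT y|lborel. f (x + ?e n *\<^sub>R y) * gaussian y)" for n
  proof -
    let ?E = "?e n"
    have E: "?E \<noteq> 0" by simp
    have ih: "integrable lborel (?h n)" by (intro integrable_cis_mult ig E) simp
    have "fourier (?h n) y = inverse (?E ^ DIM('a)) *\<^sub>R gaussian (inverse ?E *\<^sub>R (y - x))" for y
    proof -
      have "fourier (gaussian :: 'a \<Rightarrow> complex) (inverse ?E *\<^sub>R (y - x)) =
         ?c *\<^sub>R (LINT \<xi>|lborel. cis (- (\<xi> \<bullet> (inverse ?E *\<^sub>R (y - x)))) * gaussian \<xi>)" by (rule fourier_eq)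
      also have "(LINT \<xi>|lborel. cis (- (\<xi> \<bullet> (inverse ?E *\<^sub>R (y - x)))) * gaussian \<xi>) =
         \<bar>?E\<bar> ^ DIM('a) *\<^sub>R (LINT \<xi>|lborel. cis (- ((0 + ?E *\<^sub>R \<xi>) \<bullet> (inverse ?E *\<^sub>R (y - x)))) * gaussian (0 + ?E *\<^sub>R \<xi>))"
        by (rule integral_affine[OF _ E]) measurable
      also have "(LINT \<xi>|lborel. cis (- ((0 + ?E *\<^sub>R \<xi>) \<bullet> (inverse ?E *\<^sub>R (y - x)))) * gaussian (0 + ?E *\<^sub>R \<xi>)) =
         (LINT \<xi>|lborel. cis (- (\<xi> \<bullet> y)) * ?h n \<xi>)"
        using E by (intro Bochner_Integration.integral_cong refl)
          (simp add: mult.assoc[symmetric] cis_mult inner_diff_right inner_commute del: of_nat_Suc)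
      finally have "gaussian (inverse ?E *\<^sub>R (y - x)) = \<bar>?E\<bar> ^ DIM('a) *\<^sub>R fourier (?h n) y"
        unfolding gaussian_integrable_fourier(2) fourier_eq[of "?h n"] by (simp add: scaleR_left_commute)
      thus ?thesis using E by (simp del: of_nat_Suc)
    qed
    hence "(LINT \<xi>|lborel. fourier f \<xi> * ?h n \<xi>) =
      (LINT y|lborel. f y * (inverse (?E ^ DIM('a)) *\<^sub>R gaussian (inverse ?E *\<^sub>R (y - x))))"
      using fourier_multiplication_formula[OF schwartz_integrable[OF f] ih] by (simp del: of_nat_Suc)
    also have "\<dots> = \<bar>?E\<bar> ^ DIM('a) *\<^sub>R (LINT y|lborel. f (x + ?E *\<^sub>R y) *
        (inverse (?E ^ DIM('a)) *\<^sub>R gaussian (inverse ?E *\<^sub>R (x + ?E *\<^sub>R y - x))))"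
      by (rule integral_affine[OF _ E]) measurable
    also have "\<dots> = (LINT y|lborel. f (x + ?E *\<^sub>R y) * gaussian y)"
      using E by (simp add: mult_scaleR_right del: of_nat_Suc)
    finally show ?thesis .
  qed
  ultimately have l1: "(\<lambda>n. LINT y|lborel. f (x + ?e n *\<^sub>R y) * gaussian y) \<longlonglongrightarrow> (LINT \<xi>|lborel. cis (x \<bullet> \<xi>) * fourier f \<xi>)"
    by (simp add: mult.commute)
  obtain C where C: "\<And>y. norm (f y) \<le> C" using schwartz_bounded[OF f] by blast
  have "(\<lambda>n. LINT y|lborel. f (x + ?e n *\<^sub>R y) * gaussian y) \<longlonglongrightarrow> (LINT y::'a|lborel. f x * gaussian y)"
  proof (rule integral_dominated_convergence[where f="\<lambda>y. f x * gaussian y"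
        and s="\<lambda>n y. f (x + ?e n *\<^sub>R y) * gaussian y" and w="\<lambda>y. C * norm (gaussian y)"])
    show "integrable lborel (\<lambda>y::'a. C * norm (gaussian y))"
      using gaussian_integrable_fourier(1) by (intro integrable_mult_right integrable_norm)
    show "AE y in lborel. (\<lambda>n. f (x + ?e n *\<^sub>R y) * gaussian y) \<longlonglongrightarrow> f x * gaussian y"
    proof (intro AE_I2 tendsto_intros)
      fix y
      have "?e \<longlonglongrightarrow> 0" using LIMSEQ_Suc[OF lim_1_over_n] by simp
      hence "(\<lambda>n. x + ?e n *\<^sub>R y) \<longlonglongrightarrow> x + 0 *\<^sub>R y" by (intro tendsto_intros)
      moreover have "isCont f x" using smooth_continuous_on[OF schwartz_smooth[OF f], of UNIV] by (simp add: continuous_on_eq_continuous_at)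
      ultimately show "(\<lambda>n. f (x + ?e n *\<^sub>R y)) \<longlonglongrightarrow> f x" using isCont_tendsto_compose by fastforce
    qed
    show "AE y in lborel. norm (f (x + ?e n *\<^sub>R y) * gaussian y) \<le> C * norm (gaussian y)" for n
      using C by (intro AE_I2) (simp add: norm_mult mult_right_mono)
  qed measurable
  hence A: "(LINT \<xi>|lborel. cis (x \<bullet> \<xi>) * fourier f \<xi>) = f x * (LINT y::'a|lborel. gaussian y)"
    using LIMSEQ_unique[OF l1] by simp
  have B: "?c *\<^sub>R (LINT y::'a|lborel. gaussian y) = 1"
    using gaussian_integrable_fourier(2)[of "0::'a"] unfolding fourier_eq by (simp add: gaussian_def)
  have "inv_fourier (fourier f) x = ?c *\<^sub>R (f x * (LINT y::'a|lborel. gaussian y))"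
    unfolding A[symmetric] by (simp add: inv_fourier_def fourier_const_def)
  also have "\<dots> = f x * (?c *\<^sub>R (LINT y::'a|lborel. gaussian y))" by simp
  finally show ?thesis unfolding B by simp
qed

lemma fourier_inv_fourier:
  assumes f: "f \<in> schwartz" shows "fourier (inv_fourier f) x = f x"
proof -
  have m: "f \<in> borel_measurable borel" using schwartz_measurable f by blast
  have s: "(\<lambda>x. f (- x)) \<in> schwartz" using schwartz_affine[OF f, of "-1" 0] by simp
  have "inv_fourier f = fourier (\<lambda>x. f (- x))"
    by (simp add: fun_eq_iff inv_fourier_eq fourier_reflect[OF m])
  moreover have "fourier (fourier (\<lambda>x. f (- x))) x = f x"
    using inv_fourier_fourier[OF s, of "- x"] by (simp add: inv_fourier_eq)
  ultimately show ?thesis by simp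
qed

lemma parseval:
  assumes f: "f \<in> schwartz" and g: "g \<in> schwartz"
  shows "(LINT \<xi>|lborel. fourier f \<xi> * inv_fourier g \<xi>) = (LINT x|lborel. f x * g x)"
  using fourier_multiplication_formula[OF schwartz_integrable[OF f] schwartz_integrable[OF schwartz_inv_fourier[OF g]]]
  by (simp add: fourier_inv_fourier[OF g])

lemma plancherel:
  assumes f: "f \<in> schwartz"
  shows "(LINT \<xi>|lborel. (norm (fourier f \<xi>))\<^sup>2) = (LINT x|lborel. (norm (f x))\<^sup>2)"
proof -
  have "complex_of_real (LINT \<xi>|lborel. (norm (fourier f \<xi>))\<^sup>2) = (LINT \<xi>|lborel. fourier f \<xi> * inv_fourier (\<lambda>x. cnj (f x)) \<xi>)"
    by (simp only: cnj_fourier[symmetric] complex_norm_square[symmetric] integral_complex_of_real)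
  also have "\<dots> = (LINT x|lborel. f x * cnj (f x))" by (rule parseval[OF f schwartz_cnj[OF f]])
  also have "\<dots> = complex_of_real (LINT x|lborel. (norm (f x))\<^sup>2)"
    by (simp only: complex_norm_square[symmetric] integral_complex_of_real)
  finally show ?thesis by (simp only: of_real_eq_iff)
qed

section \<open>The Hilbert space of square integrable functions\<close>

text \<open>The real inner product. Representation theorems are proved for real functionals; complex linearity is recovered at the end
  from multiplication by \<open>\<i>\<close>.\<close>

definition l2_inner :: "('a::euclidean_space \<Rightarrow> complex) \<Rightarrow> ('a \<Rightarrow> complex) \<Rightarrow> real" where
  "l2_inner f g = (LINT x|lborel. f x \<bullet> g x)"

lemma L2_iff: "f \<in> L2 \<longleftrightarrow> f \<in> borel_measurable borel \<and> integrable lborel (\<lambda>x. (norm (f x))\<^sup>2)"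
  by (simp add: L2_def)

lemma L2_measurable: "f \<in> L2 \<Longrightarrow> f \<in> borel_measurable borel"
  by (simp add: L2_iff)

lemma L2_integrable: "f \<in> L2 \<Longrightarrow> integrable lborel (\<lambda>x. (norm (f x))\<^sup>2)"
  by (simp add: L2_iff)

lemma L2_bound:
  assumes "f \<in> borel_measurable borel" "integrable lborel g" "\<And>x. (norm (f x))\<^sup>2 \<le> g x"
  shows "f \<in> L2"
  unfolding L2_iff
proof
  note [measurable] = assms(1)
  show "integrable lborel (\<lambda>x. (norm (f x))\<^sup>2)"
  proof (rule Bochner_Integration.integrable_bound[OF assms(2)])
    show "AE x in lborel. norm ((norm (f x))\<^sup>2) \<le> norm (g x)"
      using assms(3) by (intro AE_I2) (simp add: order_trans[OF assms(3)])
  qed measurable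
qed (rule assms)

lemma norm_add_sq_le: "(norm (a + b))\<^sup>2 \<le> 2 * (norm a)\<^sup>2 + 2 * (norm (b::'a::real_normed_vector))\<^sup>2"
proof -
  have "(norm (a + b))\<^sup>2 \<le> (norm a + norm b)\<^sup>2" by (intro power_mono norm_triangle_ineq) simp
  also have "\<dots> \<le> 2 * (norm a)\<^sup>2 + 2 * (norm b)\<^sup>2"
    using sum_squares_bound[of "norm a" "norm b"] by (simp add: power2_sum)
  finally show ?thesis .
qed

lemma L2_add: assumes "f \<in> L2" "g \<in> L2" shows "(\<lambda>x. f x + g x) \<in> L2"
proof (rule L2_bound)
  note [measurable] = assms[THEN L2_measurable]
  show "(\<lambda>x. f x + g x) \<in> borel_measurable borel" by measurable
  show "integrable lborel (\<lambda>x. 2 * (norm (f x))\<^sup>2 + 2 * (norm (g x))\<^sup>2)"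
    using assms[THEN L2_integrable] by simp
qed (rule norm_add_sq_le)

lemma L2_cmult: assumes "f \<in> L2" shows "(\<lambda>x. c * f x) \<in> L2"
  using assms by (auto simp: L2_iff norm_mult power_mult_distrib intro!: borel_measurable_times)

lemma L2_scaleR: "f \<in> L2 \<Longrightarrow> (\<lambda>x. c *\<^sub>R f x) \<in> L2"
  using L2_cmult[of f "complex_of_real c"] by (simp add: scaleR_conv_of_real)

lemma L2_cnj: assumes "f \<in> L2" shows "(\<lambda>x. cnj (f x)) \<in> L2"
proof -
  have "cnj \<in> borel_measurable borel" by (intro borel_measurable_continuous_onI continuous_intros)
  with assms show ?thesis by (simp add: L2_iff measurable_compose[of f borel borel cnj])
qed

lemma L2_diff: "f \<in> L2 \<Longrightarrow> g \<in> L2 \<Longrightarrow> (\<lambda>x. f x - g x) \<in> L2"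
  using L2_add[OF _ L2_cmult[of g "-1"], of f] by simp

lemma L2_norm_nonneg: "0 \<le> L2_norm f"
  by (simp add: L2_norm_def)

lemma L2_norm_sq: "(L2_norm f)\<^sup>2 = (LINT x|lborel. (norm (f x))\<^sup>2)"
  by (simp add: L2_norm_def)

lemma l2_inner_self: "l2_inner f f = (L2_norm f)\<^sup>2"
  by (simp add: l2_inner_def L2_norm_sq power2_norm_eq_inner)

lemma L2_norm_cmult: "L2_norm (\<lambda>x. c * f x) = norm c * L2_norm f"
  by (simp add: L2_norm_def norm_mult power_mult_distrib real_sqrt_mult)

lemma L2_norm_zero: "L2_norm (\<lambda>x. 0) = 0"
  by (simp add: L2_norm_def)

lemma L2_norm_cnj: "L2_norm (\<lambda>x. cnj (f x)) = L2_norm f"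
  by (simp add: L2_norm_def)

lemma L2_norm_minus_commute: "L2_norm (\<lambda>x. f x - g x) = L2_norm (\<lambda>x. g x - f x)"
  by (simp add: L2_norm_def norm_minus_commute)

lemma L2_norm_mult_integrable:
  assumes "f \<in> L2" "g \<in> L2" shows "integrable lborel (\<lambda>x. norm (f x) * norm (g x))"
proof (rule Bochner_Integration.integrable_bound)
  note [measurable] = assms[THEN L2_measurable]
  show "integrable lborel (\<lambda>x. (norm (f x))\<^sup>2 + (norm (g x))\<^sup>2)"
    using assms[THEN L2_integrable] by simp
  show "(\<lambda>x. norm (f x) * norm (g x)) \<in> borel_measurable lborel" by measurable
  have "norm (f x) * norm (g x) \<le> (norm (f x))\<^sup>2 + (norm (g x))\<^sup>2" for x
    using sum_squares_bound[of "norm (f x)" "norm (g x)"] mult_nonneg_nonneg[OF norm_ge_zero norm_ge_zero, of "f x" "g x"]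
    by linarith
  thus "AE x in lborel. norm (norm (f x) * norm (g x)) \<le> norm ((norm (f x))\<^sup>2 + (norm (g x))\<^sup>2)"
    by (intro AE_I2) simp
qed

lemma L2_mult_integrable:
  assumes "f \<in> L2" "g \<in> L2"
  shows "integrable lborel (\<lambda>x. f x * g x)" "integrable lborel (\<lambda>x. f x \<bullet> g x)"
proof -
  note [measurable] = assms[THEN L2_measurable]
  show "integrable lborel (\<lambda>x. f x * g x)"
    by (rule Bochner_Integration.integrable_bound[OF L2_norm_mult_integrable[OF assms]])
      (simp_all add: norm_mult)
  show "integrable lborel (\<lambda>x. f x \<bullet> g x)"
    by (rule Bochner_Integration.integrable_bound[OF L2_norm_mult_integrable[OF assms]])
      (simp_all add: Cauchy_Schwarz_ineq2)
qed

lemma L2_Cauchy_Schwarz: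
  assumes "f \<in> L2" "g \<in> L2"
  shows "(LINT x|lborel. norm (f x) * norm (g x)) \<le> L2_norm f * L2_norm g"
proof (cases "L2_norm f = 0 \<or> L2_norm g = 0")
  case True
  have z: "AE x in lborel. norm (h x) = 0" if "h \<in> L2" "L2_norm h = 0" for h :: "'a \<Rightarrow> complex"
  proof -
    have "(LINT x|lborel. (norm (h x))\<^sup>2) = 0" using L2_norm_sq[of h] that(2) by simp
    hence "AE x in lborel. (norm (h x))\<^sup>2 = 0"
      using integral_nonneg_eq_0_iff_AE[OF L2_integrable[OF that(1)]] by simp
    thus ?thesis by simp
  qed
  from True have "AE x in lborel. norm (f x) * norm (g x) = 0"
    using z[OF assms(1)] z[OF assms(2)] by (elim disjE) auto
  hence "(LINT x|lborel. norm (f x) * norm (g x)) = 0" by (rule integral_eq_zero_AE)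
  thus ?thesis by (simp add: L2_norm_nonneg)
next
  case False
  define a b where "a = L2_norm f" and "b = L2_norm g"
  have ab: "0 < a" "0 < b" using False L2_norm_nonneg[of f] L2_norm_nonneg[of g] by (auto simp: a_def b_def)
  have i: "integrable lborel (\<lambda>x. (b / a) * (norm (f x))\<^sup>2 + (a / b) * (norm (g x))\<^sup>2)"
    using assms[THEN L2_integrable] by simp
  have "2 * (norm (f x) * norm (g x)) \<le> (b / a) * (norm (f x))\<^sup>2 + (a / b) * (norm (g x))\<^sup>2" for x
  proof -
    have "0 \<le> (sqrt (b / a) * norm (f x) - sqrt (a / b) * norm (g x))\<^sup>2" by simp
    also have "\<dots> = (b / a) * (norm (f x))\<^sup>2 + (a / b) * (norm (g x))\<^sup>2 - 2 * (sqrt (b / a) * sqrt (a / b)) * (norm (f x) * norm (g x))"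
      using ab by (simp add: power2_diff power_mult_distrib mult_ac)
    also have "sqrt (b / a) * sqrt (a / b) = 1" using ab by (simp add: real_sqrt_mult[symmetric])
    finally show ?thesis by simp
  qed
  hence "(LINT x|lborel. 2 * (norm (f x) * norm (g x))) \<le> (LINT x|lborel. (b / a) * (norm (f x))\<^sup>2 + (a / b) * (norm (g x))\<^sup>2)"
    by (intro integral_mono i integrable_mult_right L2_norm_mult_integrable assms)
  also have "\<dots> = (b / a) * a\<^sup>2 + (a / b) * b\<^sup>2"
    using assms[THEN L2_integrable] by (simp add: a_def b_def L2_norm_sq)
  also have "\<dots> = 2 * (a * b)" using ab by (simp add: power2_eq_square)
  finally show ?thesis by (simp add: a_def b_def)
qed

lemma norm_integral_mult_le:
  assumes "f \<in> L2" "g \<in> L2"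
  shows "norm (LINT x|lborel. f x * g x) \<le> L2_norm f * L2_norm g"
  using integral_norm_bound[of lborel "\<lambda>x. f x * g x"] L2_Cauchy_Schwarz[OF assms]
  by (simp add: norm_mult)

lemma l2_inner_le:
  assumes "f \<in> L2" "g \<in> L2"
  shows "\<bar>l2_inner f g\<bar> \<le> L2_norm f * L2_norm g"
proof -
  have "\<bar>l2_inner f g\<bar> \<le> (LINT x|lborel. norm (f x \<bullet> g x))"
    using integral_norm_bound[of lborel "\<lambda>x. f x \<bullet> g x"] by (simp add: l2_inner_def)
  also have "\<dots> \<le> (LINT x|lborel. norm (f x) * norm (g x))"
    using L2_mult_integrable(2)[OF assms] L2_norm_mult_integrable[OF assms]
    by (intro integral_mono) (simp_all add: Cauchy_Schwarz_ineq2)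
  finally show ?thesis using L2_Cauchy_Schwarz[OF assms] by simp
qed

lemma l2_inner_add_left:
  "f \<in> L2 \<Longrightarrow> g \<in> L2 \<Longrightarrow> h \<in> L2 \<Longrightarrow> l2_inner (\<lambda>x. f x + g x) h = l2_inner f h + l2_inner g h"
  by (simp add: l2_inner_def inner_add_left L2_mult_integrable)

lemma l2_inner_diff_left:
  "f \<in> L2 \<Longrightarrow> g \<in> L2 \<Longrightarrow> h \<in> L2 \<Longrightarrow> l2_inner (\<lambda>x. f x - g x) h = l2_inner f h - l2_inner g h"
  by (simp add: l2_inner_def inner_diff_left L2_mult_integrable)

lemma l2_inner_commute: "l2_inner f g = l2_inner g f"
  by (simp add: l2_inner_def inner_commute)

lemma l2_inner_scaleR_left: "l2_inner (\<lambda>x. c *\<^sub>R f x) g = c * l2_inner f g"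
  by (simp add: l2_inner_def)

lemma L2_norm_scaleR: "L2_norm (\<lambda>x. c *\<^sub>R f x) = \<bar>c\<bar> * L2_norm f"
  using L2_norm_cmult[of "complex_of_real c" f] by (simp add: scaleR_conv_of_real)

lemma L2_norm_add_sq:
  assumes "f \<in> L2" "g \<in> L2"
  shows "(L2_norm (\<lambda>x. f x + g x))\<^sup>2 = (L2_norm f)\<^sup>2 + 2 * l2_inner f g + (L2_norm g)\<^sup>2"
proof -
  have "(norm (f x + g x))\<^sup>2 = (norm (f x))\<^sup>2 + 2 * (f x \<bullet> g x) + (norm (g x))\<^sup>2" for x
    by (simp add: power2_norm_eq_inner inner_add_left inner_add_right inner_commute)
  thus ?thesis unfolding L2_norm_sq l2_inner_def
    using assms[THEN L2_integrable] L2_mult_integrable(2)[OF assms] by simp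
qed

lemma L2_norm_diff_sq:
  assumes "f \<in> L2" "g \<in> L2"
  shows "(L2_norm (\<lambda>x. f x - g x))\<^sup>2 = (L2_norm f)\<^sup>2 - 2 * l2_inner f g + (L2_norm g)\<^sup>2"
proof -
  have "(norm (f x - g x))\<^sup>2 = (norm (f x))\<^sup>2 - 2 * (f x \<bullet> g x) + (norm (g x))\<^sup>2" for x
    by (simp add: power2_norm_eq_inner inner_diff_left inner_diff_right inner_commute)
  thus ?thesis unfolding L2_norm_sq l2_inner_def
    using assms[THEN L2_integrable] L2_mult_integrable(2)[OF assms] by simp
qed

lemma L2_norm_triangle:
  assumes "f \<in> L2" "g \<in> L2"
  shows "L2_norm (\<lambda>x. f x + g x) \<le> L2_norm f + L2_norm g"
proof (rule power2_le_imp_le)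
  show "(L2_norm (\<lambda>x. f x + g x))\<^sup>2 \<le> (L2_norm f + L2_norm g)\<^sup>2"
    using l2_inner_le[OF assms] unfolding L2_norm_add_sq[OF assms] by (simp add: power2_sum)
qed (simp add: L2_norm_nonneg)

lemma L2_norm_triangle_diff:
  assumes "f \<in> L2" "g \<in> L2"
  shows "L2_norm (\<lambda>x. f x - g x) \<le> L2_norm f + L2_norm g"
  using L2_norm_triangle[OF assms(1) L2_cmult[OF assms(2), of "-1"]] L2_norm_cmult[of "-1" g] by simp

lemma L2_nn_integral:
  assumes "f \<in> L2"
  shows "(\<integral>\<^sup>+x. ennreal ((norm (f x))\<^sup>2) \<partial>lborel) = ennreal ((L2_norm f)\<^sup>2)"
  unfolding L2_norm_sq by (rule nn_integral_eq_integral[OF L2_integrable[OF assms]]) simp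

lemma L2_of_nn_integral:
  assumes [measurable]: "f \<in> borel_measurable borel"
    and le: "(\<integral>\<^sup>+x. ennreal ((norm (f x))\<^sup>2) \<partial>lborel) \<le> ennreal (c\<^sup>2)" and "0 \<le> c"
  shows "f \<in> L2" "L2_norm f \<le> c"
proof -
  have "(\<integral>\<^sup>+x. ennreal (norm ((norm (f x))\<^sup>2)) \<partial>lborel) < \<infinity>"
    using le by (simp add: order_le_less_trans)
  thus L: "f \<in> L2" unfolding L2_iff by (auto intro: integrableI_bounded)
  have "(L2_norm f)\<^sup>2 \<le> c\<^sup>2" using le unfolding L2_nn_integral[OF L] by simp
  thus "L2_norm f \<le> c" using power2_le_imp_le \<open>0 \<le> c\<close> by blast
qed

text \<open>A fast Cauchy subsequence converges almost everywhere: if the \<open>k\<close>-th increment has norm at most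
  \<open>2 ^ (-k)\<close>, then the sum of the squared increments stays integrable even with the weights \<open>2 ^ k\<close>,
  so almost everywhere the increments decay geometrically.\<close>

lemma L2_fast_Cauchy_AE_convergent:
  assumes L: "\<And>k. f k \<in> L2" and le: "\<And>k. L2_norm (\<lambda>x. f (Suc k) x - f k x) \<le> (1 / 2) ^ k"
  shows "AE x in lborel. convergent (\<lambda>k. f k x)"
proof -
  note [measurable] = L[THEN L2_measurable]
  let ?d = "\<lambda>k x. ennreal (2 ^ k * (norm (f (Suc k) x - f k x))\<^sup>2)"
  have "(\<integral>\<^sup>+x. ?d k x \<partial>lborel) \<le> ennreal ((1 / 2) ^ k)" for k
  proof -
    have "(\<integral>\<^sup>+x. ?d k x \<partial>lborel) = (\<integral>\<^sup>+x. ennreal (2 ^ k) * ennreal ((norm (f (Suc k) x - f k x))\<^sup>2) \<partial>lborel)"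
      by (simp add: ennreal_mult)
    also have "\<dots> = ennreal (2 ^ k) * ennreal ((L2_norm (\<lambda>x. f (Suc k) x - f k x))\<^sup>2)"
      by (subst nn_integral_cmult) (simp_all add: L2_nn_integral L2_diff L)
    also have "\<dots> = ennreal (2 ^ k * (L2_norm (\<lambda>x. f (Suc k) x - f k x))\<^sup>2)" by (simp add: ennreal_mult)
    also have "\<dots> \<le> ennreal (2 ^ k * ((1 / 2) ^ k)\<^sup>2)"
      by (intro ennreal_leI mult_left_mono power_mono le) (simp_all add: L2_norm_nonneg)
    also have "2 ^ k * ((1 / 2) ^ k)\<^sup>2 = (1 / 2 :: real) ^ k"
      by (simp add: power2_eq_square power_mult_distrib[symmetric] flip: mult.assoc)
    finally show ?thesis .
  qed
  hence "(\<Sum>k. \<integral>\<^sup>+x. ?d k x \<partial>lborel) \<le> (\<Sum>k. ennreal ((1 / 2) ^ k))"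
    by (intro suminf_le) auto
  also have "\<dots> = ennreal (\<Sum>k. (1 / 2) ^ k)"
    by (intro suminf_ennreal2) (auto simp: summable_geometric)
  also have "\<dots> < \<infinity>" by simp
  finally have "(\<integral>\<^sup>+x. (\<Sum>k. ?d k x) \<partial>lborel) \<noteq> \<infinity>"
    by (subst nn_integral_suminf) auto
  hence "AE x in lborel. (\<Sum>k. ?d k x) \<noteq> \<infinity>" by (intro nn_integral_PInf_AE) auto
  thus ?thesis
  proof (rule AE_mp, intro AE_I2 impI)
    fix x assume fin: "(\<Sum>k. ?d k x) \<noteq> \<infinity>"
    have "\<exists>M. S = ennreal M \<and> 0 \<le> M" if "S \<noteq> \<infinity>" for S :: ennreal using that by (cases S) auto
    from this[OF fin] obtain M where M: "(\<Sum>k. ?d k x) = ennreal M" "0 \<le> M" by blast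
    have B: "norm (f (Suc k) x - f k x) \<le> sqrt M * (sqrt (1 / 2)) ^ k" for k
    proof -
      have "h k \<le> (\<Sum>k. h k)" for h :: "nat \<Rightarrow> ennreal"
        using sum_le_suminf[of h "{k}"] by simp
      from this[of "\<lambda>k. ?d k x"] have "?d k x \<le> (\<Sum>k. ?d k x)" .
      hence "2 ^ k * (norm (f (Suc k) x - f k x))\<^sup>2 \<le> M" unfolding M(1) using M(2) by (simp only: ennreal_le_iff)
      hence "(norm (f (Suc k) x - f k x))\<^sup>2 \<le> M * (1 / 2) ^ k" by (simp add: field_simps)
      hence "sqrt ((norm (f (Suc k) x - f k x))\<^sup>2) \<le> sqrt (M * (1 / 2) ^ k)" by (rule real_sqrt_le_mono)
      thus ?thesis by (simp add: real_sqrt_mult real_sqrt_power)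
    qed
    have "sqrt (1 / 2) < 1" by (rule real_sqrt_lt_1_iff[THEN iffD2]) simp
    hence S: "summable (\<lambda>k. sqrt M * (sqrt (1 / 2)) ^ k)"
      by (intro summable_mult summable_geometric) simp
    have "summable (\<lambda>k. f (Suc k) x - f k x)"
      by (rule summable_comparison_test[OF exI[of _ 0] S]) (use B in blast)
    hence "convergent (\<lambda>n. \<Sum>k<n. f (Suc k) x - f k x)" by (rule summable_iff_convergent[THEN iffD1])
    hence "convergent (\<lambda>n. (\<Sum>k<n. f (Suc k) x - f k x) + f 0 x)"
      by (rule convergent_add[OF _ convergent_const])
    thus "convergent (\<lambda>k. f k x)" using sum_lessThan_telescope[of "\<lambda>k. f k x"] by simp
  qed
qed

text \<open>A subsequence with geometrically decaying increments converges almost everywhere, and Fatou's lemma turns the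
  pointwise limit into a limit in norm.\<close>

lemma L2_complete:
  assumes L: "\<And>n. f n \<in> L2"
    and cauchy: "\<And>e. 0 < e \<Longrightarrow> \<exists>N. \<forall>m\<ge>N. \<forall>n\<ge>N. L2_norm (\<lambda>x. f m x - f n x) \<le> e"
  shows "\<exists>g\<in>L2. (\<lambda>n. L2_norm (\<lambda>x. f n x - g x)) \<longlonglongrightarrow> 0"
proof -
  obtain N where N: "\<And>k m n. m \<ge> N k \<Longrightarrow> n \<ge> N k \<Longrightarrow> L2_norm (\<lambda>x. f m x - f n x) \<le> (1 / 2) ^ k"
    using cauchy[of "(1 / 2) ^ k" for k] by (metis zero_less_power half_gt_zero zero_less_one)
  define r where "r k = (\<Sum>j\<le>k. N j) + k" for k
  have rN: "N k \<le> r k" for k using member_le_sum[of k "{..k}" N] by (simp add: r_def)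
  have r_mono: "r k \<le> r (Suc k)" for k by (simp add: r_def)
  have "L2_norm (\<lambda>x. f (r (Suc k)) x - f (r k) x) \<le> (1 / 2) ^ k" for k
    using N[of k "r (Suc k)" "r k"] rN[of k] r_mono[of k] by simp
  from L2_fast_Cauchy_AE_convergent[of "\<lambda>k. f (r k)", OF L this]
  have conv: "AE x in lborel. convergent (\<lambda>k. f (r k) x)" .
  note [measurable] = L[THEN L2_measurable]
  define g where "g x = lim (\<lambda>k. f (r k) x)" for x
  have gm[measurable]: "g \<in> borel_measurable borel" unfolding g_def by measurable
  have close: "(\<lambda>x. f n x - g x) \<in> L2 \<and> L2_norm (\<lambda>x. f n x - g x) \<le> e"
    if e: "0 < e" and n: "\<forall>m\<ge>n. L2_norm (\<lambda>x. f n x - f m x) \<le> e" for e n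
  proof -
    have "(\<integral>\<^sup>+x. ennreal ((norm (f n x - g x))\<^sup>2) \<partial>lborel) \<le>
      (\<integral>\<^sup>+x. liminf (\<lambda>k. ennreal ((norm (f n x - f (r k) x))\<^sup>2)) \<partial>lborel)"
    proof (rule nn_integral_mono_AE, rule AE_mp[OF conv], intro AE_I2 impI)
      fix x assume "convergent (\<lambda>k. f (r k) x)"
      hence "(\<lambda>k. f (r k) x) \<longlonglongrightarrow> g x" by (simp add: g_def convergent_LIMSEQ_iff)
      hence "(\<lambda>k. ennreal ((norm (f n x - f (r k) x))\<^sup>2)) \<longlonglongrightarrow> ennreal ((norm (f n x - g x))\<^sup>2)"
        by (intro tendsto_intros tendsto_ennrealI)
      from lim_imp_Liminf[OF trivial_limit_sequentially this]
      show "ennreal ((norm (f n x - g x))\<^sup>2) \<le> liminf (\<lambda>k. ennreal ((norm (f n x - f (r k) x))\<^sup>2))" by simp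
    qed
    also have "\<dots> \<le> liminf (\<lambda>k. \<integral>\<^sup>+x. ennreal ((norm (f n x - f (r k) x))\<^sup>2) \<partial>lborel)"
      by (rule nn_integral_liminf) measurable
    also have "\<dots> \<le> ennreal (e\<^sup>2)"
    proof -
      have "\<forall>\<^sub>F k in sequentially. (\<integral>\<^sup>+x. ennreal ((norm (f n x - f (r k) x))\<^sup>2) \<partial>lborel) \<le> ennreal (e\<^sup>2)"
      proof (rule eventually_sequentiallyI[of n])
        fix k assume "n \<le> k"
        hence "n \<le> r k" by (simp add: r_def)
        hence "L2_norm (\<lambda>x. f n x - f (r k) x) \<le> e" using n by simp
        thus "(\<integral>\<^sup>+x. ennreal ((norm (f n x - f (r k) x))\<^sup>2) \<partial>lborel) \<le> ennreal (e\<^sup>2)"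
          unfolding L2_nn_integral[OF L2_diff[OF L L]] by (intro ennreal_leI power_mono) (simp_all add: L2_norm_nonneg)
      qed
      thus ?thesis by (intro Liminf_le) simp_all
    qed
    finally show ?thesis using L2_of_nn_integral[of "\<lambda>x. f n x - g x" e] e by auto
  qed
  have ev: "\<exists>N0. \<forall>n\<ge>N0. (\<lambda>x. f n x - g x) \<in> L2 \<and> L2_norm (\<lambda>x. f n x - g x) \<le> e" if "0 < e" for e
    using cauchy[OF that] close[OF that] by (meson order_trans)
  obtain n where "(\<lambda>x. f n x - g x) \<in> L2" using ev[of 1] by auto
  hence "g \<in> L2" using L2_diff[OF L[of n]] by fastforce
  moreover have "(\<lambda>n. L2_norm (\<lambda>x. f n x - g x)) \<longlonglongrightarrow> 0"
  proof (rule LIMSEQ_I)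
    fix e :: real assume "0 < e"
    with ev[of "e / 2"] obtain N0 where N0: "\<And>n. n \<ge> N0 \<Longrightarrow> L2_norm (\<lambda>x. f n x - g x) \<le> e / 2" by auto
    have "norm (L2_norm (\<lambda>x. f n x - g x) - 0) < e" if "n \<ge> N0" for n
      using N0[OF that] L2_norm_nonneg[of "\<lambda>x. f n x - g x"] \<open>0 < e\<close> by simp
    thus "\<exists>no. \<forall>n\<ge>no. norm (L2_norm (\<lambda>x. f n x - g x) - 0) < e" by blast
  qed
  ultimately show ?thesis by blast
qed

lemma l2_inner_tendsto:
  assumes "\<And>n. f n \<in> L2" "g \<in> L2" "h \<in> L2" "(\<lambda>n. L2_norm (\<lambda>x. f n x - g x)) \<longlonglongrightarrow> 0"
  shows "(\<lambda>n. l2_inner (f n) h) \<longlonglongrightarrow> l2_inner g h"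
proof -
  have "(\<lambda>n. L2_norm (\<lambda>x. f n x - g x) * L2_norm h) \<longlonglongrightarrow> 0 * L2_norm h"
    by (intro tendsto_intros assms)
  hence l: "(\<lambda>n. L2_norm (\<lambda>x. f n x - g x) * L2_norm h) \<longlonglongrightarrow> 0" by simp
  have "norm (l2_inner (f n) h - l2_inner g h) \<le> L2_norm (\<lambda>x. f n x - g x) * L2_norm h" for n
    using l2_inner_le[OF L2_diff[OF assms(1,2)] assms(3), of n] by (simp add: l2_inner_diff_left assms)
  hence "(\<lambda>n. l2_inner (f n) h - l2_inner g h) \<longlonglongrightarrow> 0"
    by (intro Lim_null_comparison[OF always_eventually l]) blast
  thus ?thesis by (simp add: LIM_zero_iff)
qed

text \<open>The representing function minimises the quadratic functional below; the parallelogram law makes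
  every minimising sequence Cauchy. The subspace need not be closed, and the representing function is
  then only a limit of its elements.\<close>

lemma riesz_representation:
  fixes l :: "('a::euclidean_space \<Rightarrow> complex) \<Rightarrow> real"
  assumes V: "V \<subseteq> L2" "V \<noteq> {}"
    and add: "\<And>f g. f \<in> V \<Longrightarrow> g \<in> V \<Longrightarrow> (\<lambda>x. f x + g x) \<in> V \<and> l (\<lambda>x. f x + g x) = l f + l g"
    and scale: "\<And>f c. f \<in> V \<Longrightarrow> (\<lambda>x. c *\<^sub>R f x) \<in> V \<and> l (\<lambda>x. c *\<^sub>R f x) = c * l f"
    and bd: "\<And>f. f \<in> V \<Longrightarrow> l f \<le> K * L2_norm f" and K: "0 \<le> K"
  shows "\<exists>w\<in>L2. (\<forall>v\<in>V. l v = l2_inner w v) \<and> L2_norm w \<le> K \<and>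
    (\<forall>e>0. \<exists>v\<in>V. L2_norm (\<lambda>x. w x - v x) < e)"
proof -
  define J where "J v = (L2_norm v)\<^sup>2 - 2 * l v" for v
  have VL: "v \<in> L2" if "v \<in> V" for v using V that by blast
  have Jge: "- K\<^sup>2 \<le> J v" if "v \<in> V" for v
  proof -
    have "0 \<le> (L2_norm v - K)\<^sup>2" by simp
    thus ?thesis using bd[OF that] by (simp add: J_def power2_diff mult.commute)
  qed
  have bdd: "bdd_below (J ` V)" using Jge by (auto simp: bdd_below_def)
  define m where "m = Inf (J ` V)"
  have m_le: "m \<le> J v" if "v \<in> V" for v unfolding m_def using bdd that by (intro cInf_lower) auto
  have "\<exists>v\<in>V. J v < m + 1 / real (Suc n)" for n
  proof -
    have "Inf (J ` V) < m + 1 / real (Suc n)" by (simp add: m_def)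
    thus ?thesis using V(2) bdd by (simp add: cInf_less_iff)
  qed
  then obtain v where v: "\<And>n. v n \<in> V" "\<And>n. J (v n) < m + 1 / real (Suc n)" by metis
  \<comment> \<open>the parallelogram law: the midpoint of two near minimisers cannot have a value below the infimum\<close>
  have par: "(L2_norm (\<lambda>x. v i x - v j x))\<^sup>2 \<le> 2 / real (Suc i) + 2 / real (Suc j)" for i j
  proof -
    let ?h = "\<lambda>x. (1 / 2) *\<^sub>R (v i x + v j x)"
    have h: "?h \<in> V" "l ?h = (l (v i) + l (v j)) / 2"
      using add[OF v(1) v(1), of i j] scale[of "\<lambda>x. v i x + v j x" "1 / 2"] by auto
    have "(L2_norm ?h)\<^sup>2 = (L2_norm (\<lambda>x. v i x + v j x))\<^sup>2 / 4"
      unfolding L2_norm_scaleR by (simp add: power_mult_distrib power2_eq_square)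
    hence "(L2_norm (\<lambda>x. v i x - v j x))\<^sup>2 = 2 * J (v i) + 2 * J (v j) - 4 * J ?h"
      unfolding J_def h(2) using L2_norm_add_sq[OF VL VL, OF v(1) v(1), of i j] L2_norm_diff_sq[OF VL VL, OF v(1) v(1), of i j]
      by argo
    thus ?thesis using m_le[OF h(1)] v(2)[of i] v(2)[of j] by simp
  qed
  have "\<exists>g\<in>L2. (\<lambda>n. L2_norm (\<lambda>x. v n x - g x)) \<longlonglongrightarrow> 0"
  proof (rule L2_complete)
    fix e :: real assume e: "0 < e"
    obtain N where N: "4 / e\<^sup>2 < real N" using reals_Archimedean2 by blast
    have "L2_norm (\<lambda>x. v i x - v j x) \<le> e" if "i \<ge> N" "j \<ge> N" for i j
    proof (rule power2_le_imp_le)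
      have "0 < 4 / e\<^sup>2" using e by simp
      hence N0: "0 < real N" using N by (rule order_less_trans)
      have "2 / real (Suc i) \<le> 2 / real N" "2 / real (Suc j) \<le> 2 / real N"
        using that N0 by (intro divide_left_mono; simp)+
      hence "2 / real (Suc i) + 2 / real (Suc j) \<le> 4 / real N" by simp
      also have "\<dots> \<le> e\<^sup>2" using N e N0 by (simp add: field_simps)
      finally show "(L2_norm (\<lambda>x. v i x - v j x))\<^sup>2 \<le> e\<^sup>2" using par[of i j] by linarith
    qed (use e in simp)
    thus "\<exists>N. \<forall>m\<ge>N. \<forall>n\<ge>N. L2_norm (\<lambda>x. v m x - v n x) \<le> e" by blast
  qed (use VL v in blast)
  then obtain w where w: "w \<in> L2" "(\<lambda>n. L2_norm (\<lambda>x. v n x - w x)) \<longlonglongrightarrow> 0" by blast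
  have rep: "l u = l2_inner w u" if u: "u \<in> V" for u
  proof -
    define d where "d = l2_inner w u - l u"
    \<comment> \<open>the limit of the \<open>v n\<close> minimises \<open>J\<close>, so moving in the direction \<open>u\<close> does not decrease the value\<close>
    have q: "0 \<le> 2 * t * d + t\<^sup>2 * (L2_norm u)\<^sup>2" for t
    proof -
      have lower: "- 1 / real (Suc n) \<le> 2 * t * (l2_inner (v n) u - l u) + t\<^sup>2 * (L2_norm u)\<^sup>2" for n
      proof -
        have s: "(\<lambda>x. v n x + t *\<^sub>R u x) \<in> V" "l (\<lambda>x. v n x + t *\<^sub>R u x) = l (v n) + t * l u"
          using add[OF v(1), of "\<lambda>x. t *\<^sub>R u x" n] scale[OF u, of t] by auto
        have "J (\<lambda>x. v n x + t *\<^sub>R u x) = J (v n) + 2 * t * (l2_inner (v n) u - l u) + t\<^sup>2 * (L2_norm u)\<^sup>2"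
          unfolding J_def s(2) L2_norm_add_sq[OF VL[OF v(1)] L2_scaleR[OF VL[OF u]]] L2_norm_scaleR
            l2_inner_commute[of "v n"] l2_inner_scaleR_left
          by (simp add: algebra_simps power_mult_distrib)
        thus ?thesis using m_le[OF s(1)] v(2)[of n] by simp
      qed
      have "(\<lambda>n. 2 * t * (l2_inner (v n) u - l u) + t\<^sup>2 * (L2_norm u)\<^sup>2) \<longlonglongrightarrow> 2 * t * d + t\<^sup>2 * (L2_norm u)\<^sup>2"
        unfolding d_def using l2_inner_tendsto[OF VL[OF v(1)] w(1) VL[OF u] w(2)] by (intro tendsto_intros)
      moreover have "(\<lambda>n. - 1 / real (Suc n)) \<longlonglongrightarrow> 0"
        using tendsto_minus[OF LIMSEQ_Suc[OF lim_1_over_n]] by simp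
      ultimately show ?thesis using lower LIMSEQ_le by blast
    qed
    \<comment> \<open>the minimiser of the parabola, up to the added 1 that avoids a division by 0\<close>
    let ?B = "(L2_norm u)\<^sup>2 + 1"
    have B: "0 < ?B" by (simp add: add_nonneg_pos)
    have "0 \<le> 2 * (- d / ?B) * d + (- d / ?B)\<^sup>2 * (L2_norm u)\<^sup>2" by (rule q)
    also have "\<dots> \<le> 2 * (- d / ?B) * d + (- d / ?B)\<^sup>2 * ?B"
      by (intro add_left_mono mult_left_mono) auto
    also have "\<dots> = - d\<^sup>2 / ?B"
    proof -
      have "2 * (- d / b) * d + (- d / b)\<^sup>2 * b = - d\<^sup>2 / b" if "0 < b" for b
        using that by (simp add: field_simps power2_eq_square)
      from this[OF B] show ?thesis .
    qed
    finally have "d\<^sup>2 \<le> 0" using B by (simp add: divide_le_0_iff zero_le_divide_iff)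
    thus ?thesis by (simp add: d_def)
  qed
  have nt: "(\<lambda>n. L2_norm (v n)) \<longlonglongrightarrow> L2_norm w"
  proof -
    have "norm (L2_norm (v n) - L2_norm w) \<le> L2_norm (\<lambda>x. v n x - w x)" for n
      using L2_norm_triangle[OF L2_diff[OF VL[OF v(1)] w(1)] w(1), of n]
        L2_norm_triangle_diff[OF VL[OF v(1)] L2_diff[OF VL[OF v(1)] w(1)], of n n] by simp
    hence "(\<lambda>n. L2_norm (v n) - L2_norm w) \<longlonglongrightarrow> 0"
      by (intro Lim_null_comparison[OF always_eventually w(2)]) blast
    thus ?thesis by (simp add: LIM_zero_iff)
  qed
  have "(L2_norm w)\<^sup>2 \<le> K * L2_norm w"
  proof (rule LIMSEQ_le)
    show "(\<lambda>n. l2_inner (v n) w) \<longlonglongrightarrow> (L2_norm w)\<^sup>2"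
      using l2_inner_tendsto[OF VL[OF v(1)] w(1) w(1) w(2)] by (simp add: l2_inner_self)
    show "(\<lambda>n. K * L2_norm (v n)) \<longlonglongrightarrow> K * L2_norm w" by (intro tendsto_intros nt)
    show "\<exists>N. \<forall>n\<ge>N. l2_inner (v n) w \<le> K * L2_norm (v n)"
      using bd[OF v(1)] rep[OF v(1)] by (auto simp: l2_inner_commute[of w])
  qed
  hence wK: "L2_norm w \<le> K" using L2_norm_nonneg[of w] K
    by (cases "L2_norm w = 0") (auto simp: power2_eq_square)
  have "\<exists>u\<in>V. L2_norm (\<lambda>x. w x - u x) < e" if e: "0 < e" for e
  proof -
    obtain n where "norm (L2_norm (\<lambda>x. v n x - w x) - 0) < e" using LIMSEQ_D[OF w(2) e] by blast
    hence "L2_norm (\<lambda>x. w x - v n x) < e"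
      using L2_norm_minus_commute[of "v n" w] by (simp add: L2_norm_nonneg abs_of_nonneg)
    thus ?thesis using v(1)[of n] by blast
  qed
  hence "(\<forall>v\<in>V. l v = l2_inner w v) \<and> L2_norm w \<le> K \<and>
    (\<forall>e>0. \<exists>v\<in>V. L2_norm (\<lambda>x. w x - v x) < e)" using rep wK by simp
  thus ?thesis using w(1) by (rule bexI)
qed

text \<open>The Babuska--Brezzi principle. Let \<open>p\<close> be the orthogonal projection of \<open>cnj (a f)\<close> onto the closed span of the functions
  \<open>b h\<close>. Testing against the partner \<open>h\<close> of \<open>f\<close>, the inf-sup condition gives \<open>L2_norm (a f) \<le> C * L2_norm p\<close>. So \<open>g f\<close> depends only on
  \<open>p\<close>, with bound \<open>C * N\<close>, and the function that represents this functional of \<open>p\<close> lies in the closed span and reproduces \<open>g\<close>. The projections exist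
  by the Riesz representation theorem as well.\<close>

lemma inf_sup_solution:
  fixes a b :: "('a::euclidean_space \<Rightarrow> complex) \<Rightarrow> 'a \<Rightarrow> complex"
  assumes D0: "D \<noteq> {}"
    and Dadd: "\<And>f h. f \<in> D \<Longrightarrow> h \<in> D \<Longrightarrow> (\<lambda>x. f x + h x) \<in> D"
    and Dmult: "\<And>f c. f \<in> D \<Longrightarrow> (\<lambda>x. c * f x) \<in> D"
    and aL: "\<And>f. f \<in> D \<Longrightarrow> a f \<in> L2" and bL: "\<And>f. f \<in> D \<Longrightarrow> b f \<in> L2"
    and aadd: "\<And>f h. f \<in> D \<Longrightarrow> h \<in> D \<Longrightarrow> a (\<lambda>x. f x + h x) = (\<lambda>x. a f x + a h x)"
    and badd: "\<And>f h. f \<in> D \<Longrightarrow> h \<in> D \<Longrightarrow> b (\<lambda>x. f x + h x) = (\<lambda>x. b f x + b h x)"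
    and amult: "\<And>f c. f \<in> D \<Longrightarrow> a (\<lambda>x. c * f x) = (\<lambda>x. c * a f x)"
    and bmult: "\<And>f c. f \<in> D \<Longrightarrow> b (\<lambda>x. c * f x) = (\<lambda>x. c * b f x)"
    and infsup: "\<And>f. f \<in> D \<Longrightarrow> \<exists>h\<in>D. (L2_norm (a f))\<^sup>2 \<le> Re (LINT x|lborel. a f x * b h x) \<and> L2_norm (b h) \<le> C * L2_norm (a f)"
    and C: "0 \<le> C"
    and gadd: "\<And>f h. f \<in> D \<Longrightarrow> h \<in> D \<Longrightarrow> g (\<lambda>x. f x + h x) = g f + g h"
    and gmult: "\<And>f c. f \<in> D \<Longrightarrow> g (\<lambda>x. c * f x) = c * g f"
    and gbd: "\<And>f. f \<in> D \<Longrightarrow> norm (g f) \<le> N * L2_norm (a f)" and N: "0 \<le> N"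
  shows "\<exists>w\<in>L2. (\<forall>f\<in>D. (LINT x|lborel. w x * a f x) = g f) \<and> L2_norm w \<le> C * N \<and>
    (\<forall>e>0. \<exists>f\<in>D. L2_norm (\<lambda>x. w x - b f x) < e)"
proof -
  define c where "c f = (\<lambda>x. cnj (a f x))" for f
  have cL: "c f \<in> L2" if "f \<in> D" for f unfolding c_def using L2_cnj[OF aL[OF that]] .
  have inner_c: "l2_inner w (c f) = Re (LINT x|lborel. w x * a f x)" if "w \<in> L2" "f \<in> D" for w f
  proof -
    have "Re (LINT x|lborel. w x * a f x) = (LINT x|lborel. Re (w x * a f x))"
      by (rule integral_Re[symmetric], rule L2_mult_integrable(1)[OF that(1) aL[OF that(2)]])
    thus ?thesis by (simp add: l2_inner_def c_def inner_complex_def)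
  qed
  define cl where "cl p \<longleftrightarrow> p \<in> L2 \<and> (\<forall>e>0. \<exists>f\<in>D. L2_norm (\<lambda>x. p x - b f x) < e)" for p
  \<comment> \<open>\<open>p\<close> is the orthogonal projection of \<open>c f\<close> onto the closure of the image of \<open>b\<close>\<close>
  define rel where "rel p f \<longleftrightarrow> cl p \<and> f \<in> D \<and> (\<forall>h\<in>D. l2_inner p (b h) = l2_inner (c f) (b h))" for p f
  have ctrl: "L2_norm (a f) \<le> C * L2_norm p" if "rel p f" for p f
  proof -
    have f: "f \<in> D" and p: "p \<in> L2" using that by (auto simp: rel_def cl_def)
    obtain h where h: "h \<in> D" "(L2_norm (a f))\<^sup>2 \<le> Re (LINT x|lborel. a f x * b h x)" "L2_norm (b h) \<le> C * L2_norm (a f)"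
      using infsup[OF f] by blast
    have "(LINT x|lborel. a f x * b h x) = (LINT x|lborel. b h x * a f x)" by (simp add: mult.commute)
    hence "(L2_norm (a f))\<^sup>2 \<le> l2_inner (b h) (c f)" using h(2) inner_c[OF bL[OF h(1)] f] by simp
    also have "\<dots> = l2_inner p (b h)" using that h(1) by (simp add: rel_def l2_inner_commute[of "b h"])
    also have "\<dots> \<le> L2_norm p * L2_norm (b h)" using l2_inner_le[OF p bL[OF h(1)]] by simp
    also have "\<dots> \<le> L2_norm p * (C * L2_norm (a f))" using h(3) by (intro mult_left_mono) (simp_all add: L2_norm_nonneg)
    finally have "L2_norm (a f) * L2_norm (a f) \<le> (C * L2_norm p) * L2_norm (a f)" by (simp add: power2_eq_square mult_ac)
    thus ?thesis using L2_norm_nonneg[of "a f"] mult_nonneg_nonneg[OF C L2_norm_nonneg[of p]]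
      by (cases "L2_norm (a f) = 0") auto
  qed
  have cl_add: "cl (\<lambda>x. p x + q x)" if "cl p" "cl q" for p q
    unfolding cl_def
  proof (intro conjI allI impI)
    show "(\<lambda>x. p x + q x) \<in> L2" using that L2_add by (auto simp: cl_def)
    fix e :: real assume "0 < e"
    hence "0 < e / 2" by simp
    with that obtain f h where fh: "f \<in> D" "L2_norm (\<lambda>x. p x - b f x) < e / 2" "h \<in> D" "L2_norm (\<lambda>x. q x - b h x) < e / 2"
      unfolding cl_def by meson
    have "L2_norm (\<lambda>x. (p x - b f x) + (q x - b h x)) \<le> L2_norm (\<lambda>x. p x - b f x) + L2_norm (\<lambda>x. q x - b h x)"
      using that fh by (intro L2_norm_triangle L2_diff bL) (auto simp: cl_def)
    moreover have "(\<lambda>x. (p x - b f x) + (q x - b h x)) = (\<lambda>x. p x + q x - b (\<lambda>x. f x + h x) x)"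
      by (simp add: badd[OF fh(1,3)] algebra_simps fun_eq_iff)
    ultimately have "L2_norm (\<lambda>x. p x + q x - b (\<lambda>x. f x + h x) x) < e" using fh by simp
    thus "\<exists>f\<in>D. L2_norm (\<lambda>x. p x + q x - b f x) < e" using Dadd[OF fh(1,3)] by blast
  qed
  have cl_scale: "cl (\<lambda>x. r *\<^sub>R p x)" if "cl p" for p r
    unfolding cl_def
  proof (intro conjI allI impI)
    show "(\<lambda>x. r *\<^sub>R p x) \<in> L2" using that L2_scaleR by (auto simp: cl_def)
    fix e :: real assume e: "0 < e"
    hence "0 < e / (\<bar>r\<bar> + 1)" by simp
    with that obtain f where f: "f \<in> D" "L2_norm (\<lambda>x. p x - b f x) < e / (\<bar>r\<bar> + 1)"
      unfolding cl_def by meson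
    have "(\<lambda>x. r *\<^sub>R p x - b (\<lambda>x. complex_of_real r * f x) x) = (\<lambda>x. r *\<^sub>R (p x - b f x))"
      by (simp add: bmult[OF f(1)] scaleR_conv_of_real algebra_simps fun_eq_iff)
    hence "L2_norm (\<lambda>x. r *\<^sub>R p x - b (\<lambda>x. complex_of_real r * f x) x) = \<bar>r\<bar> * L2_norm (\<lambda>x. p x - b f x)"
      by (simp add: L2_norm_scaleR)
    also have "\<dots> \<le> \<bar>r\<bar> * (e / (\<bar>r\<bar> + 1))" using f(2) by (intro mult_left_mono) auto
    also have "\<dots> < e" using e by (simp add: field_simps)
    finally show "\<exists>f\<in>D. L2_norm (\<lambda>x. r *\<^sub>R p x - b f x) < e" using Dmult[OF f(1)] by blast
  qed
  have rel_add: "rel (\<lambda>x. p x + q x) (\<lambda>x. f x + h x)" if "rel p f" "rel q h" for p q f h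
  proof -
    have "c (\<lambda>x. f x + h x) = (\<lambda>x. c f x + c h x)" using that aadd by (simp add: c_def rel_def)
    thus ?thesis using that cl_add Dadd cL bL unfolding rel_def
      by (simp add: l2_inner_add_left cl_def)
  qed
  have rel_scale: "rel (\<lambda>x. r *\<^sub>R p x) (\<lambda>x. complex_of_real r * f x)" if "rel p f" for p f r
  proof -
    have "c (\<lambda>x. complex_of_real r * f x) = (\<lambda>x. r *\<^sub>R c f x)" using that amult by (simp add: c_def rel_def scaleR_conv_of_real)
    thus ?thesis using that cl_scale Dmult unfolding rel_def by (simp add: l2_inner_scaleR_left)
  qed
  \<comment> \<open>by the control of \<open>a\<close> by the projection, two functions with the same projection differ by one that \<open>g\<close> annihilates\<close>
  have unique: "g f = g h" if "rel p f" "rel p h" for p f h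
  proof -
    have m: "(\<lambda>x. - 1 * h x) \<in> D" "f \<in> D" "h \<in> D" using that Dmult[of h "- 1"] unfolding rel_def by blast+
    have r: "rel (\<lambda>x. p x + (-1) *\<^sub>R p x) (\<lambda>x. f x + complex_of_real (-1) * h x)"
      using rel_add[OF that(1) rel_scale[OF that(2)]] .
    let ?k = "\<lambda>x. f x + complex_of_real (-1) * h x"
    have k: "?k \<in> D" using r unfolding rel_def by blast
    have "L2_norm (\<lambda>x. p x + (-1) *\<^sub>R p x) = 0" by (simp add: L2_norm_zero)
    with ctrl[OF r] have "L2_norm (a ?k) \<le> 0" by simp
    hence "N * L2_norm (a ?k) \<le> N * 0" by (rule mult_left_mono[OF _ N])
    with gbd[OF k] have "norm (g ?k) \<le> 0" by linarith
    hence "g (\<lambda>x. f x + - 1 * h x) = 0" by simp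
    thus ?thesis using gadd[OF m(2,1)] gmult[OF m(3), of "- 1"] by simp
  qed
  have proj: "\<exists>p. rel p f" if f: "f \<in> D" for f
  proof -
    have "\<exists>w\<in>L2. (\<forall>v\<in>b ` D. l2_inner (c f) v = l2_inner w v) \<and> L2_norm w \<le> L2_norm (c f) \<and>
      (\<forall>e>0. \<exists>v\<in>b ` D. L2_norm (\<lambda>x. w x - v x) < e)"
    proof (rule riesz_representation)
      show "b ` D \<subseteq> L2" "b ` D \<noteq> {}" using bL D0 by auto
      show "0 \<le> L2_norm (c f)" by (rule L2_norm_nonneg)
    next
      fix v assume "v \<in> b ` D"
      thus "l2_inner (c f) v \<le> L2_norm (c f) * L2_norm v"
        using l2_inner_le[OF cL[OF f], of v] bL by auto
    next
      fix u v assume "u \<in> b ` D" "v \<in> b ` D"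
      then obtain h k where hk: "h \<in> D" "k \<in> D" "u = b h" "v = b k" by blast
      have "(\<lambda>x. u x + v x) = b (\<lambda>x. h x + k x)" by (simp add: hk badd)
      thus "(\<lambda>x. u x + v x) \<in> b ` D \<and> l2_inner (c f) (\<lambda>x. u x + v x) = l2_inner (c f) u + l2_inner (c f) v"
        using Dadd[OF hk(1,2)] l2_inner_add_left[OF bL bL cL, OF hk(1,2) f]
        by (simp add: l2_inner_commute[of "c f"] hk(3,4))
    next
      fix u and r :: real assume "u \<in> b ` D"
      then obtain h where h: "h \<in> D" "u = b h" by blast
      have "(\<lambda>x. r *\<^sub>R u x) = b (\<lambda>x. complex_of_real r * h x)" by (simp add: h bmult scaleR_conv_of_real)
      thus "(\<lambda>x. r *\<^sub>R u x) \<in> b ` D \<and> l2_inner (c f) (\<lambda>x. r *\<^sub>R u x) = r * l2_inner (c f) u"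
        using Dmult[OF h(1)] l2_inner_scaleR_left[of r u "c f"] by (simp add: l2_inner_commute[of "c f"])
    qed
    then obtain w where w: "w \<in> L2" "\<forall>v\<in>b ` D. l2_inner (c f) v = l2_inner w v"
      "\<forall>e>0. \<exists>v\<in>b ` D. L2_norm (\<lambda>x. w x - v x) < e" by blast
    have "\<forall>e>0. \<exists>h\<in>D. L2_norm (\<lambda>x. w x - b h x) < e" using w(3) by simp
    hence "rel w f" using w(1,2) f by (simp add: rel_def cl_def)
    thus ?thesis by blast
  qed
  define V where "V = {p. \<exists>f. rel p f}"
  define l where "l p = Re (g (SOME f. rel p f))" for p
  have l_eq: "l p = Re (g f)" if "rel p f" for p f
    unfolding l_def using unique[OF someI[of "rel p", OF that] that] by simp
  have "\<exists>w\<in>L2. (\<forall>v\<in>V. l v = l2_inner w v) \<and> L2_norm w \<le> C * N \<and>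
      (\<forall>e>0. \<exists>v\<in>V. L2_norm (\<lambda>x. w x - v x) < e)"
  proof (rule riesz_representation)
    show "V \<subseteq> L2" by (auto simp: V_def rel_def cl_def)
    show "V \<noteq> {}" using D0 proj unfolding V_def by blast
    show "0 \<le> C * N" using C N by simp
  next
    fix p assume "p \<in> V"
    then obtain f where f: "rel p f" by (auto simp: V_def)
    have "l p \<le> norm (g f)" unfolding l_eq[OF f] by (rule complex_Re_le_cmod)
    also have "\<dots> \<le> N * L2_norm (a f)" using gbd f by (simp add: rel_def)
    also have "\<dots> \<le> N * (C * L2_norm p)" by (intro mult_left_mono ctrl f N)
    finally show "l p \<le> C * N * L2_norm p" by (simp add: mult_ac)
  next
    fix p q assume "p \<in> V" "q \<in> V"
    then obtain f h where fh: "rel p f" "rel q h" by (auto simp: V_def)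
    show "(\<lambda>x. p x + q x) \<in> V \<and> l (\<lambda>x. p x + q x) = l p + l q"
      using rel_add[OF fh] l_eq[OF rel_add[OF fh]] l_eq[OF fh(1)] l_eq[OF fh(2)] gadd[of f h] fh
      unfolding V_def rel_def[of p f] rel_def[of q h] by auto
  next
    fix p and r :: real assume "p \<in> V"
    then obtain f where f: "rel p f" by (auto simp: V_def)
    show "(\<lambda>x. r *\<^sub>R p x) \<in> V \<and> l (\<lambda>x. r *\<^sub>R p x) = r * l p"
      using rel_scale[OF f] l_eq[OF rel_scale[OF f]] l_eq[OF f] gmult[of f "complex_of_real r"] f
      unfolding V_def rel_def[of p f] by auto
  qed
  then obtain w where w: "w \<in> L2" "\<And>v. v \<in> V \<Longrightarrow> l v = l2_inner w v" "L2_norm w \<le> C * N"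
    "\<And>e. 0 < e \<Longrightarrow> \<exists>v\<in>V. L2_norm (\<lambda>x. w x - v x) < e" by blast
  have clw: "\<exists>f\<in>D. L2_norm (\<lambda>x. w x - b f x) < e" if "0 < e" for e
  proof -
    have e2: "0 < e / 2" using that by simp
    obtain p where p: "p \<in> V" "L2_norm (\<lambda>x. w x - p x) < e / 2" using w(4)[OF e2] by blast
    hence clp: "cl p" by (auto simp: V_def rel_def)
    then obtain f where f: "f \<in> D" "L2_norm (\<lambda>x. p x - b f x) < e / 2" unfolding cl_def using e2 by blast
    have "L2_norm (\<lambda>x. (w x - p x) + (p x - b f x)) \<le> L2_norm (\<lambda>x. w x - p x) + L2_norm (\<lambda>x. p x - b f x)"
      using clp w(1) bL[OF f(1)] by (intro L2_norm_triangle L2_diff) (auto simp: cl_def)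
    hence "L2_norm (\<lambda>x. w x - b f x) < e" using p(2) f(2) by simp
    thus ?thesis using f(1) by blast
  qed
  \<comment> \<open>\<open>w\<close> is a limit of functions \<open>b h\<close>, so it pairs with \<open>c f\<close> as with its projection\<close>
  have Re_eq: "Re (LINT x|lborel. w x * a f x) = Re (g f)" if f: "f \<in> D" for f
  proof -
    obtain p where p: "rel p f" using proj[OF f] by blast
    have pL: "p \<in> L2" using p by (simp add: rel_def cl_def)
    define d where "d = l2_inner w (\<lambda>x. p x - c f x)"
    have dL: "(\<lambda>x. p x - c f x) \<in> L2" by (intro L2_diff pL cL f)
    have small: "\<bar>d\<bar> \<le> e * L2_norm (\<lambda>x. p x - c f x)" if e: "0 < e" for e
    proof -
      obtain h where h: "h \<in> D" "L2_norm (\<lambda>x. w x - b h x) < e" using clw[OF e] by blast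
      have "l2_inner (b h) (\<lambda>x. p x - c f x) = 0"
        using p h(1) l2_inner_diff_left[OF pL cL[OF f] bL[OF h(1)]] unfolding rel_def
        by (simp add: l2_inner_commute[of "b h"])
      hence "d = l2_inner (\<lambda>x. w x - b h x) (\<lambda>x. p x - c f x)"
        unfolding d_def using l2_inner_diff_left[OF w(1) bL[OF h(1)] dL] by simp
      hence "\<bar>d\<bar> \<le> L2_norm (\<lambda>x. w x - b h x) * L2_norm (\<lambda>x. p x - c f x)"
        using l2_inner_le[OF L2_diff[OF w(1) bL[OF h(1)]] dL] by simp
      also have "\<dots> \<le> e * L2_norm (\<lambda>x. p x - c f x)"
        using h(2) by (intro mult_right_mono) (simp_all add: L2_norm_nonneg)
      finally show ?thesis .
    qed
    have "\<bar>d\<bar> \<le> 0"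
    proof (rule field_le_epsilon)
      fix e :: real assume e: "0 < e"
      let ?M = "L2_norm (\<lambda>x. p x - c f x)"
      have M: "0 \<le> ?M" by (rule L2_norm_nonneg)
      have "0 < e / (?M + 1)" using e M by (simp add: add_nonneg_pos)
      from small[OF this] have "\<bar>d\<bar> \<le> e / (?M + 1) * ?M" .
      also have "\<dots> \<le> e" using e M by (simp add: field_simps)
      finally show "\<bar>d\<bar> \<le> 0 + e" by simp
    qed
    hence "l2_inner w (c f) = l2_inner w p"
      using l2_inner_diff_left[OF pL cL[OF f] w(1)] by (simp add: d_def l2_inner_commute[of w])
    also have "\<dots> = l p"
    proof -
      have "p \<in> V" using p unfolding V_def by blast
      from w(2)[OF this] show ?thesis by simp
    qed
    also have "\<dots> = Re (g f)" by (rule l_eq[OF p])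
    finally show ?thesis using inner_c[OF w(1) f] by simp
  qed
  have "(LINT x|lborel. w x * a f x) = g f" if f: "f \<in> D" for f
  proof (rule complex_eqI)
    show "Re (LINT x|lborel. w x * a f x) = Re (g f)" by (rule Re_eq[OF f])
    have "(LINT x|lborel. w x * a (\<lambda>x. \<i> * f x) x) = \<i> * (LINT x|lborel. w x * a f x)"
      unfolding amult[OF f] mult.left_commute[of _ \<i>] by simp
    thus "Im (LINT x|lborel. w x * a f x) = Im (g f)"
      using Re_eq[OF Dmult[OF f, of \<i>]] gmult[OF f, of \<i>] by simp
  qed
  hence "(\<forall>f\<in>D. (LINT x|lborel. w x * a f x) = g f) \<and> L2_norm w \<le> C * N \<and>
    (\<forall>e>0. \<exists>f\<in>D. L2_norm (\<lambda>x. w x - b f x) < e)" using w(3) clw by simp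
  thus ?thesis using w(1) by (rule bexI)
qed

section \<open>Bessel potentials of Schwartz functions\<close>

text \<open>As the multiplier is even, the transform and its inverse could be exchanged; in this form the operator
  is the transpose of the Bessel potential of distributions.\<close>

definition bessel_op :: "real \<Rightarrow> ('a::euclidean_space \<Rightarrow> complex) \<Rightarrow> 'a \<Rightarrow> complex" where
  "bessel_op s f = fourier (\<lambda>\<xi>. bracket s \<xi> *\<^sub>R inv_fourier f \<xi>)"

definition sob_norm :: "real \<Rightarrow> ('a::euclidean_space \<Rightarrow> complex) \<Rightarrow> real" where
  "sob_norm s f = L2_norm (\<lambda>\<xi>. bracket s \<xi> *\<^sub>R inv_fourier f \<xi>)"

lemma schwartz_L2: "f \<in> schwartz \<Longrightarrow> f \<in> L2"
proof -
  assume f: "f \<in> schwartz"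
  have "integrable lborel (\<lambda>x. Re (f x * cnj (f x)))"
    using schwartz_integrable[OF schwartz_mult[OF f schwartz_cnj[OF f]]] by (rule integrable_Re)
  moreover have "Re (f x * cnj (f x)) = (norm (f x))\<^sup>2" for x by (simp only: complex_norm_square[symmetric] Re_complex_of_real)
  ultimately show "f \<in> L2" using schwartz_measurable[OF f] by (simp add: L2_iff)
qed

lemma L2_norm_fourier: "f \<in> schwartz \<Longrightarrow> L2_norm (fourier f) = L2_norm f"
  by (simp add: L2_norm_def plancherel)

lemma schwartz_bessel_op: "f \<in> schwartz \<Longrightarrow> bessel_op s f \<in> schwartz"
  unfolding bessel_op_def by (intro schwartz_fourier schwartz_bracket schwartz_inv_fourier)

lemma L2_norm_bessel_op: "f \<in> schwartz \<Longrightarrow> L2_norm (bessel_op s f) = sob_norm s f"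
  unfolding bessel_op_def sob_norm_def
  by (intro L2_norm_fourier schwartz_bracket schwartz_inv_fourier)

lemma inv_fourier_add:
  "f \<in> schwartz \<Longrightarrow> g \<in> schwartz \<Longrightarrow> inv_fourier (\<lambda>x. f x + g x) \<xi> = inv_fourier f \<xi> + inv_fourier g \<xi>"
  by (simp add: inv_fourier_eq fourier_add schwartz_integrable)

lemma inv_fourier_cmult: "inv_fourier (\<lambda>x. c * f x) \<xi> = c * inv_fourier f \<xi>"
  by (simp add: inv_fourier_eq fourier_cmult)

lemma bessel_op_add:
  assumes "f \<in> schwartz" "g \<in> schwartz"
  shows "bessel_op s (\<lambda>x. f x + g x) = (\<lambda>x. bessel_op s f x + bessel_op s g x)"
proof -
  have "integrable lborel (\<lambda>\<xi>. bracket s \<xi> *\<^sub>R inv_fourier h \<xi>)" if "h \<in> schwartz" for h :: "'a \<Rightarrow> complex"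
    using that by (intro schwartz_integrable schwartz_bracket schwartz_inv_fourier)
  thus ?thesis using assms
    by (simp add: bessel_op_def inv_fourier_add scaleR_right_distrib fourier_add fun_eq_iff)
qed

lemma bessel_op_cmult: "bessel_op s (\<lambda>x. c * f x) = (\<lambda>x. c * bessel_op s f x)"
proof -
  have "(\<lambda>\<xi>. bracket s \<xi> *\<^sub>R inv_fourier (\<lambda>x. c * f x) \<xi>) = (\<lambda>\<xi>. c * (bracket s \<xi> *\<^sub>R inv_fourier f \<xi>))"
    by (simp add: inv_fourier_cmult)
  thus ?thesis unfolding bessel_op_def by (simp only: fourier_cmult[abs_def])
qed

lemma bessel_op_compose:
  assumes "f \<in> schwartz" shows "bessel_op s (bessel_op t f) = bessel_op (s + t) f"
proof -
  have "inv_fourier (bessel_op t f) = (\<lambda>\<xi>. bracket t \<xi> *\<^sub>R inv_fourier f \<xi>)"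
    unfolding bessel_op_def
    using inv_fourier_fourier[OF schwartz_bracket[OF schwartz_inv_fourier[OF assms]]] by (simp add: fun_eq_iff)
  thus ?thesis by (simp add: bessel_op_def bracket_mult)
qed

lemma bessel_op_0: "f \<in> schwartz \<Longrightarrow> bessel_op 0 f = f"
  by (simp add: bessel_op_def bracket_0 fourier_inv_fourier fun_eq_iff)

lemma bessel_op_inverse: "f \<in> schwartz \<Longrightarrow> bessel_op s (bessel_op (- s) f) = f"
  by (simp add: bessel_op_compose bessel_op_0)

lemma bracket_minus: "bracket s (- x) = bracket s x"
  by (simp add: bracket_def)

text \<open>By Parseval's formula both sides are integrals of the multiplier against transforms of \<open>f\<close> and \<open>g\<close>, with \<open>\<xi>\<close> replaced
  by \<open>- \<xi>\<close>; the multiplier is even.\<close>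

lemma integral_bessel_op:
  assumes f: "f \<in> schwartz" and g: "g \<in> schwartz"
  shows "(LINT x|lborel. bessel_op s f x * g x) = (LINT x|lborel. f x * bessel_op s g x)"
proof -
  let ?m = "\<lambda>h \<xi>. bracket s \<xi> *\<^sub>R inv_fourier h \<xi>"
  have mf: "?m f \<in> schwartz" using f by (intro schwartz_bracket schwartz_inv_fourier)
  have mg: "?m g \<in> schwartz" using g by (intro schwartz_bracket schwartz_inv_fourier)
  have "(LINT x|lborel. bessel_op s f x * g x) = (LINT \<xi>|lborel. ?m f \<xi> * fourier g \<xi>)"
    unfolding bessel_op_def by (rule fourier_multiplication_formula[OF schwartz_integrable[OF mf] schwartz_integrable[OF g]])
  also have "\<dots> = (LINT \<xi>|lborel. ?m f (- \<xi>) * fourier g (- \<xi>))"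
    using schwartz_measurable[OF schwartz_mult[OF mf schwartz_fourier[OF g]]]
    by (rule integral_reflect[symmetric])
  also have "\<dots> = (LINT \<xi>|lborel. fourier f \<xi> * ?m g \<xi>)"
    by (simp add: inv_fourier_eq bracket_minus)
  also have "\<dots> = (LINT x|lborel. f x * bessel_op s g x)"
    unfolding bessel_op_def by (rule fourier_multiplication_formula[OF schwartz_integrable[OF f] schwartz_integrable[OF mg]])
  finally show ?thesis .
qed

lemma integral_bessel_op_pair:
  assumes f: "f \<in> schwartz" and g: "g \<in> schwartz"
  shows "(LINT x|lborel. bessel_op s f x * bessel_op (- s) g x) = (LINT x|lborel. f x * g x)"
  using integral_bessel_op[OF f schwartz_bessel_op[OF g]] by (simp add: bessel_op_inverse[OF g])

lemma norm_integral_le_sob_norm: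
  assumes f: "f \<in> schwartz" and g: "g \<in> schwartz"
  shows "norm (LINT x|lborel. f x * g x) \<le> sob_norm s f * sob_norm (- s) g"
  using norm_integral_mult_le[OF schwartz_L2[OF schwartz_bessel_op[OF f, of s]] schwartz_L2[OF schwartz_bessel_op[OF g, of "- s"]]]
  by (simp only: integral_bessel_op_pair[OF f g] L2_norm_bessel_op[OF f] L2_norm_bessel_op[OF g])

lemma sob_norm_nonneg: "0 \<le> sob_norm s f"
  by (simp add: sob_norm_def L2_norm_nonneg)

lemma sob_norm_0:
  assumes f: "f \<in> schwartz" shows "sob_norm 0 f = L2_norm f"
  using L2_norm_bessel_op[OF f, of 0] unfolding bessel_op_0[OF f] by simp

lemma sob_norm_bessel_op: "f \<in> schwartz \<Longrightarrow> sob_norm s (bessel_op t f) = sob_norm (s + t) f"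
  using L2_norm_bessel_op[of "bessel_op t f" s] L2_norm_bessel_op[of f "s + t"]
  by (simp add: bessel_op_compose schwartz_bessel_op)

lemma weighted_L2: "f \<in> schwartz \<Longrightarrow> (\<lambda>\<xi>. bracket s \<xi> *\<^sub>R inv_fourier f \<xi>) \<in> L2"
  by (intro schwartz_L2 schwartz_bracket schwartz_inv_fourier)

lemma sob_norm_sq:
  assumes "f \<in> schwartz"
  shows "integrable lborel (\<lambda>\<xi>. bracket (2 * s) \<xi> * (norm (inv_fourier f \<xi>))\<^sup>2)"
    "(sob_norm s f)\<^sup>2 = (LINT \<xi>|lborel. bracket (2 * s) \<xi> * (norm (inv_fourier f \<xi>))\<^sup>2)"
proof -
  have "(norm (bracket s \<xi> *\<^sub>R inv_fourier f \<xi>))\<^sup>2 = bracket (2 * s) \<xi> * (norm (inv_fourier f \<xi>))\<^sup>2" for \<xi>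
  proof -
    have "(norm (bracket s \<xi> *\<^sub>R inv_fourier f \<xi>))\<^sup>2 = (bracket s \<xi> * bracket s \<xi>) * (norm (inv_fourier f \<xi>))\<^sup>2"
      using bracket_pos[of s \<xi>] by (simp add: power_mult_distrib power2_eq_square)
    thus ?thesis by (simp add: bracket_mult)
  qed
  thus "integrable lborel (\<lambda>\<xi>. bracket (2 * s) \<xi> * (norm (inv_fourier f \<xi>))\<^sup>2)"
    "(sob_norm s f)\<^sup>2 = (LINT \<xi>|lborel. bracket (2 * s) \<xi> * (norm (inv_fourier f \<xi>))\<^sup>2)"
    using L2_integrable[OF weighted_L2[OF assms, of s]] by (simp_all add: sob_norm_def L2_norm_sq)
qed

lemma bracket_mono: "s \<le> t \<Longrightarrow> bracket s x \<le> bracket t x"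
  unfolding bracket_def by (intro powr_mono) auto

lemma sob_norm_mono:
  assumes "f \<in> schwartz" "s \<le> t" shows "sob_norm s f \<le> sob_norm t f"
proof (rule power2_le_imp_le)
  show "(sob_norm s f)\<^sup>2 \<le> (sob_norm t f)\<^sup>2"
    unfolding sob_norm_sq(2)[OF assms(1)]
    using assms by (intro integral_mono sob_norm_sq(1) mult_right_mono bracket_mono) auto
qed (rule sob_norm_nonneg)

lemma sob_norm_add:
  assumes "f \<in> schwartz" "g \<in> schwartz"
  shows "sob_norm s (\<lambda>x. f x + g x) \<le> sob_norm s f + sob_norm s g"
proof -
  have "(\<lambda>\<xi>. bracket s \<xi> *\<^sub>R inv_fourier (\<lambda>x. f x + g x) \<xi>) = (\<lambda>\<xi>. bracket s \<xi> *\<^sub>R inv_fourier f \<xi> + bracket s \<xi> *\<^sub>R inv_fourier g \<xi>)"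
    by (simp add: inv_fourier_add assms scaleR_right_distrib)
  thus ?thesis unfolding sob_norm_def
    using L2_norm_triangle[OF weighted_L2[OF assms(1)] weighted_L2[OF assms(2)]] by simp
qed

lemma sob_norm_cmult: "sob_norm s (\<lambda>x. c * f x) = norm c * sob_norm s f"
proof -
  have "(\<lambda>\<xi>. bracket s \<xi> *\<^sub>R inv_fourier (\<lambda>x. c * f x) \<xi>) = (\<lambda>\<xi>. c * (bracket s \<xi> *\<^sub>R inv_fourier f \<xi>))"
    by (simp add: inv_fourier_cmult)
  thus ?thesis unfolding sob_norm_def by (simp only: L2_norm_cmult)
qed

lemma sob_norm_sum:
  assumes "finite A" "\<And>i. i \<in> A \<Longrightarrow> f i \<in> schwartz"
  shows "sob_norm s (\<lambda>x. \<Sum>i\<in>A. f i x) \<le> (\<Sum>i\<in>A. sob_norm s (f i))"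
  using assms
proof (induction A rule: finite_induct)
  case empty
  have "sob_norm s (\<lambda>x::'b. 0 * 0) = 0" by (simp only: sob_norm_cmult) simp
  thus ?case by simp
next
  case (insert i A)
  have "sob_norm s (\<lambda>x. f i x + (\<Sum>i\<in>A. f i x)) \<le> sob_norm s (f i) + sob_norm s (\<lambda>x. \<Sum>i\<in>A. f i x)"
    using insert by (intro sob_norm_add schwartz_sum) auto
  moreover have "sob_norm s (\<lambda>x. \<Sum>i\<in>A. f i x) \<le> (\<Sum>i\<in>A. sob_norm s (f i))" using insert by simp
  ultimately show ?case using insert by simp
qed

lemma norm_inv_fourier_partial_deriv:
  assumes "f \<in> schwartz" "b \<in> Basis"
  shows "norm (inv_fourier (partial_deriv b f) \<xi>) = \<bar>\<xi> \<bullet> b\<bar> * norm (inv_fourier f \<xi>)"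
  by (simp add: inv_fourier_eq fourier_of_partial_deriv[OF assms] norm_mult)

text \<open>On the Fourier side, \<open>1 + (norm \<xi>)\<^sup>2\<close> is the sum of 1 and the squared symbols of the partial derivatives.\<close>

lemma sob_norm_succ:
  fixes f :: "'a::euclidean_space \<Rightarrow> complex"
  assumes f: "f \<in> schwartz"
  shows "(sob_norm (s + 1) f)\<^sup>2 = (sob_norm s f)\<^sup>2 + (\<Sum>b\<in>Basis. (sob_norm s (partial_deriv b f))\<^sup>2)"
proof -
  let ?w = "\<lambda>\<xi>. bracket (2 * s) \<xi> * (norm (inv_fourier f \<xi>))\<^sup>2"
  have pd: "bracket (2 * s) \<xi> * (norm (inv_fourier (partial_deriv b f) \<xi>))\<^sup>2 = (\<xi> \<bullet> b)\<^sup>2 * ?w \<xi>" if "b \<in> Basis" for b \<xi>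
    by (simp add: norm_inv_fourier_partial_deriv[OF f that] power_mult_distrib)
  have i: "integrable lborel (\<lambda>\<xi>. (\<xi> \<bullet> b)\<^sup>2 * ?w \<xi>)" if "b \<in> Basis" for b
    using sob_norm_sq(1)[OF schwartz_partial_deriv[OF f that], of s] unfolding pd[OF that] .
  have "bracket (2 * (s + 1)) \<xi> * (norm (inv_fourier f \<xi>))\<^sup>2 = ?w \<xi> + (\<Sum>b\<in>Basis. (\<xi> \<bullet> b)\<^sup>2 * ?w \<xi>)" for \<xi> :: 'a
  proof -
    have "bracket 2 \<xi> = 1 + (norm \<xi>)\<^sup>2"
    proof -
      have "0 < 1 + (norm \<xi>)\<^sup>2" by (simp add: add_pos_nonneg)
      thus ?thesis by (simp add: bracket_def)
    qed
    also have "(norm \<xi>)\<^sup>2 = (\<Sum>b\<in>Basis. (\<xi> \<bullet> b)\<^sup>2)"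
      unfolding power2_norm_eq_inner by (subst euclidean_inner) (simp add: power2_eq_square)
    finally have "bracket (2 * s) \<xi> * bracket 2 \<xi> = bracket (2 * s) \<xi> * (1 + (\<Sum>b\<in>Basis. (\<xi> \<bullet> b)\<^sup>2))" by simp
    hence "bracket (2 * (s + 1)) \<xi> = bracket (2 * s) \<xi> * (1 + (\<Sum>b\<in>Basis. (\<xi> \<bullet> b)\<^sup>2))"
      by (simp add: bracket_mult distrib_left)
    hence "bracket (2 * (s + 1)) \<xi> * (norm (inv_fourier f \<xi>))\<^sup>2 = ?w \<xi> * (1 + (\<Sum>b\<in>Basis. (\<xi> \<bullet> b)\<^sup>2))"
      by (simp only: mult_ac)
    thus ?thesis by (simp only: distrib_left mult_1_right sum_distrib_left mult.commute[of "?w \<xi>"])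
  qed
  hence "(sob_norm (s + 1) f)\<^sup>2 = (LINT \<xi>|lborel. ?w \<xi> + (\<Sum>b\<in>Basis. (\<xi> \<bullet> b)\<^sup>2 * ?w \<xi>))"
    unfolding sob_norm_sq(2)[OF f] by simp
  also have "\<dots> = (LINT \<xi>|lborel. ?w \<xi>) + (LINT \<xi>|lborel. (\<Sum>b\<in>Basis. (\<xi> \<bullet> b)\<^sup>2 * ?w \<xi>))"
    by (intro Bochner_Integration.integral_add sob_norm_sq(1)[OF f] Bochner_Integration.integrable_sum i)
  also have "(LINT \<xi>|lborel. (\<Sum>b\<in>Basis. (\<xi> \<bullet> b)\<^sup>2 * ?w \<xi>)) = (\<Sum>b\<in>Basis. LINT \<xi>|lborel. (\<xi> \<bullet> b)\<^sup>2 * ?w \<xi>)"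
    by (intro Bochner_Integration.integral_sum i)
  also have "\<dots> = (\<Sum>b\<in>Basis. (sob_norm s (partial_deriv b f))\<^sup>2)"
    by (intro sum.cong refl) (simp only: sob_norm_sq(2)[OF schwartz_partial_deriv[OF f]] pd)
  finally show ?thesis by (simp only: sob_norm_sq(2)[OF f])
qed

lemma sob_norm_partial_deriv:
  assumes f: "f \<in> schwartz" and b: "b \<in> Basis"
  shows "sob_norm s (partial_deriv b f) \<le> sob_norm (s + 1) f"
proof (rule power2_le_imp_le)
  have "(sob_norm s (partial_deriv b f))\<^sup>2 \<le> (\<Sum>b\<in>Basis. (sob_norm s (partial_deriv b f))\<^sup>2)"
    using b by (intro member_le_sum) auto
  also have "\<dots> \<le> (sob_norm (s + 1) f)\<^sup>2" unfolding sob_norm_succ[OF f] by simp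
  finally show "(sob_norm s (partial_deriv b f))\<^sup>2 \<le> (sob_norm (s + 1) f)\<^sup>2" .
qed (rule sob_norm_nonneg)

subsection \<open>Schwartz seminorms\<close>

lemma schwartz_seminorm_upper:
  fixes f :: "'a::euclidean_space \<Rightarrow> complex"
  assumes f: "f \<in> schwartz" and bs: "bs \<in> lists Basis" "length bs \<le> N"
  shows "(1 + norm x) ^ N * norm (iter_deriv bs f x) \<le> schwartz_seminorm N f"
proof -
  let ?I = "{bs \<in> lists (Basis::'a set). length bs \<le> N}"
  have "?I = {bs. set bs \<subseteq> Basis \<and> length bs \<le> N}" by auto
  hence fin: "finite ?I" using finite_lists_length_le[OF finite_Basis] by simp
  have "\<exists>C. \<forall>x. (1 + norm x) ^ N * norm (iter_deriv bs f x) \<le> C" if "bs \<in> lists Basis" for bs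
    using f that unfolding schwartz_iff decay_def by blast
  then obtain C where C: "\<And>bs x. bs \<in> lists Basis \<Longrightarrow> (1 + norm x) ^ N * norm (iter_deriv bs f x) \<le> C bs" by metis
  have "bdd_above ((\<lambda>(bs, x). (1 + norm x) ^ N * norm (iter_deriv bs f x)) ` (?I \<times> UNIV))"
    unfolding bdd_above_def
  proof (rule exI[of _ "Max (C ` ?I)"], rule ballI)
    fix y assume "y \<in> (\<lambda>(bs, x). (1 + norm x) ^ N * norm (iter_deriv bs f x)) ` (?I \<times> UNIV)"
    then obtain bs x where y: "y = (1 + norm x) ^ N * norm (iter_deriv bs f x)" "bs \<in> ?I" by auto
    hence "C bs \<le> Max (C ` ?I)" using fin by (intro Max_ge) auto
    thus "y \<le> Max (C ` ?I)" using C[of bs x] y by simp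
  qed
  from cSUP_upper[OF _ this, of "(bs, x)"] bs show ?thesis by (simp add: schwartz_seminorm_def)
qed

lemma schwartz_seminorm_partial_deriv:
  fixes f :: "'a::euclidean_space \<Rightarrow> complex"
  assumes f: "f \<in> schwartz" and b: "b \<in> Basis"
  shows "schwartz_seminorm N (partial_deriv b f) \<le> schwartz_seminorm (Suc N) f"
  unfolding schwartz_seminorm_def[of N]
proof (rule cSUP_least)
  show "{bs \<in> lists (Basis::'a set). length bs \<le> N} \<times> UNIV \<noteq> ({} :: ('a list \<times> 'a) set)"
  proof -
    have "([], 0) \<in> {bs \<in> lists (Basis::'a set). length bs \<le> N} \<times> (UNIV :: 'a set)" by simp
    thus ?thesis by blast
  qed
  fix p assume "p \<in> {bs \<in> lists (Basis::'a set). length bs \<le> N} \<times> (UNIV :: 'a set)"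
  then obtain bs x where p: "p = (bs, x)" "bs \<in> lists Basis" "length bs \<le> N" by auto
  have "(1 + norm x) ^ N * norm (iter_deriv bs (partial_deriv b f) x) \<le> (1 + norm x) ^ Suc N * norm (iter_deriv (bs @ [b]) f x)"
    unfolding iter_deriv_snoc by (intro mult_right_mono power_increasing) auto
  also have "\<dots> \<le> schwartz_seminorm (Suc N) f"
    using p b by (intro schwartz_seminorm_upper f) auto
  finally show "(case p of (bs, x) \<Rightarrow> (1 + norm x) ^ N * norm (iter_deriv bs (partial_deriv b f) x)) \<le> schwartz_seminorm (Suc N) f"
    by (simp add: p)
qed

lemma L2_norm_le_seminorm:
  "\<exists>C\<ge>0. \<forall>f\<in>(schwartz :: ('a::euclidean_space \<Rightarrow> complex) set). L2_norm f \<le> C * schwartz_seminorm (2 * DIM('a)) f"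
proof (intro exI conjI ballI)
  let ?k = "\<lambda>x::'a. inverse ((1 + norm x) ^ (2 * DIM('a)))"
  let ?C = "sqrt (LINT x|lborel. ?k x)"
  have kpos: "0 \<le> ?k x" for x :: 'a by simp
  show "0 \<le> ?C" by (simp add: integral_nonneg_AE)
  fix f :: "'a \<Rightarrow> complex" assume f: "f \<in> schwartz"
  let ?S = "schwartz_seminorm (2 * DIM('a)) f"
  have le: "(1 + norm x) ^ (2 * DIM('a)) * norm (f x) \<le> ?S" for x
    using schwartz_seminorm_upper[OF f, of "[]" "2 * DIM('a)" x] by simp
  have S0: "0 \<le> ?S" by (rule order_trans[OF _ le[of 0]]) simp
  have "(norm (f x))\<^sup>2 \<le> ?S\<^sup>2 * ?k x" for x
  proof -
    have p: "1 \<le> (1 + norm x) ^ (2 * DIM('a))" by (rule one_le_power) simp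
    have "norm (f x) \<le> ?S * ?k x"
    proof -
      have "0 < (1 + norm x) ^ (2 * DIM('a))" using p by linarith
      thus ?thesis using le[of x] by (simp only: divide_inverse[symmetric] pos_le_divide_eq mult.commute)
    qed
    moreover have "norm (f x) \<le> ?S"
      by (rule order_trans[OF _ le[of x]]) (use p in \<open>simp add: mult_le_cancel_right1\<close>)
    ultimately have "norm (f x) * norm (f x) \<le> ?S * (?S * ?k x)" using S0 by (intro mult_mono) auto
    thus ?thesis by (simp add: power2_eq_square mult_ac)
  qed
  hence "(LINT x|lborel. (norm (f x))\<^sup>2) \<le> (LINT x|lborel. ?S\<^sup>2 * ?k x)"
    using L2_integrable[OF schwartz_L2[OF f]] integrable_decay_kernel by (intro integral_mono) auto
  hence "(L2_norm f)\<^sup>2 \<le> ?S\<^sup>2 * (LINT x|lborel. ?k x)" by (simp add: L2_norm_sq)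
  also have "\<dots> = (?C * ?S)\<^sup>2" by (simp add: power_mult_distrib integral_nonneg_AE mult.commute)
  finally show "L2_norm f \<le> ?C * ?S" using S0 by (intro power2_le_imp_le[of "L2_norm f"]) (simp_all add: integral_nonneg_AE)
qed

text \<open>This makes functionals that are bounded in a Sobolev norm continuous on the Schwartz space. The order is an integer because the induction
  proceeds by adding derivatives.\<close>

lemma sob_norm_le_seminorm:
  "\<exists>C\<ge>0. \<exists>N. \<forall>f\<in>(schwartz :: ('a::euclidean_space \<Rightarrow> complex) set). sob_norm (real m) f \<le> C * schwartz_seminorm N f"
proof (induction m)
  case 0
  show ?case using L2_norm_le_seminorm[where 'a='a] by (auto simp: sob_norm_0)
next
  case (Suc m)
  then obtain C N where C: "0 \<le> C" and le: "\<And>f :: 'a \<Rightarrow> complex. f \<in> schwartz \<Longrightarrow> sob_norm (real m) f \<le> C * schwartz_seminorm N f"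
    by blast
  have mono: "schwartz_seminorm N f \<le> schwartz_seminorm (Suc N) f" if f: "f \<in> schwartz" for f :: "'a \<Rightarrow> complex"
    unfolding schwartz_seminorm_def[of N]
  proof (rule cSUP_least)
    show "{bs \<in> lists (Basis::'a set). length bs \<le> N} \<times> UNIV \<noteq> ({} :: ('a list \<times> 'a) set)"
    proof -
      have "([], 0) \<in> {bs \<in> lists (Basis::'a set). length bs \<le> N} \<times> (UNIV :: 'a set)" by simp
      thus ?thesis by blast
    qed
    fix p assume "p \<in> {bs \<in> lists (Basis::'a set). length bs \<le> N} \<times> (UNIV :: 'a set)"
    then obtain bs x where p: "p = (bs, x)" "bs \<in> lists Basis" "length bs \<le> N" by auto
    have "(1 + norm x) ^ N * norm (iter_deriv bs f x) \<le> (1 + norm x) ^ Suc N * norm (iter_deriv bs f x)"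
      by (intro mult_right_mono power_increasing) auto
    also have "\<dots> \<le> schwartz_seminorm (Suc N) f"
      using p by (intro schwartz_seminorm_upper f) auto
    finally show "(case p of (bs, x) \<Rightarrow> (1 + norm x) ^ N * norm (iter_deriv bs f x)) \<le> schwartz_seminorm (Suc N) f"
      by (simp add: p)
  qed
  have "sob_norm (real (Suc m)) f \<le> (C * (1 + DIM('a))) * schwartz_seminorm (Suc N) f" if f: "f \<in> schwartz" for f :: "'a \<Rightarrow> complex"
  proof -
    let ?T = "schwartz_seminorm (Suc N) f"
    have a: "sob_norm (real m) f \<le> C * ?T" using le[OF f] mult_left_mono[OF mono[OF f] C] by linarith
    have b: "sob_norm (real m) (partial_deriv b f) \<le> C * ?T" if "b \<in> Basis" for b
      using le[OF schwartz_partial_deriv[OF f that]] mult_left_mono[OF schwartz_seminorm_partial_deriv[OF f that] C, of N] by linarith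
    have T: "0 \<le> C * ?T" using a sob_norm_nonneg[of "real m" f] by linarith
    have "(sob_norm (real m + 1) f)\<^sup>2 \<le> (C * ?T)\<^sup>2 + (\<Sum>b\<in>(Basis::'a set). (C * ?T)\<^sup>2)"
      unfolding sob_norm_succ[OF f] by (intro add_mono sum_mono power_mono a b sob_norm_nonneg)
    also have "\<dots> = (1 + DIM('a)) * (C * ?T)\<^sup>2" by (simp add: algebra_simps)
    also have "\<dots> \<le> (1 + DIM('a))\<^sup>2 * (C * ?T)\<^sup>2"
      by (intro mult_right_mono) (auto simp: power2_eq_square)
    also have "\<dots> = ((1 + DIM('a)) * (C * ?T))\<^sup>2" by (simp only: power_mult_distrib of_nat_power)
    finally have "sob_norm (real m + 1) f \<le> (1 + DIM('a)) * (C * ?T)"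
      by (rule power2_le_imp_le) (use T in simp)
    thus ?thesis by (simp add: mult_ac add.commute)
  qed
  moreover have "0 \<le> C * (1 + real DIM('a))" using C by simp
  ultimately show ?case by (metis of_nat_1 of_nat_add)
qed

section \<open>Bessel potential spaces and square integrable functions\<close>

lemma bessel_potential_eq: "bessel_potential s u = (\<lambda>\<phi>\<in>schwartz. u (bessel_op s \<phi>))"
proof (rule ext)
  fix \<phi> :: "'a \<Rightarrow> complex"
  show "bessel_potential s u \<phi> = (\<lambda>\<phi>\<in>schwartz. u (bessel_op s \<phi>)) \<phi>"
  proof (cases "\<phi> \<in> schwartz")
    case True
    hence "inv_fourier \<phi> \<in> schwartz" "(\<lambda>\<xi>. bracket s \<xi> *\<^sub>R inv_fourier \<phi> \<xi>) \<in> schwartz"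
      by (simp_all add: schwartz_inv_fourier schwartz_bracket)
    thus ?thesis using True unfolding bracket_def
      by (simp add: bessel_potential_def inv_fourier_dist_def mult_dist_def fourier_dist_def bessel_op_def bracket_def)
  qed (simp add: bessel_potential_def inv_fourier_dist_def)
qed

text \<open>The distribution whose Bessel potential of order \<open>s\<close> is the function \<open>w\<close>.\<close>

definition dist_of_density :: "real \<Rightarrow> ('a::euclidean_space \<Rightarrow> complex) \<Rightarrow> 'a functional" where
  "dist_of_density s w = (\<lambda>\<phi>\<in>schwartz. LINT x|lborel. w x * bessel_op (- s) \<phi> x)"

lemma bessel_potential_dist_of_density:
  "bessel_potential s (dist_of_density s w) = dist_of_fun w"
proof (rule ext)
  fix \<phi> :: "'a \<Rightarrow> complex"
  show "bessel_potential s (dist_of_density s w) \<phi> = dist_of_fun w \<phi>"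
  proof (cases "\<phi> \<in> schwartz")
    case True
    hence "bessel_op (- s) (bessel_op s \<phi>) = \<phi>" using bessel_op_inverse[of \<phi> "- s"] by simp
    with True show ?thesis
      by (simp add: bessel_potential_eq dist_of_density_def dist_of_fun_def schwartz_bessel_op)
  qed (simp add: bessel_potential_eq dist_of_fun_def)
qed

lemma dist_of_density_tempered:
  fixes w :: "'a::euclidean_space \<Rightarrow> complex"
  assumes w: "w \<in> L2" shows "dist_of_density s w \<in> tempered"
proof -
  have lin: "dist_of_density s w (\<lambda>x. a * \<phi> x + b * \<psi> x) = a * dist_of_density s w \<phi> + b * dist_of_density s w \<psi>"
    if p: "\<phi> \<in> schwartz" "\<psi> \<in> schwartz" for \<phi> \<psi> a b
  proof -
    have "bessel_op (- s) (\<lambda>x. a * \<phi> x + b * \<psi> x) = (\<lambda>x. a * bessel_op (- s) \<phi> x + b * bessel_op (- s) \<psi> x)"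
      using bessel_op_add[OF schwartz_cmult[OF p(1)] schwartz_cmult[OF p(2)]] by (simp add: bessel_op_cmult)
    moreover have "integrable lborel (\<lambda>x. w x * bessel_op (- s) f x)" if "f \<in> schwartz" for f
      using L2_mult_integrable(1)[OF w schwartz_L2[OF schwartz_bessel_op[OF that]]] .
    ultimately show ?thesis using p
      by (simp add: dist_of_density_def schwartz_add schwartz_cmult distrib_left mult.left_commute[of "w _"])
  qed
  obtain C N where C: "0 \<le> C" and le: "\<And>f :: 'a \<Rightarrow> complex. f \<in> schwartz \<Longrightarrow> sob_norm (real (nat \<lceil>\<bar>s\<bar>\<rceil>)) f \<le> C * schwartz_seminorm N f"
    using sob_norm_le_seminorm[where 'a='a, of "nat \<lceil>\<bar>s\<bar>\<rceil>"] by blast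
  have "norm (dist_of_density s w \<phi>) \<le> (L2_norm w * C) * schwartz_seminorm N \<phi>" if p: "\<phi> \<in> schwartz" for \<phi>
  proof -
    have "norm (dist_of_density s w \<phi>) \<le> L2_norm w * sob_norm (- s) \<phi>"
      using norm_integral_mult_le[OF w schwartz_L2[OF schwartz_bessel_op[OF p]], of "- s"] p
      by (simp add: dist_of_density_def L2_norm_bessel_op)
    also have "\<dots> \<le> L2_norm w * (C * schwartz_seminorm N \<phi>)"
    proof (rule mult_left_mono)
      have "- s \<le> real (nat \<lceil>\<bar>s\<bar>\<rceil>)" by linarith
      from sob_norm_mono[OF p this] le[OF p] show "sob_norm (- s) \<phi> \<le> C * schwartz_seminorm N \<phi>" by linarith
    qed (rule L2_norm_nonneg)
    finally show ?thesis by (simp add: mult_ac)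
  qed
  moreover have "dist_of_density s w \<in> extensional schwartz" by (simp add: dist_of_density_def)
  ultimately show ?thesis unfolding tempered_def using lin by blast
qed

lemma dist_of_density_bessel_space: "w \<in> L2 \<Longrightarrow> dist_of_density s w \<in> bessel_space s"
  unfolding bessel_space_def using dist_of_density_tempered bessel_potential_dist_of_density by blast

section \<open>Smooth cutoff functions\<close>

subsection \<open>A bump function\<close>

text \<open>The negative powers in front of the exponential occur in the derivatives of \<open>exp (- inverse t)\<close>; with them the family is closed under differentiation.\<close>

definition flat :: "nat \<Rightarrow> real \<Rightarrow> real" where
  "flat k t = (if 0 < t then inverse t ^ k / exp (inverse t) else 0)"

lemma flat_tendsto_0: "((\<lambda>t. flat k t) \<longlongrightarrow> 0) (at_right 0)"
proof -
  have "((\<lambda>t. inverse t ^ k / exp (inverse t)) \<longlongrightarrow> (0::real)) (at_right 0)"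
    by (rule filterlim_compose[OF tendsto_power_div_exp_0 filterlim_inverse_at_top_right])
  moreover have "\<forall>\<^sub>F t in at_right (0::real). inverse t ^ k / exp (inverse t) = flat k t"
    unfolding eventually_at_right_field by (rule exI[of _ 1]) (simp add: flat_def)
  ultimately show ?thesis by (rule Lim_transform_eventually)
qed

lemma flat_DERIV: "(flat k has_real_derivative (- real k * flat (Suc k) t + flat (k + 2) t)) (at t)"
proof -
  consider "t > 0" | "t < 0" | "t = 0" by linarith
  thus ?thesis
  proof cases
    case 1
    have "((\<lambda>t. inverse t ^ k * exp (- inverse t)) has_real_derivative
      (- real k * (inverse t ^ Suc k * exp (- inverse t)) + inverse t ^ (k + 2) * exp (- inverse t))) (at t)"
    proof (cases k)
      case 0
      show ?thesis unfolding 0 using 1 by (auto intro!: derivative_eq_intros simp: power2_eq_square)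
    next
      case (Suc j)
      show ?thesis unfolding Suc using 1
        by (auto intro!: derivative_eq_intros simp: power2_eq_square algebra_simps) (cases j; simp)
    qed
    hence "((\<lambda>t. inverse t ^ k * exp (- inverse t)) has_real_derivative
      (- real k * flat (Suc k) t + flat (k + 2) t)) (at t)"
      using 1 by (simp add: flat_def exp_minus divide_inverse)
    thus ?thesis
      by (rule has_field_derivative_transform_within_open[where S="{0<..}"])
        (use 1 in \<open>auto simp: flat_def exp_minus divide_inverse\<close>)
  next
    case 2
    have "((\<lambda>t. 0) has_real_derivative 0) (at t)" by simp
    hence "(flat k has_real_derivative 0) (at t)"
      by (rule has_field_derivative_transform_within_open[where S="{..<0}"])
        (use 2 in \<open>auto simp: flat_def\<close>)
    thus ?thesis using 2 by (simp add: flat_def)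
  next
    case 3
    have r: "((\<lambda>t. (flat k t - flat k 0) / (t - 0)) \<longlongrightarrow> 0) (at_right 0)"
    proof (rule Lim_transform_eventually[OF flat_tendsto_0[of "Suc k"]])
      show "\<forall>\<^sub>F t in at_right 0. flat (Suc k) t = (flat k t - flat k 0) / (t - 0)"
        unfolding eventually_at_right_field by (rule exI[of _ 1]) (simp add: flat_def divide_inverse)
    qed
    have l: "((\<lambda>t. (flat k t - flat k 0) / (t - 0)) \<longlongrightarrow> 0) (at_left 0)"
    proof (rule Lim_transform_eventually[OF tendsto_const])
      show "\<forall>\<^sub>F t in at_left 0. 0 = (flat k t - flat k 0) / (t - 0)"
        unfolding eventually_at_left_field by (rule exI[of _ "-1"]) (simp add: flat_def)
    qed
    have "(flat k has_real_derivative 0) (at 0)"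
      unfolding has_field_derivative_iff using l r by (simp add: filterlim_split_at)
    thus ?thesis using 3 by (simp add: flat_def)
  qed
qed

definition bumps :: "('a::euclidean_space \<Rightarrow> complex) set" where
  "bumps = range (\<lambda>k x. complex_of_real (flat k (1 - (norm x)\<^sup>2)))"

lemma bumps_deriv:
  fixes f :: "'a::euclidean_space \<Rightarrow> complex"
  assumes "f \<in> bumps"
  shows "f differentiable (at x)" "partial_deriv b f \<in> polynomial_span bumps"
proof -
  from assms obtain k where f: "f = (\<lambda>x. complex_of_real (flat k (1 - (norm x)\<^sup>2)))"
    unfolding bumps_def by blast
  let ?D = "\<lambda>t. - real k * flat (Suc k) t + flat (k + 2) t"
  have d: "((\<lambda>x. complex_of_real (flat k (1 - (norm x)\<^sup>2))) has_derivative
      (\<lambda>h. complex_of_real (?D (1 - (norm x)\<^sup>2) * (- 2 * (h \<bullet> x))))) (at x)" for x :: 'a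
  proof -
    have "((\<lambda>x. 1 - x \<bullet> x) has_derivative (\<lambda>h. - 2 * (h \<bullet> x))) (at x)"
      by (auto intro!: derivative_eq_intros simp: inner_commute fun_eq_iff)
    from has_derivative_of_real[OF has_derivative_compose[OF this flat_DERIV[unfolded has_field_derivative_def]], where 'a=complex]
    show ?thesis unfolding power2_norm_eq_inner .
  qed
  have "partial_deriv b f = (\<lambda>x. complex_of_real (2 * real k) * (complex_of_real (x \<bullet> b) * complex_of_real (flat (Suc k) (1 - (norm x)\<^sup>2))) +
      complex_of_real (- 2) * (complex_of_real (x \<bullet> b) * complex_of_real (flat (k + 2) (1 - (norm x)\<^sup>2))))"
    unfolding f partial_deriv_eqI[OF d] by (simp add: inner_commute algebra_simps fun_eq_iff)
  moreover have "(\<lambda>x::'a. complex_of_real (flat j (1 - (norm x)\<^sup>2))) \<in> polynomial_span bumps" for j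
    by (rule polynomial_span.base) (auto simp: bumps_def)
  ultimately show "partial_deriv b f \<in> polynomial_span bumps"
    by (simp only:) (intro polynomial_span.add polynomial_span.cmult polynomial_span.coord)
  show "f differentiable (at x)" unfolding f using d differentiable_def by blast
qed

lemma smooth_bump: "smooth (\<lambda>x. complex_of_real (flat 0 (1 - (norm x)\<^sup>2)))"
proof (rule smooth_coinduct[where S="polynomial_span bumps"])
  show "(\<lambda>x. complex_of_real (flat 0 (1 - (norm x)\<^sup>2))) \<in> polynomial_span bumps"
    by (rule polynomial_span.base) (auto simp: bumps_def)
qed (use polynomial_span_deriv[OF _ bumps_deriv] in blast)+

lemma partial_deriv_eq_0:
  assumes "open X" "x \<in> X" "\<And>y. y \<in> X \<Longrightarrow> f y = 0"
  shows "partial_deriv b f x = 0"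
proof -
  have "((\<lambda>y. 0) has_derivative (\<lambda>h. 0)) (at x)" by simp
  hence "(f has_derivative (\<lambda>h. 0)) (at x)"
    by (rule has_derivative_transform_within_open[OF _ assms(1,2)]) (use assms(3) in simp)
  from frechet_derivative_at[OF this] show ?thesis by (simp add: partial_deriv_def fun_eq_iff)
qed

lemma schwartz_compact_support:
  fixes f :: "'a::euclidean_space \<Rightarrow> complex"
  assumes f: "smooth f" "\<And>x. R < norm x \<Longrightarrow> f x = 0"
  shows "f \<in> schwartz"
proof (rule schwartz_coinduct[where S="{f. smooth f \<and> (\<forall>x. R < norm x \<longrightarrow> f x = 0)}"])
  fix g assume g: "g \<in> {f::'a \<Rightarrow> complex. smooth f \<and> (\<forall>x. R < norm x \<longrightarrow> f x = 0)}"
  show "g differentiable (at x)" for x using g smooth_differentiable by blast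
  show "partial_deriv b g \<in> {f::'a \<Rightarrow> complex. smooth f \<and> (\<forall>x. R < norm x \<longrightarrow> f x = 0)}" if "b \<in> Basis" for b
  proof -
    have "partial_deriv b g x = 0" if "R < norm x" for x
    proof (rule partial_deriv_eq_0[where X="{x. R < norm x}"])
      show "open {x::'a. R < norm x}" by (intro open_Collect_less continuous_intros)
    qed (use g that in auto)
    thus ?thesis using g smooth_partial_deriv that by blast
  qed
  show "decay g" unfolding decay_def
  proof
    fix N
    have "continuous_on (cball 0 R) (\<lambda>x. (1 + norm x) ^ N * norm (g x))"
      using g by (intro continuous_intros smooth_continuous_on) auto
    hence "bounded ((\<lambda>x. (1 + norm x) ^ N * norm (g x)) ` cball 0 R)"
      by (intro compact_imp_bounded compact_continuous_image compact_cball)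
    then obtain C where "\<forall>y\<in>(\<lambda>x. (1 + norm x) ^ N * norm (g x)) ` cball 0 R. norm y \<le> C"
      unfolding bounded_iff by blast
    hence C: "\<bar>(1 + norm x) ^ N * norm (g x)\<bar> \<le> C" if "x \<in> cball 0 R" for x using that by simp
    have "(1 + norm x) ^ N * norm (g x) \<le> max C 0" for x
      using C[of x] g by (cases "norm x \<le> R") auto
    thus "\<exists>C. \<forall>x. (1 + norm x) ^ N * norm (g x) \<le> C" by blast
  qed
qed (use f in auto)

lemma test_functions_schwartz: "test_functions \<Omega> \<subseteq> schwartz"
proof
  fix f assume f: "f \<in> test_functions \<Omega>"
  hence "bounded (closure {x. f x \<noteq> 0})" by (auto simp: test_functions_def compact_imp_bounded)
  then obtain R where R: "\<And>x. x \<in> closure {x. f x \<noteq> 0} \<Longrightarrow> norm x \<le> R" unfolding bounded_iff by blast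
  have "f x = 0" if "R < norm x" for x using R[of x] closure_subset[of "{x. f x \<noteq> 0}"] that by force
  thus "f \<in> schwartz" using f schwartz_compact_support[of f R] by (auto simp: test_functions_def)
qed

lemma mollifier_exists:
  "\<exists>\<rho> :: 'a::euclidean_space \<Rightarrow> real. (\<lambda>x. complex_of_real (\<rho> x)) \<in> schwartz \<and> (\<forall>x. 0 \<le> \<rho> x) \<and>
    (\<forall>x. 1 \<le> norm x \<longrightarrow> \<rho> x = 0) \<and> (LINT x|lborel. \<rho> x) = 1"
proof -
  define f where "f x = flat 0 (1 - (norm x)\<^sup>2)" for x :: 'a
  have f0: "0 \<le> f x" for x by (simp add: f_def flat_def)
  have fz: "f x = 0 \<longleftrightarrow> 1 \<le> norm x" for x
  proof -
    have "(norm x)\<^sup>2 < 1 \<longleftrightarrow> norm x < 1" using power2_less_imp_less[of "norm x" 1] power_strict_mono[of "norm x" 1 2] by auto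
    thus ?thesis by (auto simp: f_def flat_def)
  qed
  have fS: "(\<lambda>x. complex_of_real (f x)) \<in> schwartz"
    by (rule schwartz_compact_support[where R=1]) (use smooth_bump fz in \<open>auto simp: f_def\<close>)
  have fi: "integrable lborel f" using schwartz_integrable[OF fS] by (simp add: complex_of_real_integrable_eq)
  have "(LINT x|lborel. f x) \<noteq> 0"
  proof
    assume "(LINT x|lborel. f x) = 0"
    hence "AE x in lborel. f x = 0" using integral_nonneg_eq_0_iff_AE[OF fi] f0 by simp
    hence "AE x in lborel. (x::'a) \<notin> ball 0 1" by (rule AE_mp) (intro AE_I2, simp add: fz)
    hence "emeasure lborel (ball (0::'a) 1) = 0"
      by (subst (asm) AE_iff_measurable[of "ball 0 1"]) auto
    thus False using content_ball_pos[of 1 "0::'a"] by (simp add: measure_def)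
  qed
  moreover have "0 \<le> (LINT x|lborel. f x)" using f0 by (intro integral_nonneg_AE) simp
  ultimately have I: "0 < (LINT x|lborel. f x)" by simp
  let ?I = "LINT x|lborel. f x"
  have "(\<lambda>x. complex_of_real (f x / ?I)) \<in> schwartz"
    using schwartz_cmult[OF fS, of "complex_of_real (inverse ?I)"] by (simp add: divide_inverse mult.commute)
  moreover have "(LINT x|lborel. f x / ?I) = 1" using I by simp
  ultimately show ?thesis using f0 fz I by (intro exI[of _ "\<lambda>x. f x / ?I"]) auto
qed

subsection \<open>Convolution\<close>

text \<open>The bound has to be uniform in \<open>x\<close>. Since \<open>f\<close> is itself a Fourier transform of a Schwartz function, it is an instance of the Taylor formula for
  transforms.\<close>

lemma schwartz_taylor:
  fixes f :: "'a::euclidean_space \<Rightarrow> complex"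
  assumes f: "f \<in> schwartz"
  shows "\<exists>C. \<forall>x h. norm (f (x + h) - f x - frechet_derivative f (at x) h) \<le> C * (norm h)\<^sup>2"
proof -
  let ?g = "inv_fourier f"
  have g: "?g \<in> schwartz" by (rule schwartz_inv_fourier[OF f])
  have fg: "fourier ?g = f" using fourier_inv_fourier[OF f] by (simp add: fun_eq_iff)
  have "frechet_derivative f (at x) = (\<lambda>h. fourier (\<lambda>y. - \<i> * (complex_of_real (y \<bullet> h) * ?g y)) x)" for x
    using frechet_derivative_at[OF fourier_has_derivative[OF g, of x]] unfolding fg by simp
  thus ?thesis using fourier_taylor[OF g] unfolding fg by metis
qed

lemma frechet_derivative_eq_sum:
  assumes "smooth f"
  shows "frechet_derivative f (at x) h = (\<Sum>b\<in>Basis. (h \<bullet> b) *\<^sub>R partial_deriv b f x)"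
proof -
  have lin: "linear (frechet_derivative f (at x))"
    using smooth_has_derivative[OF assms] has_derivative_linear by blast
  have "frechet_derivative f (at x) h = frechet_derivative f (at x) (\<Sum>b\<in>Basis. (h \<bullet> b) *\<^sub>R b)"
    by (simp add: euclidean_representation)
  also have "\<dots> = (\<Sum>b\<in>Basis. frechet_derivative f (at x) ((h \<bullet> b) *\<^sub>R b))" by (rule linear_sum[OF lin])
  also have "\<dots> = (\<Sum>b\<in>Basis. (h \<bullet> b) *\<^sub>R partial_deriv b f x)"
    by (simp add: linear_cmul[OF lin] partial_deriv_def)
  finally show ?thesis .
qed

lemma integrable_convolution:
  fixes g :: "'a::euclidean_space \<Rightarrow> complex"
  assumes g: "integrable lborel g" and f: "f \<in> schwartz"
  shows "integrable lborel (\<lambda>y. g y * f (x - y))"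
proof -
  obtain C where C: "\<And>x. norm (f x) \<le> C" using schwartz_bounded[OF f] by blast
  have [measurable]: "f \<in> borel_measurable borel" "g \<in> borel_measurable borel" using schwartz_measurable f g by auto
  show ?thesis
  proof (rule Bochner_Integration.integrable_bound)
    show "integrable lborel (\<lambda>y. C * norm (g y))" using g by simp
    have "norm (g y * f (x - y)) \<le> norm (C * norm (g y))" for y
    proof -
      have "norm (g y) * norm (f (x - y)) \<le> norm (g y) * C" by (intro mult_left_mono C) simp
      also have "\<dots> \<le> \<bar>C * norm (g y)\<bar>" by (simp add: mult.commute)
      finally show ?thesis by (simp add: norm_mult)
    qed
    thus "AE y in lborel. norm (g y * f (x - y)) \<le> norm (C * norm (g y))" by simp
  qed measurable
qed

lemma convolution_has_derivative:
  fixes g :: "'a::euclidean_space \<Rightarrow> complex"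
  assumes g: "integrable lborel g" and f: "f \<in> schwartz"
  shows "((\<lambda>x. LINT y|lborel. g y * f (x - y)) has_derivative
    (\<lambda>h. \<Sum>b\<in>Basis. (h \<bullet> b) *\<^sub>R (LINT y|lborel. g y * partial_deriv b f (x - y)))) (at x)"
proof -
  let ?D = "\<lambda>h. \<Sum>b\<in>Basis. (h \<bullet> b) *\<^sub>R (LINT y|lborel. g y * partial_deriv b f (x - y))"
  obtain C where C: "\<And>x h. norm (f (x + h) - f x - frechet_derivative f (at x) h) \<le> C * (norm h)\<^sup>2"
    using schwartz_taylor[OF f] by blast
  have ip: "integrable lborel (\<lambda>y. g y * partial_deriv b f (x - y))" if "b \<in> Basis" for b
    using integrable_convolution[OF g schwartz_partial_deriv[OF f that]] .
  show ?thesis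
  proof (rule has_derivative_quadratic_bound)
    show "linear ?D"
      by (rule linearI) (simp_all add: inner_add_left scaleR_add_left sum.distrib scaleR_sum_right)
    fix h
    let ?r = "\<lambda>y. f ((x - y) + h) - f (x - y) - frechet_derivative f (at (x - y)) h"
    have s: "g y * frechet_derivative f (at (x - y)) h = (\<Sum>b\<in>Basis. (h \<bullet> b) *\<^sub>R (g y * partial_deriv b f (x - y)))" for y
      unfolding frechet_derivative_eq_sum[OF schwartz_smooth[OF f]] by (simp add: sum_distrib_left)
    have iD: "integrable lborel (\<lambda>y. g y * frechet_derivative f (at (x - y)) h)"
      unfolding s using ip by (intro Bochner_Integration.integrable_sum integrable_scaleR_right) auto
    have D: "?D h = (LINT y|lborel. g y * frechet_derivative f (at (x - y)) h)"
      unfolding s using ip by (subst Bochner_Integration.integral_sum) auto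
    have i1: "integrable lborel (\<lambda>y. g y * f ((x - y) + h))"
      using integrable_convolution[OF g f, of "x + h"] by (simp add: add_diff_eq diff_add_eq)
    note i2 = integrable_convolution[OF g f, of x]
    have "(LINT y|lborel. g y * f (x + h - y)) = (LINT y|lborel. g y * f ((x - y) + h))"
      by (simp add: diff_add_eq)
    hence eq: "(LINT y|lborel. g y * f (x + h - y)) - (LINT y|lborel. g y * f (x - y)) - ?D h = (LINT y|lborel. g y * ?r y)"
      unfolding D using i1 i2 iD by (simp add: right_diff_distrib)
    have 1: "norm ((LINT y|lborel. g y * f (x + h - y)) - (LINT y|lborel. g y * f (x - y)) - ?D h) \<le> (LINT y|lborel. norm (g y * ?r y))"
      unfolding eq by (rule integral_norm_bound)
    have ir: "integrable lborel (\<lambda>y. g y * ?r y)" using i1 i2 iD by (simp add: right_diff_distrib)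
    have "(LINT y|lborel. norm (g y * ?r y)) \<le> (LINT y|lborel. (C * (norm h)\<^sup>2) * norm (g y))"
    proof (rule integral_mono)
      fix y
      have "norm (g y) * norm (?r y) \<le> norm (g y) * (C * (norm h)\<^sup>2)" by (intro mult_left_mono C) simp
      thus "norm (g y * ?r y) \<le> (C * (norm h)\<^sup>2) * norm (g y)" by (simp add: norm_mult mult.commute)
    qed (use ir g in auto)
    also have "\<dots> = (C * (LINT y|lborel. norm (g y))) * (norm h)\<^sup>2" by simp
    finally show "norm ((LINT y|lborel. g y * f (x + h - y)) - (LINT y|lborel. g y * f (x - y)) - ?D h)
      \<le> (C * (LINT y|lborel. norm (g y))) * (norm h)\<^sup>2" using 1 by linarith
  qed
qed

lemma smooth_convolution:
  fixes g :: "'a::euclidean_space \<Rightarrow> complex"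
  assumes g: "integrable lborel g" and f: "f \<in> schwartz"
  shows "smooth (\<lambda>x. LINT y|lborel. g y * f (x - y))"
proof (rule smooth_coinduct[where S="(\<lambda>f x. LINT y|lborel. g y * f (x - y)) ` schwartz"])
  fix h assume "h \<in> (\<lambda>f x. LINT y|lborel. g y * f (x - y)) ` schwartz"
  then obtain f where f: "f \<in> schwartz" "h = (\<lambda>x. LINT y|lborel. g y * f (x - y))" by blast
  note d = convolution_has_derivative[OF g f(1)]
  show "h differentiable (at x)" for x unfolding f(2) using d differentiable_def by blast
  fix b :: 'a assume b: "b \<in> Basis"
  have "(\<Sum>b'\<in>Basis. (b \<bullet> b') *\<^sub>R (LINT y|lborel. g y * partial_deriv b' f (x - y))) = (LINT y|lborel. g y * partial_deriv b f (x - y))" for x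
  proof -
    have "(\<Sum>b'\<in>Basis. (b \<bullet> b') *\<^sub>R (LINT y|lborel. g y * partial_deriv b' f (x - y))) =
      (\<Sum>b'\<in>Basis. if b' = b then (LINT y|lborel. g y * partial_deriv b' f (x - y)) else 0)"
      using b by (intro sum.cong refl) (simp add: inner_Basis)
    thus ?thesis using b by simp
  qed
  hence "partial_deriv b h = (\<lambda>x. LINT y|lborel. g y * partial_deriv b f (x - y))"
    unfolding f(2) partial_deriv_eqI[OF d] by simp
  thus "partial_deriv b h \<in> (\<lambda>f x. LINT y|lborel. g y * f (x - y)) ` schwartz"
    using schwartz_partial_deriv[OF f(1) b] by blast
qed (use f in blast)

subsection \<open>Mollified indicator functions\<close>

definition mollifier :: "'a::euclidean_space \<Rightarrow> real" where
  "mollifier = (SOME \<rho>. (\<lambda>x. complex_of_real (\<rho> x)) \<in> schwartz \<and> (\<forall>x. 0 \<le> \<rho> x) \<and>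
    (\<forall>x. 1 \<le> norm x \<longrightarrow> \<rho> x = 0) \<and> (LINT x|lborel. \<rho> x) = 1)"

lemma mollifier:
  shows mollifier_schwartz: "(\<lambda>x::'a::euclidean_space. complex_of_real (mollifier x)) \<in> schwartz"
    and mollifier_nonneg: "0 \<le> mollifier (x::'a)"
    and mollifier_eq_0: "1 \<le> norm x \<Longrightarrow> mollifier (x::'a) = 0"
    and mollifier_integral: "(LINT x::'a|lborel. mollifier x) = 1"
  using someI_ex[OF mollifier_exists[where 'a='a]] unfolding mollifier_def[symmetric] by auto

lemma mollifier_integrable: "integrable lborel (mollifier :: 'a::euclidean_space \<Rightarrow> real)"
  using schwartz_integrable[OF mollifier_schwartz] by (simp add: complex_of_real_integrable_eq)

lemma mollifier_measurable[measurable]: "(mollifier :: 'a::euclidean_space \<Rightarrow> real) \<in> borel_measurable borel"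
  using mollifier_integrable by auto

text \<open>The convolution of the indicator function of \<open>E\<close> with the mollifier of width \<open>\<epsilon>\<close>. In this form, with the translation and the dilation
  inside the indicator function, it makes sense for unbounded \<open>E\<close> as well.\<close>

definition cutoff :: "'a::euclidean_space set \<Rightarrow> real \<Rightarrow> 'a \<Rightarrow> real" where
  "cutoff E \<epsilon> x = (LINT z|lborel. indicator E (x - \<epsilon> *\<^sub>R z) * mollifier z)"

lemma cutoff_integrable:
  assumes [measurable]: "E \<in> sets borel"
  shows "integrable lborel (\<lambda>z. indicator E (x - \<epsilon> *\<^sub>R z) * mollifier z)"
  by (rule Bochner_Integration.integrable_bound[OF mollifier_integrable])
    (auto simp: indicator_def)

lemma cutoff_bounds:
  assumes "E \<in> sets borel"
  shows "0 \<le> cutoff E \<epsilon> x" "cutoff E \<epsilon> x \<le> 1"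
proof -
  show "0 \<le> cutoff E \<epsilon> x" unfolding cutoff_def
    by (intro integral_nonneg_AE AE_I2) (simp add: mollifier_nonneg indicator_def)
  have "cutoff E \<epsilon> x \<le> (LINT z::'a|lborel. mollifier z)" unfolding cutoff_def
    by (intro integral_mono cutoff_integrable assms mollifier_integrable) (simp add: mollifier_nonneg indicator_def)
  thus "cutoff E \<epsilon> x \<le> 1" by (simp add: mollifier_integral)
qed

lemma cutoff_eq_1:
  assumes "0 < \<epsilon>" "ball x \<epsilon> \<subseteq> E" shows "cutoff E \<epsilon> x = 1"
proof -
  have "indicator E (x - \<epsilon> *\<^sub>R z) * mollifier z = mollifier z" for z
  proof (cases "norm z < 1")
    case True
    have "\<epsilon> * norm z < \<epsilon> * 1" using True assms(1) by (intro mult_strict_left_mono)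
    hence "x - \<epsilon> *\<^sub>R z \<in> ball x \<epsilon>" using assms(1) by (simp add: dist_norm)
    hence "indicator E (x - \<epsilon> *\<^sub>R z) = (1 :: real)" using assms(2) by (auto simp: indicator_def simp del: mem_ball)
    thus ?thesis by simp
  qed (simp add: mollifier_eq_0)
  thus ?thesis unfolding cutoff_def by (simp only: mollifier_integral)
qed

lemma cutoff_eq_0:
  assumes "0 < \<epsilon>" "ball x \<epsilon> \<inter> E = {}" shows "cutoff E \<epsilon> x = 0"
proof -
  have "indicator E (x - \<epsilon> *\<^sub>R z) * mollifier z = 0" for z
  proof (cases "norm z < 1")
    case True
    have "\<epsilon> * norm z < \<epsilon> * 1" using True assms(1) by (intro mult_strict_left_mono)
    hence "x - \<epsilon> *\<^sub>R z \<in> ball x \<epsilon>" using assms(1) by (simp add: dist_norm)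
    hence "indicator E (x - \<epsilon> *\<^sub>R z) = (0 :: real)" using assms(2) by (auto simp: indicator_def simp del: mem_ball)
    thus ?thesis by simp
  qed (simp add: mollifier_eq_0)
  thus ?thesis unfolding cutoff_def by (simp only: integral_zero)
qed

lemma cutoff_smooth:
  fixes E :: "'a::euclidean_space set"
  assumes E[measurable]: "E \<in> sets borel" and "bounded E" and \<epsilon>: "0 < \<epsilon>"
  shows "smooth (\<lambda>x. complex_of_real (cutoff E \<epsilon> x))"
proof -
  let ?g = "\<lambda>y::'a. complex_of_real (indicator E y)"
  define f where "f x = complex_of_real (inverse (\<epsilon> ^ DIM('a))) * complex_of_real (mollifier (inverse \<epsilon> *\<^sub>R x + 0))" for x :: 'a
  have f: "f \<in> schwartz" unfolding f_def
    using \<epsilon> by (intro schwartz_cmult schwartz_affine[OF mollifier_schwartz]) simp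
  have [measurable]: "f \<in> borel_measurable borel" using schwartz_measurable[OF f] .
  have "emeasure lborel E < \<infinity>" using emeasure_bounded_finite[OF \<open>bounded E\<close>] by simp
  hence g: "integrable lborel ?g" by (intro integrable_of_real integrable_real_indicator) auto
  have "(LINT y|lborel. ?g y * f (x - y)) = complex_of_real (cutoff E \<epsilon> x)" for x
  proof -
    have "(LINT y|lborel. ?g y * f (x - y)) = \<bar>- \<epsilon>\<bar> ^ DIM('a) *\<^sub>R (LINT y|lborel. ?g (x + (- \<epsilon>) *\<^sub>R y) * f (x - (x + (- \<epsilon>) *\<^sub>R y)))"
      using \<epsilon> by (intro integral_affine) auto
    also have "\<dots> = (LINT y|lborel. \<bar>- \<epsilon>\<bar> ^ DIM('a) *\<^sub>R (?g (x + (- \<epsilon>) *\<^sub>R y) * f (x - (x + (- \<epsilon>) *\<^sub>R y))))"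
      by (rule integral_scaleR_right[symmetric])
    also have "\<dots> = (LINT y|lborel. complex_of_real (indicator E (x - \<epsilon> *\<^sub>R y) * mollifier y))"
      using \<epsilon> by (intro Bochner_Integration.integral_cong refl) (simp add: f_def scaleR_conv_of_real)
    finally show ?thesis by (simp only: cutoff_def integral_complex_of_real)
  qed
  thus ?thesis using smooth_convolution[OF g f] by simp
qed

text \<open>For \<open>t \<le> 1\<close> the difference is at most a derivative bound times \<open>t\<close> and vanishes off the ball of radius 2; for
  larger \<open>t\<close> it suffices that both functions have integral 1.\<close>

lemma mollifier_translate_L1:
  "\<exists>M\<ge>1. \<forall>b\<in>(Basis::'a::euclidean_space set). \<forall>t>0. (LINT z::'a|lborel. \<bar>mollifier (z + t *\<^sub>R b) - mollifier z\<bar>) \<le> M * t"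
proof -
  have sm: "smooth (\<lambda>x::'a. complex_of_real (mollifier x))" using schwartz_smooth[OF mollifier_schwartz] .
  have "\<exists>B. \<forall>x. norm (partial_deriv b (\<lambda>x::'a. complex_of_real (mollifier x)) x) \<le> B" if "b \<in> Basis" for b :: 'a
    using schwartz_bounded[OF schwartz_partial_deriv[OF mollifier_schwartz that]] .
  then obtain B where B: "\<And>b x. b \<in> Basis \<Longrightarrow> norm (partial_deriv b (\<lambda>x::'a. complex_of_real (mollifier x)) x) \<le> B b" by metis
  define L where "L = Max (B ` Basis)"
  have L: "norm (partial_deriv b (\<lambda>x::'a. complex_of_real (mollifier x)) x) \<le> L" if "b \<in> Basis" for b x
  proof -
    have "B b \<le> L" unfolding L_def using that by (intro Max_ge) auto
    thus ?thesis using B[OF that, of x] by linarith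
  qed
  obtain b0 :: 'a where b0: "b0 \<in> Basis" using nonempty_Basis by blast
  have L0: "0 \<le> L" by (rule order_trans[OF norm_ge_zero L[OF b0, of 0]])
  let ?V = "measure lborel (cball (0::'a) 2)"
  define M where "M = max 2 (L * ?V)"
  have "(LINT z::'a|lborel. \<bar>mollifier (z + t *\<^sub>R b) - mollifier z\<bar>) \<le> M * t" if b: "b \<in> Basis" and t: "0 < t" for b t
  proof (cases "t \<le> 1")
    case True
    have "\<bar>mollifier (z + t *\<^sub>R b) - mollifier z\<bar> \<le> L * t * indicator (cball 0 2) z" for z
    proof (cases "norm z \<le> 2")
      case True
      have "norm (complex_of_real (mollifier (z + t *\<^sub>R b)) - complex_of_real (mollifier z)) \<le> L * t"
        using norm_diff_le_line[OF sm _ L[OF b]] t by simp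
      thus ?thesis using True by (simp flip: of_real_diff)
    next
      case False
      have "norm z \<le> norm (z + t *\<^sub>R b) + norm (t *\<^sub>R b)" using norm_triangle_ineq4[of "z + t *\<^sub>R b" "t *\<^sub>R b"] by simp
      hence "1 \<le> norm (z + t *\<^sub>R b)" using False \<open>t \<le> 1\<close> t b by simp
      thus ?thesis using False by (simp add: mollifier_eq_0)
    qed
    moreover have fin: "emeasure lborel (cball (0::'a) 2) < \<infinity>" using emeasure_bounded_finite[of "cball (0::'a) 2"] by simp
    ultimately have "(LINT z::'a|lborel. \<bar>mollifier (z + t *\<^sub>R b) - mollifier z\<bar>) \<le> (LINT z::'a|lborel. L * t * indicator (cball 0 2) z)"
      using L0 t by (intro integral_mono' integrable_mult_right integrable_real_indicator) auto
    also have "\<dots> = L * ?V * t" by simp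
    also have "\<dots> \<le> M * t" using t by (intro mult_right_mono) (auto simp: M_def)
    finally show ?thesis .
  next
    case False
    have it: "integrable lborel (\<lambda>z. mollifier (z + t *\<^sub>R b))"
      using schwartz_integrable[OF schwartz_affine[OF mollifier_schwartz, of 1 "t *\<^sub>R b"]] by (simp add: complex_of_real_integrable_eq)
    have "(LINT z::'a|lborel. \<bar>mollifier (z + t *\<^sub>R b) - mollifier z\<bar>) \<le> (LINT z::'a|lborel. mollifier (z + t *\<^sub>R b) + mollifier z)"
      using it mollifier_integrable mollifier_nonneg
      by (intro integral_mono) (auto simp: abs_le_iff add_increasing intro: order_trans[of _ 0])
    also have "\<dots> = (LINT z::'a|lborel. mollifier (z + t *\<^sub>R b)) + (LINT z::'a|lborel. mollifier z)"
      by (rule Bochner_Integration.integral_add[OF it mollifier_integrable])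
    also have "\<dots> = 2" using integral_translate[OF mollifier_measurable, of "t *\<^sub>R b"] by (simp add: mollifier_integral)
    also have "\<dots> \<le> M * t" using False mult_mono[of 2 M 1 t] by (simp add: M_def)
    finally show ?thesis .
  qed
  moreover have "1 \<le> M" by (simp add: M_def)
  ultimately show ?thesis by blast
qed

text \<open>Moving the point is the same as moving the mollifier, rescaled by \<open>1 / \<epsilon>\<close>. The indicator function enters only through its bound 1, so the constant
  is uniform over all sets.\<close>

lemma cutoff_Lipschitz:
  "\<exists>M\<ge>1. \<forall>E\<in>sets borel. \<forall>\<epsilon>>0. \<forall>b\<in>Basis. \<forall>t>0. \<forall>x::'a::euclidean_space.
    \<bar>cutoff E \<epsilon> (x + t *\<^sub>R b) - cutoff E \<epsilon> x\<bar> \<le> M * (t / \<epsilon>)"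
proof -
  obtain M where M: "1 \<le> M" "\<And>b t. b \<in> (Basis::'a set) \<Longrightarrow> 0 < t \<Longrightarrow> (LINT z::'a|lborel. \<bar>mollifier (z + t *\<^sub>R b) - mollifier z\<bar>) \<le> M * t"
    using mollifier_translate_L1[where 'a='a] by blast
  have "\<bar>cutoff E \<epsilon> (x + t *\<^sub>R b) - cutoff E \<epsilon> x\<bar> \<le> M * (t / \<epsilon>)"
    if E[measurable]: "E \<in> sets borel" and \<epsilon>: "0 < \<epsilon>" and b: "b \<in> Basis" and t: "0 < t" for E \<epsilon> b t and x :: 'a
  proof -
    let ?k = "(t / \<epsilon>) *\<^sub>R b"
    have "cutoff E \<epsilon> (x + t *\<^sub>R b) = (LINT z|lborel. indicator E (x + t *\<^sub>R b - \<epsilon> *\<^sub>R (z + ?k)) * mollifier (z + ?k))"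
      unfolding cutoff_def by (rule integral_translate[symmetric]) measurable
    also have "\<dots> = (LINT z|lborel. indicator E (x - \<epsilon> *\<^sub>R z) * mollifier (z + ?k))"
      using \<epsilon> by (simp add: scaleR_add_right)
    finally have 1: "cutoff E \<epsilon> (x + t *\<^sub>R b) = (LINT z|lborel. indicator E (x - \<epsilon> *\<^sub>R z) * mollifier (z + ?k))" .
    have it: "integrable lborel (\<lambda>z. mollifier (z + ?k))"
      using schwartz_integrable[OF schwartz_affine[OF mollifier_schwartz, of 1 ?k]] by (simp add: complex_of_real_integrable_eq)
    have i2: "integrable lborel (\<lambda>z. indicator E (x - \<epsilon> *\<^sub>R z) * mollifier (z + ?k))"
      by (rule Bochner_Integration.integrable_bound[OF it]) (auto simp: indicator_def)
    have "cutoff E \<epsilon> (x + t *\<^sub>R b) - cutoff E \<epsilon> x = (LINT z|lborel. indicator E (x - \<epsilon> *\<^sub>R z) * (mollifier (z + ?k) - mollifier z))"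
      unfolding 1 using i2 cutoff_integrable[OF E, of x \<epsilon>] by (simp add: cutoff_def right_diff_distrib)
    hence "\<bar>cutoff E \<epsilon> (x + t *\<^sub>R b) - cutoff E \<epsilon> x\<bar> \<le> (LINT z|lborel. norm (indicator E (x - \<epsilon> *\<^sub>R z) * (mollifier (z + ?k) - mollifier z)))"
      using integral_norm_bound[of lborel "\<lambda>z. indicator E (x - \<epsilon> *\<^sub>R z) * (mollifier (z + ?k) - mollifier z)"] by simp
    also have "\<dots> \<le> (LINT z|lborel. \<bar>mollifier (z + ?k) - mollifier z\<bar>)"
      using it mollifier_integrable by (intro integral_mono') (auto simp: indicator_def)
    also have "\<dots> \<le> M * (t / \<epsilon>)" using M(2)[OF b, of "t / \<epsilon>"] t \<epsilon> by simp
    finally show ?thesis .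
  qed
  thus ?thesis using M(1) by blast
qed

subsection \<open>Uniqueness of the density\<close>

text \<open>The indicator function of a compact set is the pointwise limit of mollified indicator functions of shrinking neighbourhoods, which are
  Schwartz functions.\<close>

lemma integral_compact_eq_0:
  fixes d :: "'a::euclidean_space \<Rightarrow> complex"
  assumes d: "d \<in> L2" and ortho: "\<And>\<phi>. \<phi> \<in> schwartz \<Longrightarrow> (LINT x|lborel. d x * \<phi> x) = 0" and K: "compact K"
  shows "(LINT x|lborel. d x * complex_of_real (indicator K x)) = 0"
proof (cases "K = {}")
  case False
  note [measurable] = L2_measurable[OF d]
  have cK: "closed K" "bounded K" using K compact_imp_closed compact_imp_bounded by auto
  let ?e = "\<lambda>n. 1 / real (Suc n)"
  let ?E = "\<lambda>n. {x. infdist x K \<le> ?e n}"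
  have cl: "closed (?E n)" for n by (intro closed_Collect_le continuous_intros)
  have Em: "?E n \<in> sets borel" for n using cl by auto
  obtain R where R: "\<And>x. x \<in> K \<Longrightarrow> norm x \<le> R" using cK(2) unfolding bounded_iff by blast
  have ER: "norm x \<le> R + 1" if "x \<in> ?E n" for x n
  proof -
    have "infdist x K \<le> 1" using that order_trans[of "infdist x K" "?e n" 1] by simp
    moreover obtain y where y: "y \<in> K" "infdist x K = dist x y" using infdist_attains_inf[OF cK(1) False] by blast
    ultimately have "norm (x - y) \<le> 1" by (simp add: dist_norm)
    moreover have "norm x \<le> norm (x - y) + norm y" using norm_triangle_ineq[of "x - y" y] by simp
    ultimately show ?thesis using R[OF y(1)] by linarith
  qed
  let ?c = "\<lambda>n x. complex_of_real (cutoff (?E n) (?e n) x)"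
  have sup: "?c n x = 0" if "R + 2 < norm x" for n x
  proof -
    have "ball x (?e n) \<inter> ?E n = {}"
    proof (rule ccontr)
      assume "ball x (?e n) \<inter> ?E n \<noteq> {}"
      then obtain y where y: "dist x y < ?e n" "y \<in> ?E n" by auto
      have "?e n \<le> 1" by simp
      hence "norm (x - y) \<le> 1" using y(1) by (simp only: dist_norm)
      moreover have "norm x \<le> norm (x - y) + norm y" using norm_triangle_ineq[of "x - y" y] by simp
      ultimately show False using ER[OF y(2)] that by linarith
    qed
    thus ?thesis using cutoff_eq_0[of "?e n" x "?E n"] by simp
  qed
  have sch: "?c n \<in> schwartz" for n
  proof (rule schwartz_compact_support[OF _ sup])
    have "bounded (?E n)" unfolding bounded_iff using ER by blast
    thus "smooth (?c n)" by (intro cutoff_smooth Em) simp_all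
  qed
  have lim: "(\<lambda>n. d x * ?c n x) \<longlonglongrightarrow> d x * complex_of_real (indicator K x)" for x
  proof (cases "x \<in> K")
    case True
    have "cutoff (?E n) (?e n) x = 1" for n
    proof (rule cutoff_eq_1)
      show "ball x (?e n) \<subseteq> ?E n"
      proof
        fix y assume "y \<in> ball x (?e n)"
        thus "y \<in> ?E n" using infdist_le[OF True, of y] by (simp add: dist_commute)
      qed
    qed simp
    thus ?thesis using True by simp
  next
    case nin: False
    hence pos: "0 < infdist x K" using in_closed_iff_infdist_zero[OF cK(1) False, of x] infdist_nonneg[of x K] by auto
    have "(\<lambda>n. 2 * ?e n) \<longlonglongrightarrow> 2 * 0" by (intro tendsto_intros LIMSEQ_Suc[OF lim_1_over_n])
    hence "\<forall>\<^sub>F n in sequentially. 2 * ?e n < infdist x K" using order_tendstoD(2)[OF _ pos] by simp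
    hence "\<forall>\<^sub>F n in sequentially. d x * ?c n x = d x * complex_of_real (indicator K x)"
    proof (rule eventually_mono)
      fix n assume *: "2 * ?e n < infdist x K"
      have "ball x (?e n) \<inter> ?E n = {}"
      proof (rule ccontr)
        assume "ball x (?e n) \<inter> ?E n \<noteq> {}"
        then obtain y where y: "dist x y < ?e n" "infdist y K \<le> ?e n" by auto
        have "infdist x K \<le> infdist y K + dist x y" by (rule infdist_triangle)
        thus False using y * by linarith
      qed
      thus "d x * ?c n x = d x * complex_of_real (indicator K x)" using cutoff_eq_0[of "?e n" x "?E n"] nin by simp
    qed
    thus ?thesis by (rule tendsto_eventually)
  qed
  have B: "(\<lambda>x::'a. complex_of_real (indicator (cball 0 (R + 2)) x)) \<in> L2"
  proof (rule L2_bound)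
    have "emeasure lborel (cball (0::'a) (R + 2)) < \<infinity>" using emeasure_bounded_finite[of "cball (0::'a) (R + 2)"] by simp
    thus "integrable lborel (indicator (cball (0::'a) (R + 2)) :: 'a \<Rightarrow> real)" by (intro integrable_real_indicator) auto
  qed (auto simp: indicator_def)
  have "(\<lambda>n. LINT x|lborel. d x * ?c n x) \<longlonglongrightarrow> (LINT x|lborel. d x * complex_of_real (indicator K x))"
  proof (rule integral_dominated_convergence)
    show "integrable lborel (\<lambda>x. norm (d x) * norm (complex_of_real (indicator (cball (0::'a) (R + 2)) x)))"
      by (rule L2_norm_mult_integrable[OF d B])
    show "AE x in lborel. (\<lambda>n. d x * ?c n x) \<longlonglongrightarrow> d x * complex_of_real (indicator K x)" using lim by simp
    show "AE x in lborel. norm (d x * ?c n x) \<le> norm (d x) * norm (complex_of_real (indicator (cball (0::'a) (R + 2)) x))" for n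
    proof (rule AE_I2)
      fix x
      show "norm (d x * ?c n x) \<le> norm (d x) * norm (complex_of_real (indicator (cball (0::'a) (R + 2)) x))"
        using sup[of x n] cutoff_bounds[OF Em, of n "?e n" x]
        by (cases "norm x \<le> R + 2") (auto simp: norm_mult mult_left_le)
    qed
    show "(\<lambda>x. d x * ?c n x) \<in> borel_measurable lborel" for n
      using schwartz_measurable[OF sch[of n]] by measurable
    have [measurable]: "K \<in> sets borel" using cK(1) by (rule borel_closed)
    show "(\<lambda>x. d x * complex_of_real (indicator K x)) \<in> borel_measurable lborel" by measurable
  qed
  moreover have "(LINT x|lborel. d x * ?c n x) = 0" for n by (rule ortho[OF sch])
  ultimately have "(\<lambda>n::nat. 0 :: complex) \<longlonglongrightarrow> (LINT x|lborel. d x * complex_of_real (indicator K x))" by simp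
  thus ?thesis using LIMSEQ_unique tendsto_const by blast
qed simp

text \<open>The Borel set where the real part is positive can be exhausted by compact sets, and over each of them the integral of the
  real part vanishes.\<close>

lemma AE_Re_nonpos:
  fixes d :: "'a::euclidean_space \<Rightarrow> complex"
  assumes d: "d \<in> L2" and ortho: "\<And>\<phi>. \<phi> \<in> schwartz \<Longrightarrow> (LINT x|lborel. d x * \<phi> x) = 0"
  shows "AE x in lborel. Re (d x) \<le> 0"
proof -
  note [measurable] = L2_measurable[OF d]
  define A where "A = {x. 0 < Re (d x)}"
  have A[measurable]: "A \<in> sets borel" unfolding A_def by measurable
  have comp: "emeasure lborel K = 0" if K: "compact K" "K \<subseteq> A" for K
  proof -
    have [measurable]: "K \<in> sets borel" by (rule borel_closed[OF compact_imp_closed[OF K(1)]])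
    have "emeasure lborel K < \<infinity>" using emeasure_bounded_finite[OF compact_imp_bounded[OF K(1)]] by simp
    hence iL: "integrable lborel (indicator K :: 'a \<Rightarrow> real)" by (intro integrable_real_indicator) auto
    have "(\<lambda>x::'a. complex_of_real (indicator K x)) \<in> L2"
      by (rule L2_bound[OF _ iL]) (auto simp: indicator_def)
    hence i: "integrable lborel (\<lambda>x. d x * complex_of_real (indicator K x))" using L2_mult_integrable(1)[OF d] by blast
    have "(LINT x|lborel. Re (d x * complex_of_real (indicator K x))) = 0"
      using integral_Re[OF i] integral_compact_eq_0[OF d ortho K(1)] by simp
    moreover have "0 \<le> Re (d x * complex_of_real (indicator K x))" for x using K(2) by (auto simp: indicator_def A_def)
    ultimately have "AE x in lborel. Re (d x * complex_of_real (indicator K x)) = 0"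
      using integral_nonneg_eq_0_iff_AE[OF integrable_Re[OF i]] by simp
    hence "AE x in lborel. x \<notin> K" by (rule AE_mp) (intro AE_I2, use K(2) in \<open>auto simp: A_def\<close>)
    thus ?thesis by (subst (asm) AE_iff_measurable[OF _ refl]) auto
  qed
  have clo: "emeasure lborel T = 0" if T: "closed T" "T \<subseteq> A" for T
  proof -
    have "T = (\<Union>n. T \<inter> cball 0 (real n))"
    proof -
      have "\<exists>n. norm x \<le> real n" for x :: 'a using real_arch_simple by blast
      thus ?thesis by auto
    qed
    moreover have "emeasure lborel (\<Union>n. T \<inter> cball 0 (real n)) = 0"
      using T comp[of "T \<inter> cball 0 (real n)" for n]
      by (intro emeasure_UN_eq_0) (auto intro!: comp closed_Int_compact borel_closed closed_Int)
    ultimately show ?thesis by simp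
  qed
  have small: "emeasure lborel A \<le> ennreal e" if e: "0 < e" for e
  proof -
    have Al: "A \<in> sets lebesgue" using A by auto
    obtain T where T: "closed T" "T \<subseteq> A" "emeasure lebesgue (A - T) < ennreal e"
      using sets_lebesgue_inner_closed[OF Al e] by metis
    have [measurable]: "T \<in> sets borel" using T by auto
    have "emeasure lborel A \<le> emeasure lborel (T \<union> (A - T))" by (intro emeasure_mono) auto
    also have "\<dots> \<le> emeasure lborel T + emeasure lborel (A - T)" by (intro emeasure_subadditive) auto
    also have "\<dots> \<le> ennreal e" using clo[OF T(1,2)] T(3) by simp
    finally show ?thesis .
  qed
  have "emeasure lborel A \<le> 0"
    by (rule ennreal_le_epsilon) (simp only: add_0 small)
  hence "emeasure lborel A = 0" by simp
  hence "AE x in lborel. x \<notin> A" by (subst AE_iff_measurable[OF _ refl]) auto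
  thus ?thesis by (rule AE_mp) (intro AE_I2, auto simp: A_def)
qed

text \<open>The orthogonality is preserved under multiplication by a constant; the constants 1, -1, \<open>\<i>\<close> and \<open>- \<i>\<close> give all four sign conditions.\<close>

lemma L2_ortho_schwartz_eq_0:
  fixes d :: "'a::euclidean_space \<Rightarrow> complex"
  assumes d: "d \<in> L2" and ortho: "\<And>\<phi>. \<phi> \<in> schwartz \<Longrightarrow> (LINT x|lborel. d x * \<phi> x) = 0"
  shows "AE x in lborel. d x = 0"
proof -
  have r: "AE x in lborel. Re (c * d x) \<le> 0" for c
  proof (rule AE_Re_nonpos)
    show "(\<lambda>x. c * d x) \<in> L2" by (rule L2_cmult[OF d])
    show "(LINT x|lborel. c * d x * \<phi> x) = 0" if "\<phi> \<in> schwartz" for \<phi>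
      using ortho[OF that] by (simp add: mult.assoc)
  qed
  from r[of 1] r[of "-1"] r[of \<i>] r[of "- \<i>"] show ?thesis
    by eventually_elim (auto intro: complex_eqI)
qed

lemma dist_of_fun_eq_L2_norm:
  fixes w :: "'a::euclidean_space \<Rightarrow> complex"
  assumes w: "w \<in> L2" "v \<in> L2" and eq: "dist_of_fun w = dist_of_fun v"
  shows "L2_norm w = L2_norm v"
proof -
  have "AE x in lborel. w x - v x = 0"
  proof (rule L2_ortho_schwartz_eq_0)
    show "(\<lambda>x. w x - v x) \<in> L2" by (rule L2_diff[OF w])
    fix \<phi> :: "'a \<Rightarrow> complex" assume p: "\<phi> \<in> schwartz"
    have "(LINT x|lborel. w x * \<phi> x) = (LINT x|lborel. v x * \<phi> x)"
      using fun_cong[OF eq, of \<phi>] p by (simp add: dist_of_fun_def)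
    thus "(LINT x|lborel. (w x - v x) * \<phi> x) = 0"
      using L2_mult_integrable(1)[OF w(1) schwartz_L2[OF p]] L2_mult_integrable(1)[OF w(2) schwartz_L2[OF p]]
      by (simp add: left_diff_distrib)
  qed
  note [measurable] = w[THEN L2_measurable]
  have "(LINT x|lborel. (norm (w x))\<^sup>2) = (LINT x|lborel. (norm (v x))\<^sup>2)"
    using \<open>AE x in lborel. w x - v x = 0\<close> by (intro integral_cong_AE) auto
  thus ?thesis by (simp add: L2_norm_def)
qed

lemma bessel_norm_eq:
  assumes "bessel_potential s u = dist_of_fun w" "w \<in> L2"
  shows "bessel_norm s u = L2_norm w"
proof -
  let ?v = "SOME v. v \<in> L2 \<and> bessel_potential s u = dist_of_fun v"
  have "?v \<in> L2 \<and> bessel_potential s u = dist_of_fun ?v"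
    by (rule someI[of "\<lambda>v. v \<in> L2 \<and> bessel_potential s u = dist_of_fun v" w]) (use assms in simp)
  thus ?thesis unfolding bessel_norm_def using assms dist_of_fun_eq_L2_norm[of ?v w] by simp
qed

section \<open>Fractional norms by differences\<close>

text \<open>The weight of a shift of length \<open>t\<close> in the Gagliardo seminorm along a line. It suffices to shift in one sense, as the
  opposite shift leads to the same differences at translated points.\<close>

definition kern :: "real \<Rightarrow> real \<Rightarrow> real" where
  "kern s t = (if 0 < t then t powr (- 1 - 2 * s) else 0)"

lemma kern_nonneg: "0 \<le> kern s t"
  by (simp add: kern_def)

lemma kern_measurable[measurable]: "kern s \<in> borel_measurable borel"
  unfolding kern_def[abs_def] by measurable

text \<open>The kernel is homogeneous of degree \<open>- 1 - 2 * s\<close>. This is where all powers \<open>- 2 * s\<close> of distances and \<open>2 * s\<close> of frequencies come from.\<close>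

lemma kern_scale:
  fixes h :: "real \<Rightarrow> ennreal"
  assumes [measurable]: "h \<in> borel_measurable borel" and R: "0 < R"
  shows "(\<integral>\<^sup>+t. h (t / R) * ennreal (kern s t) \<partial>lborel) = ennreal (R powr (- 2 * s)) * (\<integral>\<^sup>+t. h t * ennreal (kern s t) \<partial>lborel)"
proof -
  have k: "kern s (R * t) = R powr (- 1 - 2 * s) * kern s t" for t
    using R by (auto simp: kern_def powr_mult zero_less_mult_iff)
  have e: "h (R * t / R) * ennreal (kern s (R * t)) = ennreal (R powr (- 1 - 2 * s)) * (h t * ennreal (kern s t))" for t
    unfolding k using R by (simp add: ennreal_mult kern_nonneg mult_ac)
  have "(\<integral>\<^sup>+t. h (t / R) * ennreal (kern s t) \<partial>lborel) = ennreal \<bar>R\<bar> * (\<integral>\<^sup>+t. h ((0 + R * t) / R) * ennreal (kern s (0 + R * t)) \<partial>lborel)"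
    using R by (intro nn_integral_real_affine) auto
  also have "\<dots> = ennreal R * (ennreal (R powr (- 1 - 2 * s)) * (\<integral>\<^sup>+t. h t * ennreal (kern s t) \<partial>lborel))"
    using R by (simp only: add_0 e abs_of_pos) (subst nn_integral_cmult, auto)
  also have "\<dots> = ennreal (R * R powr (- 1 - 2 * s)) * (\<integral>\<^sup>+t. h t * ennreal (kern s t) \<partial>lborel)"
    using R by (simp add: ennreal_mult mult.assoc)
  also have "R * R powr (- 1 - 2 * s) = R powr (- 2 * s)" using R by (simp add: powr_mult_base)
  finally show ?thesis .
qed

text \<open>The largest possible energy at a single point of a function with oscillation at most 1 and Lipschitz constant \<open>M\<close>.\<close>

definition truncated_mass :: "real \<Rightarrow> real \<Rightarrow> ennreal" where
  "truncated_mass s M = (\<integral>\<^sup>+t. ennreal (min 1 ((M * t)\<^sup>2)) * ennreal (kern s t) \<partial>lborel)"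

lemma truncated_mass_finite:
  assumes s: "0 < s" "s < 1 / 2" shows "truncated_mass s M < \<infinity>"
proof -
  have tail: "(\<integral>\<^sup>+t. ennreal (t powr (- 1 - 2 * s)) * indicator {1..} t \<partial>lborel) = ennreal (0 - (- (1 powr (- 2 * s) / (2 * s))))"
  proof (rule nn_integral_FTC_atLeast)
    show "((\<lambda>t. - (t powr (- 2 * s) / (2 * s))) has_real_derivative t powr (- 1 - 2 * s)) (at t)" if "1 \<le> t" for t :: real
      using that s by (auto intro!: derivative_eq_intros simp: algebra_simps) (rule arg_cong[where f="\<lambda>r. t powr r"], simp)
    have "((\<lambda>t. t powr (- 2 * s)) \<longlongrightarrow> 0) at_top"
      using s by (intro tendsto_neg_powr filterlim_ident) auto
    hence "((\<lambda>t. - (t powr (- 2 * s) / (2 * s))) \<longlongrightarrow> - (0 / (2 * s))) at_top"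
      using s by (intro tendsto_intros) auto
    thus "((\<lambda>t. - (t powr (- 2 * s) / (2 * s))) \<longlongrightarrow> 0) at_top" by simp
  qed auto
  have "truncated_mass s M \<le> (\<integral>\<^sup>+t. ennreal (M\<^sup>2) * indicator {0..1} t + ennreal (t powr (- 1 - 2 * s)) * indicator {1..} t \<partial>(lborel::real measure))"
    unfolding truncated_mass_def
  proof (rule nn_integral_mono)
    fix t :: real
    consider "t \<le> 0" | "0 < t" "t < 1" | "1 \<le> t" by linarith
    thus "ennreal (min 1 ((M * t)\<^sup>2)) * ennreal (kern s t) \<le> ennreal (M\<^sup>2) * indicator {0..1} t + ennreal (t powr (- 1 - 2 * s)) * indicator {1..} t"
    proof cases
      case 1 thus ?thesis by (simp add: kern_def)
    next
      case 2
      have "min 1 ((M * t)\<^sup>2) * kern s t \<le> (M * t)\<^sup>2 * kern s t" by (intro mult_right_mono kern_nonneg) simp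
      also have "\<dots> = M\<^sup>2 * (t powr 2 * t powr (- 1 - 2 * s))" using 2 by (simp add: kern_def power_mult_distrib)
      also have "t powr 2 * t powr (- 1 - 2 * s) = t powr (1 - 2 * s)" by (simp add: powr_add[symmetric])
      also have "M\<^sup>2 * t powr (1 - 2 * s) \<le> M\<^sup>2 * 1"
        using 2 s by (intro mult_left_mono powr_le1) auto
      finally have "ennreal (min 1 ((M * t)\<^sup>2) * kern s t) \<le> ennreal (M\<^sup>2)" by (intro ennreal_leI) simp
      thus ?thesis using 2 by (simp add: ennreal_mult kern_nonneg)
    next
      case 3
      have "min 1 ((M * t)\<^sup>2) * kern s t \<le> 1 * kern s t" by (intro mult_right_mono kern_nonneg) simp
      hence "ennreal (min 1 ((M * t)\<^sup>2) * kern s t) \<le> ennreal (t powr (- 1 - 2 * s))" using 3 by (intro ennreal_leI) (simp add: kern_def)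
      thus ?thesis using 3 by (simp add: ennreal_mult kern_nonneg add_increasing)
    qed
  qed
  also have "\<dots> = ennreal (M\<^sup>2) + ennreal (0 - (- (1 powr (- 2 * s) / (2 * s))))"
    unfolding tail[symmetric] by (subst nn_integral_add) (auto simp: nn_integral_cmult)
  also have "\<dots> < \<infinity>" by simp
  finally show ?thesis .
qed

text \<open>The energy of a wave of frequency 1 along a line, the constant that relates energies of differences to Fourier multipliers.\<close>

definition osc_mass :: "real \<Rightarrow> ennreal" where
  "osc_mass s = (\<integral>\<^sup>+t. ennreal ((norm (cis t - 1))\<^sup>2) * ennreal (kern s t) \<partial>lborel)"

lemma osc_mass_finite:
  assumes s: "0 < s" "s < 1 / 2" shows "osc_mass s < \<infinity>"
proof -
  have "(norm (cis t - 1))\<^sup>2 \<le> 4 * min 1 ((1 * t)\<^sup>2)" for t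
  proof -
    have "norm (cis t - 1) \<le> \<bar>t\<bar>" using iexp_approx1[of t 0] by (simp add: cis_conv_exp)
    hence "(norm (cis t - 1))\<^sup>2 \<le> \<bar>t\<bar>\<^sup>2" by (intro power_mono) auto
    hence "(norm (cis t - 1))\<^sup>2 \<le> 4 * t\<^sup>2" using zero_le_power2[of t] by (simp only: power2_abs)
    moreover have "norm (cis t - 1) \<le> 2" using norm_triangle_ineq4[of "cis t" 1] by simp
    hence "(norm (cis t - 1))\<^sup>2 \<le> 2\<^sup>2" by (intro power_mono) auto
    ultimately show ?thesis by (simp add: min_def)
  qed
  hence "osc_mass s \<le> (\<integral>\<^sup>+t. ennreal (4 * min 1 ((1 * t)\<^sup>2)) * ennreal (kern s t) \<partial>lborel)"
    unfolding osc_mass_def by (intro nn_integral_mono mult_right_mono ennreal_leI) auto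
  also have "\<dots> = (\<integral>\<^sup>+t. 4 * (ennreal (min 1 ((1 * t)\<^sup>2)) * ennreal (kern s t)) \<partial>lborel)"
    by (intro nn_integral_cong) (simp add: ennreal_mult mult.assoc)
  also have "\<dots> = 4 * truncated_mass s 1" unfolding truncated_mass_def by (rule nn_integral_cmult) measurable
  also have "\<dots> < \<infinity>" using truncated_mass_finite[OF s, of 1] by (simp add: ennreal_mult_less_top)
  finally show ?thesis .
qed

lemma osc_mass_nonzero: "osc_mass s \<noteq> 0"
proof
  assume "osc_mass s = 0"
  hence "AE t in lborel. ennreal ((norm (cis t - 1))\<^sup>2) * ennreal (kern s t) = 0"
    unfolding osc_mass_def by (subst (asm) nn_integral_0_iff_AE) auto
  hence "AE t in lborel. t \<notin> {0<..<1::real}"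
  proof (rule AE_mp, intro AE_I2 impI)
    fix t :: real assume z: "ennreal ((norm (cis t - 1))\<^sup>2) * ennreal (kern s t) = 0"
    show "t \<notin> {0<..<1}"
    proof
      assume t: "t \<in> {0<..<1}"
      have "0 < sin t" using t pi_gt3 by (intro sin_gt_zero) auto
      hence "Im (cis t) \<noteq> Im 1" by simp
      hence "cis t \<noteq> 1" by metis
      moreover have "0 < kern s t" using t by (simp add: kern_def)
      ultimately show False using z by simp
    qed
  qed
  hence "emeasure lborel {0<..<1::real} = 0" by (subst (asm) AE_iff_measurable[of "{0<..<1}"]) auto
  thus False by simp
qed

lemma osc_mass_scale:
  "(\<integral>\<^sup>+t. ennreal ((norm (cis (- (t * a)) - 1))\<^sup>2) * ennreal (kern s t) \<partial>lborel) = ennreal (\<bar>a\<bar> powr (2 * s)) * osc_mass s"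
proof (cases "a = 0")
  case False
  have "norm (cis (- (t * a)) - 1) = norm (cis (t / (1 / \<bar>a\<bar>)) - 1)" for t
  proof -
    have "norm (cis (- u) - 1) = norm (cis u - 1)" for u
      using complex_mod_cnj[of "cis u - 1"] by (simp add: cis_cnj)
    from this[of "t * a"] this[of "- (t * a)"] show ?thesis by (simp add: abs_if)
  qed
  hence "(\<integral>\<^sup>+t. ennreal ((norm (cis (- (t * a)) - 1))\<^sup>2) * ennreal (kern s t) \<partial>lborel) =
    (\<integral>\<^sup>+t. (\<lambda>t. ennreal ((norm (cis t - 1))\<^sup>2)) (t / (1 / \<bar>a\<bar>)) * ennreal (kern s t) \<partial>lborel)" by simp
  also have "\<dots> = ennreal ((1 / \<bar>a\<bar>) powr (- 2 * s)) * osc_mass s"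
    unfolding osc_mass_def using False by (intro kern_scale) auto
  also have "(1 / \<bar>a\<bar>) powr (- 2 * s) = \<bar>a\<bar> powr (2 * s)" using False by (simp add: powr_divide powr_minus_divide)
  finally show ?thesis .
qed simp

text \<open>The outer integration is over the length \<open>t\<close> of the shift in direction \<open>e\<close>.\<close>

definition dir_energy :: "real \<Rightarrow> 'a::euclidean_space \<Rightarrow> ('a \<Rightarrow> complex) \<Rightarrow> ennreal" where
  "dir_energy s e f = (\<integral>\<^sup>+t. (\<integral>\<^sup>+x. ennreal ((norm (f (x + t *\<^sub>R e) - f x))\<^sup>2) * ennreal (kern s t) \<partial>lborel) \<partial>lborel)"

lemma L2_norm_inv_fourier: "f \<in> schwartz \<Longrightarrow> L2_norm (inv_fourier f) = L2_norm f"
  using L2_norm_fourier[OF schwartz_inv_fourier, of f] fourier_inv_fourier[of f]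
  by (metis (no_types, lifting) ext)

lemma nn_integral_difference:
  fixes f :: "'a::euclidean_space \<Rightarrow> complex"
  assumes f: "f \<in> schwartz"
  shows "(\<integral>\<^sup>+x. ennreal ((norm (f (x + h) - f x))\<^sup>2) \<partial>lborel) =
    (\<integral>\<^sup>+\<xi>. ennreal ((norm (cis (- (h \<bullet> \<xi>)) - 1))\<^sup>2) * ennreal ((norm (inv_fourier f \<xi>))\<^sup>2) \<partial>lborel)"
proof -
  let ?g = "\<lambda>x. f (x + h) - f x"
  have fh: "(\<lambda>x. f (x + h)) \<in> schwartz" using schwartz_affine[OF f, of 1 h] by simp
  have g: "?g \<in> schwartz" by (rule schwartz_diff[OF fh f])
  have "inv_fourier ?g \<xi> = (cis (- (h \<bullet> \<xi>)) - 1) * inv_fourier f \<xi>" for \<xi>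
    using fourier_diff[OF schwartz_integrable[OF fh] schwartz_integrable[OF f], of "- \<xi>"]
    by (simp add: inv_fourier_eq fourier_translate schwartz_measurable[OF f] algebra_simps)
  hence "(norm (inv_fourier ?g \<xi>))\<^sup>2 = (norm (cis (- (h \<bullet> \<xi>)) - 1))\<^sup>2 * (norm (inv_fourier f \<xi>))\<^sup>2" for \<xi>
    by (simp add: norm_mult power_mult_distrib)
  hence "(\<integral>\<^sup>+\<xi>. ennreal ((norm (inv_fourier ?g \<xi>))\<^sup>2) \<partial>lborel) =
    (\<integral>\<^sup>+\<xi>. ennreal ((norm (cis (- (h \<bullet> \<xi>)) - 1))\<^sup>2) * ennreal ((norm (inv_fourier f \<xi>))\<^sup>2) \<partial>lborel)"
    by (simp add: ennreal_mult)
  moreover have "(\<integral>\<^sup>+\<xi>. ennreal ((norm (inv_fourier ?g \<xi>))\<^sup>2) \<partial>lborel) = (\<integral>\<^sup>+x. ennreal ((norm (?g x))\<^sup>2) \<partial>lborel)"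
    unfolding L2_nn_integral[OF schwartz_L2[OF g]] L2_nn_integral[OF schwartz_L2[OF schwartz_inv_fourier[OF g]]]
      L2_norm_inv_fourier[OF g] ..
  ultimately show ?thesis by simp
qed

text \<open>Shifting by \<open>t *\<^sub>R e\<close> multiplies the transform by a phase of frequency \<open>e \<bullet> \<xi>\<close>; after Plancherel and Fubini, the integral over
  \<open>t\<close> scales like \<open>\<bar>e \<bullet> \<xi>\<bar> powr (2 * s)\<close>.\<close>

lemma dir_energy_fourier:
  fixes f :: "'a::euclidean_space \<Rightarrow> complex"
  assumes f: "f \<in> schwartz"
  shows "dir_energy s e f = osc_mass s * (\<integral>\<^sup>+\<xi>. ennreal (\<bar>e \<bullet> \<xi>\<bar> powr (2 * s)) * ennreal ((norm (inv_fourier f \<xi>))\<^sup>2) \<partial>lborel)"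
proof -
  have [measurable]: "f \<in> borel_measurable borel" "inv_fourier f \<in> borel_measurable borel"
    using schwartz_measurable schwartz_inv_fourier f by blast+
  have "dir_energy s e f = (\<integral>\<^sup>+t. (\<integral>\<^sup>+\<xi>. (ennreal ((norm (cis (- (t * (e \<bullet> \<xi>))) - 1))\<^sup>2) * ennreal (kern s t)) * ennreal ((norm (inv_fourier f \<xi>))\<^sup>2) \<partial>lborel) \<partial>lborel)"
    unfolding dir_energy_def
  proof (rule nn_integral_cong)
    fix t
    have "(\<integral>\<^sup>+x. ennreal ((norm (f (x + t *\<^sub>R e) - f x))\<^sup>2) * ennreal (kern s t) \<partial>lborel) =
      (\<integral>\<^sup>+\<xi>. ennreal ((norm (cis (- (t * (e \<bullet> \<xi>))) - 1))\<^sup>2) * ennreal ((norm (inv_fourier f \<xi>))\<^sup>2) \<partial>lborel) * ennreal (kern s t)"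
      by (subst nn_integral_multc) (auto simp: nn_integral_difference[OF f])
    also have "\<dots> = (\<integral>\<^sup>+\<xi>. (ennreal ((norm (cis (- (t * (e \<bullet> \<xi>))) - 1))\<^sup>2) * ennreal (kern s t)) * ennreal ((norm (inv_fourier f \<xi>))\<^sup>2) \<partial>lborel)"
      by (subst nn_integral_multc[symmetric]) (auto simp: mult_ac)
    finally show "(\<integral>\<^sup>+x. ennreal ((norm (f (x + t *\<^sub>R e) - f x))\<^sup>2) * ennreal (kern s t) \<partial>lborel) =
      (\<integral>\<^sup>+\<xi>. (ennreal ((norm (cis (- (t * (e \<bullet> \<xi>))) - 1))\<^sup>2) * ennreal (kern s t)) * ennreal ((norm (inv_fourier f \<xi>))\<^sup>2) \<partial>lborel)" .
  qed
  also have "\<dots> = (\<integral>\<^sup>+\<xi>. (\<integral>\<^sup>+t. (ennreal ((norm (cis (- (t * (e \<bullet> \<xi>))) - 1))\<^sup>2) * ennreal (kern s t)) * ennreal ((norm (inv_fourier f \<xi>))\<^sup>2) \<partial>lborel) \<partial>lborel)"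
    by (rule lborel_pair.Fubini') measurable
  also have "\<dots> = (\<integral>\<^sup>+\<xi>. osc_mass s * (ennreal (\<bar>e \<bullet> \<xi>\<bar> powr (2 * s)) * ennreal ((norm (inv_fourier f \<xi>))\<^sup>2)) \<partial>lborel)"
  proof (rule nn_integral_cong)
    fix \<xi>
    let ?v = "ennreal ((norm (inv_fourier f \<xi>))\<^sup>2)"
    have "(\<integral>\<^sup>+t. (ennreal ((norm (cis (- (t * (e \<bullet> \<xi>))) - 1))\<^sup>2) * ennreal (kern s t)) * ?v \<partial>lborel) =
      (\<integral>\<^sup>+t. ennreal ((norm (cis (- (t * (e \<bullet> \<xi>))) - 1))\<^sup>2) * ennreal (kern s t) \<partial>lborel) * ?v"
      by (rule nn_integral_multc) measurable
    thus "(\<integral>\<^sup>+t. (ennreal ((norm (cis (- (t * (e \<bullet> \<xi>))) - 1))\<^sup>2) * ennreal (kern s t)) * ?v \<partial>lborel) =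
      osc_mass s * (ennreal (\<bar>e \<bullet> \<xi>\<bar> powr (2 * s)) * ?v)"
      unfolding osc_mass_scale by (simp only: mult_ac)
  qed
  also have "\<dots> = osc_mass s * (\<integral>\<^sup>+\<xi>. ennreal (\<bar>e \<bullet> \<xi>\<bar> powr (2 * s)) * ennreal ((norm (inv_fourier f \<xi>))\<^sup>2) \<partial>lborel)"
    by (rule nn_integral_cmult) measurable
  finally show ?thesis .
qed

lemma sob_norm_nn_integral:
  assumes "f \<in> schwartz"
  shows "ennreal ((sob_norm s f)\<^sup>2) = (\<integral>\<^sup>+\<xi>. ennreal (bracket (2 * s) \<xi>) * ennreal ((norm (inv_fourier f \<xi>))\<^sup>2) \<partial>lborel)"
proof -
  have "0 \<le> bracket (2 * s) \<xi>" for \<xi> :: 'a using bracket_pos[of "2 * s" \<xi>] by simp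
  thus ?thesis unfolding sob_norm_sq(2)[OF assms]
    by (subst nn_integral_eq_integral[OF sob_norm_sq(1)[OF assms], symmetric]) (auto simp: ennreal_mult)
qed

lemma dir_energy_le_sob_norm:
  fixes f :: "'a::euclidean_space \<Rightarrow> complex"
  assumes f: "f \<in> schwartz" and e: "norm e = 1" and s: "0 < s"
  shows "dir_energy s e f \<le> osc_mass s * ennreal ((sob_norm s f)\<^sup>2)"
  unfolding dir_energy_fourier[OF f] sob_norm_nn_integral[OF f]
proof (intro mult_left_mono nn_integral_mono mult_right_mono ennreal_leI)
  fix \<xi>
  show "\<bar>e \<bullet> \<xi>\<bar> powr (2 * s) \<le> bracket (2 * s) \<xi>"
  proof (cases "e \<bullet> \<xi> = 0")
    case False
    have "\<bar>e \<bullet> \<xi>\<bar> \<le> norm \<xi>" using Cauchy_Schwarz_ineq2[of e \<xi>] e by simp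
    hence "\<bar>e \<bullet> \<xi>\<bar>\<^sup>2 \<le> (norm \<xi>)\<^sup>2" by (intro power_mono) auto
    have "\<bar>e \<bullet> \<xi>\<bar> powr (2 * s) = (\<bar>e \<bullet> \<xi>\<bar>\<^sup>2) powr s" using False by (simp add: powr_powr[symmetric])
    also have "\<dots> \<le> (1 + (norm \<xi>)\<^sup>2) powr s" using \<open>\<bar>e \<bullet> \<xi>\<bar>\<^sup>2 \<le> (norm \<xi>)\<^sup>2\<close> s by (intro powr_mono2) auto
    finally show ?thesis by (simp add: bracket_def)
  qed (use bracket_pos[of "2 * s" \<xi>] in simp)
qed auto

text \<open>With \<open>M\<close> the largest of 1 and the squared coordinates, \<open>1 + (norm \<xi>)\<^sup>2\<close> is at most \<open>1 + DIM('a)\<close> times \<open>M\<close>, and \<open>M powr s\<close> is one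
  of the terms on the right hand side.\<close>

lemma bracket_le_coordinates:
  fixes \<xi> :: "'a::euclidean_space"
  assumes s: "0 < s"
  shows "bracket (2 * s) \<xi> \<le> (1 + real DIM('a)) powr s * (1 + (\<Sum>b\<in>Basis. \<bar>b \<bullet> \<xi>\<bar> powr (2 * s)))"
proof -
  define M where "M = Max (insert 1 ((\<lambda>b. (b \<bullet> \<xi>)\<^sup>2) ` (Basis::'a set)))"
  have M: "1 \<le> M" "\<And>b. b \<in> Basis \<Longrightarrow> (b \<bullet> \<xi>)\<^sup>2 \<le> M" unfolding M_def by (intro Max_ge; simp)+
  have "(norm \<xi>)\<^sup>2 = (\<Sum>b\<in>Basis. (b \<bullet> \<xi>)\<^sup>2)"
    unfolding power2_norm_eq_inner by (subst euclidean_inner) (simp add: power2_eq_square inner_commute)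
  also have "\<dots> \<le> real DIM('a) * M" using sum_bounded_above[of Basis "\<lambda>b. (b \<bullet> \<xi>)\<^sup>2" M] M by simp
  finally have "1 + (norm \<xi>)\<^sup>2 \<le> (1 + real DIM('a)) * M" using M(1) by (simp add: algebra_simps)
  hence "bracket (2 * s) \<xi> \<le> ((1 + real DIM('a)) * M) powr s" unfolding bracket_def
    using s by (simp add: powr_mono2)
  also have "\<dots> = (1 + real DIM('a)) powr s * M powr s" using M(1) by (simp add: powr_mult)
  finally have 1: "bracket (2 * s) \<xi> \<le> (1 + real DIM('a)) powr s * M powr s" .
  have 2: "M powr s \<le> 1 + (\<Sum>b\<in>Basis. \<bar>b \<bullet> \<xi>\<bar> powr (2 * s))"
  proof -
    have n: "0 \<le> (\<Sum>b\<in>(Basis::'a set). \<bar>b \<bullet> \<xi>\<bar> powr (2 * s))" by (intro sum_nonneg) auto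
    have "M \<in> insert 1 ((\<lambda>b. (b \<bullet> \<xi>)\<^sup>2) ` (Basis::'a set))" unfolding M_def by (intro Max_in) auto
    then consider "M = 1" | b where "b \<in> (Basis::'a set)" "M = (b \<bullet> \<xi>)\<^sup>2" by auto
    thus ?thesis
    proof cases
      case 2
      have "b \<bullet> \<xi> \<noteq> 0" using 2 M(1) by auto
      hence "M powr s = \<bar>b \<bullet> \<xi>\<bar> powr (2 * s)" unfolding 2 by (simp add: powr_powr[symmetric])
      also have "\<dots> \<le> (\<Sum>b\<in>(Basis::'a set). \<bar>b \<bullet> \<xi>\<bar> powr (2 * s))" using 2(1) by (intro member_le_sum) auto
      finally show ?thesis by simp
    qed (use n in simp)
  qed
  show ?thesis by (rule order_trans[OF 1 mult_left_mono[OF 2]]) simp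
qed

text \<open>Energies in the coordinate directions suffice, because the sum of the multipliers \<open>\<bar>b \<bullet> \<xi>\<bar> powr (2 * s)\<close> controls the
  multiplier of \<open>sob_norm\<close>.\<close>

lemma sob_norm_le_dir_energy:
  assumes s: "0 < s" "s < 1 / 2"
  shows "\<exists>C. \<forall>f\<in>(schwartz :: ('a::euclidean_space \<Rightarrow> complex) set).
    ennreal ((sob_norm s f)\<^sup>2) \<le> ennreal C * (ennreal ((L2_norm f)\<^sup>2) + (\<Sum>b\<in>Basis. dir_energy s b f))"
proof -
  obtain k where k: "osc_mass s = ennreal k" "0 < k"
    using osc_mass_finite[OF s] osc_mass_nonzero[of s] by (cases "osc_mass s") (auto simp: less_le)
  define c where "c = (1 + real DIM('a)) powr s"
  define C where "C = c * (1 + 1 / k)"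
  have c: "0 \<le> c" by (simp add: c_def)
  have "ennreal ((sob_norm s f)\<^sup>2) \<le> ennreal C * (ennreal ((L2_norm f)\<^sup>2) + (\<Sum>b\<in>Basis. dir_energy s b f))"
    if f: "f \<in> schwartz" for f :: "'a \<Rightarrow> complex"
  proof -
    have [measurable]: "inv_fourier f \<in> borel_measurable borel" using schwartz_measurable schwartz_inv_fourier f by blast
    let ?v = "\<lambda>\<xi>. ennreal ((norm (inv_fourier f \<xi>))\<^sup>2)"
    let ?I = "\<lambda>b. \<integral>\<^sup>+\<xi>. ennreal (\<bar>b \<bullet> \<xi>\<bar> powr (2 * s)) * ?v \<xi> \<partial>lborel"
    have "ennreal ((sob_norm s f)\<^sup>2) \<le> (\<integral>\<^sup>+\<xi>. ennreal (c * (1 + (\<Sum>b\<in>Basis. \<bar>b \<bullet> \<xi>\<bar> powr (2 * s)))) * ?v \<xi> \<partial>lborel)"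
      unfolding sob_norm_nn_integral[OF f] c_def
      using s by (intro nn_integral_mono mult_right_mono ennreal_leI bracket_le_coordinates) auto
    also have "\<dots> = (\<integral>\<^sup>+\<xi>. ennreal c * (?v \<xi> + (\<Sum>b\<in>Basis. ennreal (\<bar>b \<bullet> \<xi>\<bar> powr (2 * s)) * ?v \<xi>)) \<partial>lborel)"
    proof (rule nn_integral_cong)
      fix \<xi> :: 'a
      have "ennreal (c * (1 + (\<Sum>b\<in>Basis. \<bar>b \<bullet> \<xi>\<bar> powr (2 * s)))) = ennreal c * (1 + (\<Sum>b\<in>Basis. ennreal (\<bar>b \<bullet> \<xi>\<bar> powr (2 * s))))"
        using c by (subst ennreal_mult) (auto simp: sum_nonneg)
      thus "ennreal (c * (1 + (\<Sum>b\<in>Basis. \<bar>b \<bullet> \<xi>\<bar> powr (2 * s)))) * ?v \<xi> =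
        ennreal c * (?v \<xi> + (\<Sum>b\<in>Basis. ennreal (\<bar>b \<bullet> \<xi>\<bar> powr (2 * s)) * ?v \<xi>))"
        by (simp only: distrib_right sum_distrib_right mult.assoc mult_1)
    qed
    also have "\<dots> = ennreal c * ((\<integral>\<^sup>+\<xi>. ?v \<xi> \<partial>lborel) + (\<Sum>b\<in>Basis. ?I b))"
      by (subst nn_integral_cmult, measurable) (subst nn_integral_add, measurable, subst nn_integral_sum, auto)
    also have "(\<integral>\<^sup>+\<xi>. ?v \<xi> \<partial>lborel) = ennreal ((L2_norm f)\<^sup>2)"
      using L2_nn_integral[OF schwartz_L2[OF schwartz_inv_fourier[OF f]]] by (simp add: L2_norm_inv_fourier[OF f])
    also have "(\<Sum>b\<in>Basis. ?I b) = ennreal (1 / k) * (\<Sum>b\<in>Basis. dir_energy s b f)"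
      unfolding dir_energy_fourier[OF f] k(1) sum_distrib_left
      using k(2) by (intro sum.cong refl) (simp add: mult.assoc[symmetric] ennreal_mult[symmetric])
    also have "ennreal c * (ennreal ((L2_norm f)\<^sup>2) + ennreal (1 / k) * (\<Sum>b\<in>Basis. dir_energy s b f)) \<le>
      ennreal c * (ennreal (1 + 1 / k) * (ennreal ((L2_norm f)\<^sup>2) + (\<Sum>b\<in>Basis. dir_energy s b f)))"
    proof (rule mult_left_mono)
      have "1 * ennreal ((L2_norm f)\<^sup>2) \<le> ennreal (1 + 1 / k) * ennreal ((L2_norm f)\<^sup>2)"
        using k(2) by (intro mult_right_mono) (auto simp: ennreal_1[symmetric] simp del: ennreal_1 intro!: ennreal_leI)
      moreover have "ennreal (1 / k) * (\<Sum>b\<in>Basis. dir_energy s b f) \<le> ennreal (1 + 1 / k) * (\<Sum>b\<in>Basis. dir_energy s b f)"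
        by (intro mult_right_mono ennreal_leI) auto
      ultimately show "ennreal ((L2_norm f)\<^sup>2) + ennreal (1 / k) * (\<Sum>b\<in>Basis. dir_energy s b f) \<le>
        ennreal (1 + 1 / k) * (ennreal ((L2_norm f)\<^sup>2) + (\<Sum>b\<in>Basis. dir_energy s b f))"
        by (simp add: distrib_left add_mono)
    qed simp
    also have "\<dots> = ennreal C * (ennreal ((L2_norm f)\<^sup>2) + (\<Sum>b\<in>Basis. dir_energy s b f))"
      using k(2) c by (simp add: C_def ennreal_mult mult.assoc)
    finally show ?thesis .
  qed
  thus ?thesis by blast
qed

subsection \<open>Hardy's inequality\<close>

text \<open>The left hand side is of the order of \<open>K powr (2 * s - 1)\<close>; it is the fraction of the Hardy integral that has to be absorbed.\<close>

lemma powr_ratio_small: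
  assumes "s < 1 / 2" "0 < s"
  shows "\<exists>K\<ge>2. 2 * (1 + 2 * K) powr (1 + 2 * s) / (K * (K - 1)) \<le> (1 / 4 :: real)"
proof -
  have "((\<lambda>K. 4 * 3 powr (1 + 2 * s) * K powr (2 * s - 1)) \<longlongrightarrow> 4 * 3 powr (1 + 2 * s) * 0) at_top"
    using assms by (intro tendsto_intros tendsto_neg_powr filterlim_ident) auto
  hence "\<forall>\<^sub>F K in at_top. 4 * 3 powr (1 + 2 * s) * K powr (2 * s - 1) < 1 / 4"
    by (intro order_tendstoD(2)) auto
  hence "\<forall>\<^sub>F K in at_top. 2 \<le> K \<and> 4 * 3 powr (1 + 2 * s) * K powr (2 * s - 1) < (1 / 4 :: real)"
    using eventually_ge_at_top[of 2] by eventually_elim simp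
  then obtain K :: real where K: "2 \<le> K" "4 * 3 powr (1 + 2 * s) * K powr (2 * s - 1) < 1 / 4"
    using eventually_happens trivial_limit_at_top_linorder by blast
  have "2 * (1 + 2 * K) powr (1 + 2 * s) / (K * (K - 1)) \<le> 2 * (3 * K) powr (1 + 2 * s) / (K * (K / 2))"
    using K(1) assms by (intro frac_le mult_left_mono powr_mono2) auto
  also have "\<dots> = 4 * 3 powr (1 + 2 * s) * (K powr (1 + 2 * s) / K powr 2)"
    using K(1) by (simp add: powr_mult power2_eq_square)
  also have "K powr (1 + 2 * s) / K powr 2 = K powr (2 * s - 1)"
    by (simp add: powr_diff[symmetric])
  finally show ?thesis using K by (intro exI[of _ K]) linarith
qed

text \<open>A point \<open>x\<close> at distance \<open>\<rho>\<close> from the graph, measured along \<open>e\<close>, is compared with the average over the points \<open>x + t *\<^sub>R e\<close>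
  with \<open>t\<close> between \<open>K * \<rho>\<close> and \<open>2 * K * \<rho>\<close>. The differences are part of the energy. The shifted values form again
  a Hardy integral: a point at distance \<open>r\<close> is hit only from points whose distance is of the order of \<open>r / K\<close> and whose position
  ranges over an interval of length of the order of \<open>r / K\<close>. So the original weight \<open>r powr (- 2 * s)\<close> reappears with
  a factor of the order of \<open>K powr (2 * s - 1)\<close>, and as \<open>2 * s < 1\<close>, the integral can be absorbed for large \<open>K\<close>. Adding
  \<open>\<delta>\<close> to the distance makes the Hardy integral finite beforehand, without which nothing could be absorbed.\<close>

lemma hardy_graph:
  assumes s: "0 < s" "s < 1 / 2"
  shows "\<exists>C. \<forall>f\<in>(schwartz :: ('a::euclidean_space \<Rightarrow> complex) set). \<forall>\<tau>\<in>borel_measurable borel. \<forall>e. \<forall>\<delta>>0.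
    (\<forall>x t. \<tau> (x + t *\<^sub>R e) = \<tau> x + t) \<longrightarrow>
    (\<integral>\<^sup>+x. ennreal ((norm (f x))\<^sup>2) * ennreal ((\<bar>\<tau> x\<bar> + \<delta>) powr (- 2 * s)) \<partial>lborel) \<le> ennreal C * dir_energy s e f"
proof -
  obtain K :: real where K: "2 \<le> K" "2 * (1 + 2 * K) powr (1 + 2 * s) / (K * (K - 1)) \<le> 1 / 4"
    using powr_ratio_small[OF s(2,1)] by blast
  define \<theta> where "\<theta> = 2 * (1 + 2 * K) powr (1 + 2 * s) / (K * (K - 1))"
  define C1 where "C1 = (2 * K) powr (1 + 2 * s) / K"
  have C1: "0 < C1" using K by (simp add: C1_def)
  have \<theta>: "0 \<le> \<theta>" "\<theta> \<le> 1 / 4" using K by (simp_all add: \<theta>_def)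
  have "(\<integral>\<^sup>+x. ennreal ((norm (f x))\<^sup>2) * ennreal ((\<bar>\<tau> x\<bar> + \<delta>) powr (- 2 * s)) \<partial>lborel) \<le> ennreal (4 * C1) * dir_energy s e f"
    if f: "f \<in> schwartz" and \<tau>m[measurable]: "\<tau> \<in> borel_measurable borel" and \<delta>: "0 < \<delta>"
      and \<tau>: "\<forall>x t. \<tau> (x + t *\<^sub>R e) = \<tau> x + t" for f :: "'a \<Rightarrow> complex" and \<tau> e \<delta>
  proof -
    have fm[measurable]: "f \<in> borel_measurable borel" using schwartz_measurable f by blast
    define \<rho> where "\<rho> x = \<bar>\<tau> x\<bar> + \<delta>" for x
    have \<rho>m[measurable]: "\<rho> \<in> borel_measurable borel" unfolding \<rho>_def[abs_def] by measurable
    have \<rho>: "\<delta> \<le> \<rho> x" "0 < \<rho> x" for x using \<delta> by (auto simp: \<rho>_def)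
    \<comment> \<open>a kernel of total mass \<open>\<rho> x powr (- 2 * s)\<close> that realises the average over the shifted points\<close>
    define k where "k x t = (if K * \<rho> x \<le> t \<and> t \<le> 2 * K * \<rho> x then \<rho> x powr (- 1 - 2 * s) / K else 0)" for x t
    have km[measurable]: "(\<lambda>(x, t). k x t) \<in> borel_measurable (borel \<Otimes>\<^sub>M borel)"
      unfolding k_def[abs_def] by measurable
    have km2[measurable]: "(\<lambda>(t, x). k (x - t *\<^sub>R e) t) \<in> borel_measurable (borel \<Otimes>\<^sub>M borel)"
      unfolding k_def[abs_def] by measurable
    have k0: "0 \<le> k x t" for x t using K by (simp add: k_def)
    have k_mass: "(\<integral>\<^sup>+t. ennreal (k x t) \<partial>lborel) = ennreal (\<rho> x powr (- 2 * s))" for x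
    proof -
      have "(\<integral>\<^sup>+t. ennreal (k x t) \<partial>lborel) = (\<integral>\<^sup>+t. ennreal (\<rho> x powr (- 1 - 2 * s) / K) * indicator {K * \<rho> x..2 * K * \<rho> x} t \<partial>lborel)"
        by (intro nn_integral_cong) (simp add: k_def indicator_def)
      also have "\<dots> = ennreal (\<rho> x powr (- 1 - 2 * s) / K) * ennreal (2 * K * \<rho> x - K * \<rho> x)"
        using K \<rho>[of x] by (subst nn_integral_cmult) auto
      also have "\<dots> = ennreal ((\<rho> x powr (- 1 - 2 * s) / K) * (2 * K * \<rho> x - K * \<rho> x))"
        using K \<rho>[of x] by (subst ennreal_mult[symmetric]) auto
      also have "(\<rho> x powr (- 1 - 2 * s) / K) * (2 * K * \<rho> x - K * \<rho> x) = \<rho> x * \<rho> x powr (- 1 - 2 * s)"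
        using K by (simp add: field_simps)
      also have "\<dots> = \<rho> x powr (- 2 * s)" using \<rho>[of x] by (simp add: powr_mult_base)
      finally show ?thesis .
    qed
    have k_kern: "k x t \<le> C1 * kern s t" for x t
    proof (cases "K * \<rho> x \<le> t \<and> t \<le> 2 * K * \<rho> x")
      case True
      have t: "0 < t" using True K \<rho>[of x] by (smt (verit) mult_pos_pos)
      have "t / (2 * K) \<le> \<rho> x" using True K by (simp add: field_simps)
      hence "\<rho> x powr (- 1 - 2 * s) \<le> (t / (2 * K)) powr (- 1 - 2 * s)"
        using t K s by (intro powr_mono2') auto
      also have "\<dots> = t powr (- 1 - 2 * s) / (2 * K) powr (- 1 - 2 * s)" using t K by (simp add: powr_divide)
      also have "\<dots> = (2 * K) powr (1 + 2 * s) * t powr (- 1 - 2 * s)"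
        using powr_minus[of "2 * K" "1 + 2 * s"] by (simp add: divide_inverse mult.commute)
      finally have "\<rho> x powr (- 1 - 2 * s) / K \<le> (2 * K) powr (1 + 2 * s) * t powr (- 1 - 2 * s) / K"
        using K by (intro divide_right_mono) auto
      thus ?thesis using True t by (simp add: k_def C1_def kern_def)
    next
      case False
      have "k x t = 0" using False by (auto simp: k_def)
      thus ?thesis using C1 kern_nonneg[of s t] by simp
    qed
    \<comment> \<open>the mass that reaches a fixed point \<open>y\<close>\<close>
    have k_back: "(\<integral>\<^sup>+t. ennreal (k (y - t *\<^sub>R e) t) \<partial>lborel) \<le> ennreal (\<theta> * \<rho> y powr (- 2 * s))" for y
    proof -
      let ?a = "((1 + 2 * K) / \<rho> y) powr (1 + 2 * s) / K"
      let ?r = "\<rho> y / (K - 1)"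
      have a0: "0 \<le> ?a" using K by simp
      have kb: "k (y - t *\<^sub>R e) t \<le> ?a * indicator {\<tau> y - ?r..\<tau> y + ?r} t" for t
      proof (cases "K * \<rho> (y - t *\<^sub>R e) \<le> t \<and> t \<le> 2 * K * \<rho> (y - t *\<^sub>R e)")
        case True
        let ?p = "\<rho> (y - t *\<^sub>R e)"
        have tau: "\<tau> (y - t *\<^sub>R e) = \<tau> y - t" using \<tau>[rule_format, of "y - t *\<^sub>R e" t] by simp
        have p: "?p = \<bar>\<tau> y - t\<bar> + \<delta>" unfolding \<rho>_def tau ..
        have t: "0 < t" using True K \<rho>[of "y - t *\<^sub>R e"] by (smt (verit) mult_pos_pos)
        have y: "\<rho> y = \<bar>\<tau> y\<bar> + \<delta>" by (simp add: \<rho>_def)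
        have "\<rho> y \<le> ?p + t" using t p y by linarith
        also have "\<dots> \<le> (1 + 2 * K) * ?p" using True by (simp add: algebra_simps)
        finally have up: "\<rho> y \<le> (1 + 2 * K) * ?p" .
        have "(K - 1) * ?p \<le> t - ?p" using True by (simp add: algebra_simps)
        also have "\<dots> \<le> \<rho> y" using p y \<delta> by linarith
        finally have "?p \<le> ?r" using K by (simp add: field_simps)
        hence "\<bar>\<tau> y - t\<bar> \<le> ?r" using p \<delta> by linarith
        hence ind: "t \<in> {\<tau> y - ?r..\<tau> y + ?r}" by auto
        have "\<rho> y / (1 + 2 * K) \<le> ?p" using up K by (simp add: field_simps)
        hence "?p powr (- 1 - 2 * s) \<le> (\<rho> y / (1 + 2 * K)) powr (- 1 - 2 * s)"
          using \<rho>[of y] K s by (intro powr_mono2') auto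
        also have "\<dots> = ((1 + 2 * K) / \<rho> y) powr (1 + 2 * s)"
        proof -
          have "- 1 - 2 * s = - (1 + 2 * s)" by simp
          hence "(\<rho> y / (1 + 2 * K)) powr (- 1 - 2 * s) = inverse ((\<rho> y / (1 + 2 * K)) powr (1 + 2 * s))"
            by (simp only: powr_minus)
          thus ?thesis using \<rho>[of y] K by (simp add: powr_divide)
        qed
        finally show ?thesis using True ind K by (simp add: k_def divide_right_mono)
      next
        case False
        hence "k (y - t *\<^sub>R e) t = 0" by (auto simp: k_def)
        moreover have "0 \<le> ?a * indicator {\<tau> y - ?r..\<tau> y + ?r} t" by (rule mult_nonneg_nonneg[OF a0]) simp
        ultimately show ?thesis by simp
      qed
      have "(\<integral>\<^sup>+t. ennreal (k (y - t *\<^sub>R e) t) \<partial>lborel) \<le> (\<integral>\<^sup>+t. ennreal ?a * indicator {\<tau> y - ?r..\<tau> y + ?r} t \<partial>lborel)"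
      proof (rule nn_integral_mono)
        fix t
        have "ennreal (k (y - t *\<^sub>R e) t) \<le> ennreal (?a * indicator {\<tau> y - ?r..\<tau> y + ?r} t)"
          by (rule ennreal_leI[OF kb])
        also have "\<dots> = ennreal ?a * indicator {\<tau> y - ?r..\<tau> y + ?r} t"
          by (cases "t \<in> {\<tau> y - ?r..\<tau> y + ?r}") simp_all
        finally show "ennreal (k (y - t *\<^sub>R e) t) \<le> ennreal ?a * indicator {\<tau> y - ?r..\<tau> y + ?r} t" .
      qed
      also have "\<dots> = ennreal ?a * ennreal (2 * ?r)"
        using K \<rho>[of y] by (subst nn_integral_cmult) (auto simp: emeasure_lborel_Icc_eq)
      also have "\<dots> = ennreal (?a * (2 * ?r))" using a0 K \<rho>[of y] by (subst ennreal_mult) auto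
      also have "?a * (2 * ?r) = \<theta> * (\<rho> y / \<rho> y powr (1 + 2 * s))"
        using K \<rho>[of y] by (simp add: \<theta>_def powr_divide field_simps)
      also have "\<rho> y / \<rho> y powr (1 + 2 * s) = \<rho> y powr (- 2 * s)"
        using \<rho>[of y] powr_diff[of "\<rho> y" 1 "1 + 2 * s"] by simp
      finally show ?thesis .
    qed
    let ?v = "\<lambda>x. ennreal ((norm (f x))\<^sup>2)"
    define H where "H = (\<integral>\<^sup>+x. ?v x * ennreal (\<rho> x powr (- 2 * s)) \<partial>lborel)"
    define E where "E = dir_energy s e f"
    define I1 where "I1 = (\<integral>\<^sup>+x. (\<integral>\<^sup>+t. ennreal (k x t) * ennreal ((norm (f (x + t *\<^sub>R e) - f x))\<^sup>2) \<partial>lborel) \<partial>lborel)"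
    define I2 where "I2 = (\<integral>\<^sup>+x. (\<integral>\<^sup>+t. ennreal (k x t) * ?v (x + t *\<^sub>R e) \<partial>lborel) \<partial>lborel)"
    have "H = (\<integral>\<^sup>+x. (\<integral>\<^sup>+t. ennreal (k x t) * ?v x \<partial>lborel) \<partial>lborel)"
      unfolding H_def by (intro nn_integral_cong, subst nn_integral_multc) (auto simp: k_mass mult.commute)
    also have "\<dots> \<le> (\<integral>\<^sup>+x. (\<integral>\<^sup>+t. 2 * (ennreal (k x t) * ennreal ((norm (f (x + t *\<^sub>R e) - f x))\<^sup>2)) + 2 * (ennreal (k x t) * ?v (x + t *\<^sub>R e)) \<partial>lborel) \<partial>lborel)"
    proof (intro nn_integral_mono)
      fix x t
      have "(norm (f x))\<^sup>2 \<le> 2 * (norm (f (x + t *\<^sub>R e) - f x))\<^sup>2 + 2 * (norm (f (x + t *\<^sub>R e)))\<^sup>2"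
        using norm_add_sq_le[of "f x - f (x + t *\<^sub>R e)" "f (x + t *\<^sub>R e)"] by (simp add: norm_minus_commute)
      hence "k x t * (norm (f x))\<^sup>2 \<le> k x t * (2 * (norm (f (x + t *\<^sub>R e) - f x))\<^sup>2 + 2 * (norm (f (x + t *\<^sub>R e)))\<^sup>2)"
        by (rule mult_left_mono[OF _ k0])
      hence "ennreal (k x t * (norm (f x))\<^sup>2) \<le> ennreal (2 * (k x t * (norm (f (x + t *\<^sub>R e) - f x))\<^sup>2) + 2 * (k x t * (norm (f (x + t *\<^sub>R e)))\<^sup>2))"
        by (intro ennreal_leI) (simp add: algebra_simps)
      thus "ennreal (k x t) * ?v x \<le> 2 * (ennreal (k x t) * ennreal ((norm (f (x + t *\<^sub>R e) - f x))\<^sup>2)) + 2 * (ennreal (k x t) * ?v (x + t *\<^sub>R e))"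
        by (simp add: ennreal_mult k0)
    qed
    also have "\<dots> = 2 * I1 + 2 * I2"
      unfolding I1_def I2_def
      by (subst nn_integral_add, measurable)+ (simp add: nn_integral_cmult nn_integral_add)
    finally have H_le: "H \<le> 2 * I1 + 2 * I2" .
    have "I1 = (\<integral>\<^sup>+t. (\<integral>\<^sup>+x. ennreal (k x t) * ennreal ((norm (f (x + t *\<^sub>R e) - f x))\<^sup>2) \<partial>lborel) \<partial>lborel)"
      unfolding I1_def by (rule lborel_pair.Fubini') measurable
    also have "\<dots> \<le> (\<integral>\<^sup>+t. (\<integral>\<^sup>+x. ennreal C1 * (ennreal ((norm (f (x + t *\<^sub>R e) - f x))\<^sup>2) * ennreal (kern s t)) \<partial>lborel) \<partial>lborel)"
    proof (intro nn_integral_mono)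
      fix t x
      have "ennreal (k x t) \<le> ennreal C1 * ennreal (kern s t)"
        using ennreal_leI[OF k_kern[of x t]] C1 by (simp add: ennreal_mult kern_nonneg)
      from mult_right_mono[OF this, of "ennreal ((norm (f (x + t *\<^sub>R e) - f x))\<^sup>2)"]
      show "ennreal (k x t) * ennreal ((norm (f (x + t *\<^sub>R e) - f x))\<^sup>2) \<le> ennreal C1 * (ennreal ((norm (f (x + t *\<^sub>R e) - f x))\<^sup>2) * ennreal (kern s t))"
        by (simp add: mult_ac)
    qed
    also have "\<dots> = ennreal C1 * E"
      unfolding E_def dir_energy_def by (simp add: nn_integral_cmult)
    finally have I1_le: "I1 \<le> ennreal C1 * E" .
    have "I2 = (\<integral>\<^sup>+t. (\<integral>\<^sup>+x. ennreal (k x t) * ?v (x + t *\<^sub>R e) \<partial>lborel) \<partial>lborel)"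
      unfolding I2_def by (rule lborel_pair.Fubini') measurable
    also have "\<dots> = (\<integral>\<^sup>+t. (\<integral>\<^sup>+x. ennreal (k (x - t *\<^sub>R e) t) * ?v x \<partial>lborel) \<partial>lborel)"
    proof (rule nn_integral_cong)
      fix t
      have "(\<integral>\<^sup>+x. ennreal (k ((x + t *\<^sub>R e) - t *\<^sub>R e) t) * ?v (x + t *\<^sub>R e) \<partial>lborel) = (\<integral>\<^sup>+x. ennreal (k (x - t *\<^sub>R e) t) * ?v x \<partial>lborel)"
        by (rule nn_integral_translate) measurable
      thus "(\<integral>\<^sup>+x. ennreal (k x t) * ?v (x + t *\<^sub>R e) \<partial>lborel) = (\<integral>\<^sup>+x. ennreal (k (x - t *\<^sub>R e) t) * ?v x \<partial>lborel)" by simp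
    qed
    also have "\<dots> = (\<integral>\<^sup>+x. (\<integral>\<^sup>+t. ennreal (k (x - t *\<^sub>R e) t) * ?v x \<partial>lborel) \<partial>lborel)"
      by (rule lborel_pair.Fubini') measurable
    also have "\<dots> = (\<integral>\<^sup>+x. (\<integral>\<^sup>+t. ennreal (k (x - t *\<^sub>R e) t) \<partial>lborel) * ?v x \<partial>lborel)"
      by (intro nn_integral_cong nn_integral_multc) measurable
    also have "\<dots> \<le> (\<integral>\<^sup>+x. ennreal \<theta> * (?v x * ennreal (\<rho> x powr (- 2 * s))) \<partial>lborel)"
    proof (rule nn_integral_mono)
      fix x
      show "(\<integral>\<^sup>+t. ennreal (k (x - t *\<^sub>R e) t) \<partial>lborel) * ?v x \<le> ennreal \<theta> * (?v x * ennreal (\<rho> x powr (- 2 * s)))"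
        using mult_right_mono[OF k_back[of x], of "?v x"] \<theta> by (simp add: ennreal_mult mult_ac)
    qed
    also have "\<dots> = ennreal \<theta> * H" unfolding H_def by (rule nn_integral_cmult) measurable
    finally have I2_le: "I2 \<le> ennreal \<theta> * H" .
    have "H \<le> (\<integral>\<^sup>+x. ennreal (\<delta> powr (- 2 * s)) * ?v x \<partial>lborel)"
      unfolding H_def using \<rho> \<delta> s
      by (intro nn_integral_mono) (auto simp: mult.commute intro!: mult_left_mono ennreal_leI powr_mono2')
    also have "\<dots> = ennreal (\<delta> powr (- 2 * s)) * ennreal ((L2_norm f)\<^sup>2)"
      by (simp add: nn_integral_cmult L2_nn_integral[OF schwartz_L2[OF f]])
    also have "\<dots> < \<infinity>" by (simp add: ennreal_mult_less_top)
    finally have Hfin: "H < \<infinity>" .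
    have "H \<le> 2 * (ennreal C1 * E) + 2 * (ennreal \<theta> * H)"
      using H_le add_mono[OF mult_left_mono[OF I1_le, of 2] mult_left_mono[OF I2_le, of 2]] by (simp add: order_trans)
    have "H \<le> ennreal (4 * C1) * E"
    proof (cases "E = \<infinity>")
      case True
      thus ?thesis using C1 by (simp add: ennreal_mult_eq_top_iff)
    next
      case False
      then obtain E' where E': "E = ennreal E'" "0 \<le> E'" by (cases E) auto
      obtain h where h: "H = ennreal h" "0 \<le> h" using Hfin by (cases H) auto
      have "ennreal h \<le> ennreal (2 * (C1 * E') + 2 * (\<theta> * h))"
        using \<open>H \<le> 2 * (ennreal C1 * E) + 2 * (ennreal \<theta> * H)\<close> E' h C1 \<theta> by (simp add: ennreal_mult)
      hence "h \<le> 2 * (C1 * E') + 2 * (\<theta> * h)" using E' h C1 \<theta> by (subst (asm) ennreal_le_iff) auto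
      moreover have "\<theta> * h \<le> 1 / 4 * h" using \<theta>(2) h(2) by (rule mult_right_mono)
      ultimately have "h \<le> 4 * C1 * E'" by simp
      thus ?thesis unfolding E'(1) h(1) using C1 E'(2) by (simp add: ennreal_mult[symmetric] ennreal_leI)
    qed
    thus ?thesis by (simp add: H_def E_def \<rho>_def)
  qed
  thus ?thesis by blast
qed

subsection \<open>Multipliers\<close>

text \<open>The product rule for differences, with the factor that is not differenced bounded by 1.\<close>

lemma dir_energy_mult:
  fixes f :: "'a::euclidean_space \<Rightarrow> complex" and m :: "'a \<Rightarrow> real"
  assumes f: "f \<in> schwartz" and m[measurable]: "m \<in> borel_measurable borel" and m1: "\<And>x. \<bar>m x\<bar> \<le> 1"
  shows "dir_energy s e (\<lambda>x. complex_of_real (m x) * f x) \<le> 2 * dir_energy s e f +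
    2 * (\<integral>\<^sup>+x. ennreal ((norm (f x))\<^sup>2) * (\<integral>\<^sup>+t. ennreal ((m (x + t *\<^sub>R e) - m x)\<^sup>2) * ennreal (kern s t) \<partial>lborel) \<partial>lborel)"
proof -
  have [measurable]: "f \<in> borel_measurable borel" using schwartz_measurable f by blast
  let ?d = "\<lambda>x t. ennreal ((norm (f (x + t *\<^sub>R e) - f x))\<^sup>2) * ennreal (kern s t)"
  let ?w = "\<lambda>x t. ennreal ((norm (f x))\<^sup>2) * (ennreal ((m (x + t *\<^sub>R e) - m x)\<^sup>2) * ennreal (kern s t))"
  have "dir_energy s e (\<lambda>x. complex_of_real (m x) * f x) \<le> (\<integral>\<^sup>+t. (\<integral>\<^sup>+x. 2 * ?d x t + 2 * ?w x t \<partial>lborel) \<partial>lborel)"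
    unfolding dir_energy_def
  proof (intro nn_integral_mono)
    fix t x
    let ?y = "x + t *\<^sub>R e"
    have "complex_of_real (m ?y) * f ?y - complex_of_real (m x) * f x =
      complex_of_real (m ?y) * (f ?y - f x) + complex_of_real (m ?y - m x) * f x" by (simp add: algebra_simps)
    hence "(norm (complex_of_real (m ?y) * f ?y - complex_of_real (m x) * f x))\<^sup>2 \<le>
      2 * (norm (complex_of_real (m ?y) * (f ?y - f x)))\<^sup>2 + 2 * (norm (complex_of_real (m ?y - m x) * f x))\<^sup>2"
      using norm_add_sq_le by simp
    also have "\<dots> \<le> 2 * (norm (f ?y - f x))\<^sup>2 + 2 * ((norm (f x))\<^sup>2 * (m ?y - m x)\<^sup>2)"
    proof -
      have "(norm (complex_of_real (m ?y) * (f ?y - f x)))\<^sup>2 \<le> (norm (f ?y - f x))\<^sup>2"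
        using m1[of ?y] by (intro power_mono) (auto simp: norm_mult mult_left_le_one_le)
      moreover have "(norm (complex_of_real (m ?y - m x) * f x))\<^sup>2 = (norm (f x))\<^sup>2 * (m ?y - m x)\<^sup>2"
        by (simp only: norm_mult power_mult_distrib norm_of_real power2_abs mult.commute)
      ultimately show ?thesis by simp
    qed
    finally have "(norm (complex_of_real (m ?y) * f ?y - complex_of_real (m x) * f x))\<^sup>2 * kern s t \<le>
      (2 * (norm (f ?y - f x))\<^sup>2 + 2 * ((norm (f x))\<^sup>2 * (m ?y - m x)\<^sup>2)) * kern s t"
      by (rule mult_right_mono[OF _ kern_nonneg])
    hence "ennreal ((norm (complex_of_real (m ?y) * f ?y - complex_of_real (m x) * f x))\<^sup>2 * kern s t) \<le>
      ennreal (2 * ((norm (f ?y - f x))\<^sup>2 * kern s t) + 2 * ((norm (f x))\<^sup>2 * ((m ?y - m x)\<^sup>2 * kern s t)))"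
      by (intro ennreal_leI) (simp add: algebra_simps)
    thus "ennreal ((norm (complex_of_real (m ?y) * f ?y - complex_of_real (m x) * f x))\<^sup>2) * ennreal (kern s t) \<le> 2 * ?d x t + 2 * ?w x t"
      by (simp add: ennreal_mult kern_nonneg)
  qed
  also have "\<dots> = 2 * dir_energy s e f + 2 * (\<integral>\<^sup>+t. (\<integral>\<^sup>+x. ?w x t \<partial>lborel) \<partial>lborel)"
    unfolding dir_energy_def by (simp add: nn_integral_add nn_integral_cmult)
  also have "(\<integral>\<^sup>+t. (\<integral>\<^sup>+x. ?w x t \<partial>lborel) \<partial>lborel) = (\<integral>\<^sup>+x. (\<integral>\<^sup>+t. ?w x t \<partial>lborel) \<partial>lborel)"
    by (rule lborel_pair.Fubini') measurable
  also have "\<dots> = (\<integral>\<^sup>+x. ennreal ((norm (f x))\<^sup>2) * (\<integral>\<^sup>+t. ennreal ((m (x + t *\<^sub>R e) - m x)\<^sup>2) * ennreal (kern s t) \<partial>lborel) \<partial>lborel)"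
    by (intro nn_integral_cong nn_integral_cmult) measurable
  finally show ?thesis .
qed

text \<open>If \<open>m\<close> varies at \<open>x\<close> on the scale \<open>R\<close>, rescaling \<open>t\<close> by \<open>R\<close> gives the weight of Hardy's inequality.\<close>

lemma variation_le_truncated_mass:
  assumes R: "0 < R" and le: "\<And>t. 0 < t \<Longrightarrow> (m (x + t *\<^sub>R e) - m x)\<^sup>2 \<le> min 1 ((N * (t / R))\<^sup>2)"
  shows "(\<integral>\<^sup>+t. ennreal ((m (x + t *\<^sub>R e) - m x)\<^sup>2) * ennreal (kern s t) \<partial>lborel) \<le> ennreal (R powr (- 2 * s)) * truncated_mass s N"
proof -
  have "(\<integral>\<^sup>+t. ennreal ((m (x + t *\<^sub>R e) - m x)\<^sup>2) * ennreal (kern s t) \<partial>lborel) \<le>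
    (\<integral>\<^sup>+t. (\<lambda>u. ennreal (min 1 ((N * u)\<^sup>2))) (t / R) * ennreal (kern s t) \<partial>lborel)"
  proof (rule nn_integral_mono)
    fix t
    show "ennreal ((m (x + t *\<^sub>R e) - m x)\<^sup>2) * ennreal (kern s t) \<le> (\<lambda>u. ennreal (min 1 ((N * u)\<^sup>2))) (t / R) * ennreal (kern s t)"
      using le[of t] by (cases "0 < t") (auto simp: kern_def intro!: mult_right_mono ennreal_leI)
  qed
  also have "\<dots> = ennreal (R powr (- 2 * s)) * truncated_mass s N"
    unfolding truncated_mass_def using R by (intro kern_scale) auto
  finally show ?thesis .
qed

section \<open>Cutoff functions adapted to a Lipschitz domain\<close>

text \<open>The signed height over the graph: it measures the distance to the graph along \<open>e\<close>, and it is defined on the whole space, not only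
  in the chart.\<close>

lemma hypograph_height:
  assumes "lipschitz_hypograph H"
  shows "\<exists>e \<tau> \<Lambda>. norm e = 1 \<and> 0 \<le> \<Lambda> \<and> (\<forall>x t. \<tau> (x + t *\<^sub>R e) = \<tau> x + t) \<and>
    (\<forall>x y. \<bar>\<tau> x - \<tau> y\<bar> \<le> \<Lambda> * norm (x - y)) \<and> H = {x. \<tau> x < (0::real)}"
proof -
  obtain e f L where e: "norm e = 1" and L: "L-lipschitz_on {y. y \<bullet> e = 0} f"
    and H: "H = {x. x \<bullet> e < f (x - (x \<bullet> e) *\<^sub>R e)}"
    using assms unfolding lipschitz_hypograph_def by blast
  have ee: "e \<bullet> e = 1" using e by (simp add: norm_eq_1)
  define P where "P x = x - (x \<bullet> e) *\<^sub>R e" for x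
  define \<tau> where "\<tau> x = x \<bullet> e - f (P x)" for x
  have P: "P x \<in> {y. y \<bullet> e = 0}" for x by (simp add: P_def inner_diff_left ee)
  have L0: "0 \<le> L" using L by (simp add: lipschitz_on_def)
  have "\<tau> (x + t *\<^sub>R e) = \<tau> x + t" for x t
  proof -
    have "P (x + t *\<^sub>R e) = P x" by (simp add: P_def inner_add_left ee algebra_simps)
    thus ?thesis by (simp add: \<tau>_def inner_add_left ee)
  qed
  moreover have "\<bar>\<tau> x - \<tau> y\<bar> \<le> (1 + L * 2) * norm (x - y)" for x y
  proof -
    have c: "\<bar>(x - y) \<bullet> e\<bar> \<le> norm (x - y)" using Cauchy_Schwarz_ineq2[of "x - y" e] e by simp
    have "P x - P y = (x - y) - ((x - y) \<bullet> e) *\<^sub>R e" by (simp add: P_def inner_diff_left algebra_simps)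
    hence "norm (P x - P y) \<le> norm (x - y) + norm (((x - y) \<bullet> e) *\<^sub>R e)" using norm_triangle_ineq4 by metis
    hence "norm (P x - P y) \<le> 2 * norm (x - y)" using c e by simp
    moreover have "\<bar>f (P x) - f (P y)\<bar> \<le> L * norm (P x - P y)"
      using lipschitz_onD[OF L P P, of x y] by (simp add: dist_norm)
    ultimately have "\<bar>f (P x) - f (P y)\<bar> \<le> L * (2 * norm (x - y))"
      using mult_left_mono[OF _ L0] by (meson order_trans)
    moreover have "\<tau> x - \<tau> y = (x - y) \<bullet> e - (f (P x) - f (P y))" by (simp add: \<tau>_def inner_diff_left)
    ultimately show ?thesis using c by (simp add: algebra_simps)
  qed
  moreover have "H = {x. \<tau> x < 0}" by (simp add: H \<tau>_def P_def)
  moreover have "0 \<le> 1 + L * 2" using L0 by simp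
  ultimately show ?thesis using e by blast
qed

text \<open>In a chart, \<open>\<Omega>\<close> is the set where the height is negative, so the height vanishes at the frontier points in the chart. Since heights are globally
  Lipschitz, the charts themselves can be forgotten from here on.\<close>

lemma frontier_heights:
  fixes \<Omega> :: "'a::euclidean_space set"
  assumes "lipschitz_domain \<Omega>"
  shows "\<exists>(T :: ('a \<times> ('a \<Rightarrow> real)) set) \<Lambda>. finite T \<and> 0 \<le> \<Lambda> \<and>
    (\<forall>(e, \<tau>)\<in>T. norm e = 1 \<and> (\<forall>x t. \<tau> (x + t *\<^sub>R e) = \<tau> x + t) \<and> (\<forall>x y. \<bar>\<tau> x - \<tau> y\<bar> \<le> \<Lambda> * norm (x - y))) \<and>
    (\<forall>p\<in>frontier \<Omega>. \<exists>(e, \<tau>)\<in>T. \<tau> p = 0)"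
proof -
  have \<Omega>: "open \<Omega>" using assms by (simp add: lipschitz_domain_def)
  obtain \<C> where fin: "finite \<C>" and ch: "\<forall>(W, H)\<in>\<C>. open W \<and> lipschitz_hypograph H \<and> W \<inter> \<Omega> = W \<inter> H"
    and cov: "frontier \<Omega> \<subseteq> (\<Union>(W, H)\<in>\<C>. W)"
    using assms unfolding lipschitz_domain_def by (elim exE conjE)
  have "\<forall>c\<in>\<C>. \<exists>e \<tau> \<Lambda>. norm e = 1 \<and> 0 \<le> \<Lambda> \<and> (\<forall>x t. \<tau> (x + t *\<^sub>R e) = \<tau> x + t) \<and>
    (\<forall>x y. \<bar>\<tau> x - \<tau> y\<bar> \<le> \<Lambda> * norm (x - y)) \<and> snd c = {x. \<tau> x < (0::real)}"
  proof
    fix c assume "c \<in> \<C>"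
    hence "lipschitz_hypograph (snd c)" using ch by (auto simp: split_beta)
    thus "\<exists>e \<tau> \<Lambda>. norm e = 1 \<and> 0 \<le> \<Lambda> \<and> (\<forall>x t. \<tau> (x + t *\<^sub>R e) = \<tau> x + t) \<and>
      (\<forall>x y. \<bar>\<tau> x - \<tau> y\<bar> \<le> \<Lambda> * norm (x - y)) \<and> snd c = {x. \<tau> x < (0::real)}" by (rule hypograph_height)
  qed
  from bchoice[OF this] obtain e where "\<forall>c\<in>\<C>. \<exists>\<tau> \<Lambda>. norm (e c) = 1 \<and> 0 \<le> \<Lambda> \<and> (\<forall>x t. \<tau> (x + t *\<^sub>R e c) = \<tau> x + t) \<and>
    (\<forall>x y. \<bar>\<tau> x - \<tau> y\<bar> \<le> \<Lambda> * norm (x - y)) \<and> snd c = {x. \<tau> x < (0::real)}" ..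
  from bchoice[OF this] obtain \<tau> where "\<forall>c\<in>\<C>. \<exists>\<Lambda>. norm (e c) = 1 \<and> 0 \<le> \<Lambda> \<and> (\<forall>x t. \<tau> c (x + t *\<^sub>R e c) = \<tau> c x + t) \<and>
    (\<forall>x y. \<bar>\<tau> c x - \<tau> c y\<bar> \<le> \<Lambda> * norm (x - y)) \<and> snd c = {x. \<tau> c x < (0::real)}" ..
  from bchoice[OF this] obtain \<Lambda> where "\<forall>c\<in>\<C>. norm (e c) = 1 \<and> 0 \<le> \<Lambda> c \<and> (\<forall>x t. \<tau> c (x + t *\<^sub>R e c) = \<tau> c x + t) \<and>
    (\<forall>x y. \<bar>\<tau> c x - \<tau> c y\<bar> \<le> \<Lambda> c * norm (x - y)) \<and> snd c = {x. \<tau> c x < (0::real)}" ..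
  note ht = bspec[OF this]
  define L where "L = (\<Sum>c\<in>\<C>. \<Lambda> c)"
  have L: "\<Lambda> c \<le> L" if "c \<in> \<C>" for c unfolding L_def using fin ht that by (intro member_le_sum) auto
  have L0: "0 \<le> L" unfolding L_def using ht by (intro sum_nonneg) auto
  have lip: "\<bar>\<tau> c x - \<tau> c y\<bar> \<le> L * norm (x - y)" if "c \<in> \<C>" for c x y
    using ht[OF that] mult_right_mono[OF L[OF that], of "norm (x - y)"] by (meson norm_ge_zero order_trans)
  have zero: "\<tau> c p = 0" if c: "c \<in> \<C>" and p: "p \<in> frontier \<Omega>" "p \<in> fst c" for c p
  proof -
    obtain W H where WH: "c = (W, H)" by (cases c)
    have W: "open W" "W \<inter> \<Omega> = W \<inter> H" using bspec[OF ch c] WH by simp_all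
    have H: "H = {x. \<tau> c x < 0}" using ht[OF c] WH by simp
    have cont: "continuous_on UNIV (\<tau> c)"
    proof -
      have "L-lipschitz_on UNIV (\<tau> c)" using lip[OF c] L0 by (auto simp: lipschitz_on_def dist_norm)
      thus ?thesis by (rule lipschitz_on_continuous_on)
    qed
    have pn: "p \<notin> \<Omega>" using p(1) \<Omega> by (simp add: frontier_def interior_open)
    have pc: "p \<in> closure \<Omega>" using p(1) by (simp add: frontier_def)
    have in_\<Omega>: "x \<in> \<Omega> \<longleftrightarrow> \<tau> c x < 0" if "x \<in> W" for x
    proof -
      have "x \<in> W \<inter> \<Omega> \<longleftrightarrow> x \<in> W \<inter> H" by (simp only: W(2))
      thus ?thesis using that by (simp add: H)
    qed
    have pW: "p \<in> W" using p(2) WH by simp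
    have "\<not> \<tau> c p < 0" using pn in_\<Omega>[OF pW] by simp
    moreover have "\<not> 0 < \<tau> c p"
    proof
      assume "0 < \<tau> c p"
      hence "p \<in> W \<inter> {x. 0 < \<tau> c x}" using pW by simp
      moreover have "open (W \<inter> {x. 0 < \<tau> c x})"
        using W(1) cont by (intro open_Int open_Collect_less) (auto intro: continuous_intros)
      ultimately obtain x where "x \<in> W" "0 < \<tau> c x" "x \<in> \<Omega>" using pc open_Int_closure_eq_empty by blast
      thus False using in_\<Omega>[of x] by simp
    qed
    ultimately show ?thesis by simp
  qed
  let ?T = "(\<lambda>c. (e c, \<tau> c)) ` \<C>"
  have "finite ?T" using fin by simp
  moreover have "\<forall>(e, \<tau>)\<in>?T. norm e = 1 \<and> (\<forall>x t. \<tau> (x + t *\<^sub>R e) = \<tau> x + t) \<and> (\<forall>x y. \<bar>\<tau> x - \<tau> y\<bar> \<le> L * norm (x - y))"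
    using ht lip by (simp add: split_beta)
  moreover have "\<forall>p\<in>frontier \<Omega>. \<exists>(e, \<tau>)\<in>?T. \<tau> p = 0"
  proof
    fix p assume p: "p \<in> frontier \<Omega>"
    then obtain c where c: "c \<in> \<C>" "p \<in> fst c" using subsetD[OF cov, of p] by (auto simp: split_beta)
    thus "\<exists>(e, \<tau>)\<in>?T. \<tau> p = 0" using zero[OF c(1) p c(2)] c(1) by force
  qed
  ultimately show ?thesis using L0 by blast
qed

text \<open>The height that vanishes at a nearest frontier point is at most its Lipschitz constant times the distance to the frontier. Which
  height this is depends on the point, and the weight is bounded by the sum over all of them; this is where the finiteness of the atlas is used.\<close>

lemma hardy_frontier:
  fixes \<Omega> :: "'a::euclidean_space set"
  assumes \<Omega>: "lipschitz_domain \<Omega>" and ne: "frontier \<Omega> \<noteq> {}" and s: "0 < s" "s < 1 / 2"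
  shows "\<exists>C. \<forall>f\<in>schwartz. \<forall>\<epsilon>>0.
    (\<integral>\<^sup>+x. ennreal ((norm (f x))\<^sup>2) * ennreal ((infdist x (frontier \<Omega>) + \<epsilon>) powr (- 2 * s)) \<partial>lborel)
      \<le> ennreal C * ennreal ((sob_norm s f)\<^sup>2)"
proof -
  obtain T :: "('a \<times> ('a \<Rightarrow> real)) set" and \<Lambda> where T0: "finite T" "0 \<le> \<Lambda>"
    and T1: "\<forall>(e, \<tau>)\<in>T. norm e = 1 \<and> (\<forall>x t. \<tau> (x + t *\<^sub>R e) = \<tau> x + t) \<and> (\<forall>x y. \<bar>\<tau> x - \<tau> y\<bar> \<le> \<Lambda> * norm (x - y))"
    and T2: "\<forall>p\<in>frontier \<Omega>. \<exists>(e, \<tau>)\<in>T. \<tau> p = 0"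
    using frontier_heights[OF \<Omega>] by (elim exE conjE)
  have T: "finite T" "0 \<le> \<Lambda>"
    "\<And>e \<tau>. (e, \<tau>) \<in> T \<Longrightarrow> norm e = 1" "\<And>e \<tau> x t. (e, \<tau>) \<in> T \<Longrightarrow> \<tau> (x + t *\<^sub>R e) = \<tau> x + t"
    "\<And>e \<tau> x y. (e, \<tau>) \<in> T \<Longrightarrow> \<bar>\<tau> x - \<tau> y\<bar> \<le> \<Lambda> * norm (x - y)"
    "\<And>p. p \<in> frontier \<Omega> \<Longrightarrow> \<exists>(e, \<tau>)\<in>T. \<tau> p = 0"
    subgoal by (rule T0)
    subgoal by (rule T0)
    subgoal using bspec[OF T1] by force
    subgoal using bspec[OF T1] by force
    subgoal using bspec[OF T1] by force
    subgoal using T2 by blast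
    done
  obtain Ch where Ch0: "\<forall>f\<in>(schwartz :: ('a \<Rightarrow> complex) set). \<forall>\<tau>\<in>borel_measurable borel. \<forall>e. \<forall>\<delta>>0.
    (\<forall>x t. \<tau> (x + t *\<^sub>R e) = \<tau> x + t) \<longrightarrow>
    (\<integral>\<^sup>+x. ennreal ((norm (f x))\<^sup>2) * ennreal ((\<bar>\<tau> x\<bar> + \<delta>) powr (- 2 * s)) \<partial>lborel) \<le> ennreal Ch * dir_energy s e f"
    using hardy_graph[OF s, where 'a='a] by (elim exE)
  have Ch: "(\<integral>\<^sup>+x. ennreal ((norm (f x))\<^sup>2) * ennreal ((\<bar>\<tau> x\<bar> + \<delta>) powr (- 2 * s)) \<partial>lborel) \<le> ennreal Ch * dir_energy s e f"
    if "f \<in> schwartz" "\<tau> \<in> borel_measurable borel" "0 < \<delta>" "\<forall>x t. \<tau> (x + t *\<^sub>R e) = \<tau> x + t" for f :: "'a \<Rightarrow> complex" and \<tau> e \<delta>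
    using spec[OF spec[OF bspec[OF bspec[OF Ch0 that(1)] that(2)], of e], of \<delta>] that(3,4) by (elim impE)
  obtain k where k: "osc_mass s = ennreal k" "0 \<le> k" using osc_mass_finite[OF s] by (cases "osc_mass s") auto
  define M where "M = (\<Lambda> + 1) powr (2 * s)"
  define C where "C = M * (real (card T) * (max Ch 0 * k))"
  have M0: "0 \<le> M" by (simp add: M_def)
  have \<tau>m: "\<tau> \<in> borel_measurable borel" if "(e, \<tau>) \<in> T" for e \<tau>
  proof -
    have "\<Lambda>-lipschitz_on UNIV \<tau>" using T(5)[OF that] T(2) by (auto simp: lipschitz_on_def dist_norm)
    thus ?thesis by (intro borel_measurable_continuous_onI lipschitz_on_continuous_on)
  qed
  have "(\<integral>\<^sup>+x. ennreal ((norm (f x))\<^sup>2) * ennreal ((infdist x (frontier \<Omega>) + \<epsilon>) powr (- 2 * s)) \<partial>lborel)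
      \<le> ennreal C * ennreal ((sob_norm s f)\<^sup>2)" if f: "f \<in> schwartz" and \<epsilon>: "0 < \<epsilon>" for f \<epsilon>
  proof -
    have [measurable]: "f \<in> borel_measurable borel" using schwartz_measurable f by blast
    let ?v = "\<lambda>x. ennreal ((norm (f x))\<^sup>2)"
    let ?q = "\<lambda>p x. ?v x * ennreal ((\<bar>snd p x\<bar> + \<epsilon>) powr (- 2 * s))"
    have qm: "?q p \<in> borel_measurable lborel" if "p \<in> T" for p
    proof -
      have [measurable]: "snd p \<in> borel_measurable borel" using \<tau>m[of "fst p" "snd p"] that by simp
      show ?thesis by measurable
    qed
    have "(\<integral>\<^sup>+x. ?v x * ennreal ((infdist x (frontier \<Omega>) + \<epsilon>) powr (- 2 * s)) \<partial>lborel)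
      \<le> (\<integral>\<^sup>+x. ennreal M * (\<Sum>p\<in>T. ?q p x) \<partial>lborel)"
    proof (rule nn_integral_mono)
      fix x
      let ?d = "infdist x (frontier \<Omega>)"
      obtain y where y: "y \<in> frontier \<Omega>" "?d = dist x y"
        using infdist_attains_inf[OF frontier_closed ne] by blast
      obtain e \<tau> where et: "(e, \<tau>) \<in> T" "\<tau> y = 0" using T(6)[OF y(1)] by auto
      have "\<bar>\<tau> x\<bar> \<le> \<Lambda> * ?d" using T(5)[OF et(1), of x y] et(2) y(2) by (simp add: dist_norm)
      moreover have "0 \<le> ?d" "0 \<le> \<Lambda> * \<epsilon>" using T(2) \<epsilon> by (auto simp: infdist_nonneg)
      ultimately have "\<bar>\<tau> x\<bar> + \<epsilon> \<le> (\<Lambda> + 1) * (?d + \<epsilon>)" by (simp add: algebra_simps)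
      hence "(\<bar>\<tau> x\<bar> + \<epsilon>) / (\<Lambda> + 1) \<le> ?d + \<epsilon>" using T(2) by (simp add: field_simps)
      hence "(?d + \<epsilon>) powr (- 2 * s) \<le> ((\<bar>\<tau> x\<bar> + \<epsilon>) / (\<Lambda> + 1)) powr (- 2 * s)"
        using T(2) \<epsilon> s by (intro powr_mono2') auto
      also have "\<dots> = M * (\<bar>\<tau> x\<bar> + \<epsilon>) powr (- 2 * s)"
        using T(2) \<epsilon> powr_minus[of "\<Lambda> + 1" "2 * s"] by (simp add: powr_divide M_def field_simps)
      finally have "ennreal ((?d + \<epsilon>) powr (- 2 * s)) \<le> ennreal (M * (\<bar>\<tau> x\<bar> + \<epsilon>) powr (- 2 * s))" by (rule ennreal_leI)
      hence "?v x * ennreal ((?d + \<epsilon>) powr (- 2 * s)) \<le> ?v x * (ennreal M * ennreal ((\<bar>\<tau> x\<bar> + \<epsilon>) powr (- 2 * s)))"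
        using M0 by (intro mult_left_mono) (simp_all add: ennreal_mult)
      also have "\<dots> = ennreal M * ?q (e, \<tau>) x" by (simp add: mult_ac)
      also have "\<dots> \<le> ennreal M * (\<Sum>p\<in>T. ?q p x)"
        by (intro mult_left_mono member_le_sum et(1) T(1)) auto
      finally show "?v x * ennreal ((?d + \<epsilon>) powr (- 2 * s)) \<le> ennreal M * (\<Sum>p\<in>T. ?q p x)" .
    qed
    also have "\<dots> = ennreal M * (\<integral>\<^sup>+x. (\<Sum>p\<in>T. ?q p x) \<partial>lborel)"
      by (intro nn_integral_cmult borel_measurable_sum qm)
    also have "(\<integral>\<^sup>+x. (\<Sum>p\<in>T. ?q p x) \<partial>lborel) = (\<Sum>p\<in>T. \<integral>\<^sup>+x. ?q p x \<partial>lborel)"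
      by (intro nn_integral_sum qm)
    finally have 1: "(\<integral>\<^sup>+x. ?v x * ennreal ((infdist x (frontier \<Omega>) + \<epsilon>) powr (- 2 * s)) \<partial>lborel)
      \<le> ennreal M * (\<Sum>p\<in>T. \<integral>\<^sup>+x. ?q p x \<partial>lborel)" .
    have each: "(\<integral>\<^sup>+x. ?q p x \<partial>lborel) \<le> ennreal (max Ch 0 * k) * ennreal ((sob_norm s f)\<^sup>2)" if p: "p \<in> T" for p
    proof -
      obtain e \<tau> where et: "p = (e, \<tau>)" by (cases p)
      have "(\<integral>\<^sup>+x. ?q p x \<partial>lborel) \<le> ennreal Ch * dir_energy s e f"
        using Ch[OF f \<tau>m \<epsilon>, of e \<tau> e] T(4) p et by simp
      also have "\<dots> \<le> ennreal (max Ch 0) * (ennreal k * ennreal ((sob_norm s f)\<^sup>2))"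
        using dir_energy_le_sob_norm[OF f T(3) s(1), of e \<tau>] p et unfolding k(1)
        by (intro mult_mono ennreal_leI) auto
      finally show ?thesis using k(2) by (simp add: ennreal_mult mult.assoc)
    qed
    have "(\<Sum>p\<in>T. \<integral>\<^sup>+x. ?q p x \<partial>lborel) \<le> of_nat (card T) * (ennreal (max Ch 0 * k) * ennreal ((sob_norm s f)\<^sup>2))"
      by (rule sum_bounded_above) (rule each)
    hence "ennreal M * (\<Sum>p\<in>T. \<integral>\<^sup>+x. ?q p x \<partial>lborel) \<le> ennreal M * (of_nat (card T) * (ennreal (max Ch 0 * k) * ennreal ((sob_norm s f)\<^sup>2)))"
      by (rule mult_left_mono) simp
    also have "\<dots> = ennreal C * ennreal ((sob_norm s f)\<^sup>2)"
      using M0 k(2) by (simp add: C_def ennreal_mult ennreal_of_nat_eq_real_of_nat mult.assoc)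
    finally show ?thesis using 1 by (rule order_trans[rotated])
  qed
  thus ?thesis by blast
qed

lemma ball_frontier_disjoint:
  fixes S :: "'a::euclidean_space set"
  assumes "ball x r \<inter> frontier S = {}"
  shows "ball x r \<subseteq> S \<or> ball x r \<inter> S = {}"
  using connected_Int_frontier[OF connected_ball, of x r S] assms by blast

text \<open>The cutoff function of width \<open>\<epsilon>\<close> varies only where the distance \<open>d\<close> to the frontier is at most of the order of \<open>\<epsilon>\<close>; at all
  other points a shift has to be at least of the order of \<open>d\<close> to change its value. So it varies on the scale \<open>d + \<epsilon>\<close>, and the
  energy that it adds is a Hardy integral of the frontier, with a constant that does not depend on \<open>\<epsilon>\<close>.\<close>

lemma inner_cutoff:
  fixes \<Omega> :: "'a::euclidean_space set"
  assumes \<Omega>: "lipschitz_domain \<Omega>" and s: "0 < s" "s < 1 / 2"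
  shows "\<exists>C. \<forall>K. compact K \<longrightarrow> K \<subseteq> \<Omega> \<longrightarrow> (\<exists>E \<epsilon> S. E \<in> sets borel \<and> 0 < \<epsilon> \<and> \<epsilon> \<le> 1 \<and> closed S \<and> S \<subseteq> \<Omega> \<and>
    (\<forall>x\<in>K. cutoff E \<epsilon> x = 1) \<and> (\<forall>x. cutoff E \<epsilon> x \<noteq> 0 \<longrightarrow> x \<in> S) \<and>
    (\<forall>f\<in>schwartz. \<forall>b\<in>Basis. (\<integral>\<^sup>+x. ennreal ((norm (f x))\<^sup>2) *
      (\<integral>\<^sup>+t. ennreal ((cutoff E \<epsilon> (x + t *\<^sub>R b) - cutoff E \<epsilon> x)\<^sup>2) * ennreal (kern s t) \<partial>lborel) \<partial>lborel)
        \<le> ennreal C * ennreal ((sob_norm s f)\<^sup>2)))"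
proof (cases "frontier \<Omega> = {}")
  case True
  hence "\<Omega> = UNIV" using \<Omega> by (auto simp: frontier_eq_empty lipschitz_domain_def)
  moreover have "cutoff UNIV 1 x = 1" for x :: 'a by (rule cutoff_eq_1) auto
  ultimately show ?thesis by (intro exI[of _ 0] allI impI exI[of _ UNIV] exI[of _ 1]) auto
next
  case False
  let ?d = "\<lambda>x. infdist x (frontier \<Omega>)"
  have op: "open \<Omega>" using \<Omega> by (simp add: lipschitz_domain_def)
  obtain Ch where Ch: "\<And>f \<epsilon>. f \<in> schwartz \<Longrightarrow> 0 < \<epsilon> \<Longrightarrow>
    (\<integral>\<^sup>+x. ennreal ((norm (f x))\<^sup>2) * ennreal ((?d x + \<epsilon>) powr (- 2 * s)) \<partial>lborel) \<le> ennreal Ch * ennreal ((sob_norm s f)\<^sup>2)"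
    using hardy_frontier[OF \<Omega> False s] by blast
  obtain M where M: "1 \<le> M" "\<And>E \<epsilon> b t x. E \<in> sets borel \<Longrightarrow> 0 < \<epsilon> \<Longrightarrow> b \<in> Basis \<Longrightarrow> 0 < t \<Longrightarrow>
    \<bar>cutoff E \<epsilon> (x + t *\<^sub>R b) - cutoff E \<epsilon> (x::'a)\<bar> \<le> M * (t / \<epsilon>)"
    using cutoff_Lipschitz[where 'a='a] by blast
  obtain tm where tm: "truncated_mass s (5 * M) = ennreal tm" "0 \<le> tm"
    using truncated_mass_finite[OF s, of "5 * M"] by (cases "truncated_mass s (5 * M)") auto
  have ball: "ball x (?d x) \<subseteq> \<Omega> \<or> ball x (?d x) \<inter> \<Omega> = {}" for x
  proof (rule ball_frontier_disjoint)
    show "ball x (?d x) \<inter> frontier \<Omega> = {}"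
    proof (rule ccontr)
      assume "ball x (?d x) \<inter> frontier \<Omega> \<noteq> {}"
      then obtain y where "dist x y < ?d x" "y \<in> frontier \<Omega>" by auto
      thus False using infdist_le[of y "frontier \<Omega>" x] by simp
    qed
  qed
  have same: "x \<in> \<Omega> \<longleftrightarrow> y \<in> \<Omega>" if "dist x y < ?d x" for x y
  proof -
    have "x \<in> ball x (?d x)" "y \<in> ball x (?d x)"
      using that zero_le_dist[of x y] by (simp_all only: mem_ball dist_self)
    thus ?thesis using ball[of x] by blast
  qed
  have tri: "?d x \<le> ?d y + dist x y" for x y by (rule infdist_triangle)
  have "\<exists>E \<epsilon> S. E \<in> sets borel \<and> 0 < \<epsilon> \<and> \<epsilon> \<le> 1 \<and> closed S \<and> S \<subseteq> \<Omega> \<and>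
    (\<forall>x\<in>K. cutoff E \<epsilon> x = 1) \<and> (\<forall>x. cutoff E \<epsilon> x \<noteq> 0 \<longrightarrow> x \<in> S) \<and>
    (\<forall>f\<in>schwartz. \<forall>b\<in>Basis. (\<integral>\<^sup>+x. ennreal ((norm (f x))\<^sup>2) *
      (\<integral>\<^sup>+t. ennreal ((cutoff E \<epsilon> (x + t *\<^sub>R b) - cutoff E \<epsilon> x)\<^sup>2) * ennreal (kern s t) \<partial>lborel) \<partial>lborel)
        \<le> ennreal (tm * max Ch 0) * ennreal ((sob_norm s f)\<^sup>2))" if K: "compact K" "K \<subseteq> \<Omega>" for K
  proof -
    have "K \<inter> frontier \<Omega> = {}" using K(2) op by (auto simp: frontier_def interior_open)
    from separate_compact_closed[OF K(1) frontier_closed this]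
    obtain \<delta> where \<delta>: "0 < \<delta>" "\<forall>x\<in>K. \<forall>y\<in>frontier \<Omega>. \<delta> \<le> dist x y" by (elim exE conjE)
    have Kd: "\<delta> \<le> ?d x" if "x \<in> K" for x
    proof -
      obtain y where "y \<in> frontier \<Omega>" "?d x = dist x y" using infdist_attains_inf[OF frontier_closed False] by blast
      thus ?thesis using \<delta>(2) that by simp
    qed
    define \<epsilon> where "\<epsilon> = min 1 (\<delta> / 3)"
    have \<epsilon>: "0 < \<epsilon>" "\<epsilon> \<le> 1" "3 * \<epsilon> \<le> \<delta>" using \<delta>(1) by (auto simp: \<epsilon>_def min_def)
    \<comment> \<open>inside \<open>\<Omega>\<close>, the indicator function of \<open>E\<close> jumps at distance \<open>2 * \<epsilon>\<close>; so after mollification the values are 0 up to distance \<open>\<epsilon>\<close> and 1 from distance \<open>3 * \<epsilon>\<close> on\<close>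
    define E where "E = {x. 2 * \<epsilon> \<le> ?d x} \<inter> \<Omega>"
    define S where "S = {x. \<epsilon> \<le> ?d x} \<inter> closure \<Omega>"
    have Em: "E \<in> sets borel" unfolding E_def
      using op by (intro sets.Int borel_closed closed_Collect_le continuous_intros borel_open)
    have Sc: "closed S" unfolding S_def by (intro closed_Int closed_Collect_le continuous_intros closed_closure)
    have S\<Omega>: "S \<subseteq> \<Omega>"
    proof
      fix x assume x: "x \<in> S"
      show "x \<in> \<Omega>"
      proof (rule ccontr)
        assume "x \<notin> \<Omega>"
        hence "x \<in> frontier \<Omega>" using x op by (simp add: S_def frontier_def interior_open)
        hence "?d x = 0" by simp
        thus False using x \<epsilon> by (simp add: S_def)
      qed
    qed
    let ?c = "cutoff E \<epsilon>"
    have one: "?c x = 1" if "x \<in> \<Omega>" "3 * \<epsilon> \<le> ?d x" for x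
    proof (rule cutoff_eq_1[OF \<epsilon>(1)], rule subsetI)
      fix y assume y: "y \<in> ball x \<epsilon>"
      hence "dist x y < ?d x" using that \<epsilon>(1) by simp
      hence "y \<in> \<Omega>" using same that by blast
      thus "y \<in> E" using tri[of x y] y that by (simp add: E_def)
    qed
    have nz: "x \<in> S" if "?c x \<noteq> 0" for x
    proof -
      have "ball x \<epsilon> \<inter> E \<noteq> {}" using cutoff_eq_0[OF \<epsilon>(1), of x E] that by blast
      then obtain y where y: "dist x y < \<epsilon>" "2 * \<epsilon> \<le> ?d y" "y \<in> \<Omega>" by (auto simp: E_def)
      have "x \<in> \<Omega>" using same[of y x] y \<epsilon>(1) by (simp add: dist_commute)
      moreover have "\<epsilon> \<le> ?d x" using tri[of y x] y by (simp add: dist_commute)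
      ultimately show ?thesis using closure_subset by (auto simp: S_def)
    qed
    have variation: "(?c (x + t *\<^sub>R b) - ?c x)\<^sup>2 \<le> min 1 ((5 * M * (t / (?d x + \<epsilon>)))\<^sup>2)"
      if b: "b \<in> Basis" and t: "0 < t" for x b t
    \<comment> \<open>in this case both points lie on the same side of the frontier, at distance at least \<open>3 * \<epsilon>\<close> from it; otherwise \<open>?d x + \<epsilon>\<close> is at most \<open>5 * t\<close> or \<open>5 * \<epsilon>\<close>\<close>
    proof (cases "t < ?d x - 3 * \<epsilon>")
      case True
      let ?y = "x + t *\<^sub>R b"
      have dy: "dist x ?y = t" using b t by (simp add: dist_norm)
      have sm: "x \<in> \<Omega> \<longleftrightarrow> ?y \<in> \<Omega>" using same[of x ?y] dy True \<epsilon>(1) by simp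
      have d: "3 * \<epsilon> \<le> ?d x" "3 * \<epsilon> \<le> ?d ?y" using True t tri[of x ?y] dy by auto
      have "?c ?y = ?c x"
      proof (cases "x \<in> \<Omega>")
        case True
        thus ?thesis using one[of x] one[of ?y] sm d by simp
      next
        case False
        hence "x \<notin> S" "?y \<notin> S" using S\<Omega> sm by (simp_all only: subset_iff) blast+
        hence "?c x = 0" "?c ?y = 0" using nz[of x] nz[of ?y] by (simp_all only:) blast+
        thus ?thesis by simp
      qed
      thus ?thesis by simp
    next
      case False
      let ?D = "\<bar>?c (x + t *\<^sub>R b) - ?c x\<bar>"
      let ?R = "?d x + \<epsilon>"
      have R: "0 < ?R" using \<epsilon>(1) infdist_nonneg[of x "frontier \<Omega>"] by simp
      have D1: "?D \<le> 1" using cutoff_bounds[OF Em, of \<epsilon> x] cutoff_bounds[OF Em, of \<epsilon> "x + t *\<^sub>R b"] by simp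
      have "?D \<le> 5 * M * (t / ?R)"
      proof (cases "\<epsilon> \<le> t")
        case True
        hence "?R \<le> 5 * t" using False by linarith
        hence "1 \<le> 5 * (t / ?R)" using R by (simp add: field_simps)
        also have "\<dots> \<le> M * (5 * (t / ?R))" using M(1) R t by (intro mult_right_mono[of 1 M, simplified]) auto
        finally have "1 \<le> 5 * M * (t / ?R)" by (simp only: mult_ac)
        thus ?thesis using D1 by (rule order_trans[rotated])
      next
        case small: False
        hence "?R \<le> 5 * \<epsilon>" using False by linarith
        hence "1 / \<epsilon> \<le> 5 / ?R" using R \<epsilon>(1) by (simp add: field_simps)
        hence "M * t * (1 / \<epsilon>) \<le> M * t * (5 / ?R)" using M(1) t by (intro mult_left_mono) auto
        hence "M * (t / \<epsilon>) \<le> 5 * M * (t / ?R)" by (simp add: mult_ac)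
        thus ?thesis using M(2)[OF Em \<epsilon>(1) b t, of x] by (rule order_trans[rotated])
      qed
      hence "?D\<^sup>2 \<le> (5 * M * (t / ?R))\<^sup>2" by (intro power_mono) auto
      moreover have "?D\<^sup>2 \<le> 1\<^sup>2" using D1 by (intro power_mono) auto
      ultimately show ?thesis by simp
    qed
    have en: "(\<integral>\<^sup>+x. ennreal ((norm (f x))\<^sup>2) *
      (\<integral>\<^sup>+t. ennreal ((?c (x + t *\<^sub>R b) - ?c x)\<^sup>2) * ennreal (kern s t) \<partial>lborel) \<partial>lborel)
        \<le> ennreal (tm * max Ch 0) * ennreal ((sob_norm s f)\<^sup>2)" if f: "f \<in> schwartz" and b: "b \<in> Basis" for f b
    proof -
      have [measurable]: "f \<in> borel_measurable borel" using schwartz_measurable f by blast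
      have [measurable]: "?d \<in> borel_measurable borel" by (intro borel_measurable_continuous_onI continuous_intros)
      have "(\<integral>\<^sup>+x. ennreal ((norm (f x))\<^sup>2) *
        (\<integral>\<^sup>+t. ennreal ((?c (x + t *\<^sub>R b) - ?c x)\<^sup>2) * ennreal (kern s t) \<partial>lborel) \<partial>lborel) \<le>
        (\<integral>\<^sup>+x. ennreal tm * (ennreal ((norm (f x))\<^sup>2) * ennreal ((?d x + \<epsilon>) powr (- 2 * s))) \<partial>lborel)"
      proof (rule nn_integral_mono)
        fix x
        have "0 < ?d x + \<epsilon>" using \<epsilon>(1) infdist_nonneg[of x "frontier \<Omega>"] by simp
        from variation_le_truncated_mass[OF this, where m = ?c and x = x and e = b and N = "5 * M" and s = s, OF variation[OF b]]
        have "(\<integral>\<^sup>+t. ennreal ((?c (x + t *\<^sub>R b) - ?c x)\<^sup>2) * ennreal (kern s t) \<partial>lborel) \<le> ennreal ((?d x + \<epsilon>) powr (- 2 * s)) * ennreal tm"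
          unfolding tm(1) by simp
        from mult_left_mono[OF this, of "ennreal ((norm (f x))\<^sup>2)"]
        show "ennreal ((norm (f x))\<^sup>2) * (\<integral>\<^sup>+t. ennreal ((?c (x + t *\<^sub>R b) - ?c x)\<^sup>2) * ennreal (kern s t) \<partial>lborel)
          \<le> ennreal tm * (ennreal ((norm (f x))\<^sup>2) * ennreal ((?d x + \<epsilon>) powr (- 2 * s)))" by (simp add: mult_ac)
      qed
      also have "\<dots> = ennreal tm * (\<integral>\<^sup>+x. ennreal ((norm (f x))\<^sup>2) * ennreal ((?d x + \<epsilon>) powr (- 2 * s)) \<partial>lborel)"
        by (rule nn_integral_cmult) measurable
      also have "\<dots> \<le> ennreal tm * (ennreal (max Ch 0) * ennreal ((sob_norm s f)\<^sup>2))"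
        by (intro mult_left_mono order_trans[OF Ch[OF f \<epsilon>(1)]] mult_right_mono ennreal_leI) auto
      also have "\<dots> = ennreal (tm * max Ch 0) * ennreal ((sob_norm s f)\<^sup>2)" using tm(2) by (simp add: ennreal_mult mult.assoc)
      finally show ?thesis .
    qed
    have "?c x = 1" if "x \<in> K" for x
      using one[of x] Kd[OF that] subsetD[OF K(2) that] \<epsilon>(3) by simp
    thus ?thesis using Em \<epsilon>(1,2) Sc S\<Omega> nz en
      by (intro exI[of _ E] exI[of _ \<epsilon>] exI[of _ S] conjI allI ballI impI) simp_all
  qed
  thus ?thesis by (intro exI[of _ "tm * max Ch 0"] allI impI)
qed

lemma test_functions_iff:
  "f \<in> test_functions \<Omega> \<longleftrightarrow> smooth f \<and> (\<exists>K. compact K \<and> K \<subseteq> \<Omega> \<and> (\<forall>x. x \<notin> K \<longrightarrow> f x = 0))"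
proof
  assume f: "f \<in> test_functions \<Omega>"
  have "f x = 0" if "x \<notin> closure {x. f x \<noteq> 0}" for x using that closure_subset[of "{x. f x \<noteq> 0}"] by blast
  thus "smooth f \<and> (\<exists>K. compact K \<and> K \<subseteq> \<Omega> \<and> (\<forall>x. x \<notin> K \<longrightarrow> f x = 0))"
    using f unfolding test_functions_def by blast
next
  assume "smooth f \<and> (\<exists>K. compact K \<and> K \<subseteq> \<Omega> \<and> (\<forall>x. x \<notin> K \<longrightarrow> f x = 0))"
  then obtain K where K: "smooth f" "compact K" "K \<subseteq> \<Omega>" "\<And>x. x \<notin> K \<Longrightarrow> f x = 0" by blast
  have "closure {x. f x \<noteq> 0} \<subseteq> K" using K(4) by (intro closure_minimal compact_imp_closed K(2)) blast
  moreover from this have "compact (closure {x. f x \<noteq> 0})"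
    using compact_Int_closed[OF K(2) closed_closure[of "{x. f x \<noteq> 0}"]] by (simp only: inf.absorb2)
  ultimately show "f \<in> test_functions \<Omega>" using K(1,3) by (auto simp: test_functions_def)
qed

lemma cutoff_measurable:
  fixes E :: "'a::euclidean_space set"
  assumes E: "E \<in> sets borel" shows "cutoff E \<epsilon> \<in> borel_measurable borel"
proof -
  have "(\<lambda>p. indicat_real E (fst p - \<epsilon> *\<^sub>R snd p)) \<in> borel_measurable (borel \<Otimes>\<^sub>M lborel)"
    by (rule measurable_compose[OF _ borel_measurable_indicator[OF E]]) measurable
  moreover have "(\<lambda>p :: 'a \<times> 'a. mollifier (snd p)) \<in> borel_measurable (borel \<Otimes>\<^sub>M lborel)"
    by (rule measurable_compose[OF _ mollifier_measurable]) measurable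
  ultimately have "(\<lambda>p. indicat_real E (fst p - \<epsilon> *\<^sub>R snd p) * mollifier (snd p)) \<in> borel_measurable (borel \<Otimes>\<^sub>M lborel)"
    by (rule borel_measurable_times)
  thus ?thesis unfolding cutoff_def[abs_def]
    by (intro lborel.borel_measurable_lebesgue_integral) (simp add: split_beta)
qed

text \<open>Cutoff functions of unbounded sets inherit local properties, such as smoothness, from those of bounded sets.\<close>

lemma cutoff_local:
  assumes "0 < \<epsilon>" "ball x \<epsilon> \<subseteq> B" shows "cutoff E \<epsilon> x = cutoff (E \<inter> B) \<epsilon> x"
proof -
  have "indicator E (x - \<epsilon> *\<^sub>R z) * mollifier z = indicator (E \<inter> B) (x - \<epsilon> *\<^sub>R z) * mollifier z" for z
  proof (cases "norm z < 1")
    case True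
    have "\<epsilon> * norm z < \<epsilon> * 1" using True assms(1) by (intro mult_strict_left_mono)
    hence "x - \<epsilon> *\<^sub>R z \<in> ball x \<epsilon>" using assms(1) by (simp add: dist_norm)
    hence "x - \<epsilon> *\<^sub>R z \<in> B" using assms(2) by blast
    thus ?thesis by (simp add: indicator_def)
  qed (simp add: mollifier_eq_0)
  thus ?thesis unfolding cutoff_def by (simp only:)
qed

text \<open>The inner cutoff function is multiplied by one at infinity, of width 1, which makes the support compact. The latter varies on
  the scale 1 everywhere, so it adds only a multiple of the squared norm of order 0.\<close>

lemma cutoff_multiplier_pos:
  fixes \<Omega> :: "'a::euclidean_space set"
  assumes \<Omega>: "lipschitz_domain \<Omega>" and s: "0 < s" "s < 1 / 2"
  shows "\<exists>C\<ge>0. \<forall>K. compact K \<longrightarrow> K \<subseteq> \<Omega> \<longrightarrow> (\<exists>m :: 'a \<Rightarrow> real. (\<forall>x\<in>K. m x = 1) \<and> (\<forall>x. \<bar>m x\<bar> \<le> 1) \<and>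
    (\<forall>f. smooth f \<longrightarrow> (\<lambda>x. complex_of_real (m x) * f x) \<in> test_functions \<Omega>) \<and>
    (\<forall>f\<in>schwartz. sob_norm s (\<lambda>x. complex_of_real (m x) * f x) \<le> C * sob_norm s f))"
proof -
  obtain Ci where Ci: "\<forall>K. compact K \<longrightarrow> K \<subseteq> \<Omega> \<longrightarrow> (\<exists>E \<epsilon> S. E \<in> sets borel \<and> 0 < \<epsilon> \<and> \<epsilon> \<le> 1 \<and> closed S \<and> S \<subseteq> \<Omega> \<and>
    (\<forall>x\<in>K. cutoff E \<epsilon> x = 1) \<and> (\<forall>x. cutoff E \<epsilon> x \<noteq> 0 \<longrightarrow> x \<in> S) \<and>
    (\<forall>f\<in>schwartz. \<forall>b\<in>Basis. (\<integral>\<^sup>+x. ennreal ((norm (f x))\<^sup>2) *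
      (\<integral>\<^sup>+t. ennreal ((cutoff E \<epsilon> (x + t *\<^sub>R b) - cutoff E \<epsilon> x)\<^sup>2) * ennreal (kern s t) \<partial>lborel) \<partial>lborel)
        \<le> ennreal Ci * ennreal ((sob_norm s f)\<^sup>2)))"
    using inner_cutoff[OF \<Omega> s] by (elim exE)
  obtain M where M: "1 \<le> M" "\<And>E \<epsilon> b t x. E \<in> sets borel \<Longrightarrow> 0 < \<epsilon> \<Longrightarrow> b \<in> Basis \<Longrightarrow> 0 < t \<Longrightarrow>
    \<bar>cutoff E \<epsilon> (x + t *\<^sub>R b) - cutoff E \<epsilon> (x::'a)\<bar> \<le> M * (t / \<epsilon>)"
    using cutoff_Lipschitz[where 'a='a] by blast
  obtain tm where tm: "truncated_mass s M = ennreal tm" "0 \<le> tm"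
    using truncated_mass_finite[OF s, of M] by (cases "truncated_mass s M") auto
  obtain k where k: "osc_mass s = ennreal k" "0 \<le> k" using osc_mass_finite[OF s] by (cases "osc_mass s") auto
  obtain Cs where Cs: "\<And>f. f \<in> (schwartz :: ('a \<Rightarrow> complex) set) \<Longrightarrow>
    ennreal ((sob_norm s f)\<^sup>2) \<le> ennreal Cs * (ennreal ((L2_norm f)\<^sup>2) + (\<Sum>b\<in>Basis. dir_energy s b f))"
    using sob_norm_le_dir_energy[OF s, where 'a='a] by blast
  define B where "B = 2 * k + 2 * (2 * max Ci 0 + 2 * tm)"
  define A where "A = max Cs 0 * (1 + real DIM('a) * B)"
  have B0: "0 \<le> B" using k tm by (simp add: B_def)
  have A0: "0 \<le> A" using B0 by (simp add: A_def)
  have "\<exists>m :: 'a \<Rightarrow> real. (\<forall>x\<in>K. m x = 1) \<and> (\<forall>x. \<bar>m x\<bar> \<le> 1) \<and>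
    (\<forall>f. smooth f \<longrightarrow> (\<lambda>x. complex_of_real (m x) * f x) \<in> test_functions \<Omega>) \<and>
    (\<forall>f\<in>schwartz. sob_norm s (\<lambda>x. complex_of_real (m x) * f x) \<le> sqrt A * sob_norm s f)" if K: "compact K" "K \<subseteq> \<Omega>" for K
  proof -
    from Ci[rule_format, OF K] obtain E \<epsilon> S where E: "E \<in> sets borel" "0 < \<epsilon>" "\<epsilon> \<le> 1" "closed S" "S \<subseteq> \<Omega>"
      "\<forall>x\<in>K. cutoff E \<epsilon> x = 1" "\<forall>x. cutoff E \<epsilon> x \<noteq> 0 \<longrightarrow> x \<in> S"
      "\<forall>f\<in>schwartz. \<forall>b\<in>Basis. (\<integral>\<^sup>+x. ennreal ((norm (f x))\<^sup>2) *
      (\<integral>\<^sup>+t. ennreal ((cutoff E \<epsilon> (x + t *\<^sub>R b) - cutoff E \<epsilon> x)\<^sup>2) * ennreal (kern s t) \<partial>lborel) \<partial>lborel)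
        \<le> ennreal Ci * ennreal ((sob_norm s f)\<^sup>2)"
      by (elim exE conjE)
    obtain R where R: "\<And>x. x \<in> K \<Longrightarrow> norm x \<le> R" using compact_imp_bounded[OF K(1)] unfolding bounded_iff by blast
    let ?Q = "cball (0::'a) (R + 1)"
    let ?c = "cutoff E \<epsilon>" and ?n = "cutoff ?Q 1"
    have Q: "?Q \<in> sets borel" by simp
    define m where "m x = ?n x * ?c x" for x
    have cb: "0 \<le> ?c x" "?c x \<le> 1" "0 \<le> ?n x" "?n x \<le> 1" for x
      using cutoff_bounds[OF E(1), of \<epsilon> x] cutoff_bounds[OF Q, of 1 x] by auto
    have m1: "\<bar>m x\<bar> \<le> 1" for x using cb[of x] by (simp add: m_def mult_le_one)
    have mK: "m x = 1" if "x \<in> K" for x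
    proof -
      have "ball x 1 \<subseteq> ?Q"
      proof
        fix y assume "y \<in> ball x 1"
        thus "y \<in> ?Q" using R[OF that] norm_triangle_ineq[of x "y - x"] by (simp add: dist_norm norm_minus_commute)
      qed
      hence "?n x = 1" by (intro cutoff_eq_1) auto
      thus ?thesis using bspec[OF E(6) that] by (simp add: m_def)
    qed
    have n0: "norm x \<le> R + 2" if "?n x \<noteq> 0" for x
    proof (rule ccontr)
      assume far: "\<not> norm x \<le> R + 2"
      have "ball x 1 \<inter> ?Q = {}"
      proof (rule ccontr)
        assume "ball x 1 \<inter> ?Q \<noteq> {}"
        then obtain y where "dist x y < 1" "norm y \<le> R + 1" by auto
        thus False using far norm_triangle_ineq[of y "x - y"] by (simp add: dist_norm)
      qed
      thus False using cutoff_eq_0[of 1 x ?Q] that by simp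
    qed
    \<comment> \<open>where the cutoff function at infinity lives, \<open>E\<close> may be replaced by a bounded set\<close>
    let ?E' = "E \<inter> cball 0 (R + 3)"
    have m_eq: "m x = ?n x * cutoff ?E' \<epsilon> x" for x
    proof (cases "?n x = 0")
      case False
      have "ball x \<epsilon> \<subseteq> cball 0 (R + 3)"
      proof
        fix y assume "y \<in> ball x \<epsilon>"
        thus "y \<in> cball 0 (R + 3)" using n0[OF False] E(3) norm_triangle_ineq[of x "y - x"] by (simp add: dist_norm norm_minus_commute)
      qed
      from cutoff_local[OF E(2) this, of E] show ?thesis by (simp only: m_def)
    qed (simp add: m_def)
    have smooth_m: "smooth (\<lambda>x. complex_of_real (m x))"
    proof -
      have "smooth (\<lambda>x. complex_of_real (?n x))" by (intro cutoff_smooth) auto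
      moreover have "smooth (\<lambda>x. complex_of_real (cutoff ?E' \<epsilon> x))"
        using E by (intro cutoff_smooth) (auto intro: bounded_subset[OF bounded_cball])
      ultimately show ?thesis using smooth_mult unfolding m_eq of_real_mult by blast
    qed
    have test: "(\<lambda>x. complex_of_real (m x) * f x) \<in> test_functions \<Omega>" if f: "smooth f" for f
      unfolding test_functions_iff
    proof (intro conjI exI[of _ "S \<inter> cball 0 (R + 2)"] allI impI)
      show "smooth (\<lambda>x. complex_of_real (m x) * f x)" by (rule smooth_mult[OF smooth_m f])
      show "compact (S \<inter> cball 0 (R + 2))" using E(4) by (intro closed_Int_compact) auto
      show "S \<inter> cball 0 (R + 2) \<subseteq> \<Omega>" using E(5) by blast
      fix x assume "x \<notin> S \<inter> cball 0 (R + 2)"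
      hence "?c x = 0 \<or> ?n x = 0" using spec[OF E(7), of x] n0[of x] by auto
      thus "complex_of_real (m x) * f x = 0" by (auto simp: m_def)
    qed
    have mm[measurable]: "m \<in> borel_measurable borel"
    proof -
      have "(\<lambda>x. Re (complex_of_real (m x))) \<in> borel_measurable borel"
        using smooth_measurable[OF smooth_m] by measurable
      thus ?thesis by simp
    qed
    have cm: "?c \<in> borel_measurable borel" and nm: "?n \<in> borel_measurable borel"
      by (rule cutoff_measurable[OF E(1)], rule cutoff_measurable[OF Q])
    have bound: "sob_norm s (\<lambda>x. complex_of_real (m x) * f x) \<le> sqrt A * sob_norm s f" if f: "f \<in> schwartz" for f
    proof -
      note [measurable] = cm nm schwartz_measurable[OF f]
      let ?X = "ennreal ((sob_norm s f)\<^sup>2)"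
      let ?v = "\<lambda>x. ennreal ((norm (f x))\<^sup>2)"
      let ?V = "\<lambda>g b x. \<integral>\<^sup>+t. ennreal ((g (x + t *\<^sub>R b) - g x)\<^sup>2) * ennreal (kern s t) \<partial>lborel"
      have mf: "(\<lambda>x. complex_of_real (m x) * f x) \<in> schwartz"
        using test[OF schwartz_smooth[OF f]] test_functions_schwartz by blast
      have Lf: "L2_norm f \<le> sob_norm s f" using sob_norm_mono[OF f, of 0 s] s sob_norm_0[OF f] by simp
      have vX: "(\<integral>\<^sup>+x. ?v x \<partial>lborel) \<le> ?X"
        unfolding L2_nn_integral[OF schwartz_L2[OF f]] by (intro ennreal_leI power_mono Lf L2_norm_nonneg)
      have Vm: "?V m b x \<le> 2 * ?V ?c b x + 2 * ennreal tm" if b: "b \<in> Basis" for b x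
      proof -
        have "?V m b x \<le> (\<integral>\<^sup>+t. 2 * (ennreal ((?c (x + t *\<^sub>R b) - ?c x)\<^sup>2) * ennreal (kern s t)) +
          2 * (ennreal ((?n (x + t *\<^sub>R b) - ?n x)\<^sup>2) * ennreal (kern s t)) \<partial>lborel)"
        proof (rule nn_integral_mono)
          fix t
          let ?y = "x + t *\<^sub>R b"
          have "m ?y - m x = ?n ?y * (?c ?y - ?c x) + ?c x * (?n ?y - ?n x)" by (simp add: m_def algebra_simps)
          hence "(m ?y - m x)\<^sup>2 \<le> 2 * (?n ?y * (?c ?y - ?c x))\<^sup>2 + 2 * (?c x * (?n ?y - ?n x))\<^sup>2"
            using norm_add_sq_le[of "?n ?y * (?c ?y - ?c x)" "?c x * (?n ?y - ?n x)"] by simp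
          also have "\<dots> \<le> 2 * (?c ?y - ?c x)\<^sup>2 + 2 * (?n ?y - ?n x)\<^sup>2"
          proof -
            have "(?n ?y)\<^sup>2 * (?c ?y - ?c x)\<^sup>2 \<le> 1 * (?c ?y - ?c x)\<^sup>2" using cb[of ?y] by (intro mult_right_mono power_le_one) auto
            moreover have "(?c x)\<^sup>2 * (?n ?y - ?n x)\<^sup>2 \<le> 1 * (?n ?y - ?n x)\<^sup>2" using cb[of x] by (intro mult_right_mono power_le_one) auto
            ultimately show ?thesis by (simp only: power_mult_distrib)
          qed
          finally have "(m ?y - m x)\<^sup>2 * kern s t \<le> (2 * (?c ?y - ?c x)\<^sup>2 + 2 * (?n ?y - ?n x)\<^sup>2) * kern s t"
            by (rule mult_right_mono[OF _ kern_nonneg])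
          hence "ennreal ((m ?y - m x)\<^sup>2 * kern s t) \<le> ennreal (2 * ((?c ?y - ?c x)\<^sup>2 * kern s t) + 2 * ((?n ?y - ?n x)\<^sup>2 * kern s t))"
            by (intro ennreal_leI) (simp add: algebra_simps)
          thus "ennreal ((m ?y - m x)\<^sup>2) * ennreal (kern s t) \<le> 2 * (ennreal ((?c ?y - ?c x)\<^sup>2) * ennreal (kern s t)) +
            2 * (ennreal ((?n ?y - ?n x)\<^sup>2) * ennreal (kern s t))" by (simp add: ennreal_mult kern_nonneg)
        qed
        also have "\<dots> = 2 * ?V ?c b x + 2 * ?V ?n b x" by (simp add: nn_integral_add nn_integral_cmult)
        also have "\<dots> \<le> 2 * ?V ?c b x + 2 * ennreal tm"
        proof (intro add_left_mono mult_left_mono)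
          have "?V ?n b x \<le> ennreal (1 powr (- 2 * s)) * truncated_mass s M"
          proof (rule variation_le_truncated_mass)
            fix t :: real assume t: "0 < t"
            have "\<bar>?n (x + t *\<^sub>R b) - ?n x\<bar> \<le> M * (t / 1)" using M(2)[OF Q _ b t, of 1 x] by simp
            hence "\<bar>?n (x + t *\<^sub>R b) - ?n x\<bar>\<^sup>2 \<le> (M * (t / 1))\<^sup>2" by (intro power_mono) auto
            moreover have "\<bar>?n (x + t *\<^sub>R b) - ?n x\<bar> \<le> 1" using cb[of x] cb[of "x + t *\<^sub>R b"] by simp
            hence "\<bar>?n (x + t *\<^sub>R b) - ?n x\<bar>\<^sup>2 \<le> 1\<^sup>2" by (intro power_mono) auto
            ultimately show "(?n (x + t *\<^sub>R b) - ?n x)\<^sup>2 \<le> min 1 ((M * (t / 1))\<^sup>2)" by simp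
          qed simp
          thus "?V ?n b x \<le> ennreal tm" by (simp add: tm(1))
        qed simp
        finally show ?thesis .
      qed
      have dir: "dir_energy s b (\<lambda>x. complex_of_real (m x) * f x) \<le> ennreal B * ?X" if b: "b \<in> Basis" for b
      proof -
        have "(\<integral>\<^sup>+x. ?v x * ?V m b x \<partial>lborel) \<le> (\<integral>\<^sup>+x. 2 * (?v x * ?V ?c b x) + 2 * ennreal tm * ?v x \<partial>lborel)"
        proof (rule nn_integral_mono)
          fix x
          show "?v x * ?V m b x \<le> 2 * (?v x * ?V ?c b x) + 2 * ennreal tm * ?v x"
            using mult_left_mono[OF Vm[OF b, of x], of "?v x"] by (simp add: distrib_left mult_ac)
        qed
        also have "\<dots> = 2 * (\<integral>\<^sup>+x. ?v x * ?V ?c b x \<partial>lborel) + 2 * ennreal tm * (\<integral>\<^sup>+x. ?v x \<partial>lborel)"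
          by (simp add: nn_integral_add nn_integral_cmult)
        also have "\<dots> \<le> 2 * (ennreal (max Ci 0) * ?X) + 2 * ennreal tm * ?X"
          by (intro add_mono mult_left_mono vX order_trans[OF bspec[OF bspec[OF E(8) f] b]] mult_right_mono ennreal_leI) auto
        finally have 2: "(\<integral>\<^sup>+x. ?v x * ?V m b x \<partial>lborel) \<le> 2 * (ennreal (max Ci 0) * ?X) + 2 * ennreal tm * ?X" .
        have "dir_energy s b (\<lambda>x. complex_of_real (m x) * f x) \<le> 2 * dir_energy s b f + 2 * (\<integral>\<^sup>+x. ?v x * ?V m b x \<partial>lborel)"
          by (rule dir_energy_mult[OF f mm m1])
        also have "\<dots> \<le> 2 * (ennreal k * ?X) + 2 * (2 * (ennreal (max Ci 0) * ?X) + 2 * ennreal tm * ?X)"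
          using dir_energy_le_sob_norm[OF f _ s(1), of b] b unfolding k(1)
          by (intro add_mono mult_left_mono 2) auto
        also have "\<dots> = ennreal B * ?X"
        proof -
          have "ennreal B = 2 * ennreal k + 2 * (2 * ennreal (max Ci 0) + 2 * ennreal tm)"
            using k(2) tm(2) by (simp add: B_def ennreal_mult)
          thus ?thesis by (simp only: distrib_right distrib_left mult.assoc)
        qed
        finally show ?thesis .
      qed
      have Lm: "ennreal ((L2_norm (\<lambda>x. complex_of_real (m x) * f x))\<^sup>2) \<le> ?X"
        unfolding L2_nn_integral[OF schwartz_L2[OF mf], symmetric]
      proof (rule order_trans[OF nn_integral_mono vX])
        fix x
        show "ennreal ((norm (complex_of_real (m x) * f x))\<^sup>2) \<le> ?v x"
          using m1[of x] by (intro ennreal_leI power_mono) (auto simp: norm_mult mult_left_le_one_le)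
      qed
      have "ennreal ((sob_norm s (\<lambda>x. complex_of_real (m x) * f x))\<^sup>2) \<le>
        ennreal (max Cs 0) * (?X + (\<Sum>b\<in>(Basis::'a set). ennreal B * ?X))"
        using order_trans[OF Cs[OF mf] mult_mono[OF ennreal_leI add_mono[OF Lm sum_mono[OF dir]]]] by simp
      also have "\<dots> = ennreal A * ?X"
        using B0 by (simp add: A_def ennreal_mult ennreal_of_nat_eq_real_of_nat[symmetric] distrib_right distrib_left mult_ac)
      also have "\<dots> = ennreal (A * (sob_norm s f)\<^sup>2)" using A0 by (simp add: ennreal_mult)
      finally have "(sob_norm s (\<lambda>x. complex_of_real (m x) * f x))\<^sup>2 \<le> A * (sob_norm s f)\<^sup>2"
        using A0 by (subst (asm) ennreal_le_iff) auto
      hence "(sob_norm s (\<lambda>x. complex_of_real (m x) * f x))\<^sup>2 \<le> (sqrt A * sob_norm s f)\<^sup>2"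
        using A0 by (simp add: power_mult_distrib)
      thus ?thesis by (rule power2_le_imp_le) (simp add: A0 sob_norm_nonneg)
    qed
    show ?thesis using mK m1 test bound by (intro exI[of _ m] conjI allI ballI impI)
  qed
  thus ?thesis using A0 by (intro exI[of _ "sqrt A"] conjI allI impI) simp_all
qed

text \<open>For \<open>s = 0\<close> the boundedness of \<open>m\<close> by 1 suffices, and the cutoff functions of any other order can be used.\<close>

lemma cutoff_multiplier:
  fixes \<Omega> :: "'a::euclidean_space set"
  assumes \<Omega>: "lipschitz_domain \<Omega>" and s: "0 \<le> s" "s < 1 / 2"
  shows "\<exists>C\<ge>0. \<forall>K. compact K \<longrightarrow> K \<subseteq> \<Omega> \<longrightarrow> (\<exists>m :: 'a \<Rightarrow> real. (\<forall>x\<in>K. m x = 1) \<and>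
    (\<forall>f. smooth f \<longrightarrow> (\<lambda>x. complex_of_real (m x) * f x) \<in> test_functions \<Omega>) \<and>
    (\<forall>f\<in>schwartz. sob_norm s (\<lambda>x. complex_of_real (m x) * f x) \<le> C * sob_norm s f))"
proof (cases "s = 0")
  case False
  hence "0 < s" using s by simp
  from cutoff_multiplier_pos[OF \<Omega> this s(2)] show ?thesis by meson
next
  case True
  have "\<exists>m :: 'a \<Rightarrow> real. (\<forall>x\<in>K. m x = 1) \<and>
    (\<forall>f. smooth f \<longrightarrow> (\<lambda>x. complex_of_real (m x) * f x) \<in> test_functions \<Omega>) \<and>
    (\<forall>f\<in>schwartz. sob_norm s (\<lambda>x. complex_of_real (m x) * f x) \<le> 1 * sob_norm s f)" if K: "compact K" "K \<subseteq> \<Omega>" for K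
  proof -
    obtain m :: "'a \<Rightarrow> real" where m: "\<forall>x\<in>K. m x = 1" "\<And>x. \<bar>m x\<bar> \<le> 1"
      "\<And>f. smooth f \<Longrightarrow> (\<lambda>x. complex_of_real (m x) * f x) \<in> test_functions \<Omega>"
      using cutoff_multiplier_pos[OF \<Omega>, of "1 / 4"] K by force
    have "sob_norm s (\<lambda>x. complex_of_real (m x) * f x) \<le> 1 * sob_norm s f" if f: "f \<in> schwartz" for f
    proof -
      have mf: "(\<lambda>x. complex_of_real (m x) * f x) \<in> schwartz"
        using m(3)[OF schwartz_smooth[OF f]] test_functions_schwartz by blast
      have "(LINT x|lborel. (norm (complex_of_real (m x) * f x))\<^sup>2) \<le> (LINT x|lborel. (norm (f x))\<^sup>2)"
        using m(2) by (intro integral_mono L2_integrable schwartz_L2 mf f power_mono)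
          (auto simp: norm_mult mult_left_le_one_le)
      hence "L2_norm (\<lambda>x. complex_of_real (m x) * f x) \<le> L2_norm f"
        unfolding L2_norm_def by (rule real_sqrt_le_mono)
      thus ?thesis by (simp add: True sob_norm_0 f mf)
    qed
    thus ?thesis using m(1,3) by blast
  qed
  thus ?thesis by (intro exI[of _ 1]) auto
qed

section \<open>The inf-sup condition\<close>

definition inf_sup :: "'a::euclidean_space set \<Rightarrow> real \<Rightarrow> bool" where
  "inf_sup \<Omega> \<sigma> \<longleftrightarrow> (\<exists>C\<ge>0. \<forall>\<phi>\<in>test_functions \<Omega>. \<exists>\<psi>\<in>test_functions \<Omega>.
     (sob_norm \<sigma> \<phi>)\<^sup>2 \<le> Re (LINT x|lborel. \<phi> x * \<psi> x) \<and> sob_norm (- \<sigma>) \<psi> \<le> C * sob_norm \<sigma> \<phi>)"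

text \<open>The norm of order \<open>- s\<close> is attained in the pairing with a function of order \<open>s\<close>, namely \<open>z\<close> below, and multiplication by a real function is its own transpose.\<close>

lemma sob_norm_mult_dual:
  assumes m: "\<And>f. f \<in> schwartz \<Longrightarrow> (\<lambda>x. complex_of_real (m x) * f x) \<in> schwartz"
    and le: "\<And>f. f \<in> schwartz \<Longrightarrow> sob_norm s (\<lambda>x. complex_of_real (m x) * f x) \<le> C * sob_norm s f"
    and C: "0 \<le> C" and v: "v \<in> schwartz"
  shows "sob_norm (- s) (\<lambda>x. complex_of_real (m x) * v x) \<le> C * sob_norm (- s) v"
proof -
  let ?h = "\<lambda>x. complex_of_real (m x) * v x"
  define p where "p = bessel_op (- s) ?h"
  define q where "q x = cnj (p x)" for x
  define z where "z = bessel_op (- s) q"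
  have h: "?h \<in> schwartz" by (rule m[OF v])
  have p: "p \<in> schwartz" unfolding p_def by (rule schwartz_bessel_op[OF h])
  have q: "q \<in> schwartz" unfolding q_def by (rule schwartz_cnj[OF p])
  have z: "z \<in> schwartz" unfolding z_def by (rule schwartz_bessel_op[OF q])
  have np: "L2_norm p = sob_norm (- s) ?h" unfolding p_def by (rule L2_norm_bessel_op[OF h])
  have nz: "sob_norm s z = L2_norm p"
    unfolding z_def sob_norm_bessel_op[OF q] using sob_norm_0[OF q] L2_norm_cnj[of p] by (simp add: q_def[abs_def])
  have "complex_of_real ((L2_norm p)\<^sup>2) = (LINT x|lborel. p x * q x)"
    unfolding q_def L2_norm_sq by (simp only: complex_norm_square[symmetric] integral_complex_of_real)
  also have "\<dots> = (LINT x|lborel. ?h x * z x)" unfolding p_def z_def by (rule integral_bessel_op[OF h q])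
  also have "\<dots> = (LINT x|lborel. v x * (complex_of_real (m x) * z x))" by (simp add: mult_ac)
  finally have "(L2_norm p)\<^sup>2 = norm (LINT x|lborel. v x * (complex_of_real (m x) * z x))"
    by (metis abs_of_nonneg norm_of_real zero_le_power2)
  also have "\<dots> \<le> sob_norm (- s) v * sob_norm s (\<lambda>x. complex_of_real (m x) * z x)"
    using norm_integral_le_sob_norm[OF v m[OF z], of "- s"] by simp
  also have "\<dots> \<le> sob_norm (- s) v * (C * sob_norm s z)" by (intro mult_left_mono le z sob_norm_nonneg)
  finally have "L2_norm p * L2_norm p \<le> (C * sob_norm (- s) v) * L2_norm p"
    unfolding nz by (simp add: power2_eq_square mult_ac)
  thus ?thesis unfolding np[symmetric] using L2_norm_nonneg[of p] mult_nonneg_nonneg[OF C sob_norm_nonneg[of "- s" v]]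
    by (cases "L2_norm p = 0") auto
qed

text \<open>The optimal \<open>\<psi>\<close> on the whole space is \<open>bessel_op (2 * \<sigma>)\<close> of the conjugate of \<open>\<phi>\<close>. Multiplying it by a
  cutoff function that is 1 on the support of \<open>\<phi>\<close> does not change the pairing, and for
  \<open>\<bar>\<sigma>\<bar> < 1 / 2\<close> it is harmless for the norm: directly if the order \<open>- \<sigma>\<close> of \<open>\<psi>\<close> is positive, by duality otherwise.\<close>

lemma inf_sup_base:
  fixes \<Omega> :: "'a::euclidean_space set"
  assumes \<Omega>: "lipschitz_domain \<Omega>" and \<sigma>: "\<bar>\<sigma>\<bar> < 1 / 2"
  shows "inf_sup \<Omega> \<sigma>"
proof -
  obtain C where C: "0 \<le> C" and mult: "\<And>K. compact K \<Longrightarrow> K \<subseteq> \<Omega> \<Longrightarrow> \<exists>m :: 'a \<Rightarrow> real. (\<forall>x\<in>K. m x = 1) \<and>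
    (\<forall>f. smooth f \<longrightarrow> (\<lambda>x. complex_of_real (m x) * f x) \<in> test_functions \<Omega>) \<and>
    (\<forall>f\<in>schwartz. sob_norm \<bar>\<sigma>\<bar> (\<lambda>x. complex_of_real (m x) * f x) \<le> C * sob_norm \<bar>\<sigma>\<bar> f)"
    using cutoff_multiplier[OF \<Omega> abs_ge_zero \<sigma>] by blast
  have "\<exists>\<psi>\<in>test_functions \<Omega>. (sob_norm \<sigma> \<phi>)\<^sup>2 \<le> Re (LINT x|lborel. \<phi> x * \<psi> x) \<and> sob_norm (- \<sigma>) \<psi> \<le> C * sob_norm \<sigma> \<phi>"
    if \<phi>: "\<phi> \<in> test_functions \<Omega>" for \<phi>
  proof -
    obtain K where K: "compact K" "K \<subseteq> \<Omega>" "\<And>x. x \<notin> K \<Longrightarrow> \<phi> x = 0" using \<phi> unfolding test_functions_iff by blast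
    obtain m :: "'a \<Rightarrow> real" where m: "\<And>x. x \<in> K \<Longrightarrow> m x = 1"
      "\<And>f. smooth f \<Longrightarrow> (\<lambda>x. complex_of_real (m x) * f x) \<in> test_functions \<Omega>"
      "\<And>f. f \<in> schwartz \<Longrightarrow> sob_norm \<bar>\<sigma>\<bar> (\<lambda>x. complex_of_real (m x) * f x) \<le> C * sob_norm \<bar>\<sigma>\<bar> f"
      using mult[OF K(1,2)] by blast
    have ms: "(\<lambda>x. complex_of_real (m x) * f x) \<in> schwartz" if "f \<in> schwartz" for f
      using m(2)[OF schwartz_smooth[OF that]] test_functions_schwartz by blast
    have \<phi>S: "\<phi> \<in> schwartz" using \<phi> test_functions_schwartz by blast
    \<comment> \<open>\<open>v\<close> is the optimal partner on the whole space, as the pairing of \<open>\<phi>\<close> with it is the squared norm of \<open>bessel_op \<sigma> \<phi>\<close>\<close>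
    define h where "h x = cnj (bessel_op \<sigma> \<phi> x)" for x
    have h: "h \<in> schwartz" unfolding h_def by (intro schwartz_cnj schwartz_bessel_op \<phi>S)
    define v where "v = bessel_op \<sigma> h"
    have v: "v \<in> schwartz" unfolding v_def by (rule schwartz_bessel_op[OF h])
    have nh: "L2_norm h = sob_norm \<sigma> \<phi>" unfolding h_def L2_norm_cnj by (rule L2_norm_bessel_op[OF \<phi>S])
    have nv: "sob_norm (- \<sigma>) v = sob_norm \<sigma> \<phi>"
      unfolding v_def sob_norm_bessel_op[OF h] using sob_norm_0[OF h] nh by simp
    have "(LINT x|lborel. \<phi> x * (complex_of_real (m x) * v x)) = (LINT x|lborel. \<phi> x * v x)"
    proof (intro Bochner_Integration.integral_cong refl)
      fix x show "\<phi> x * (complex_of_real (m x) * v x) = \<phi> x * v x" using m(1)[of x] K(3)[of x] by (cases "x \<in> K") auto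
    qed
    also have "\<dots> = (LINT x|lborel. bessel_op \<sigma> \<phi> x * h x)" unfolding v_def by (rule integral_bessel_op[OF \<phi>S h, symmetric])
    also have "\<dots> = complex_of_real ((L2_norm (bessel_op \<sigma> \<phi>))\<^sup>2)"
      unfolding h_def L2_norm_sq by (simp only: complex_norm_square[symmetric] integral_complex_of_real)
    finally have pair: "(sob_norm \<sigma> \<phi>)\<^sup>2 \<le> Re (LINT x|lborel. \<phi> x * (complex_of_real (m x) * v x))"
      by (simp add: L2_norm_bessel_op[OF \<phi>S])
    have "sob_norm (- \<sigma>) (\<lambda>x. complex_of_real (m x) * v x) \<le> C * sob_norm (- \<sigma>) v"
    proof (cases "0 \<le> \<sigma>")
      case True
      show ?thesis by (rule sob_norm_mult_dual[OF ms _ C v]) (use m(3) True in simp_all)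
    next
      case False
      thus ?thesis using m(3)[OF v] by simp
    qed
    hence "sob_norm (- \<sigma>) (\<lambda>x. complex_of_real (m x) * v x) \<le> C * sob_norm \<sigma> \<phi>" unfolding nv .
    thus ?thesis using pair m(2)[OF schwartz_smooth[OF v]]
      by (intro bexI[of _ "\<lambda>x. complex_of_real (m x) * v x"] conjI) assumption+
  qed
  thus ?thesis unfolding inf_sup_def using C by blast
qed

lemma test_functions_add:
  assumes "f \<in> test_functions \<Omega>" "g \<in> test_functions \<Omega>" shows "(\<lambda>x. f x + g x) \<in> test_functions \<Omega>"
proof -
  obtain K L where KL: "compact K" "K \<subseteq> \<Omega>" "\<And>x. x \<notin> K \<Longrightarrow> f x = 0" "compact L" "L \<subseteq> \<Omega>" "\<And>x. x \<notin> L \<Longrightarrow> g x = 0"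
    using assms unfolding test_functions_iff by metis
  have "smooth (\<lambda>x. f x + g x)"
    using assms test_functions_schwartz by (intro schwartz_smooth schwartz_add) auto
  moreover have "compact (K \<union> L)" "K \<union> L \<subseteq> \<Omega>" using KL by auto
  ultimately show ?thesis using KL unfolding test_functions_iff by (intro conjI exI[of _ "K \<union> L"]) auto
qed

lemma test_functions_cmult:
  assumes "f \<in> test_functions \<Omega>" shows "(\<lambda>x. c * f x) \<in> test_functions \<Omega>"
proof -
  obtain K where K: "compact K" "K \<subseteq> \<Omega>" "\<And>x. x \<notin> K \<Longrightarrow> f x = 0" using assms unfolding test_functions_iff by metis
  have "smooth (\<lambda>x. c * f x)" using assms test_functions_schwartz by (intro schwartz_smooth schwartz_cmult) auto
  thus ?thesis using K unfolding test_functions_iff by (intro conjI exI[of _ K]) auto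
qed

lemma test_functions_zero: "(\<lambda>x. 0) \<in> test_functions \<Omega>"
  unfolding test_functions_iff using schwartz_smooth[OF schwartz_zero] by (intro conjI exI[of _ "{}"]) auto

lemma test_functions_sum:
  "(\<And>i. i \<in> A \<Longrightarrow> f i \<in> test_functions \<Omega>) \<Longrightarrow> (\<lambda>x. \<Sum>i\<in>A. f i x) \<in> test_functions \<Omega>"
  by (induction A rule: infinite_finite_induct) (auto simp: test_functions_zero intro: test_functions_add)

lemma test_functions_partial_deriv:
  assumes "f \<in> test_functions \<Omega>" "b \<in> Basis" shows "partial_deriv b f \<in> test_functions \<Omega>"
proof -
  obtain K where K: "smooth f" "compact K" "K \<subseteq> \<Omega>" "\<And>x. x \<notin> K \<Longrightarrow> f x = 0" using assms unfolding test_functions_iff by metis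
  have "partial_deriv b f x = 0" if "x \<notin> K" for x
    using that K compact_imp_closed[OF K(2)] by (intro partial_deriv_eq_0[of "- K"]) auto
  thus ?thesis using K smooth_partial_deriv[OF K(1) assms(2)] unfolding test_functions_iff by blast
qed

text \<open>The squared norm of order \<open>\<sigma> + 1\<close> is the sum of those of order \<open>\<sigma>\<close> of the function and of its first
  derivatives, and these derivatives are again test functions on \<open>\<Omega>\<close>. So the functions \<open>\<psi>\<close> for all of them can
  be combined, the derivatives being moved over by partial integration.\<close>

lemma inf_sup_succ:
  fixes \<Omega> :: "'a::euclidean_space set"
  assumes "inf_sup \<Omega> \<sigma>" shows "inf_sup \<Omega> (\<sigma> + 1)"
proof -
  obtain C where C: "0 \<le> C" and isup: "\<And>\<phi>. \<phi> \<in> test_functions \<Omega> \<Longrightarrow> \<exists>\<psi>. \<psi> \<in> test_functions \<Omega> \<and>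
     (sob_norm \<sigma> \<phi>)\<^sup>2 \<le> Re (LINT x|lborel. \<phi> x * \<psi> x) \<and> sob_norm (- \<sigma>) \<psi> \<le> C * sob_norm \<sigma> \<phi>"
    using assms unfolding inf_sup_def by blast
  obtain P where P: "\<And>\<phi>. \<phi> \<in> test_functions \<Omega> \<Longrightarrow> P \<phi> \<in> test_functions \<Omega> \<and>
     (sob_norm \<sigma> \<phi>)\<^sup>2 \<le> Re (LINT x|lborel. \<phi> x * P \<phi> x) \<and> sob_norm (- \<sigma>) (P \<phi>) \<le> C * sob_norm \<sigma> \<phi>"
    using bchoice[of "test_functions \<Omega>"] isup by metis
  let ?C = "C * (1 + real DIM('a))"
  have "\<exists>\<psi>\<in>test_functions \<Omega>. (sob_norm (\<sigma> + 1) \<phi>)\<^sup>2 \<le> Re (LINT x|lborel. \<phi> x * \<psi> x) \<and>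
    sob_norm (- (\<sigma> + 1)) \<psi> \<le> ?C * sob_norm (\<sigma> + 1) \<phi>" if \<phi>: "\<phi> \<in> test_functions \<Omega>" for \<phi>
  proof -
    have S: "f \<in> schwartz" if "f \<in> test_functions \<Omega>" for f using that test_functions_schwartz by blast
    note \<phi>S = S[OF \<phi>]
    define d where "d b = partial_deriv b \<phi>" for b
    have d: "d b \<in> test_functions \<Omega>" if "b \<in> Basis" for b unfolding d_def by (rule test_functions_partial_deriv[OF \<phi> that])
    define q where "q b x = - 1 * partial_deriv b (P (d b)) x" for b x
    have qT: "q b \<in> test_functions \<Omega>" if "b \<in> Basis" for b
      unfolding q_def[abs_def] using P[OF d[OF that]] that by (intro test_functions_cmult test_functions_partial_deriv) auto
    define \<psi> where "\<psi> x = P \<phi> x + (\<Sum>b\<in>Basis. q b x)" for x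
    have sT: "(\<lambda>x. \<Sum>b\<in>Basis. q b x) \<in> test_functions \<Omega>" by (rule test_functions_sum[OF qT])
    have \<psi>T: "\<psi> \<in> test_functions \<Omega>" unfolding \<psi>_def[abs_def] using P[OF \<phi>] sT by (intro test_functions_add) auto
    have i: "integrable lborel (\<lambda>x. \<phi> x * f x)" if "f \<in> test_functions \<Omega>" for f
      by (rule schwartz_integrable[OF schwartz_mult[OF \<phi>S S[OF that]]])
    have parts: "(LINT x|lborel. \<phi> x * q b x) = (LINT x|lborel. d b x * P (d b) x)" if b: "b \<in> Basis" for b
    proof -
      have "P (d b) \<in> schwartz" using P[OF d[OF b]] S by blast
      from integral_by_parts[OF slow_of_schwartz[OF \<phi>S] this b] show ?thesis by (simp add: q_def d_def)
    qed
    have "(LINT x|lborel. \<phi> x * \<psi> x) = (LINT x|lborel. \<phi> x * P \<phi> x + (\<Sum>b\<in>Basis. \<phi> x * q b x))"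
      by (simp add: \<psi>_def distrib_left sum_distrib_left)
    also have "\<dots> = (LINT x|lborel. \<phi> x * P \<phi> x) + (LINT x|lborel. (\<Sum>b\<in>Basis. \<phi> x * q b x))"
      using P[OF \<phi>] qT by (intro Bochner_Integration.integral_add i Bochner_Integration.integrable_sum) auto
    also have "(LINT x|lborel. (\<Sum>b\<in>Basis. \<phi> x * q b x)) = (\<Sum>b\<in>Basis. LINT x|lborel. \<phi> x * q b x)"
      using qT by (intro Bochner_Integration.integral_sum i) auto
    finally have "Re (LINT x|lborel. \<phi> x * \<psi> x) = Re (LINT x|lborel. \<phi> x * P \<phi> x) + (\<Sum>b\<in>Basis. Re (LINT x|lborel. d b x * P (d b) x))"
      by (simp add: parts)
    moreover have "(\<Sum>b\<in>Basis. (sob_norm \<sigma> (d b))\<^sup>2) \<le> (\<Sum>b\<in>Basis. Re (LINT x|lborel. d b x * P (d b) x))"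
      using P[OF d] by (intro sum_mono) auto
    moreover have "(sob_norm (\<sigma> + 1) \<phi>)\<^sup>2 = (sob_norm \<sigma> \<phi>)\<^sup>2 + (\<Sum>b\<in>Basis. (sob_norm \<sigma> (d b))\<^sup>2)"
      unfolding d_def by (rule sob_norm_succ[OF \<phi>S])
    ultimately have lower: "(sob_norm (\<sigma> + 1) \<phi>)\<^sup>2 \<le> Re (LINT x|lborel. \<phi> x * \<psi> x)" using P[OF \<phi>] by linarith
    let ?N = "sob_norm (\<sigma> + 1) \<phi>"
    have "sob_norm (- (\<sigma> + 1)) (P \<phi>) \<le> sob_norm (- \<sigma>) (P \<phi>)" using P[OF \<phi>] S by (intro sob_norm_mono) auto
    also have "\<dots> \<le> C * sob_norm \<sigma> \<phi>" using P[OF \<phi>] by blast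
    also have "\<dots> \<le> C * ?N" by (intro mult_left_mono sob_norm_mono \<phi>S C) simp
    finally have 1: "sob_norm (- (\<sigma> + 1)) (P \<phi>) \<le> C * ?N" .
    have 2: "sob_norm (- (\<sigma> + 1)) (q b) \<le> C * ?N" if b: "b \<in> Basis" for b
    proof -
      have PS: "P (d b) \<in> schwartz" using P[OF d[OF b]] S by blast
      have "sob_norm (- (\<sigma> + 1)) (q b) = sob_norm (- (\<sigma> + 1)) (partial_deriv b (P (d b)))"
        unfolding q_def[abs_def] sob_norm_cmult by simp
      also have "\<dots> \<le> sob_norm (- \<sigma>) (P (d b))" using sob_norm_partial_deriv[OF PS b, of "- (\<sigma> + 1)"] by simp
      also have "\<dots> \<le> C * sob_norm \<sigma> (d b)" using P[OF d[OF b]] by blast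
      also have "\<dots> \<le> C * ?N" unfolding d_def by (intro mult_left_mono sob_norm_partial_deriv \<phi>S b C)
      finally show ?thesis .
    qed
    have "sob_norm (- (\<sigma> + 1)) \<psi> \<le> sob_norm (- (\<sigma> + 1)) (P \<phi>) + sob_norm (- (\<sigma> + 1)) (\<lambda>x. \<Sum>b\<in>Basis. q b x)"
      unfolding \<psi>_def[abs_def] using P[OF \<phi>] sT S by (intro sob_norm_add) auto
    also have "\<dots> \<le> C * ?N + (\<Sum>b\<in>(Basis::'a set). C * ?N)"
      using sob_norm_sum[of Basis q "- (\<sigma> + 1)"] qT S sum_mono[of Basis "\<lambda>b. sob_norm (- (\<sigma> + 1)) (q b)" "\<lambda>b. C * ?N"] 1 2
      by (intro add_mono) (auto intro: order_trans)
    also have "\<dots> = ?C * ?N" by (simp add: algebra_simps)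
    finally show ?thesis using lower \<psi>T by blast
  qed
  moreover have "0 \<le> ?C" using C by simp
  ultimately show ?thesis unfolding inf_sup_def by blast
qed

text \<open>The order \<open>- s\<close> is a natural number \<open>k\<close> plus an element of the open interval between \<open>- 1 / 2\<close> and \<open>1 / 2\<close>; the
  excluded values are those at which the remainder would be the end point \<open>- 1 / 2\<close>.\<close>

lemma inf_sup_not_half_integer:
  fixes \<Omega> :: "'a::euclidean_space set"
  assumes \<Omega>: "lipschitz_domain \<Omega>" and s: "s < 1 / 2" "\<forall>k::int. k > 0 \<longrightarrow> s \<noteq> 1 / 2 - of_int k"
  shows "inf_sup \<Omega> (- s)"
proof -
  define k where "k = nat \<lfloor>1 / 2 - s\<rfloor>"
  have k: "real k \<le> 1 / 2 - s" "1 / 2 - s < real k + 1"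
    using s(1) by (simp_all add: k_def)
  have "real k \<noteq> 1 / 2 - s"
  proof
    assume eq: "real k = 1 / 2 - s"
    hence "0 < int k" using s(1) by (cases k) auto
    moreover have "s = 1 / 2 - of_int (int k)" using eq by simp
    ultimately show False using s(2) by blast
  qed
  hence "real k < 1 / 2 - s" using k by simp
  hence "\<bar>- s - real k\<bar> < 1 / 2" using k by (auto simp: abs_if)
  hence base: "inf_sup \<Omega> (- s - real k)" by (rule inf_sup_base[OF \<Omega>])
  have "inf_sup \<Omega> (- s - real k + real j)" for j
  proof (induction j)
    case (Suc j)
    thus ?case using inf_sup_succ[of \<Omega> "- s - real k + real j"] by (simp add: add.assoc add.commute)
  qed (use base in simp)
  from this[of k] show ?thesis by simp
qed

section \<open>Extension by distributions supported in the closure\<close>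

text \<open>The bound of \<open>g\<close> by its quotient norm holds for each extension and hence for the infimum. The density that the Babuska--Brezzi principle
  provides defines the extension, and its approximation by functions \<open>bessel_op s f\<close> is the approximation of the extension by test functions.\<close>

lemma lipschitz_extension:
  fixes \<Omega> :: "'a::euclidean_space set"
  assumes "inf_sup \<Omega> (- s)"
  shows "\<exists>C>0. \<forall>g\<in>bessel_space_on s \<Omega>. \<exists>g'\<in>bessel_space_tilde s \<Omega>.
    g = dist_restrict g' \<Omega> \<and> bessel_norm s g' \<le> C * bessel_norm_on s \<Omega> g"
proof -
  let ?D = "test_functions \<Omega>"
  obtain C where C: "0 \<le> C" and isup: "\<And>\<phi>. \<phi> \<in> ?D \<Longrightarrow> \<exists>\<psi>\<in>?D. (sob_norm (- s) \<phi>)\<^sup>2 \<le> Re (LINT x|lborel. \<phi> x * \<psi> x) \<and>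
    sob_norm s \<psi> \<le> C * sob_norm (- s) \<phi>"
    using assms unfolding inf_sup_def by auto
  have S: "f \<in> schwartz" if "f \<in> ?D" for f using that test_functions_schwartz by blast
  let ?a = "bessel_op (- s) :: ('a \<Rightarrow> complex) \<Rightarrow> 'a \<Rightarrow> complex"
  let ?b = "bessel_op s :: ('a \<Rightarrow> complex) \<Rightarrow> 'a \<Rightarrow> complex"
  have "\<exists>g'\<in>bessel_space_tilde s \<Omega>. g = dist_restrict g' \<Omega> \<and> bessel_norm s g' \<le> (C + 1) * bessel_norm_on s \<Omega> g"
    if g: "g \<in> bessel_space_on s \<Omega>" for g
  proof -
    let ?U = "{u \<in> bessel_space s. dist_restrict u \<Omega> = g}"
    let ?N = "bessel_norm_on s \<Omega> g"
    have Une: "?U \<noteq> {}" using g by (auto simp: bessel_space_on_def)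
    have val: "u \<phi> = g \<phi>" if "u \<in> ?U" "\<phi> \<in> ?D" for u \<phi> using that by (auto simp: dist_restrict_def)
    have bnd: "norm (g \<phi>) \<le> bessel_norm s u * L2_norm (?a \<phi>)" if u: "u \<in> ?U" and \<phi>: "\<phi> \<in> ?D" for u \<phi>
    proof -
      obtain w where w: "w \<in> L2" "bessel_potential s u = dist_of_fun w" using u by (auto simp: bessel_space_def)
      have aS: "?a \<phi> \<in> schwartz" by (rule schwartz_bessel_op[OF S[OF \<phi>]])
      have "u (?b (?a \<phi>)) = (LINT x|lborel. w x * ?a \<phi> x)"
        using fun_cong[OF w(2), of "?a \<phi>"] aS by (simp add: bessel_potential_eq dist_of_fun_def)
      hence "g \<phi> = (LINT x|lborel. w x * ?a \<phi> x)" using val[OF u \<phi>] bessel_op_inverse[OF S[OF \<phi>], of s] by simp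
      thus ?thesis using norm_integral_mult_le[OF w(1) schwartz_L2[OF aS]] bessel_norm_eq[OF w(2,1)] by simp
    qed
    have nn: "0 \<le> bessel_norm s u" for u :: "'a functional" by (simp add: bessel_norm_def L2_norm_nonneg)
    have N0: "0 \<le> ?N" unfolding bessel_norm_on_def using Une nn by (intro cInf_greatest) auto
    have bndN: "norm (g \<phi>) \<le> ?N * L2_norm (?a \<phi>)" if \<phi>: "\<phi> \<in> ?D" for \<phi>
    proof (cases "L2_norm (?a \<phi>) = 0")
      case True
      obtain u where "u \<in> ?U" using Une by blast
      from bnd[OF this \<phi>] show ?thesis by (simp add: True)
    next
      case False
      hence p: "0 < L2_norm (?a \<phi>)" using L2_norm_nonneg[of "?a \<phi>"] by simp
      have "norm (g \<phi>) / L2_norm (?a \<phi>) \<le> ?N" unfolding bessel_norm_on_def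
      proof (rule cInf_greatest)
        show "bessel_norm s ` ?U \<noteq> {}" using Une by simp
        fix n assume "n \<in> bessel_norm s ` ?U"
        then obtain u where "u \<in> ?U" "n = bessel_norm s u" by blast
        thus "norm (g \<phi>) / L2_norm (?a \<phi>) \<le> n" using bnd[of u \<phi>] \<phi> p by (simp add: field_simps)
      qed
      thus ?thesis using p by (simp add: field_simps)
    qed
    obtain u0 where u0: "u0 \<in> ?U" using Une by blast
    hence u0t: "u0 \<in> tempered" by (simp add: bessel_space_def)
    have lin: "g (\<lambda>x. a * f x + b * h x) = a * g f + b * g h" if fh: "f \<in> ?D" "h \<in> ?D" for a b f h
    proof -
      have "(\<lambda>x. a * f x + b * h x) \<in> ?D" using fh by (intro test_functions_add test_functions_cmult)
      moreover have "u0 (\<lambda>x. a * f x + b * h x) = a * u0 f + b * u0 h"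
        using u0t S[OF fh(1)] S[OF fh(2)] unfolding tempered_def by blast
      ultimately show ?thesis using val[OF u0] fh by simp
    qed
    have "\<exists>w\<in>L2. (\<forall>f\<in>?D. (LINT x|lborel. w x * ?a f x) = g f) \<and> L2_norm w \<le> C * ?N \<and>
      (\<forall>e>0. \<exists>f\<in>?D. L2_norm (\<lambda>x. w x - ?b f x) < e)"
    proof (rule inf_sup_solution)
      show "?D \<noteq> {}" using test_functions_zero by blast
      show "0 \<le> C" "0 \<le> ?N" by (fact C, fact N0)
    next
      fix f h assume f: "f \<in> ?D" and h: "h \<in> ?D"
      show "(\<lambda>x. f x + h x) \<in> ?D" by (rule test_functions_add[OF f h])
      show "?a (\<lambda>x. f x + h x) = (\<lambda>x. ?a f x + ?a h x)" by (rule bessel_op_add[OF S[OF f] S[OF h]])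
      show "?b (\<lambda>x. f x + h x) = (\<lambda>x. ?b f x + ?b h x)" by (rule bessel_op_add[OF S[OF f] S[OF h]])
      show "g (\<lambda>x. f x + h x) = g f + g h" using lin[OF f h, of 1 1] by simp
    next
      fix f c assume f: "f \<in> ?D"
      show "(\<lambda>x. c * f x) \<in> ?D" by (rule test_functions_cmult[OF f])
      show "?a (\<lambda>x. c * f x) = (\<lambda>x. c * ?a f x)" by (rule bessel_op_cmult)
      show "?b (\<lambda>x. c * f x) = (\<lambda>x. c * ?b f x)" by (rule bessel_op_cmult)
      show "g (\<lambda>x. c * f x) = c * g f" using lin[OF f f, of c 0] by simp
    next
      fix f assume f: "f \<in> ?D"
      show "?a f \<in> L2" "?b f \<in> L2" by (intro schwartz_L2 schwartz_bessel_op S f)+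
      show "norm (g f) \<le> ?N * L2_norm (?a f)" by (rule bndN[OF f])
      obtain h where h: "h \<in> ?D" "(sob_norm (- s) f)\<^sup>2 \<le> Re (LINT x|lborel. f x * h x)" "sob_norm s h \<le> C * sob_norm (- s) f"
        using isup[OF f] by blast
      have "(LINT x|lborel. ?a f x * ?b h x) = (LINT x|lborel. f x * h x)"
        using integral_bessel_op_pair[OF S[OF f] S[OF h(1)], of "- s"] by simp
      thus "\<exists>h\<in>?D. (L2_norm (?a f))\<^sup>2 \<le> Re (LINT x|lborel. ?a f x * ?b h x) \<and> L2_norm (?b h) \<le> C * L2_norm (?a f)"
        using h by (auto simp: L2_norm_bessel_op[OF S[OF f]] L2_norm_bessel_op[OF S[OF h(1)]] intro!: bexI[of _ h])
    qed
    then obtain w where w: "w \<in> L2" "\<And>f. f \<in> ?D \<Longrightarrow> (LINT x|lborel. w x * ?a f x) = g f" "L2_norm w \<le> C * ?N"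
      "\<And>e. 0 < e \<Longrightarrow> \<exists>f\<in>?D. L2_norm (\<lambda>x. w x - ?b f x) < e" by blast
    let ?g = "dist_of_density s w"
    have "bessel_norm s ?g = L2_norm w" by (rule bessel_norm_eq[OF bessel_potential_dist_of_density w(1)])
    hence le: "bessel_norm s ?g \<le> (C + 1) * ?N" using w(3) N0 by (simp add: distrib_right)
    have res: "g = dist_restrict ?g \<Omega>"
    proof (rule ext)
      fix \<phi> :: "'a \<Rightarrow> complex"
      show "g \<phi> = dist_restrict ?g \<Omega> \<phi>"
      proof (cases "\<phi> \<in> ?D")
        case True
        thus ?thesis using w(2)[OF True] S[OF True] by (simp add: dist_restrict_def dist_of_density_def)
      next
        case False
        thus ?thesis using u0 by (auto simp: dist_restrict_def)
      qed
    qed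
    have "?g \<in> bessel_space_tilde s \<Omega>"
      unfolding bessel_space_tilde_def
    proof (intro CollectI conjI allI impI)
      show "?g \<in> bessel_space s" by (rule dist_of_density_bessel_space[OF w(1)])
      fix e :: real assume "0 < e"
      then obtain f where f: "f \<in> ?D" "L2_norm (\<lambda>x. w x - ?b f x) < e" using w(4) by blast
      have bf: "?b f \<in> L2" by (intro schwartz_L2 schwartz_bessel_op S f)
      let ?r = "\<lambda>\<psi>\<in>schwartz. ?g \<psi> - dist_of_fun f \<psi>"
      have "bessel_potential s ?r = dist_of_fun (\<lambda>x. w x - ?b f x)"
      proof (rule ext)
        fix \<psi> :: "'a \<Rightarrow> complex"
        show "bessel_potential s ?r \<psi> = dist_of_fun (\<lambda>x. w x - ?b f x) \<psi>"
        proof (cases "\<psi> \<in> schwartz")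
          case True
          have b: "?b \<psi> \<in> schwartz" by (rule schwartz_bessel_op[OF True])
          have "?a (?b \<psi>) = \<psi>" using bessel_op_inverse[OF True, of "- s"] by simp
          hence "bessel_potential s ?r \<psi> = (LINT x|lborel. w x * \<psi> x) - (LINT x|lborel. f x * ?b \<psi> x)"
            using True b by (simp add: bessel_potential_eq dist_of_density_def dist_of_fun_def)
          also have "(LINT x|lborel. f x * ?b \<psi> x) = (LINT x|lborel. ?b f x * \<psi> x)"
            by (rule integral_bessel_op[OF S[OF f(1)] True, symmetric])
          also have "(LINT x|lborel. w x * \<psi> x) - (LINT x|lborel. ?b f x * \<psi> x) = (LINT x|lborel. (w x - ?b f x) * \<psi> x)"
            using L2_mult_integrable(1)[OF w(1) schwartz_L2[OF True]] L2_mult_integrable(1)[OF bf schwartz_L2[OF True]]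
            by (simp add: left_diff_distrib)
          finally show ?thesis using True by (simp add: dist_of_fun_def restrict_def)
        qed (simp add: bessel_potential_eq dist_of_fun_def)
      qed
      from bessel_norm_eq[OF this L2_diff[OF w(1) bf]] f
      show "\<exists>\<phi>\<in>?D. bessel_norm s (\<lambda>\<psi>\<in>schwartz. ?g \<psi> - dist_of_fun \<phi> \<psi>) < e"
        by (intro bexI[of _ f]) (simp_all only:)
    qed
    thus ?thesis using res le by blast
  qed
  \<comment> \<open>the 1 is added because the constant has to be positive\<close>
  thus ?thesis using C by (intro exI[of _ "C + 1"]) auto
qed

theorem lemma1p2p15:
  fixes \<Omega> :: "(real ^ 'n) set" and s :: real
  assumes "lipschitz_domain \<Omega>"
    and "s < 1 / 2"
    and "\<forall>k::int. k > 0 \<longrightarrow> s \<noteq> 1 / 2 - of_int k"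
  shows "\<exists>C>0. \<forall>g\<in>bessel_space_on s \<Omega>.
           \<exists>g'\<in>bessel_space_tilde s \<Omega>.
             g = dist_restrict g' \<Omega> \<and> bessel_norm s g' \<le> C * bessel_norm_on s \<Omega> g"
  by (rule lipschitz_extension[OF inf_sup_not_half_integer[OF assms]])

end
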